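(* Let $m\ge 2$ be an integer and consider the piecewise-smooth system $$ (\dot x,\dot y)=\begin{cases}\big(f^+(x,y),\,g^+(x,y)\big), & (x,y)\in\Sigma^+,\\ \big(f^-(x,y),\,\phi(x,y)x^m\big), & (x,y)\in\Sigma^-,\end{cases}\qquad (\mathrm{P}) $$ where $f^\pm,g^+,\phi$ are $C^\infty$ functions on $\mathbb{R}^2$. Suppose that (P) has a grazing loop $L^{gra}_*$ connecting a unique tangent point, namely the origin $O$, which is a tangent point of multiplicity $(1,m)$, and that $L^{gra}_*$ is a clockwise, hyperbolic limit cycle of the upper subsystem. Assume that $f^+(0,0)f^-(0,0)>0$. Consider perturbations of (P) of the form $$ (\dot x,\dot y)=\begin{cases}\big(f^+(x,y+\alpha),\,g^+(x,y+\alpha)\big), & (x,y)\in\Sigma^+,\\ \big(f^-(x,y+\psi),\ \phi(x,y+\psi)\prod_{i=1}^{m}(x-\lambda_i)-f^-(x,y+\psi)\,\dot\psi\big), & (x,y)\in\Sigma^-,\end{cases}\qquad (\mathrm{P}') $$ where $\alpha\in\mathbb{R}$, $\boldsymbol\lambda=(\lambda_1,\dots,\lambda_m)\in\mathbb{R}^m$, $\boldsymbol k=(k_1,\dots,k_n)\in\mathbb{R}^n$, $\psi=\psi(x,\boldsymbol k)$ is a $C^\infty$ function of $x$ for each $\boldsymbol k$ with $\psi(x,\boldsymbol 0)\equiv 0$, and $\dot\psi=d\psi/dx$. Let $\beta_c$ and $\beta_s$ denote the numbers of crossing limit cycles and of sliding loops, respectively, of (P') bifurcating from $L^{gra}_*$.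 Then there exist perturbations of the form (P') (in the sense specified in the context) such that the following hold. (a) If $L^{gra}_*$ is of type $S$-$I$ or $S$-$L$, then there is a perturbation with $\beta_c+\beta_s\ge m+1$; and if additionally $m\ge 4$, then for each $\ell\in\{0,1,\dots,\lfloor m/2\rfloor\}$ there is a perturbation with $\beta_c\ge m+1-\ell$ and $\beta_s=\ell$. If $L^{gra}_*$ is of type $S$-$V$, then there is a perturbation with $\beta_c+\beta_s\ge m$; and if additionally $m\ge 4$, then for each $\ell\in\{0,1,\dots,\lfloor m/2\rfloor\}$ there is a perturbation with $\beta_c\ge m-\ell$ and $\beta_s=\ell$. (b) If $L^{gra}_*$ is of type $S$-$R$, then: if $m=2$, there is a perturbation with $\beta_c+\beta_s\ge 2$; if $m\ge 4$, then for each $\ell\in\{0,1,\dots,m/2\}$ there is a perturbation with $\beta_c\ge m+2-\ell$ and $\beta_s=\ell$.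
   Context: **Setting.** $\mathcal U\subset\mathbb{R}^2$ is a bounded open set containing the origin $O=(0,0)$ (and the loop under consideration); $\Sigma^+=\{(x,y)\in\mathcal U: y>0\}$, $\Sigma^-=\{(x,y)\in\mathcal U: y<0\}$, $\Sigma=\{(x,y)\in\mathcal U: y=0\}$ (the switching manifold). For a piecewise-smooth system given by a $C^\infty$ vector field $(f^+,g^+)$ on $\Sigma^+$ (upper subsystem) and a $C^\infty$ vector field $(f^-,g^-)$ on $\Sigma^-$ (lower subsystem), all defined on $\mathbb{R}^2$, solutions are understood in Filippov's sense (the differential inclusion whose right-hand side on $\Sigma$ is the set of convex combinations of the two vector fields). The same definitions below apply to the perturbed system with its own vector fields. **Crossing, sliding, tangent points.** Put $h(x)=g^+(x,0)g^-(x,0)$. The crossing region is $\Sigma_c=\{(x,0)\in\Sigma: h(x)>0\}$ (its points are crossing points); the sliding region is $\Sigma_s=\{(x,0)\in\Sigma: h(x)<0\}$, on which the sliding vector field is $$X_s(x,0)=\left(\frac{f^+(x,0)g^-(x,0)-f^-(x,0)g^+(x,0)}{g^-(x,0)-g^+(x,0)},\,0\right);$$ its orbits are sliding orbits. A point $(x_0,0)\in\Sigma$ is a tangent point if $h(x_0)=0$ and $f^\pm(x_0,0)\neq 0$. It has multiplicity $(m^+,m^-)$ (with $m^\pm\ge 0$ integers, $m^++m^-\ge1$) if, for each sign, $\partial^j g^\pm/\partial x^j(x_0,0)=0$ for $0\le j\le m^\pm-1$ and $\partial^{m^\pm}g^\pm/\partial x^{m^\pm}(x_0,0)\ne 0$.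 **Visibility.** A tangent point $p$ of the upper (resp. lower) subsystem is, according to the local position of the orbit of that subsystem through $p$ (and tangent to $\Sigma$ there): *visible* if near $p$ the orbit minus $p$ lies in $\Sigma^+$ (resp. $\Sigma^-$) on both sides of $p$; *invisible* if on neither side it lies in $\Sigma^+$ (resp. $\Sigma^-$); *left* if only its part to the left of $p$ lies in $\Sigma^+$ (resp. $\Sigma^-$); *right* if only its part to the right of $p$ lies in $\Sigma^+$ (resp. $\Sigma^-$). **Loops.** Let $\Gamma_i$ ($i=1,\dots,n$) denote segments of regular orbits of a subsystem, each meeting $\Sigma$ only at its endpoints $p_i,p_{i+1}\in\Sigma$. - A crossing periodic orbit is an oriented Jordan curve consisting of such $\Gamma_1,\dots,\Gamma_n$ with all $p_i$ crossing points; a crossing limit cycle is an isolated crossing periodic orbit. - A sliding loop is an oriented Jordan curve consisting of such segments $\Gamma_i$ and at least one sliding orbit (it connects tangent points). - A nonsliding loop connecting tangent points is an oriented Jordan curve consisting of such $\Gamma_1,\dots,\Gamma_n$ with at least one $p_i$ a tangent point. A point $p_i$ is a switching point if the loop passes at $p_i$ from one half-plane into the other; the loop is called grazing if it has no switching points. Here the grazing loop $L^{gra}_*$ is a periodic orbit of the upper subsystem, lying in $\Sigma^+\cup\{O\}$ and touching $\Sigma$ only at $O$. **Types.** $L^{gra}_*$ is of type $S$-$I$, $S$-$V$, $S$-$L$, $S$-$R$ if it is a stable limit cycle of the upper subsystem and $O$ is, respectively, an invisible, visible, left, right tangent point of the lower subsystem. **Perturbations and bifurcating loops.** Let $Y^\pm$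 be the vector fields of (P) and $X^\pm$ those of (P'). Their distance is $$\rho(X,Y)=\sum_{\pm}\sum_{j=1}^2 d(X_j^\pm,Y_j^\pm),\qquad d(P,Q)=\max_{(x,y)\in\overline{\mathcal U}}\ \sum_{0\le i_1+i_2\le 1}\left|\frac{\partial^{i_1+i_2}(P-Q)}{\partial x^{i_1}\partial y^{i_2}}\right|.$$ "There is a perturbation of the form (P') with [a given property of $\beta_c,\beta_s$]" means: there exist an integer $n\ge 1$ and a function $\psi(x,\boldsymbol k)$ as in the claim such that for every $\varepsilon>0$ and every neighborhood $N$ of $L^{gra}_*$ there are parameters $\alpha,\boldsymbol\lambda,\boldsymbol k$ with $|\alpha|,|\boldsymbol\lambda|,|\boldsymbol k|<\varepsilon$ and $\rho(X,Y)<\varepsilon$ for which the stated property holds with $\beta_c$ and $\beta_s$ being the numbers of crossing limit cycles and of sliding loops, respectively, of (P') contained in $N$.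
   Formalization: The loops are counted in every sufficiently small neighborhood N of the grazing loop instead of every neighborhood N, since robust sliding loops of (P) elsewhere in U would make the exact counts of sliding loops (β_s = ℓ) false for large N. *)

theory Defs
  imports "HOL-Complex_Analysis.Complex_Analysis" "HOL-Library.Extended_Nat"
begin

type_synonym plane = "real \<times> real"
type_synonym vfield = "plane \<Rightarrow> plane"

section \<open>Smooth functions and the \<open>C\<^sup>1\<close> distance\<close>

primrec Ck :: "nat \<Rightarrow> ('a::real_normed_vector \<Rightarrow> 'b::real_normed_vector) \<Rightarrow> bool" where
  "Ck 0 f \<longleftrightarrow> continuous_on UNIV f"
| "Ck (Suc k) f \<longleftrightarrow> (\<forall>x. f differentiable (at x)) \<and> (\<forall>v. Ck k (\<lambda>x. frechet_derivative f (at x) v))"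

definition smooth :: "('a::real_normed_vector \<Rightarrow> 'b::real_normed_vector) \<Rightarrow> bool" where
  "smooth f \<longleftrightarrow> (\<forall>k. Ck k f)"

definition partial_x :: "(plane \<Rightarrow> real) \<Rightarrow> plane \<Rightarrow> real" where
  "partial_x F p = deriv (\<lambda>x. F (x, snd p)) (fst p)"

definition partial_y :: "(plane \<Rightarrow> real) \<Rightarrow> plane \<Rightarrow> real" where
  "partial_y F p = deriv (\<lambda>y. F (fst p, y)) (snd p)"

text \<open>For bounded \<open>U\<close> and \<open>C\<^sup>1\<close> functions \<open>P\<close>, \<open>Q\<close> the supremum is a maximum.\<close>

definition C1_dist :: "plane set \<Rightarrow> (plane \<Rightarrow> real) \<Rightarrow> (plane \<Rightarrow> real) \<Rightarrow> real" where
  "C1_dist U P Q = (SUP p\<in>closure U.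
     \<bar>P p - Q p\<bar> + \<bar>partial_x (\<lambda>q. P q - Q q) p\<bar> + \<bar>partial_y (\<lambda>q. P q - Q q) p\<bar>)"

definition system_dist :: "plane set \<Rightarrow> vfield \<Rightarrow> vfield \<Rightarrow> vfield \<Rightarrow> vfield \<Rightarrow> real" where
  "system_dist U Xp Xm Yp Ym =
     C1_dist U (fst \<circ> Xp) (fst \<circ> Yp) + C1_dist U (snd \<circ> Xp) (snd \<circ> Yp) +
     C1_dist U (fst \<circ> Xm) (fst \<circ> Ym) + C1_dist U (snd \<circ> Xm) (snd \<circ> Ym)"

section \<open>Piecewise-smooth systems\<close>

definition Sigma_plus :: "plane set \<Rightarrow> plane set" where
  "Sigma_plus U = {p \<in> U. snd p > 0}"

definition Sigma_minus :: "plane set \<Rightarrow> plane set" where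
  "Sigma_minus U = {p \<in> U. snd p < 0}"

definition Sigma_zero :: "plane set \<Rightarrow> plane set" where
  "Sigma_zero U = {p \<in> U. snd p = 0}"

text \<open>\<open>Xp\<close> and \<open>Xm\<close> are the vector fields of the upper and of the lower subsystem.\<close>

definition crossing_region :: "plane set \<Rightarrow> vfield \<Rightarrow> vfield \<Rightarrow> plane set" where
  "crossing_region U Xp Xm = {p \<in> Sigma_zero U. snd (Xp p) * snd (Xm p) > 0}"

definition sliding_region :: "plane set \<Rightarrow> vfield \<Rightarrow> vfield \<Rightarrow> plane set" where
  "sliding_region U Xp Xm = {p \<in> Sigma_zero U. snd (Xp p) * snd (Xm p) < 0}"

definition sliding_field :: "vfield \<Rightarrow> vfield \<Rightarrow> vfield" where
  "sliding_field Xp Xm p =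
     ((fst (Xp p) * snd (Xm p) - fst (Xm p) * snd (Xp p)) / (snd (Xm p) - snd (Xp p)), 0)"

definition tangent_point :: "plane set \<Rightarrow> vfield \<Rightarrow> vfield \<Rightarrow> plane \<Rightarrow> bool" where
  "tangent_point U Xp Xm p \<longleftrightarrow> p \<in> Sigma_zero U \<and> snd (Xp p) * snd (Xm p) = 0 \<and>
     fst (Xp p) \<noteq> 0 \<and> fst (Xm p) \<noteq> 0"

definition contact_order :: "vfield \<Rightarrow> plane \<Rightarrow> nat \<Rightarrow> bool" where
  "contact_order Z p k \<longleftrightarrow>
     (\<forall>j<k. (deriv ^^ j) (\<lambda>x. snd (Z (x, 0))) (fst p) = 0) \<and>
     (deriv ^^ k) (\<lambda>x. snd (Z (x, 0))) (fst p) \<noteq> 0"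

definition tangent_point_of_multiplicity ::
  "plane set \<Rightarrow> vfield \<Rightarrow> vfield \<Rightarrow> plane \<Rightarrow> nat \<Rightarrow> nat \<Rightarrow> bool" where
  "tangent_point_of_multiplicity U Xp Xm p kp km \<longleftrightarrow>
     tangent_point U Xp Xm p \<and> kp + km \<ge> 1 \<and> contact_order Xp p kp \<and> contact_order Xm p km"

definition solves :: "vfield \<Rightarrow> (real \<Rightarrow> plane) \<Rightarrow> real set \<Rightarrow> bool" where
  "solves Z \<gamma> I \<longleftrightarrow> (\<forall>t\<in>I. (\<gamma> has_vector_derivative Z (\<gamma> t)) (at t within I))"

text \<open>\<open>S\<close> is the open half of \<open>U\<close> belonging to the subsystem \<open>Z\<close>, and \<open>p\<close> is a tangent point,
  so that near \<open>p\<close> the orbit is a graph over the first coordinate.\<close>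

definition left_part_in :: "vfield \<Rightarrow> plane set \<Rightarrow> plane \<Rightarrow> bool" where
  "left_part_in Z S p \<longleftrightarrow> (\<exists>\<delta>>0. \<exists>\<gamma>. solves Z \<gamma> {-\<delta><..<\<delta>} \<and> \<gamma> 0 = p \<and>
     (\<forall>t\<in>{-\<delta><..<\<delta>}. fst (\<gamma> t) < fst p \<longrightarrow> \<gamma> t \<in> S))"

definition right_part_in :: "vfield \<Rightarrow> plane set \<Rightarrow> plane \<Rightarrow> bool" where
  "right_part_in Z S p \<longleftrightarrow> (\<exists>\<delta>>0. \<exists>\<gamma>. solves Z \<gamma> {-\<delta><..<\<delta>} \<and> \<gamma> 0 = p \<and>
     (\<forall>t\<in>{-\<delta><..<\<delta>}. fst (\<gamma> t) > fst p \<longrightarrow> \<gamma> t \<in> S))"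

definition visible_tangent :: "vfield \<Rightarrow> plane set \<Rightarrow> plane \<Rightarrow> bool" where
  "visible_tangent Z S p \<longleftrightarrow> left_part_in Z S p \<and> right_part_in Z S p"

definition invisible_tangent :: "vfield \<Rightarrow> plane set \<Rightarrow> plane \<Rightarrow> bool" where
  "invisible_tangent Z S p \<longleftrightarrow> \<not> left_part_in Z S p \<and> \<not> right_part_in Z S p"

definition left_tangent :: "vfield \<Rightarrow> plane set \<Rightarrow> plane \<Rightarrow> bool" where
  "left_tangent Z S p \<longleftrightarrow> left_part_in Z S p \<and> \<not> right_part_in Z S p"

definition right_tangent :: "vfield \<Rightarrow> plane set \<Rightarrow> plane \<Rightarrow> bool" where
  "right_tangent Z S p \<longleftrightarrow> \<not> left_part_in Z S p \<and> right_part_in Z S p"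

section \<open>Loops\<close>

datatype piece = Upper | Lower | Sliding

definition regular_segment ::
  "plane set \<Rightarrow> vfield \<Rightarrow> plane set \<Rightarrow> (real \<Rightarrow> plane) \<Rightarrow> real \<Rightarrow> real \<Rightarrow> bool" where
  "regular_segment U Z S \<gamma> a b \<longleftrightarrow> a < b \<and> solves Z \<gamma> {a..b} \<and> (\<forall>t\<in>{a..b}. Z (\<gamma> t) \<noteq> 0) \<and>
     \<gamma> a \<in> Sigma_zero U \<and> \<gamma> b \<in> Sigma_zero U \<and> (\<forall>t\<in>{a<..<b}. \<gamma> t \<in> S)"

text \<open>The endpoints of a sliding segment may be tangent points, where the sliding vector field need
  not be defined; there only continuity is required.\<close>

definition sliding_segment ::
  "plane set \<Rightarrow> vfield \<Rightarrow> vfield \<Rightarrow> (real \<Rightarrow> plane) \<Rightarrow> real \<Rightarrow> real \<Rightarrow> bool" where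
  "sliding_segment U Xp Xm \<gamma> a b \<longleftrightarrow> a < b \<and> continuous_on {a..b} \<gamma> \<and>
     solves (sliding_field Xp Xm) \<gamma> {a<..<b} \<and>
     \<gamma> a \<in> Sigma_zero U \<and> \<gamma> b \<in> Sigma_zero U \<and> (\<forall>t\<in>{a<..<b}. \<gamma> t \<in> sliding_region U Xp Xm)"

fun is_piece ::
  "plane set \<Rightarrow> vfield \<Rightarrow> vfield \<Rightarrow> piece \<Rightarrow> (real \<Rightarrow> plane) \<Rightarrow> real \<Rightarrow> real \<Rightarrow> bool" where
  "is_piece U Xp Xm Upper \<gamma> a b = regular_segment U Xp (Sigma_plus U) \<gamma> a b"
| "is_piece U Xp Xm Lower \<gamma> a b = regular_segment U Xm (Sigma_minus U) \<gamma> a b"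
| "is_piece U Xp Xm Sliding \<gamma> a b = sliding_segment U Xp Xm \<gamma> a b"

text \<open>A closed Jordan curve \<open>\<gamma>\<close> on \<open>[\<tau> 0, \<tau> n]\<close>, oriented by time, whose \<open>n\<close> consecutive pieces
  are of the kinds \<open>\<kappa> 0, \<dots>, \<kappa> (n - 1)\<close>; the points \<open>\<gamma> (\<tau> i)\<close> are the \<open>p\<^sub>i\<close>. A loop below is the
  point set traced by such a curve; the vector fields determine its orientation.\<close>

definition loop_curve :: "plane set \<Rightarrow> vfield \<Rightarrow> vfield \<Rightarrow> nat \<Rightarrow> (nat \<Rightarrow> piece) \<Rightarrow> (nat \<Rightarrow> real) \<Rightarrow>
    (real \<Rightarrow> plane) \<Rightarrow> bool" where
  "loop_curve U Xp Xm n \<kappa> \<tau> \<gamma> \<longleftrightarrow> n \<ge> 1 \<and>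
     continuous_on {\<tau> 0..\<tau> n} \<gamma> \<and> inj_on \<gamma> {\<tau> 0..<\<tau> n} \<and> \<gamma> (\<tau> n) = \<gamma> (\<tau> 0) \<and>
     (\<forall>i<n. is_piece U Xp Xm (\<kappa> i) \<gamma> (\<tau> i) (\<tau> (Suc i)))"

definition crossing_periodic_orbit :: "plane set \<Rightarrow> vfield \<Rightarrow> vfield \<Rightarrow> plane set \<Rightarrow> bool" where
  "crossing_periodic_orbit U Xp Xm C \<longleftrightarrow> (\<exists>n \<kappa> \<tau> \<gamma>. loop_curve U Xp Xm n \<kappa> \<tau> \<gamma> \<and>
     C = \<gamma> ` {\<tau> 0..\<tau> n} \<and> (\<forall>i<n. \<kappa> i \<noteq> Sliding) \<and> (\<forall>i<n. \<gamma> (\<tau> i) \<in> crossing_region U Xp Xm))"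

definition crossing_limit_cycle :: "plane set \<Rightarrow> vfield \<Rightarrow> vfield \<Rightarrow> plane set \<Rightarrow> bool" where
  "crossing_limit_cycle U Xp Xm C \<longleftrightarrow> crossing_periodic_orbit U Xp Xm C \<and>
     (\<exists>V. open V \<and> C \<subseteq> V \<and> (\<forall>C'. crossing_periodic_orbit U Xp Xm C' \<and> C' \<subseteq> V \<longrightarrow> C' = C))"

definition sliding_loop :: "plane set \<Rightarrow> vfield \<Rightarrow> vfield \<Rightarrow> plane set \<Rightarrow> bool" where
  "sliding_loop U Xp Xm C \<longleftrightarrow> (\<exists>n \<kappa> \<tau> \<gamma>. loop_curve U Xp Xm n \<kappa> \<tau> \<gamma> \<and>
     C = \<gamma> ` {\<tau> 0..\<tau> n} \<and> (\<exists>i<n. \<kappa> i = Sliding) \<and> (\<exists>i<n. tangent_point U Xp Xm (\<gamma> (\<tau> i))))"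

text \<open>A nonsliding loop without switching points that connects exactly the tangent points in \<open>P\<close>.
  The point \<open>\<gamma> (\<tau> (Suc i))\<close> is a switching point iff the pieces before and after it lie in
  different half-planes.\<close>

definition grazing_loop :: "plane set \<Rightarrow> vfield \<Rightarrow> vfield \<Rightarrow> plane set \<Rightarrow> plane set \<Rightarrow> bool" where
  "grazing_loop U Xp Xm P C \<longleftrightarrow> (\<exists>n \<kappa> \<tau> \<gamma>. loop_curve U Xp Xm n \<kappa> \<tau> \<gamma> \<and>
     C = \<gamma> ` {\<tau> 0..\<tau> n} \<and> (\<forall>i<n. \<kappa> i \<noteq> Sliding) \<and> (\<forall>i<n. \<kappa> (Suc i mod n) = \<kappa> i) \<and>
     P \<noteq> {} \<and> P = {p \<in> (\<lambda>i. \<gamma> (\<tau> i)) ` {..<n}. tangent_point U Xp Xm p})"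

section \<open>Periodic orbits of a smooth planar vector field\<close>

text \<open>\<open>T\<close> is the minimal period, and \<open>\<gamma>\<close> is not constant.\<close>

definition periodic_solution :: "vfield \<Rightarrow> (real \<Rightarrow> plane) \<Rightarrow> real \<Rightarrow> bool" where
  "periodic_solution Z \<gamma> T \<longleftrightarrow> T > 0 \<and> solves Z \<gamma> UNIV \<and> (\<forall>t. \<gamma> (t + T) = \<gamma> t) \<and> inj_on \<gamma> {0..<T}"

definition periodic_orbit :: "vfield \<Rightarrow> plane set \<Rightarrow> bool" where
  "periodic_orbit Z L \<longleftrightarrow> (\<exists>\<gamma> T. periodic_solution Z \<gamma> T \<and> L = range \<gamma>)"

definition limit_cycle :: "vfield \<Rightarrow> plane set \<Rightarrow> bool" where
  "limit_cycle Z L \<longleftrightarrow> periodic_orbit Z L \<and>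
     (\<exists>V. open V \<and> L \<subseteq> V \<and> (\<forall>L'. periodic_orbit Z L' \<and> L' \<subseteq> V \<longrightarrow> L' = L))"

definition stable_limit_cycle :: "vfield \<Rightarrow> plane set \<Rightarrow> bool" where
  "stable_limit_cycle Z L \<longleftrightarrow> limit_cycle Z L \<and>
     (\<forall>W. open W \<and> L \<subseteq> W \<longrightarrow> (\<exists>V. open V \<and> L \<subseteq> V \<and>
        (\<forall>p\<in>V. \<exists>\<eta>. solves Z \<eta> {0..} \<and> \<eta> 0 = p \<and> (\<forall>t\<ge>0. \<eta> t \<in> W) \<and>
                   ((\<lambda>t. infdist (\<eta> t) L) \<longlongrightarrow> 0) at_top)))"

text \<open>Hyperbolicity of a periodic orbit: the derivative \<open>D\<close> of a Poincare return map at its fixed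
  point satisfies \<open>\<bar>D\<bar> \<noteq> 1\<close>. The section is the segment \<open>\<gamma> 0 + s v\<close>, \<open>\<bar>s\<bar> < \<delta>\<close>, with \<open>v\<close> transversal
  to the orbit; \<open>r\<close> is the return map and \<open>\<theta>\<close> the return time. Continuity of \<open>\<theta>\<close> and \<open>r\<close> at \<open>0\<close>
  determines both uniquely near \<open>0\<close>.\<close>

definition hyperbolic_orbit :: "vfield \<Rightarrow> plane set \<Rightarrow> bool" where
  "hyperbolic_orbit Z L \<longleftrightarrow> (\<exists>\<gamma> T v \<delta> \<theta> r D. periodic_solution Z \<gamma> T \<and> L = range \<gamma> \<and>
     fst v * snd (Z (\<gamma> 0)) \<noteq> snd v * fst (Z (\<gamma> 0)) \<and>
     \<delta> > 0 \<and> \<theta> 0 = T \<and> isCont \<theta> 0 \<and> r 0 = 0 \<and>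
     (\<forall>s. \<bar>s\<bar> < \<delta> \<longrightarrow> \<theta> s > 0 \<and> (\<exists>\<eta>. solves Z \<eta> {0..\<theta> s} \<and>
        \<eta> 0 = \<gamma> 0 + s *\<^sub>R v \<and> \<eta> (\<theta> s) = \<gamma> 0 + r s *\<^sub>R v)) \<and>
     (r has_real_derivative D) (at 0) \<and> \<bar>D\<bar> \<noteq> 1)"

text \<open>One period of \<open>\<gamma>\<close> as a path in the complex plane.\<close>

definition orbit_path :: "(real \<Rightarrow> plane) \<Rightarrow> real \<Rightarrow> real \<Rightarrow> complex" where
  "orbit_path \<gamma> T = (\<lambda>s. Complex (fst (\<gamma> (T * s))) (snd (\<gamma> (T * s))))"

definition clockwise_orbit :: "vfield \<Rightarrow> plane set \<Rightarrow> bool" where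
  "clockwise_orbit Z L \<longleftrightarrow> (\<exists>\<gamma> T. periodic_solution Z \<gamma> T \<and> L = range \<gamma> \<and>
     (\<forall>z \<in> inside (path_image (orbit_path \<gamma> T)). winding_number (orbit_path \<gamma> T) z = -1))"

section \<open>Types of the grazing loop\<close>

definition type_SI :: "plane set \<Rightarrow> vfield \<Rightarrow> vfield \<Rightarrow> plane set \<Rightarrow> bool" where
  "type_SI U Xp Xm L \<longleftrightarrow> stable_limit_cycle Xp L \<and> invisible_tangent Xm (Sigma_minus U) (0, 0)"

definition type_SV :: "plane set \<Rightarrow> vfield \<Rightarrow> vfield \<Rightarrow> plane set \<Rightarrow> bool" where
  "type_SV U Xp Xm L \<longleftrightarrow> stable_limit_cycle Xp L \<and> visible_tangent Xm (Sigma_minus U) (0, 0)"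

definition type_SL :: "plane set \<Rightarrow> vfield \<Rightarrow> vfield \<Rightarrow> plane set \<Rightarrow> bool" where
  "type_SL U Xp Xm L \<longleftrightarrow> stable_limit_cycle Xp L \<and> left_tangent Xm (Sigma_minus U) (0, 0)"

definition type_SR :: "plane set \<Rightarrow> vfield \<Rightarrow> vfield \<Rightarrow> plane set \<Rightarrow> bool" where
  "type_SR U Xp Xm L \<longleftrightarrow> stable_limit_cycle Xp L \<and> right_tangent Xm (Sigma_minus U) (0, 0)"

section \<open>The system and its perturbations\<close>

definition upper_field :: "(plane \<Rightarrow> real) \<Rightarrow> (plane \<Rightarrow> real) \<Rightarrow> vfield" where
  "upper_field fp gp = (\<lambda>(x, y). (fp (x, y), gp (x, y)))"

definition lower_field :: "(plane \<Rightarrow> real) \<Rightarrow> (plane \<Rightarrow> real) \<Rightarrow> nat \<Rightarrow> vfield" where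
  "lower_field fm \<phi> m = (\<lambda>(x, y). (fm (x, y), \<phi> (x, y) * x ^ m))"

definition perturbed_upper :: "(plane \<Rightarrow> real) \<Rightarrow> (plane \<Rightarrow> real) \<Rightarrow> real \<Rightarrow> vfield" where
  "perturbed_upper fp gp \<alpha> = (\<lambda>(x, y). (fp (x, y + \<alpha>), gp (x, y + \<alpha>)))"

text \<open>Here \<open>w\<close> stands for \<open>x \<mapsto> \<psi>(x, k)\<close> with \<open>k\<close> fixed; vectors of \<open>\<real>\<^sup>m\<close> and \<open>\<real>\<^sup>n\<close> are lists.\<close>

definition perturbed_lower ::
  "(plane \<Rightarrow> real) \<Rightarrow> (plane \<Rightarrow> real) \<Rightarrow> real list \<Rightarrow> (real \<Rightarrow> real) \<Rightarrow> vfield" where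
  "perturbed_lower fm \<phi> ls w = (\<lambda>(x, y).
     (fm (x, y + w x),
      \<phi> (x, y + w x) * (\<Prod>i<length ls. x - ls ! i) - fm (x, y + w x) * deriv w x))"

definition vec_norm :: "real list \<Rightarrow> real" where
  "vec_norm v = L2_set (\<lambda>i. v ! i) {..<length v}"

definition number_of :: "'a set \<Rightarrow> enat" where
  "number_of A = (if finite A then enat (card A) else \<infinity>)"

definition beta_c :: "plane set \<Rightarrow> vfield \<Rightarrow> vfield \<Rightarrow> plane set \<Rightarrow> enat" where
  "beta_c U Xp Xm N = number_of {C. crossing_limit_cycle U Xp Xm C \<and> C \<subseteq> N}"

definition beta_s :: "plane set \<Rightarrow> vfield \<Rightarrow> vfield \<Rightarrow> plane set \<Rightarrow> enat" where
  "beta_s U Xp Xm N = number_of {C. sliding_loop U Xp Xm C \<and> C \<subseteq> N}"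

definition realized_in :: "plane set \<Rightarrow> (plane \<Rightarrow> real) \<Rightarrow> (plane \<Rightarrow> real) \<Rightarrow> (plane \<Rightarrow> real) \<Rightarrow>
    (plane \<Rightarrow> real) \<Rightarrow> nat \<Rightarrow> nat \<Rightarrow> (real \<Rightarrow> real list \<Rightarrow> real) \<Rightarrow> (enat \<Rightarrow> enat \<Rightarrow> bool) \<Rightarrow>
    real \<Rightarrow> plane set \<Rightarrow> bool" where
  "realized_in U fp gp fm \<phi> m n \<psi> Q \<epsilon> N \<longleftrightarrow> (\<exists>\<alpha> ls k. length ls = m \<and> length k = n \<and>
     \<bar>\<alpha>\<bar> < \<epsilon> \<and> vec_norm ls < \<epsilon> \<and> vec_norm k < \<epsilon> \<and>
     (let Xp = perturbed_upper fp gp \<alpha>;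
          Xm = perturbed_lower fm \<phi> ls (\<lambda>x. \<psi> x k)
      in system_dist U Xp Xm (upper_field fp gp) (lower_field fm \<phi> m) < \<epsilon> \<and>
         Q (beta_c U Xp Xm N) (beta_s U Xp Xm N)))"

text \<open>Bifurcating from \<open>L\<close> is a local notion: the loops are counted in all neighbourhoods \<open>N\<close> of \<open>L\<close>
  that are sufficiently small, i.e. contained in some fixed \<open>N0\<close>. Without \<open>N0\<close> an exact count would
  also see loops unrelated to \<open>L\<close>, since (P) may have robust sliding loops elsewhere in \<open>U\<close>. For lower
  bounds on the numbers of loops \<open>N0\<close> makes no difference, see \<open>has_perturbation_lower_bound\<close>.\<close>

definition has_perturbation :: "plane set \<Rightarrow> (plane \<Rightarrow> real) \<Rightarrow> (plane \<Rightarrow> real) \<Rightarrow> (plane \<Rightarrow> real) \<Rightarrow>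
    (plane \<Rightarrow> real) \<Rightarrow> nat \<Rightarrow> plane set \<Rightarrow> (enat \<Rightarrow> enat \<Rightarrow> bool) \<Rightarrow> bool" where
  "has_perturbation U fp gp fm \<phi> m L Q \<longleftrightarrow> (\<exists>n\<ge>1. \<exists>\<psi>.
     (\<forall>k. length k = n \<longrightarrow> smooth (\<lambda>x. \<psi> x k)) \<and> (\<forall>x. \<psi> x (replicate n 0) = 0) \<and>
     (\<exists>N0. L \<subseteq> interior N0 \<and>
       (\<forall>\<epsilon>>0. \<forall>N. L \<subseteq> interior N \<and> N \<subseteq> N0 \<longrightarrow> realized_in U fp gp fm \<phi> m n \<psi> Q \<epsilon> N)))"

lemma number_of_mono: "A \<subseteq> B \<Longrightarrow> number_of A \<le> number_of B"
  by (auto simp: number_of_def card_mono dest: finite_subset)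

lemma has_perturbation_lower_bound:
  assumes up: "\<And>c s c' s'. Q c s \<Longrightarrow> c \<le> c' \<Longrightarrow> s \<le> s' \<Longrightarrow> Q c' s'"
  shows "has_perturbation U fp gp fm \<phi> m L Q \<longleftrightarrow> (\<exists>n\<ge>1. \<exists>\<psi>.
     (\<forall>k. length k = n \<longrightarrow> smooth (\<lambda>x. \<psi> x k)) \<and> (\<forall>x. \<psi> x (replicate n 0) = 0) \<and>
     (\<forall>\<epsilon>>0. \<forall>N. L \<subseteq> interior N \<longrightarrow> realized_in U fp gp fm \<phi> m n \<psi> Q \<epsilon> N))"
proof -
  have mono: "realized_in U fp gp fm \<phi> m n \<psi> Q \<epsilon> N'"
    if "realized_in U fp gp fm \<phi> m n \<psi> Q \<epsilon> N" "N \<subseteq> N'" for n \<psi> \<epsilon> N N'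
  proof -
    have "beta_c U Xp Xm N \<le> beta_c U Xp Xm N'" "beta_s U Xp Xm N \<le> beta_s U Xp Xm N'" for Xp Xm
      unfolding beta_c_def beta_s_def using that(2) by (auto intro!: number_of_mono)
    from up[OF _ this] that(1) show ?thesis
      unfolding realized_in_def Let_def by blast
  qed
  have "(\<exists>N0. L \<subseteq> interior N0 \<and>
       (\<forall>\<epsilon>>0. \<forall>N. L \<subseteq> interior N \<and> N \<subseteq> N0 \<longrightarrow> realized_in U fp gp fm \<phi> m n \<psi> Q \<epsilon> N)) \<longleftrightarrow>
     (\<forall>\<epsilon>>0. \<forall>N. L \<subseteq> interior N \<longrightarrow> realized_in U fp gp fm \<phi> m n \<psi> Q \<epsilon> N)" (is "?l \<longleftrightarrow> ?r") for n \<psi>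
  proof
    assume ?l
    then obtain N0 where N0: "L \<subseteq> interior N0"
      "\<And>\<epsilon> N. \<epsilon> > 0 \<Longrightarrow> L \<subseteq> interior N \<Longrightarrow> N \<subseteq> N0 \<Longrightarrow> realized_in U fp gp fm \<phi> m n \<psi> Q \<epsilon> N"
      by blast
    show ?r
    proof (intro allI impI)
      fix \<epsilon> :: real and N assume "\<epsilon> > 0" "L \<subseteq> interior N"
      then have "realized_in U fp gp fm \<phi> m n \<psi> Q \<epsilon> (N \<inter> N0)"
        using N0 by (intro N0(2)) auto
      then show "realized_in U fp gp fm \<phi> m n \<psi> Q \<epsilon> N"
        by (rule mono) simp
    qed
  next
    assume ?r
    then show ?l by (intro exI[of _ UNIV]) auto
  qed
  then show ?thesis
    unfolding has_perturbation_def by simp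
qed

end

theory Submission
 imports Defs
begin

text \<open>A perturbation with \<open>\<lambda> = 0\<close> suffices. The shift by \<open>\<alpha>\<close> lowers the stable periodic
orbit of the upper field through the switching line, so that an upper half orbit leaving from the left
of the origin lands at a point \<open>A x\<close> to the right. In the lower half plane the shear turns \<open>y = 0\<close>
into a graph \<open>w\<close>, and a lower orbit joins \<open>x < 0\<close> to \<open>y > 0\<close> only if \<open>H x = H y\<close>, where \<open>H\<close>
is a first integral of the unsheared field along \<open>w\<close>. If \<open>w\<close> solves \<open>w' = F(x, w) + \<eta> z\<close>, then \<open>H\<close> is
close to \<open>\<eta>\<close> times an antiderivative of \<open>z\<close>, so that \<open>H\<close> can be prescribed as a step function. Its steps to
the left and to the right of the origin are interleaved through \<open>A\<close>: every sign change of \<open>H x - H (A x)\<close>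
yields a crossing cycle, which is isolated because \<open>H\<close> is much steeper on the left than on the
right, and every zone where \<open>z\<close> has the reversed sign can be made to carry one sliding loop. Hence any number
of crossing limit cycles coexists with any number of sliding loops.\<close>

section \<open>Smooth functions\<close>

text \<open>The exact number of sliding loops shapes the construction. Where the cutoff ends, the
  sign of \<open>w' - F(x, w)\<close> is that of the unperturbed field, so sliding regions may lie
  on either outer side, according to the sign of \<open>\<phi> (0, 0)\<close> and the parity of
  \<open>m\<close> (recorded in \<open>rb\<close> and \<open>lb\<close>). The levels at the ends of
  the step function are placed so that no closed chain of orbit pieces passes through these regions.
  For the crossing cycles a lower bound is enough, but isolation asks for a steep level on the left
  (\<open>bl\<close>) against a nearly flat one on the right (\<open>\<tau> * v\<close>). The
  constants are nested accordingly. The radius \<open>R\<close> is small against the number of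
  steps, because the error of \<open>H\<close> relative to the variation of the prescribed
  antiderivative is of order \<open>R * L\<close>; \<open>R\<close> and the neighbourhood
  \<open>N0\<close> precede \<epsilon>. Then come the width \<open>h\<close>, the leftmost start
  \<open>- \<sigma>\<close>, the shift \<alpha> with its map \<open>A\<close>, the slots with their
  sign function \<open>v\<close>, the factor \<tau>, and last \<eta>. Since \<psi> is asked to be
  smooth in \<open>x\<close> for each \<open>k\<close>, a single scalar parameter can enumerate
  countably many profiles.\<close>

lemma DERIV_at_continuous_on:
 fixes f :: "real => real"
 assumes "\<And>x. x \<in> S ==> (f has_real_derivative f' x) (at x)"
 shows "continuous_on S f"
 using assms DERIV_isCont by (blast intro: continuous_at_imp_continuous_on)

text \<open>The derivative is an existential witness, so that each closure rule below only has to
  exhibit it. Derivatives are two-sided even at boundary points of \<open>S\<close>.\<close>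

primrec ck_on :: "nat => real set => (real => real) => bool" where
 "ck_on 0 S f \<longleftrightarrow> continuous_on S f"
| "ck_on (Suc k) S f \<longleftrightarrow> (\<exists>f'. (\<forall>x\<in>S. (f has_real_derivative f' x) (at x)) & ck_on k S f')"

lemma ck_on_cong:
 assumes "open S" "\<And>x. x \<in> S ==> f x = g x"
 shows "ck_on k S f \<longleftrightarrow> ck_on k S g"
proof (cases k)
 case (Suc k')
 have "(f has_real_derivative f' x) (at x) \<longleftrightarrow> (g has_real_derivative f' x) (at x)" if "x \<in> S" for f' x
  using assms that by (metis has_field_derivative_transform_within_open)
 with Suc show ?thesis by simp
qed (use assms in \<open>simp cong: continuous_on_cong\<close>)

lemma ck_on_subset: "ck_on k S f ==> T \<subseteq> S ==> ck_on k T f"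
proof (induction k arbitrary: f)
 case 0
 then show ?case unfolding ck_on.simps(1) by (rule continuous_on_subset)
next
 case (Suc k)
 then obtain f' where "\<forall>x\<in>S. (f has_real_derivative f' x) (at x)" "ck_on k S f'" by auto
 with Suc show ?case by (auto intro!: exI[of _ f'])
qed

lemma ck_on_SucD: "ck_on (Suc k) S f ==> ck_on k S f"
proof (induction k arbitrary: f)
 case 0
 then obtain f' where "\<forall>x\<in>S. (f has_real_derivative f' x) (at x)" by auto
 then show ?case unfolding ck_on.simps(1)
  by (intro DERIV_at_continuous_on[of S f f']) auto
next
 case (Suc k)
 then obtain f' where *: "\<forall>x\<in>S. (f has_real_derivative f' x) (at x)" "ck_on (Suc k) S f'"
  unfolding ck_on.simps(2)[of "Suc k"] by blast
 with Suc.IH show ?case unfolding ck_on.simps(2)[of k S f] by blast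
qed

lemma ck_on_imp_continuous_on: "ck_on k S f ==> continuous_on S f"
proof (induction k)
 case (Suc k)
 from Suc.IH[OF ck_on_SucD[OF Suc.prems]] show ?case .
qed simp

lemma ck_on_const [intro]: "ck_on k S (%x. c)"
proof (induction k arbitrary: c)
 case (Suc k)
 then show ?case by (auto intro!: exI[of _ "%_. 0"])
qed auto

lemma ck_on_ident [intro]: "ck_on k S (%x. x)"
 by (cases k) (auto intro!: exI[of _ "%_. 1"])

lemma ck_on_add [intro]: "ck_on k S f ==> ck_on k S g ==> ck_on k S (%x. f x + g x)"
proof (induction k arbitrary: f g)
 case (Suc k)
 then obtain f' g' where "\<forall>x\<in>S. (f has_real_derivative f' x) (at x)" "ck_on k S f'"
  "\<forall>x\<in>S. (g has_real_derivative g' x) (at x)" "ck_on k S g'" by auto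
 then show ?case using Suc.IH
  by (auto intro!: exI[of _ "%x. f' x + g' x"] derivative_intros)
qed (auto intro: continuous_intros)

lemma ck_on_mult [intro]: "ck_on k S f ==> ck_on k S g ==> ck_on k S (%x. f x * g x)"
proof (induction k arbitrary: f g)
 case (Suc k)
 then obtain f' g' where *: "\<forall>x\<in>S. (f has_real_derivative f' x) (at x)" "ck_on k S f'"
  "\<forall>x\<in>S. (g has_real_derivative g' x) (at x)" "ck_on k S g'" by auto
 show ?case unfolding ck_on.simps
 proof (intro exI[of _ "%x. f' x * g x + g' x * f x"] conjI ballI)
  show "ck_on k S (%x. f' x * g x + g' x * f x)"
   using * Suc ck_on_SucD by (intro ck_on_add) auto
  fix x assume "x \<in> S"
  then show "((%x. f x * g x) has_real_derivative f' x * g x + g' x * f x) (at x)"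
   using * by (intro DERIV_mult) auto
 qed
qed (auto intro: continuous_intros)

lemma ck_on_minus [intro]: "ck_on k S f ==> ck_on k S (%x. - f x)"
 using ck_on_mult[OF ck_on_const[of k S "-1"], of f] by simp

lemma ck_on_diff [intro]: "ck_on k S f ==> ck_on k S g ==> ck_on k S (%x. f x - g x)"
 using ck_on_add[OF _ ck_on_minus, of k S f g] by simp

lemma ck_on_sum [intro]: "(\<And>i. i \<in> I ==> ck_on k S (f i)) ==> ck_on k S (%x. \<Sum>i\<in>I. f i x)"
 by (induction I rule: infinite_finite_induct) auto

lemma ck_on_prod [intro]: "(\<And>i. i \<in> I ==> ck_on k S (f i)) ==> ck_on k S (%x. \<Prod>i\<in>I. f i x)"
 by (induction I rule: infinite_finite_induct) auto

lemma ck_on_power [intro]: "ck_on k S f ==> ck_on k S (%x. f x ^ n)"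
 by (induction n) auto

lemma ck_on_inverse [intro]:
 assumes "\<And>x. x \<in> S ==> f x ~= 0"
 shows "ck_on k S f ==> ck_on k S (%x. inverse (f x))"
proof (induction k)
 case (Suc k)
 then obtain f' where *: "\<forall>x\<in>S. (f has_real_derivative f' x) (at x)" "ck_on k S f'" by auto
 have **: "ck_on k S (%x. inverse (f x))" using Suc ck_on_SucD by blast
 show ?case unfolding ck_on.simps
 proof (intro exI[of _ "%x. - (inverse (f x) * f' x * inverse (f x))"] conjI ballI)
  show "ck_on k S (%x. - (inverse (f x) * f' x * inverse (f x)))"
   using * ** by (intro ck_on_minus ck_on_mult) auto
  fix x assume "x \<in> S"
  then show "((%x. inverse (f x)) has_real_derivative - (inverse (f x) * f' x * inverse (f x))) (at x)"
   using * assms by (intro DERIV_inverse') auto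
 qed
qed (use assms in \<open>auto intro: continuous_intros\<close>)

lemma ck_on_divide [intro]:
 "(\<And>x. x \<in> S ==> g x ~= 0) ==> ck_on k S f ==> ck_on k S g ==> ck_on k S (%x. f x / g x)"
 unfolding divide_inverse by (intro ck_on_mult ck_on_inverse)

lemma ck_on_compose:
 assumes "g ` T \<subseteq> S"
 shows "ck_on k S f ==> ck_on k T g ==> ck_on k T (%x. f (g x))"
proof (induction k arbitrary: f)
 case 0
 then show ?case using continuous_on_compose2[OF _ _ assms] by auto
next
 case (Suc k)
 then obtain f' g' where *: "\<forall>x\<in>S. (f has_real_derivative f' x) (at x)" "ck_on k S f'"
  "\<forall>x\<in>T. (g has_real_derivative g' x) (at x)" "ck_on k T g'" by auto
 show ?case unfolding ck_on.simps
 proof (intro exI[of _ "%x. f' (g x) * g' x"] conjI ballI)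
  show "ck_on k T (%x. f' (g x) * g' x)"
   using * Suc ck_on_SucD by (intro ck_on_mult) auto
  fix x assume "x \<in> T"
  then show "((%x. f (g x)) has_real_derivative f' (g x) * g' x) (at x)"
   using * assms by (intro DERIV_chain2) auto
 qed
qed

text \<open>On either set the witness agrees with \<open>deriv f\<close>, which therefore serves on
  the union. Used to glue the profile from its part near the origin and its constant parts.\<close>

lemma ck_on_Un:
 assumes "open S" "open T"
 shows "ck_on k S f ==> ck_on k T f ==> ck_on k (S \<union> T) f"
proof (induction k arbitrary: f)
 case 0
 then show ?case using assms by (auto intro: continuous_on_open_Un)
next
 case (Suc k)
 then obtain f1 f2 where *: "\<forall>x\<in>S. (f has_real_derivative f1 x) (at x)" "ck_on k S f1"
  "\<forall>x\<in>T. (f has_real_derivative f2 x) (at x)" "ck_on k T f2" by auto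
 have "\<And>x. x \<in> S ==> deriv f x = f1 x" "\<And>x. x \<in> T ==> deriv f x = f2 x"
  using * by (auto intro: DERIV_imp_deriv)
 then have "ck_on k S (deriv f)" "ck_on k T (deriv f)"
  using * assms ck_on_cong[of S "deriv f" f1] ck_on_cong[of T "deriv f" f2] by auto
 moreover have "(f has_real_derivative deriv f x) (at x)" if "x \<in> S \<union> T" for x
  using that * by (metis DERIV_imp_deriv UnE)
 ultimately show ?case using Suc.IH by (auto intro!: exI[of _ "deriv f"])
qed

lemma smooth_if_ck_on:
 assumes "\<And>k. ck_on k UNIV f"
 shows "smooth f"
proof -
 have "ck_on k UNIV f ==> Ck k f" for k
 proof (induction k arbitrary: f)
  case (Suc k)
  then obtain f' where *: "\<And>x. (f has_real_derivative f' x) (at x)" "ck_on k UNIV f'" by auto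
  then have "f differentiable (at x)" for x
   using real_differentiable_def by blast
  moreover have "frechet_derivative f (at x) v = f' x * v" for x v
   using frechet_derivative_at[OF *(1)[unfolded has_field_derivative_def], of x] by metis
  moreover have "Ck k (%x. f' x * v)" for v
   using * by (intro Suc.IH ck_on_mult) auto
  ultimately show ?case by simp
 qed auto
 with assms show ?thesis by (simp add: smooth_def)
qed

subsection \<open>Cutoff functions\<close>

text \<open>The family in \<open>j\<close> is closed under differentiation, so smoothness follows by
  induction on the order for all \<open>j\<close> at once; \<open>j = 0\<close> is the usual flat
  function.\<close>

definition flat_exp :: "nat => real => real" where
 "flat_exp j x = (if x > 0 then exp (- 1 / x) / x ^ j else 0)"

lemma flat_exp_tendsto: "((%h. exp (- 1 / h) / h ^ j) \<longlongrightarrow> 0) (at_right (0::real))"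
proof -
 have "((%x::real. x ^ j / exp x) \<longlongrightarrow> 0) at_top"
  by (rule tendsto_power_div_exp_0)
 then have "((%x::real. inverse x ^ j / exp (inverse x)) \<longlongrightarrow> 0) (at_right 0)"
  unfolding filterlim_at_right_to_top by simp
 then show ?thesis
  by (rule Lim_transform_eventually)
   (auto intro!: eventuallyI simp: exp_minus field_simps power_inverse)
qed

lemma flat_exp_has_derivative:
 "(flat_exp j has_real_derivative flat_exp (j + 2) x - real j * flat_exp (j + 1) x) (at x)"
proof -
 consider "x > 0" | "x < 0" | "x = 0" by linarith
 then show ?thesis
 proof cases
  case 1
  have "((%x. exp (- 1 / x) / x ^ j) has_real_derivative
    (exp (- 1 / x) * (1 / x\<^sup>2) * x ^ j - exp (- 1 / x) * (real j * x ^ (j - 1))) / (x ^ j * x ^ j)) (at x)"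
   using 1 by (auto intro!: derivative_eq_intros simp: power2_eq_square)
  moreover have "(exp (- 1 / x) * (1 / x\<^sup>2) * x ^ j - exp (- 1 / x) * (real j * x ^ (j - 1))) / (x ^ j * x ^ j)
    = flat_exp (j + 2) x - real j * flat_exp (j + 1) x"
   using 1 by (cases j) (simp_all add: flat_exp_def field_simps power2_eq_square)
  ultimately have "((%x. exp (- 1 / x) / x ^ j) has_real_derivative
    flat_exp (j + 2) x - real j * flat_exp (j + 1) x) (at x)" by simp
  then show ?thesis
   by (rule has_field_derivative_transform_within_open[of _ _ _ "{0<..}"]) (use 1 in \<open>auto simp: flat_exp_def\<close>)
 next
  case 2
  have "((%x. 0) has_real_derivative 0) (at x)" by simp
  then have "(flat_exp j has_real_derivative 0) (at x)"
   by (rule has_field_derivative_transform_within_open[of _ _ _ "{..<0}"]) (use 2 in \<open>auto simp: flat_exp_def\<close>)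
  then show ?thesis using 2 by (simp add: flat_exp_def)
 next
  case 3
  have "((%h. (flat_exp j (0 + h) - flat_exp j 0) / h) \<longlongrightarrow> 0) (at 0)"
  proof (rule filterlim_split_at)
   have "\<forall>\<^sub>F h in at_left (0::real). 0 = (flat_exp j (0 + h) - flat_exp j 0) / h"
    by (intro eventually_at_leftI[of "-1"]) (auto simp: flat_exp_def)
   then show "((%h. (flat_exp j (0 + h) - flat_exp j 0) / h) \<longlongrightarrow> 0) (at_left 0)"
    by (rule Lim_transform_eventually[rotated]) simp
   have "\<forall>\<^sub>F h in at_right (0::real). exp (- 1 / h) / h ^ (Suc j) = (flat_exp j (0 + h) - flat_exp j 0) / h"
    by (intro eventually_at_rightI[of _ 1]) (auto simp: flat_exp_def)
   then show "((%h. (flat_exp j (0 + h) - flat_exp j 0) / h) \<longlongrightarrow> 0) (at_right 0)"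
    by (rule Lim_transform_eventually[OF flat_exp_tendsto])
  qed
  then have "(flat_exp j has_real_derivative 0) (at 0)"
   unfolding DERIV_def by simp
  with 3 show ?thesis by (simp add: flat_exp_def)
 qed
qed

lemma ck_on_flat_exp [intro]: "ck_on k S (flat_exp j)"
proof (induction k arbitrary: j)
 case 0
 show ?case unfolding ck_on.simps(1) by (rule DERIV_at_continuous_on[OF flat_exp_has_derivative])
next
 case (Suc k)
 have "ck_on k S (%x. flat_exp (j + 2) x - real j * flat_exp (j + 1) x)"
  by (intro ck_on_diff ck_on_mult ck_on_const Suc)
 then show ?case unfolding ck_on.simps
  by (intro exI[of _ "%x. flat_exp (j + 2) x - real j * flat_exp (j + 1) x"] conjI ballI
    flat_exp_has_derivative)
qed

definition bump :: "real => real => real => real" where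
 "bump p q x = flat_exp 0 (x - p) * flat_exp 0 (q - x)"

lemma flat_exp_0_pos_iff: "flat_exp 0 x > 0 \<longleftrightarrow> x > 0"
 by (simp add: flat_exp_def)

lemma flat_exp_0_nonneg: "flat_exp 0 x >= 0"
 by (simp add: flat_exp_def)

lemma bump_nonneg: "bump p q x >= 0"
 by (simp add: bump_def flat_exp_0_nonneg)

lemma bump_pos: "p < x ==> x < q ==> bump p q x > 0"
 by (simp add: bump_def flat_exp_0_pos_iff)

lemma bump_eq_0: "x <= p \<or> q <= x ==> bump p q x = 0"
 by (auto simp: bump_def flat_exp_def)

lemma ck_on_bump [intro]: "ck_on k S (bump p q)"
proof -
 have "ck_on k S (%x. flat_exp 0 (x - p))"
  by (rule ck_on_compose[of _ _ UNIV])
   (auto intro!: ck_on_diff ck_on_const ck_on_ident ck_on_power ck_on_flat_exp)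
 moreover have "ck_on k S (%x. flat_exp 0 (q - x))"
  by (rule ck_on_compose[of _ _ UNIV])
   (auto intro!: ck_on_diff ck_on_const ck_on_ident ck_on_power ck_on_flat_exp)
 ultimately show ?thesis unfolding bump_def[abs_def] by (rule ck_on_mult)
qed

lemma continuous_on_bump: "continuous_on S (bump p q)"
 using ck_on_bump[of 0] by simp

lemma antiderivative_real_line:
 fixes f :: "real => real"
 assumes "continuous_on UNIV f"
 obtains F where "\<And>x. (F has_real_derivative f x) (at x)" "F a = 0"
proof -
 define F where "F x = (LBINT t=a..x. f t)" for x :: real
 have "(F has_vector_derivative f x) (at x)" for x
 proof -
  let ?p = "min a x - 1" and ?q = "max a x + 1"
  have "((%u. LBINT y=a..u. f y) has_vector_derivative f x) (at x within {?p..?q})"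
   by (rule interval_integral_FTC2) (auto intro: continuous_on_subset[OF assms])
  moreover have "at x within {?p..?q} = at x"
   by (rule at_within_Icc_at) auto
  ultimately show ?thesis by (simp add: F_def[abs_def])
 qed
 moreover have "F a = 0" by (simp add: F_def)
 ultimately show ?thesis
  using that[of F] by (auto simp: has_real_derivative_iff_has_vector_derivative)
qed

text \<open>\<open>B\<close> is a smooth step of height \<mu> with derivative \<open>b\<close>. Both
  are kept: \<open>b\<close> enters the slope of the level function and \<open>B\<close> its
  values.\<close>

definition bump_of_mass :: "real => real => real => (real => real) => (real => real) => bool" where
 "bump_of_mass p q \<mu> b B \<longleftrightarrow> (\<forall>k S. ck_on k S b) & (\<forall>x. (B has_real_derivative b x) (at x)) & (\<forall>x. b x >= 0) \<and>
  (\<forall>x. p < x --> x < q --> b x > 0) & (\<forall>x. x <= p \<or> q <= x --> b x = 0) & (\<forall>x\<le>p. B x = 0) & (\<forall>x\<ge>q. B x = \<mu>)"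

lemma bump_of_massD:
 assumes "bump_of_mass p q \<mu> b B"
 shows "ck_on k S b" "(B has_real_derivative b x) (at x)" "b x >= 0" "p < x ==> x < q ==> b x > 0"
  "x <= p \<or> q <= x ==> b x = 0" "x <= p ==> B x = 0" "q <= x ==> B x = \<mu>"
 using assms unfolding bump_of_mass_def by blast+

lemma bump_of_mass_exists:
 assumes "p < q" "\<mu> > 0"
 shows "\<exists>b B. bump_of_mass p q \<mu> b B"
proof -
 obtain F where F: "\<And>x. (F has_real_derivative bump p q x) (at x)" "F p = 0"
  using antiderivative_real_line[OF continuous_on_bump] by blast
 have "F p < F q"
 proof (rule DERIV_pos_imp_increasing_open[OF assms(1)])
  show "\<exists>y. (F has_real_derivative y) (at x) & 0 < y" if "p < x" "x < q" for x
   using F(1)[of x] bump_pos[OF that] by blast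
  show "continuous_on {p..q} F" by (rule DERIV_at_continuous_on[OF F(1)])
 qed
 then have Fq: "F q > 0" using F by simp
 have const: "F x = F y" if "\<forall>t. min x y < t & t < max x y --> bump p q t = 0" for x y
 proof (cases x y rule: linorder_cases)
  case less
  then show ?thesis using that F(1)
   by (intro DERIV_isconst_end[symmetric]) (auto intro!: DERIV_at_continuous_on[OF F(1)], metis)
 next
  case greater
  then show ?thesis using that F(1)
   by (intro DERIV_isconst_end) (auto intro!: DERIV_at_continuous_on[OF F(1)], metis)
 qed auto
 have le: "F x = 0" if "x <= p" for x
  using const[of x p] that F(2) bump_eq_0 by auto
 have ge: "F x = F q" if "x >= q" for x
  using const[of x q] that bump_eq_0 by auto
 show ?thesis
 proof (rule exI[of _ "%x. (\<mu> / F q) * bump p q x"], rule exI[of _ "%x. (\<mu> / F q) * F x"], unfold bump_of_mass_def, intro conjI allI impI)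
  show "((%x. (\<mu> / F q) * F x) has_real_derivative (\<mu> / F q) * bump p q x) (at x)" for x
   by (intro DERIV_cmult F)
  show "ck_on k S (%x. (\<mu> / F q) * bump p q x)" for k S
   by (intro ck_on_mult ck_on_const ck_on_bump)
  show "(\<mu> / F q) * bump p q x >= 0" for x using bump_nonneg[of p q x] Fq assms by simp
  show "(\<mu> / F q) * bump p q x > 0" if "p < x" "x < q" for x using bump_pos[OF that] Fq assms by simp
  show "(\<mu> / F q) * bump p q x = 0" if "x <= p \<or> q <= x" for x using bump_eq_0[OF that] by simp
  show "(\<mu> / F q) * F x = 0" if "x <= p" for x using le[OF that] by simp
  show "(\<mu> / F q) * F x = \<mu>" if "q <= x" for x using ge[OF that] Fq by simp
 qed
qed

text \<open>A flat function of \<open>1 - x\<^sup>2\<close> is divided by its sum with one of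
  \<open>x\<^sup>2 - 1/4\<close>. One of these two arguments is always positive, so the denominator
  never vanishes.\<close>

lemma smooth_plateau:
 obtains ct :: "real => real" where "\<And>k S. ck_on k S ct" "\<And>x. 0 <= ct x" "\<And>x. ct x <= 1"
  "\<And>x. \<bar>x\<bar> <= 1/2 ==> ct x = 1" "\<And>x. \<bar>x\<bar> >= 1 ==> ct x = 0"
proof -
 have pos: "flat_exp 0 (1 - x\<^sup>2) + flat_exp 0 (x\<^sup>2 - 1/4) > 0" for x :: real
 proof (cases "x\<^sup>2 < 1")
  case True
  then show ?thesis using flat_exp_0_pos_iff[of "1 - x\<^sup>2"] flat_exp_0_nonneg[of "x\<^sup>2 - 1/4"] by linarith
 next
  case False
  then show ?thesis using flat_exp_0_pos_iff[of "x\<^sup>2 - 1/4"] flat_exp_0_nonneg[of "1 - x\<^sup>2"] by linarith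
 qed
 have c1: "ck_on k S (%x. flat_exp 0 (1 - x\<^sup>2))" for k S
  by (rule ck_on_compose[of _ _ UNIV])
   (auto intro!: ck_on_diff ck_on_const ck_on_ident ck_on_power ck_on_flat_exp)
 have c2: "ck_on k S (%x. flat_exp 0 (x\<^sup>2 - 1/4))" for k S
  by (rule ck_on_compose[of _ _ UNIV])
   (auto intro!: ck_on_diff ck_on_const ck_on_ident ck_on_power ck_on_flat_exp)
 define ct where "ct = (%x. flat_exp 0 (1 - x\<^sup>2) / (flat_exp 0 (1 - x\<^sup>2) + flat_exp 0 (x\<^sup>2 - 1/4)))"
 show ?thesis
 proof (rule that[of ct])
  show "ck_on k S ct" for k S
   unfolding ct_def using pos c1 c2 less_irrefl by (intro ck_on_divide ck_on_add) (auto, metis less_irrefl)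
  show "0 <= ct x" for x
   unfolding ct_def using pos[of x] flat_exp_0_nonneg by (simp add: divide_nonneg_pos)
  show "ct x <= 1" for x
   unfolding ct_def using pos[of x] flat_exp_0_nonneg by (simp add: divide_le_eq_1)
  show "ct x = 1" if "\<bar>x\<bar> <= 1/2" for x
  proof -
   have "x\<^sup>2 <= (1/2)\<^sup>2" using that abs_le_square_iff[of x "1/2"] by simp
   then have "flat_exp 0 (x\<^sup>2 - 1/4) = 0" by (simp add: flat_exp_def power2_eq_square)
   then show ?thesis using pos[of x] by (simp add: ct_def)
  qed
  show "ct x = 0" if "\<bar>x\<bar> >= 1" for x
  proof -
   have "1 <= x\<^sup>2" using that abs_le_square_iff[of 1 x] by simp
   then show ?thesis by (simp add: ct_def flat_exp_def)
  qed
 qed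
qed

section \<open>Smooth functions and vector fields on the plane\<close>

definition dx :: "(plane => real) => plane => real" where
 "dx A p = frechet_derivative A (at p) (1, 0)"

definition dy :: "(plane => real) => plane => real" where
 "dy A p = frechet_derivative A (at p) (0, 1)"

lemma Ck_has_derivative:
 assumes "Ck (Suc k) A"
 shows "(A has_derivative (%v. fst v * dx A p + snd v * dy A p)) (at p)"
proof -
 have D: "(A has_derivative frechet_derivative A (at p)) (at p)"
  using assms unfolding Ck.simps frechet_derivative_works[symmetric] by blast
 interpret linear "frechet_derivative A (at p)"
  using D has_derivative_linear by blast
 have "frechet_derivative A (at p) v = fst v * dx A p + snd v * dy A p" for v
 proof -
  have "v = fst v *\<^sub>R (1, 0) + snd v *\<^sub>R (0, 1)" by (cases v) simp
  then have "frechet_derivative A (at p) v = frechet_derivative A (at p) (fst v *\<^sub>R (1, 0) + snd v *\<^sub>R (0, 1))"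
   by simp
  then show ?thesis unfolding add scale by (simp add: dx_def dy_def)
 qed
 then have "frechet_derivative A (at p) = (%v. fst v * dx A p + snd v * dy A p)" by (rule ext)
 with D show ?thesis by simp
qed

lemma Ck_dx_dy: "Ck (Suc k) A ==> Ck k (dx A)" "Ck (Suc k) A ==> Ck k (dy A)"
 unfolding dx_def[abs_def] dy_def[abs_def] by auto

lemma smooth_imp_Ck: "smooth A ==> Ck k A"
 by (simp add: smooth_def)

lemma smooth_dx: "smooth A ==> smooth (dx A)" and smooth_dy: "smooth A ==> smooth (dy A)"
 unfolding smooth_def using Ck_dx_dy by blast+

lemma smooth_has_derivative:
 "smooth A ==> (A has_derivative (%v. fst v * dx A p + snd v * dy A p)) (at p)"
 by (rule Ck_has_derivative[OF smooth_imp_Ck])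

lemma smooth_continuous_on: "smooth A ==> continuous_on S A"
 using smooth_imp_Ck[of A 0] continuous_on_subset by auto

lemma smooth_isCont: "smooth A ==> isCont A p"
 using smooth_continuous_on[of A UNIV] by (simp add: continuous_on_eq_continuous_at)

lemma Ck_chain:
 assumes "Ck (Suc k) A" and "(x has_real_derivative x') (at t within S)"
  and "(y has_real_derivative y') (at t within S)"
 shows "((%t. A (x t, y t)) has_real_derivative
  x' * dx A (x t, y t) + y' * dy A (x t, y t)) (at t within S)"
proof -
 have "((%t. (x t, y t)) has_derivative (%h. (x' * h, y' * h))) (at t within S)"
  using assms(2,3) by (intro has_derivative_Pair) (auto simp: has_field_derivative_def)
 from has_derivative_compose[OF this Ck_has_derivative[OF assms(1)]]
 have "((%t. A (x t, y t)) has_derivative (%h. x' * h * dx A (x t, y t) + y' * h * dy A (x t, y t))) (at t within S)"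
  by simp
 moreover have "(%h. x' * h * dx A (x t, y t) + y' * h * dy A (x t, y t)) =
   (*) (x' * dx A (x t, y t) + y' * dy A (x t, y t))"
  by (auto simp: algebra_simps)
 ultimately show ?thesis by (simp add: has_field_derivative_def)
qed

lemmas smooth_chain = Ck_chain[OF smooth_imp_Ck]

lemma smooth_chain_solves:
 assumes "smooth A" "(orb has_vector_derivative v) (at t within S)"
 shows "((%t. A (orb t)) has_real_derivative fst v * dx A (orb t) + snd v * dy A (orb t)) (at t within S)"
proof -
 have "((%t. fst (orb t)) has_real_derivative fst v) (at t within S)"
  "((%t. snd (orb t)) has_real_derivative snd v) (at t within S)"
  using assms(2) by (auto simp: has_real_derivative_iff_has_vector_derivative
    bounded_linear.has_vector_derivative[OF bounded_linear_fst]
    bounded_linear.has_vector_derivative[OF bounded_linear_snd])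
 from smooth_chain[OF assms(1) this] show ?thesis by simp
qed

text \<open>Serves for bootstrapping: the right-hand side of a scalar equation along a solution
  \<open>u\<close> is as regular as \<open>u\<close>, so \<open>u\<close> gains one order.\<close>

lemma ck_on_compose_plane:
 "Ck k A ==> ck_on k S u ==> ck_on k S (%x. A (x, u x))"
proof (induction k arbitrary: A)
 case 0
 then have "continuous_on UNIV A" "continuous_on S (%x. (x, u x))"
  by (auto intro: continuous_intros)
 from continuous_on_compose2[OF this] show ?case by simp
next
 case (Suc k)
 then obtain u' where u': "\<forall>x\<in>S. (u has_real_derivative u' x) (at x)" "ck_on k S u'" by auto
 have "ck_on k S (%x. 1 * dx A (x, u x) + u' x * dy A (x, u x))"
  using Suc u' ck_on_SucD Ck_dx_dy by (intro ck_on_add ck_on_mult ck_on_const) blast+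
 then show ?case unfolding ck_on.simps
 proof (intro exI[of _ "%x. 1 * dx A (x, u x) + u' x * dy A (x, u x)"] conjI ballI)
  fix x assume "x \<in> S"
  with u' show "((%x. A (x, u x)) has_real_derivative 1 * dx A (x, u x) + u' x * dy A (x, u x)) (at x)"
   by (intro Ck_chain[OF Suc.prems(1)]) auto
 qed
qed

section \<open>Lipschitz bounds, Gronwall estimates and uniqueness of orbits\<close>

lemma smooth_lipschitz:
 fixes A :: "plane => real"
 assumes "smooth A" "compact K" "convex K"
 obtains B where "B > 0" "\<And>p q. p \<in> K ==> q \<in> K ==> \<bar>A p - A q\<bar> <= B * norm (p - q)"
proof -
 have "compact (dx A ` K)" "compact (dy A ` K)"
  using assms by (auto intro!: compact_continuous_image smooth_continuous_on smooth_dx smooth_dy)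
 then obtain B1 B2 where B: "\<And>p. p \<in> K ==> \<bar>dx A p\<bar> <= B1" "\<And>p. p \<in> K ==> \<bar>dy A p\<bar> <= B2"
  unfolding compact_eq_bounded_closed bounded_iff by force
 show ?thesis
 proof (rule that[of "\<bar>B1\<bar> + \<bar>B2\<bar> + 1"])
  fix p q assume pq: "p \<in> K" "q \<in> K"
  have "norm (A p - A q) <= (\<bar>B1\<bar> + \<bar>B2\<bar> + 1) * norm (p - q)"
  proof (rule differentiable_bound[OF assms(3) _ _ pq])
   show "(A has_derivative (%v. fst v * dx A x + snd v * dy A x)) (at x within K)" for x
    by (rule has_derivative_at_withinI[OF smooth_has_derivative[OF assms(1)]])
   show "onorm (%v. fst v * dx A x + snd v * dy A x) <= \<bar>B1\<bar> + \<bar>B2\<bar> + 1" if "x \<in> K" for x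
   proof (rule onorm_le)
    fix v :: plane
    have "\<bar>fst v\<bar> <= norm v" "\<bar>snd v\<bar> <= norm v"
     by (metis norm_fst_le norm_snd_le prod.collapse real_norm_def)+
    moreover have "\<bar>dx A x\<bar> <= \<bar>B1\<bar>" "\<bar>dy A x\<bar> <= \<bar>B2\<bar>"
     using B[OF that] by linarith+
    ultimately have "\<bar>fst v * dx A x\<bar> <= norm v * \<bar>B1\<bar>" "\<bar>snd v * dy A x\<bar> <= norm v * \<bar>B2\<bar>"
     by (auto simp: abs_mult intro!: mult_mono)
    then have "\<bar>fst v * dx A x + snd v * dy A x\<bar> <= norm v * \<bar>B1\<bar> + norm v * \<bar>B2\<bar>" by linarith
    also have "\<dots> <= (\<bar>B1\<bar> + \<bar>B2\<bar> + 1) * norm v" by (simp add: algebra_simps)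
    finally show "norm (fst v * dx A x + snd v * dy A x) <= (\<bar>B1\<bar> + \<bar>B2\<bar> + 1) * norm v" by simp
   qed
  qed
  then show "\<bar>A p - A q\<bar> <= (\<bar>B1\<bar> + \<bar>B2\<bar> + 1) * norm (p - q)" by simp
 qed simp
qed

lemma upper_field_lipschitz:
 assumes "smooth f" "smooth g" "compact K" "convex K"
 obtains B where "B > 0"
  "\<And>p q. p \<in> K ==> q \<in> K ==> norm (upper_field f g p - upper_field f g q) <= B * norm (p - q)"
proof -
 obtain B1 where B1: "B1 > 0" "\<And>p q. p \<in> K ==> q \<in> K ==> \<bar>f p - f q\<bar> <= B1 * norm (p - q)"
  using smooth_lipschitz[OF assms(1,3,4)] by blast
 obtain B2 where B2: "B2 > 0" "\<And>p q. p \<in> K ==> q \<in> K ==> \<bar>g p - g q\<bar> <= B2 * norm (p - q)"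
  using smooth_lipschitz[OF assms(2,3,4)] by blast
 show ?thesis
 proof (rule that[of "B1 + B2"])
  fix p q assume pq: "p \<in> K" "q \<in> K"
  have "norm (upper_field f g p - upper_field f g q) = norm (f p - f q, g p - g q)"
   by (cases p; cases q) (simp add: upper_field_def)
  also have "\<dots> <= \<bar>f p - f q\<bar> + \<bar>g p - g q\<bar>"
   using norm_Pair_le[of "f p - f q" "g p - g q"] by simp
  also have "\<dots> <= (B1 + B2) * norm (p - q)"
   using B1(2)[OF pq] B2(2)[OF pq] by (simp add: algebra_simps)
  finally show "norm (upper_field f g p - upper_field f g q) <= (B1 + B2) * norm (p - q)" .
 qed (use B1 B2 in simp)
qed

text \<open>The squared norm \<open>n\<close> satisfies
  \<open>\<bar>n'\<bar> \<le> 2 * C * n\<close>, so \<open>n * exp (- 2 * C * t)\<close> decreases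
  and \<open>n * exp (2 * C * t)\<close> increases; these give the estimate forwards and backwards
  in time.\<close>

lemma gronwall_norm:
 fixes u :: "real => 'a::real_inner"
 assumes du: "\<And>t. t \<in> {a..b} ==> (u has_vector_derivative u' t) (at t within {a..b})"
  and bd: "\<And>t. t \<in> {a..b} ==> norm (u' t) <= C * norm (u t)"
  and st: "s \<in> {a..b}" "t \<in> {a..b}"
 shows "norm (u t) <= exp (C * \<bar>t - s\<bar>) * norm (u s)"
proof -
 define n where "n t = (norm (u t))\<^sup>2" for t
 define n' where "n' t = 2 * (u t \<bullet> u' t)" for t
 have dn: "(n has_real_derivative n' t) (at t within {a..b})" if "t \<in> {a..b}" for t
 proof -
  have "((%t. u t \<bullet> u t) has_vector_derivative (u t \<bullet> u' t + u' t \<bullet> u t)) (at t within {a..b})"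
   using bounded_bilinear.has_vector_derivative[OF bounded_bilinear_inner du[OF that] du[OF that]] .
  then show ?thesis
   by (simp add: n_def[abs_def] n'_def power2_norm_eq_inner inner_commute
     has_real_derivative_iff_has_vector_derivative)
 qed
 have bn: "\<bar>n' t\<bar> <= 2 * C * n t" if "t \<in> {a..b}" for t
 proof -
  have "\<bar>u t \<bullet> u' t\<bar> <= norm (u t) * norm (u' t)" by (rule Cauchy_Schwarz_ineq2)
  also have "\<dots> <= norm (u t) * (C * norm (u t))"
   using bd[OF that] by (intro mult_left_mono) auto
  finally show ?thesis by (simp add: n_def n'_def power2_eq_square abs_mult algebra_simps)
 qed
 have "n t <= exp (2 * C * \<bar>t - s\<bar>) * n s"
 proof (cases "s <= t")
  case True
  have "n t * exp (- 2 * C * t) <= n s * exp (- 2 * C * s)"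
  proof (rule DERIV_nonpos_imp_decreasing_open[OF True])
   fix x assume x: "s < x" "x < t"
   then have xab: "x \<in> {a..b}" and atx: "at x within {a..b} = at x"
    using st by (auto intro: at_within_Icc_at)
   have "((%t. n t * exp (- 2 * C * t)) has_real_derivative (n' x - 2 * C * n x) * exp (- 2 * C * x)) (at x)"
    using dn[OF xab] unfolding atx by (auto intro!: derivative_eq_intros simp: algebra_simps)
   moreover have "(n' x - 2 * C * n x) * exp (- 2 * C * x) <= 0"
    using bn[OF xab] by (simp add: mult_nonpos_nonneg)
   ultimately show "\<exists>y. ((%t. n t * exp (- 2 * C * t)) has_real_derivative y) (at x) & y <= 0" by blast
  next
   have "continuous_on {a..b} n" using dn by (rule DERIV_continuous_on)
   then show "continuous_on {s..t} (%t. n t * exp (- 2 * C * t))"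
    using st by (intro continuous_intros) (auto intro: continuous_on_subset)
  qed
  then have "n t * exp (- 2 * C * t) * exp (2 * C * t) <= n s * exp (- 2 * C * s) * exp (2 * C * t)"
   by (intro mult_right_mono) auto
  then show ?thesis using True by (simp add: mult.assoc flip: exp_add) (simp add: algebra_simps)
 next
  case False
  then have True: "t <= s" by simp
  have "n t * exp (2 * C * t) <= n s * exp (2 * C * s)"
  proof (rule DERIV_nonneg_imp_increasing_open[OF True])
   fix x assume x: "t < x" "x < s"
   then have xab: "x \<in> {a..b}" and atx: "at x within {a..b} = at x"
    using st by (auto intro: at_within_Icc_at)
   have "((%t. n t * exp (2 * C * t)) has_real_derivative (n' x + 2 * C * n x) * exp (2 * C * x)) (at x)"
    using dn[OF xab] unfolding atx by (auto intro!: derivative_eq_intros simp: algebra_simps)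
   moreover have "(n' x + 2 * C * n x) * exp (2 * C * x) >= 0"
    using bn[OF xab] by (intro mult_nonneg_nonneg) auto
   ultimately show "\<exists>y. ((%t. n t * exp (2 * C * t)) has_real_derivative y) (at x) & 0 <= y" by blast
  next
   have "continuous_on {a..b} n" using dn by (rule DERIV_continuous_on)
   then show "continuous_on {t..s} (%t. n t * exp (2 * C * t))"
    using st by (intro continuous_intros) (auto intro: continuous_on_subset)
  qed
  then have "n t * exp (2 * C * t) * exp (- 2 * C * t) <= n s * exp (2 * C * s) * exp (- 2 * C * t)"
   by (intro mult_right_mono) auto
  then show ?thesis using True by (simp add: mult.assoc flip: exp_add) (simp add: algebra_simps)
 qed
 also have "exp (2 * C * \<bar>t - s\<bar>) * n s = (exp (C * \<bar>t - s\<bar>) * norm (u s))\<^sup>2"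
  by (simp add: n_def power_mult_distrib flip: exp_double)
 finally show ?thesis unfolding n_def
  by (rule power2_le_imp_le) auto
qed

lemma gronwall_solutions:
 assumes "solves Z orb {a..b}" "solves Z \<eta> {a..b}"
  and lip: "\<And>p q. p \<in> K ==> q \<in> K ==> norm (Z p - Z q) <= C * norm (p - q)"
  and "orb ` {a..b} \<subseteq> K" "\<eta> ` {a..b} \<subseteq> K" "s \<in> {a..b}" "t \<in> {a..b}"
 shows "norm (orb t - \<eta> t) <= exp (C * \<bar>t - s\<bar>) * norm (orb s - \<eta> s)"
proof (rule gronwall_norm[where u = "%t. orb t - \<eta> t" and u' = "%t. Z (orb t) - Z (\<eta> t)" and a = a and b = b])
 fix t assume "t \<in> {a..b}"
 then show "((%t. orb t - \<eta> t) has_vector_derivative Z (orb t) - Z (\<eta> t)) (at t within {a..b})"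
  using assms by (intro has_vector_derivative_diff) (auto simp: solves_def)
 show "norm (Z (orb t) - Z (\<eta> t)) <= C * norm (orb t - \<eta> t)"
  using assms \<open>t \<in> {a..b}\<close> by (intro lip) auto
qed (use assms in auto)

lemma solves_continuous_on: "solves Z orb I ==> continuous_on I orb"
 unfolding solves_def using has_vector_derivative_continuous continuous_on_eq_continuous_within by blast

lemma solves_subset: "solves Z orb I ==> J \<subseteq> I ==> solves Z orb J"
 unfolding solves_def using has_vector_derivative_within_subset by blast

lemma solves_shift:
 assumes "solves Z orb I" "\<And>t. t \<in> J ==> t + c \<in> I"
 shows "solves Z (%t. orb (t + c)) J"
 unfolding solves_def
proof
 fix t assume t: "t \<in> J"
 have "((%t. orb (t + c)) has_vector_derivative 1 *\<^sub>R Z (orb (t + c))) (at t within J)"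
 proof (rule vector_diff_chain_within[where f = "%t. t + c" and g = orb, unfolded o_def])
  show "((%t. t + c) has_vector_derivative 1) (at t within J)"
   by (auto intro!: derivative_eq_intros)
  show "(orb has_vector_derivative Z (orb (t + c))) (at (t + c) within (%t. t + c) ` J)"
   using assms t by (auto simp: solves_def intro: has_vector_derivative_within_subset)
 qed
 then show "((%t. orb (t + c)) has_vector_derivative Z (orb (t + c))) (at t within J)" by simp
qed

lemma solves_cong:
 assumes "\<And>t. t \<in> I ==> orb t = \<eta> t"
 shows "solves Z orb I \<longleftrightarrow> solves Z \<eta> I"
proof -
 have "solves Z \<beta> I" if "solves Z \<alpha> I" "\<And>t. t \<in> I ==> \<alpha> t = \<beta> t" for \<alpha> \<beta>
  unfolding solves_def
 proof
  fix t assume t: "t \<in> I"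
  show "(\<beta> has_vector_derivative Z (\<beta> t)) (at t within I)"
   by (rule has_vector_derivative_transform[OF t, of _ \<alpha>]) (use that t in \<open>auto simp: solves_def\<close>)
 qed
 from this[of orb \<eta>] this[of \<eta> orb] assms show ?thesis by auto
qed

lemma compact_in_convex:
 assumes "compact (K :: plane set)"
 obtains K' where "compact K'" "convex K'" "K \<subseteq> K'"
 using that[of "convex hull K"] assms by (simp add: compact_convex_hull hull_subset)

text \<open>Smooth fields are only locally Lipschitz; the constant for Gronwall is taken on a
  compact convex set around both orbit segments.\<close>

lemma solves_unique:
 assumes "smooth f" "smooth g" "solves (upper_field f g) orb {a..b}" "solves (upper_field f g) \<eta> {a..b}"
  and "s \<in> {a..b}" "orb s = \<eta> s" "t \<in> {a..b}"
 shows "orb t = \<eta> t"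
proof -
 have "compact (orb ` {a..b} \<union> \<eta> ` {a..b})"
  using assms by (intro compact_Un compact_continuous_image) (auto intro: solves_continuous_on)
 then obtain K where K: "compact K" "convex K" "orb ` {a..b} \<union> \<eta> ` {a..b} \<subseteq> K"
  using compact_in_convex by blast
 obtain B where B: "B > 0" "\<And>p q. p \<in> K ==> q \<in> K ==> norm (upper_field f g p - upper_field f g q) <= B * norm (p - q)"
  by (rule upper_field_lipschitz[OF assms(1,2) K(1,2)]) auto
 from gronwall_solutions[OF assms(3,4) B(2), where s = s and t = t] K assms show ?thesis by auto
qed

section \<open>Scalar differential equations and level functions\<close>

lemma deriv_within_nonneg_mono:
 fixes F :: "real => real"
 assumes "p <= q" "\<And>x. x \<in> {p..q} ==> (F has_real_derivative F' x) (at x within {p..q})"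
  and "\<And>x. p < x ==> x < q ==> F' x >= 0"
 shows "F p <= F q"
proof (rule DERIV_nonneg_imp_increasing_open[OF assms(1)])
 show "\<exists>y. (F has_real_derivative y) (at x) & 0 <= y" if "p < x" "x < q" for x
  using assms(2)[of x] assms(3)[of x] that at_within_Icc_at[of p x q] by auto
 show "continuous_on {p..q} F" by (rule DERIV_continuous_on[OF assms(2)])
qed

lemma deriv_within_pos_mono:
 fixes F :: "real => real"
 assumes "p < q" "\<And>x. x \<in> {p..q} ==> (F has_real_derivative F' x) (at x within {p..q})"
  and "\<And>x. p < x ==> x < q ==> F' x > 0"
 shows "F p < F q"
proof (rule DERIV_pos_imp_increasing_open[OF assms(1)])
 show "\<exists>y. (F has_real_derivative y) (at x) & 0 < y" if "p < x" "x < q" for x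
  using assms(2)[of x] assms(3)[of x] that at_within_Icc_at[of p x q] by auto
 show "continuous_on {p..q} F" by (rule DERIV_continuous_on[OF assms(2)])
qed

lemma deriv_within_diff_bound:
 fixes F :: "real => real"
 assumes "\<And>x. x \<in> {p..q} ==> (F has_real_derivative F' x) (at x within {p..q})"
  and "\<And>x. x \<in> {p..q} ==> \<bar>F' x\<bar> <= B" and "x \<in> {p..q}" "y \<in> {p..q}"
 shows "\<bar>F x - F y\<bar> <= B * \<bar>x - y\<bar>"
 using field_differentiable_bound[of "{p..q}" F F' B x y] assms by auto

lemma has_real_derivative_within_subset:
 "(F has_real_derivative D) (at x within S) ==> T \<subseteq> S ==> (F has_real_derivative D) (at x within T)"
 by (rule DERIV_subset)

text \<open>The scalar equation \<open>y' = G x y\<close> on \<open>{-R..R}\<close>, with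
  \<open>G\<close> bounded and Lipschitz over the whole range of \<open>y\<close>. The condition
  \<open>16 * R * L \<le> 1\<close> makes the Picard operator contract on the whole interval and
  keeps the difference of two solutions constant up to the relative error \<kappa>.\<close>

locale graph_ode =
 fixes G :: "real => real => real" and R L K :: real
 assumes R_pos: "R > 0" and L_nonneg: "L >= 0" and small: "16 * R * L <= 1"
  and cont: "continuous_on ({-R..R} \<times> UNIV) (%p. G (fst p) (snd p))"
  and lip: "\<And>x y y'. x \<in> {-R..R} ==> \<bar>G x y - G x y'\<bar> <= L * \<bar>y - y'\<bar>"
  and bound: "\<And>x y. x \<in> {-R..R} ==> \<bar>G x y\<bar> <= K"
begin

definition sol :: "(real => real) => bool" where
 "sol u \<longleftrightarrow> (\<forall>x\<in>{-R..R}. (u has_real_derivative G x (u x)) (at x within {-R..R}))"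

abbreviation "\<kappa> \<equiv> 4 * R * L"

lemma kappa: "0 <= \<kappa>" "\<kappa> <= 1/4"
 using small R_pos L_nonneg by auto

lemma picard:
 assumes x1: "x1 \<in> {-R..R}"
 shows "\<exists>u. sol u & u x1 = y1"
proof -
 \<comment> \<open>Clamping the argument extends functions on the interval to bounded continuous
   functions on the line, the complete space on which the contraction principle is applied.\<close>
 define cl where "cl x = max (-R) (min R x)" for x
 have cl: "cl x \<in> {-R..R}" "x \<in> {-R..R} ==> cl x = x" for x
  using R_pos by (auto simp: cl_def)
 have ccl: "continuous_on S cl" for S
  unfolding cl_def[abs_def] by (intro continuous_intros)
 have "\<exists>A. \<forall>x\<in>{-R..R}. (A has_real_derivative G x (u x)) (at x within {-R..R})"
  for u :: "real \<Rightarrow>\<^sub>C real"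
 proof -
  have "continuous_on {-R..R} (%x. (x, u x))"
   by (intro continuous_intros) auto
  from continuous_on_compose2[OF cont this]
  have "continuous_on {-R..R} (%x. G x (u x))" by auto
  from antiderivative_continuous[OF this] show ?thesis
   by (metis has_real_derivative_iff_has_vector_derivative)
 qed
 then obtain A where A: "\<And>u x. x \<in> {-R..R} ==> (A u has_real_derivative G x (apply_bcontfun u x)) (at x within {-R..R})"
  by metis
 define T where "T u = Bcontfun (%x. y1 + (A u (cl x) - A u x1))" for u
 have T: "apply_bcontfun (T u) x = y1 + (A u (cl x) - A u x1)" for u x
 proof -
  have cA: "continuous_on {-R..R} (A u)" by (rule DERIV_continuous_on[OF A])
  have "continuous_on UNIV (%x. A u (cl x))"
   by (rule continuous_on_compose2[OF cA ccl]) (use cl in auto)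
  moreover have "bounded (range (%x. y1 + (A u (cl x) - A u x1)))"
  proof -
   have "bounded (A u ` {-R..R})"
    using cA by (intro compact_imp_bounded compact_continuous_image) auto
   then have "bounded ((%z. (y1 - A u x1) + z) ` (A u ` {-R..R}))" by (rule bounded_translation)
   then show ?thesis by (rule bounded_subset) (use cl in \<open>auto simp: algebra_simps image_image\<close>)
  qed
  ultimately have "(%x. y1 + (A u (cl x) - A u x1)) \<in> bcontfun"
   unfolding bcontfun_def by (auto intro!: continuous_intros)
  then show ?thesis unfolding T_def by (simp add: Bcontfun_inverse)
 qed
 have "dist (T u) (T v) <= (1/2) * dist u v" for u v
 proof (rule dist_bound)
  fix x
  have "\<bar>(A u (cl x) - A v (cl x)) - (A u x1 - A v x1)\<bar> <= (L * dist u v) * \<bar>cl x - x1\<bar>"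
  proof (rule deriv_within_diff_bound[where p = "-R" and q = R])
   fix t assume t: "t \<in> {-R..R}"
   show "((%t. A u t - A v t) has_real_derivative G t (u t) - G t (v t)) (at t within {-R..R})"
    by (intro derivative_intros A t)
   have "\<bar>u t - v t\<bar> <= dist u v" using dist_bounded[of u t v] by (simp add: dist_real_def)
   then show "\<bar>G t (u t) - G t (v t)\<bar> <= L * dist u v"
    using lip[OF t, of "u t" "v t"] L_nonneg by (meson mult_left_mono order_trans)
  qed (use cl x1 in auto)
  also have "\<dots> <= (L * dist u v) * (2 * R)"
   using cl(1)[of x] x1 L_nonneg by (intro mult_left_mono mult_nonneg_nonneg) auto
  also have "\<dots> = (2 * R * L) * dist u v" by simp
  also have "\<dots> <= (1/2) * dist u v" using small by (intro mult_right_mono) auto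
  finally show "dist (apply_bcontfun (T u) x) (apply_bcontfun (T v) x) <= (1/2) * dist u v"
   by (simp add: T dist_real_def algebra_simps)
 qed
 then have "\<exists>!u. T u = u" by (intro banach_fix_type[of "1/2"]) auto
 then obtain u where u: "T u = u" by blast
 have ux: "u x = y1 + (A u (cl x) - A u x1)" for x
  using T[of u x] u by simp
 have "(apply_bcontfun u has_real_derivative G x (u x)) (at x within {-R..R})" if x: "x \<in> {-R..R}" for x
 proof (rule has_field_derivative_transform_within[where d = 1])
  show "((%x. y1 + (A u x - A u x1)) has_real_derivative G x (u x)) (at x within {-R..R})"
   by (auto intro!: derivative_eq_intros A x)
  show "y1 + (A u t - A u x1) = apply_bcontfun u t" if "t \<in> {-R..R}" for t
   using ux[of t] cl(2)[OF that] by simp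
 qed (use x in auto)
 moreover have "u x1 = y1" using ux[of x1] cl(2)[OF x1] by simp
 ultimately show ?thesis unfolding sol_def by blast
qed

text \<open>At the point \<open>z\<close> of largest difference the mean value estimate gives at
  most twice the difference at \<open>x1\<close>; inserted once more into the estimate this yields
  the factor \<kappa>.\<close>

lemma sol_diff_bound:
 assumes "sol u" "sol v" "x \<in> {-R..R}" "x1 \<in> {-R..R}"
 shows "\<bar>(u x - v x) - (u x1 - v x1)\<bar> <= \<kappa> * \<bar>u x1 - v x1\<bar>"
proof -
 let ?D = "%x. u x - v x"
 have du: "(?D has_real_derivative G t (u t) - G t (v t)) (at t within {-R..R})" if "t \<in> {-R..R}" for t
  using assms that by (intro derivative_intros) (auto simp: sol_def)
 have "continuous_on {-R..R} (%x. \<bar>?D x\<bar>)"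
  by (intro continuous_intros DERIV_continuous_on[OF du, unfolded sol_def])
   (use assms in \<open>auto simp: sol_def intro!: DERIV_continuous_on\<close>)
 then obtain z where z: "z \<in> {-R..R}" "\<And>t. t \<in> {-R..R} ==> \<bar>?D t\<bar> <= \<bar>?D z\<bar>"
  using continuous_attains_sup[of "{-R..R}" "%x. \<bar>?D x\<bar>"] R_pos by auto
 have *: "\<bar>?D t - ?D x1\<bar> <= (2 * R * L) * \<bar>?D z\<bar>" if t: "t \<in> {-R..R}" for t
 proof -
  have "\<bar>?D t - ?D x1\<bar> <= (L * \<bar>?D z\<bar>) * \<bar>t - x1\<bar>"
  proof (rule deriv_within_diff_bound[where p = "-R" and q = R])
   fix s assume s: "s \<in> {-R..R}"
   show "(?D has_real_derivative G s (u s) - G s (v s)) (at s within {-R..R})" by (rule du[OF s])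
   show "\<bar>G s (u s) - G s (v s)\<bar> <= L * \<bar>?D z\<bar>"
    using lip[OF s, of "u s" "v s"] z(2)[OF s] L_nonneg by (meson mult_left_mono order_trans)
  qed (use t assms in auto)
  also have "\<dots> <= (L * \<bar>?D z\<bar>) * (2 * R)"
   using t assms(4) L_nonneg by (intro mult_left_mono mult_nonneg_nonneg) auto
  finally show ?thesis by (simp add: algebra_simps)
 qed
 from *[OF z(1)] have "\<bar>?D z - ?D x1\<bar> <= (1/2) * \<bar>?D z\<bar>"
  by (rule order_trans) (use small in \<open>intro mult_right_mono, auto\<close>)
 then have "\<bar>?D z\<bar> <= 2 * \<bar>?D x1\<bar>" by (simp add: abs_if split: if_splits)
 then have "(2 * R * L) * \<bar>?D z\<bar> <= (2 * R * L) * (2 * \<bar>?D x1\<bar>)"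
  using R_pos L_nonneg by (intro mult_left_mono) auto
 with *[OF assms(3)] show ?thesis by (simp only: mult.assoc mult.commute mult.left_commute)
qed

definition \<Phi> :: "real => real => real => real" where
 "\<Phi> x1 y1 = (SOME u. sol u & u x1 = y1)"

text \<open>A first integral: the height at which the solution through \<open>(x, y)\<close> passes
  \<open>x = 0\<close>. Two points lie on one solution graph exactly if their heights agree.\<close>

definition ht :: "real => real => real" where
 "ht x y = \<Phi> x y 0"

lemma Phi_sol: "x1 \<in> {-R..R} ==> sol (\<Phi> x1 y1)" and Phi_start: "x1 \<in> {-R..R} ==> \<Phi> x1 y1 x1 = y1"
 using someI_ex[OF picard[of x1 y1]] unfolding \<Phi>_def by auto

lemma sol_unique:
 assumes "sol u" "sol v" "x1 \<in> {-R..R}" "u x1 = v x1" "x \<in> {-R..R}"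
 shows "u x = v x"
 using sol_diff_bound[of u v x x1] assms by simp

lemma Phi_eq: "sol u ==> x1 \<in> {-R..R} ==> x \<in> {-R..R} ==> \<Phi> x1 (u x1) x = u x"
 using sol_unique[OF Phi_sol[of x1 "u x1"], of u x1 x] Phi_start[of x1 "u x1"] by auto

lemma zero_mem: "0 \<in> {-R..R}" using R_pos by simp

lemma ht_bracket:
 assumes "x \<in> {-R..R}"
 shows "\<bar>(ht x y - ht x y') - (y - y')\<bar> <= \<kappa> * \<bar>y - y'\<bar>"
 using sol_diff_bound[OF Phi_sol[OF assms, of y] Phi_sol[OF assms, of y'] zero_mem assms]
 by (simp add: Phi_start[OF assms] ht_def)

lemma ht_sol: "sol u ==> x \<in> {-R..R} ==> ht x (u x) = u 0"
 unfolding ht_def using Phi_eq zero_mem by blast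

lemma ht_Phi: "x \<in> {-R..R} ==> x1 \<in> {-R..R} ==> ht x (\<Phi> x1 y1 x) = ht x1 y1"
 using ht_sol[OF Phi_sol] by (simp add: ht_def)

lemma ht_less_iff:
 assumes "x \<in> {-R..R}"
 shows "ht x y < ht x y' \<longleftrightarrow> y < y'"
proof -
 have *: "ht x y < ht x y'" if "y < y'" for y y'
 proof -
  from ht_bracket[OF assms, of y' y]
  have "\<bar>(ht x y' - ht x y) - (y' - y)\<bar> <= (1/4) * \<bar>y' - y\<bar>"
   by (rule order_trans) (use kappa(2) in \<open>intro mult_right_mono, auto\<close>)
  with that show ?thesis by (simp add: abs_if split: if_splits)
 qed
 show ?thesis using *[of y y'] *[of y' y] by (cases y y' rule: linorder_cases) auto
qed

lemma ht_le_iff: "x \<in> {-R..R} ==> ht x y <= ht x y' \<longleftrightarrow> y <= y'"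
 using ht_less_iff[of x y' y] by (auto simp: not_less[symmetric])

lemma ht_eq_iff: "x \<in> {-R..R} ==> ht x y = ht x y' \<longleftrightarrow> y = y'"
 using ht_less_iff[of x y' y] ht_less_iff[of x y y'] by (cases y y' rule: linorder_cases) auto

lemma ht_0: "ht 0 y = y"
 using Phi_start[OF zero_mem] by (simp add: ht_def)

lemma Phi_lipschitz:
 assumes "x1 \<in> {-R..R}" "x \<in> {-R..R}" "x' \<in> {-R..R}"
 shows "\<bar>\<Phi> x1 y1 x - \<Phi> x1 y1 x'\<bar> <= K * \<bar>x - x'\<bar>"
proof (rule deriv_within_diff_bound[where p = "-R" and q = R])
 fix t assume t: "t \<in> {-R..R}"
 show "(\<Phi> x1 y1 has_real_derivative G t (\<Phi> x1 y1 t)) (at t within {-R..R})"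
  using Phi_sol[OF assms(1)] t by (auto simp: sol_def)
 show "\<bar>G t (\<Phi> x1 y1 t)\<bar> <= K" by (rule bound[OF t])
qed (use assms in auto)

lemma ht_lipschitz:
 assumes "x \<in> {-R..R}" "x' \<in> {-R..R}"
 shows "\<bar>ht x y - ht x' y'\<bar> <= 2 * (\<bar>y - y'\<bar> + K * \<bar>x - x'\<bar>)"
proof -
 let ?y = "\<Phi> x' y' x"
 from ht_bracket[OF assms(1), of y ?y]
 have "\<bar>(ht x y - ht x ?y) - (y - ?y)\<bar> <= (1/4) * \<bar>y - ?y\<bar>"
  by (rule order_trans) (use kappa(2) in \<open>intro mult_right_mono, auto\<close>)
 then have "\<bar>ht x y - ht x ?y\<bar> <= 2 * \<bar>y - ?y\<bar>" by (simp add: abs_if split: if_splits)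
 moreover have "ht x ?y = ht x' y'" using ht_Phi assms by blast
 moreover have "\<bar>?y - y'\<bar> <= K * \<bar>x - x'\<bar>"
  using Phi_lipschitz[OF assms(2,1,2), of y'] Phi_start[OF assms(2), of y'] by simp
 ultimately have "\<bar>ht x y - ht x' y'\<bar> <= 2 * \<bar>y - ?y\<bar>" "\<bar>y - ?y\<bar> <= \<bar>y - y'\<bar> + K * \<bar>x - x'\<bar>"
  by (auto simp del: abs_mult)
 then show ?thesis by (meson mult_left_mono order_trans zero_le_numeral)
qed

lemma ht_continuous_on: "continuous_on ({-R..R} \<times> UNIV) (%p. ht (fst p) (snd p))"
proof -
 have K: "K >= 0" using bound[OF zero_mem, of 0] by simp
 have "\<bar>ht (fst p) (snd p) - ht (fst q) (snd q)\<bar> <= 2 * (1 + K) * dist p q"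
  if "p \<in> {-R..R} \<times> UNIV" "q \<in> {-R..R} \<times> UNIV" for p q
 proof -
  have *: "\<bar>snd p - snd q\<bar> <= dist p q" "\<bar>fst p - fst q\<bar> <= dist p q"
   using dist_fst_le[of p q] dist_snd_le[of p q] by (auto simp: dist_real_def)
  have "\<bar>ht (fst p) (snd p) - ht (fst q) (snd q)\<bar> <= 2 * (\<bar>snd p - snd q\<bar> + K * \<bar>fst p - fst q\<bar>)"
   using that by (intro ht_lipschitz) auto
  also have "\<dots> <= 2 * (dist p q + K * dist p q)"
   using * K by (intro mult_left_mono add_mono) auto
  finally show ?thesis by (simp add: algebra_simps)
 qed
 then have "(2 * (1 + K))-lipschitz_on ({-R..R} \<times> UNIV) (%p. ht (fst p) (snd p))"
  using K by (intro lipschitz_onI) (auto simp: dist_real_def)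
 then show ?thesis by (rule lipschitz_on_continuous_on)
qed

text \<open>The graph of \<open>w\<close> is compared with the solution \<open>?Y\<close> through
  its left end. Their difference deviates from the primitive \<open>W\<close> of the defect
  \<open>w' - G x (w x)\<close> by at most \<open>\<kappa> * (V q - V p)\<close>, and
  \<open>ht_bracket\<close> turns the difference at \<open>q\<close> into one of heights at the cost
  of another \<open>2 * \<kappa> * (V q - V p)\<close>. The error is relative to the total
  variation, which \<open>V\<close> bounds, and not to the net change.\<close>

lemma level_bound:
 assumes pq: "p <= q" "{p..q} \<subseteq> {-R..R}"
  and w: "\<And>x. x \<in> {p..q} ==> (w has_real_derivative w' x) (at x within {p..q})"
  and W: "\<And>x. x \<in> {p..q} ==> (W has_real_derivative w' x - G x (w x)) (at x within {p..q})"
  and V: "\<And>x. x \<in> {p..q} ==> (V has_real_derivative v x) (at x within {p..q})"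
  and v: "\<And>x. x \<in> {p..q} ==> \<bar>w' x - G x (w x)\<bar> <= v x"
 shows "\<bar>(ht q (w q) - ht p (w p)) - (W q - W p)\<bar> <= 3 * \<kappa> * (V q - V p)" "\<bar>W q - W p\<bar> <= V q - V p"
proof -
 have pR: "p \<in> {-R..R}" "q \<in> {-R..R}" using pq by auto
 let ?Y = "\<Phi> p (w p)" let ?d = "%x. w x - ?Y x"
 have Y: "(?Y has_real_derivative G x (?Y x)) (at x within {p..q})" if "x \<in> {p..q}" for x
  using Phi_sol[OF pR(1)] that pq(2) unfolding sol_def by (meson DERIV_subset subsetD)
 have d0: "?d p = 0" using Phi_start[OF pR(1)] by simp
 have "continuous_on {p..q} (%x. \<bar>?d x\<bar>)"
  by (intro continuous_intros DERIV_continuous_on[OF w] DERIV_continuous_on[OF Y])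
 then obtain z where z: "z \<in> {p..q}" "\<And>t. t \<in> {p..q} ==> \<bar>?d t\<bar> <= \<bar>?d z\<bar>"
  using continuous_attains_sup[of "{p..q}" "%x. \<bar>?d x\<bar>"] pq(1) by auto
 have *: "\<bar>?d t - (W t - W p)\<bar> <= (2 * R * L) * \<bar>?d z\<bar>" if t: "t \<in> {p..q}" for t
 proof -
  have "\<bar>(?d t - W t) - (?d p - W p)\<bar> <= (L * \<bar>?d z\<bar>) * \<bar>t - p\<bar>"
  proof (rule deriv_within_diff_bound[where p = p and q = q])
   fix s assume s: "s \<in> {p..q}"
   show "((%x. ?d x - W x) has_real_derivative (w' s - G s (?Y s)) - (w' s - G s (w s))) (at s within {p..q})"
    by (intro derivative_intros w W Y s)
   show "\<bar>(w' s - G s (?Y s)) - (w' s - G s (w s))\<bar> <= L * \<bar>?d z\<bar>"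
    using lip[of s "w s" "?Y s"] z(2)[OF s] L_nonneg s pq(2)
    by (smt (verit, best) mult_left_mono subsetD)
  qed (use t pq in auto)
  also have "\<dots> <= (L * \<bar>?d z\<bar>) * (2 * R)"
   using t pR L_nonneg by (intro mult_left_mono mult_nonneg_nonneg) auto
  finally show ?thesis using d0 by (simp add: algebra_simps)
 qed
 have WV: "\<bar>W t - W p\<bar> <= V q - V p" if t: "t \<in> {p..q}" for t
 proof -
  have sub: "{p..t} \<subseteq> {p..q}" "{t..q} \<subseteq> {p..q}" using t by auto
  have V': "(V has_real_derivative v x) (at x within {p..t})" if "x \<in> {p..t}" for x
   by (rule has_real_derivative_within_subset[OF V sub(1)]) (use that sub(1) in blast)
  have W': "(W has_real_derivative w' x - G x (w x)) (at x within {p..t})" if "x \<in> {p..t}" for x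
   by (rule has_real_derivative_within_subset[OF W sub(1)]) (use that sub(1) in blast)
  have "V p - W p <= V t - W t"
  proof (rule deriv_within_nonneg_mono[where F = "%x. V x - W x" and F' = "%x. v x - (w' x - G x (w x))"])
   show "0 <= v x - (w' x - G x (w x))" if "p < x" "x < t" for x
    using v[of x] t that by (auto simp: abs_le_iff)
  qed (use t V' W' in \<open>auto intro!: derivative_intros\<close>)
  moreover have "V p + W p <= V t + W t"
  proof (rule deriv_within_nonneg_mono[where F = "%x. V x + W x" and F' = "%x. v x + (w' x - G x (w x))"])
   show "0 <= v x + (w' x - G x (w x))" if "p < x" "x < t" for x
    using v[of x] t that by (auto simp: abs_le_iff)
  qed (use t V' W' in \<open>auto intro!: derivative_intros\<close>)
  moreover have "V t <= V q"
  proof (rule deriv_within_nonneg_mono[where F = V and F' = v])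
   show "(V has_real_derivative v x) (at x within {t..q})" if "x \<in> {t..q}" for x
    by (rule has_real_derivative_within_subset[OF V sub(2)]) (use that sub(2) in blast)
   show "0 <= v x" if "t < x" "x < q" for x
    using v[of x] t that by auto
  qed (use t in auto)
  ultimately show ?thesis by linarith
 qed
 have V0: "0 <= V q - V p" using WV[of p] pq by auto
 from *[OF z(1)] have "\<bar>?d z - (W z - W p)\<bar> <= (1/8) * \<bar>?d z\<bar>"
  by (rule order_trans) (use small in \<open>intro mult_right_mono, auto\<close>)
 with WV[OF z(1)] V0 have "\<bar>?d z\<bar> <= 2 * (V q - V p)" by (simp add: abs_if split: if_splits)
 then have "(2 * R * L) * \<bar>?d z\<bar> <= (2 * R * L) * (2 * (V q - V p))"
  using R_pos L_nonneg by (intro mult_left_mono) auto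
 moreover have q: "q \<in> {p..q}" using pq by simp
 ultimately have dq: "\<bar>?d q - (W q - W p)\<bar> <= \<kappa> * (V q - V p)" using *[OF q] by (simp add: algebra_simps)
 have "\<bar>?d q\<bar> <= \<bar>?d z\<bar>" using z(2)[OF q] .
 then have "\<kappa> * \<bar>?d q\<bar> <= \<kappa> * (2 * (V q - V p))"
  using kappa(1) \<open>\<bar>?d z\<bar> <= 2 * (V q - V p)\<close> by (intro mult_left_mono) auto
 with ht_bracket[OF pR(2), of "w q" "?Y q"]
 have "\<bar>ht q (w q) - ht p (w p) - ?d q\<bar> <= \<kappa> * (2 * (V q - V p))"
  unfolding ht_Phi[OF pR(2,1)] by linarith
 moreover have "\<kappa> * (2 * (V q - V p)) + \<kappa> * (V q - V p) = 3 * \<kappa> * (V q - V p)" by (simp add: algebra_simps)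
 ultimately show "\<bar>(ht q (w q) - ht p (w p)) - (W q - W p)\<bar> <= 3 * \<kappa> * (V q - V p)" using dq by linarith
 show "\<bar>W q - W p\<bar> <= V q - V p" by (rule WV[OF q])
qed

lemma zeta_antiderivative:
 assumes "{p..q} \<subseteq> {-R..R}" "\<And>x. x \<in> {p..q} ==> (w has_real_derivative w' x) (at x within {p..q})"
  and "continuous_on {p..q} w'"
 obtains W where "continuous_on {p..q} (%x. w' x - G x (w x))"
  "\<And>x. x \<in> {p..q} ==> (W has_real_derivative w' x - G x (w x)) (at x within {p..q})"
proof -
 have "continuous_on {p..q} (%x. (x, w x))" by (intro continuous_intros DERIV_continuous_on[OF assms(2)])
 from continuous_on_compose2[OF cont this] assms(1) have "continuous_on {p..q} (%x. G x (w x))"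
  by (auto simp: image_subset_iff)
 with assms(3) have c: "continuous_on {p..q} (%x. w' x - G x (w x))" by (intro continuous_intros)
 with antiderivative_continuous[OF c] show ?thesis
  using that unfolding has_real_derivative_iff_has_vector_derivative by blast
qed

text \<open>Cruder form: since \<open>3 * \<kappa> \<le> 1\<close>, the error is absorbed into the
  variation itself.\<close>

lemma level_bound':
 assumes pq: "p <= q" "{p..q} \<subseteq> {-R..R}"
  and w: "\<And>x. x \<in> {p..q} ==> (w has_real_derivative w' x) (at x within {p..q})"
  and w': "continuous_on {p..q} w'"
  and V: "\<And>x. x \<in> {p..q} ==> (V has_real_derivative v x) (at x within {p..q})"
  and v: "\<And>x. x \<in> {p..q} ==> \<bar>w' x - G x (w x)\<bar> <= v x"
 shows "\<bar>ht q (w q) - ht p (w p)\<bar> <= 2 * (V q - V p)"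
proof -
 obtain W where W: "\<And>x. x \<in> {p..q} ==> (W has_real_derivative w' x - G x (w x)) (at x within {p..q})"
  by (rule zeta_antiderivative[OF pq(2) w w']) (assumption, rule that)
 have b: "\<bar>(ht q (w q) - ht p (w p)) - (W q - W p)\<bar> <= 3 * \<kappa> * (V q - V p)" "\<bar>W q - W p\<bar> <= V q - V p"
  by (rule level_bound[OF pq w W V v]; assumption)+
 have "3 * \<kappa> * (V q - V p) <= 1 * (V q - V p)"
  using kappa(2) b(2) by (intro mult_right_mono) linarith+
 from order_trans[OF b(1) this] b(2) show ?thesis by (simp add: abs_if split: if_splits)
qed

text \<open>For a defect of constant sign the variation is the net change, so \<open>s * W\<close>
  itself serves as \<open>V\<close>. Since \<open>3 * \<kappa> \<le> 3/4\<close>, a quarter of the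
  change survives, whence \<open>k / 4\<close>.\<close>

lemma level_slope:
 assumes pq: "p < q" "{p..q} \<subseteq> {-R..R}"
  and w: "\<And>x. x \<in> {p..q} ==> (w has_real_derivative w' x) (at x within {p..q})"
  and w': "continuous_on {p..q} w'" and s: "s = 1 \<or> s = - 1"
  and k: "k >= 0" "\<And>x. p < x ==> x < q ==> k <= s * (w' x - G x (w x))"
 shows "k / 4 * (q - p) <= s * (ht q (w q) - ht p (w p))"
  "(\<And>x. p < x ==> x < q ==> s * (w' x - G x (w x)) > 0) ==> 0 < s * (ht q (w q) - ht p (w p))"
proof -
 let ?z = "%x. s * (w' x - G x (w x))"
 obtain W where cz: "continuous_on {p..q} (%x. w' x - G x (w x))"
  and W: "\<And>x. x \<in> {p..q} ==> (W has_real_derivative w' x - G x (w x)) (at x within {p..q})"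
  by (rule zeta_antiderivative[OF pq(2) w w']) (assumption, rule that)
 have sW: "((%x. s * W x) has_real_derivative ?z x) (at x within {p..q})" if "x \<in> {p..q}" for x
  by (rule DERIV_cmult[OF W[OF that]])
 have nn: "?z x >= k" if "x \<in> {p..q}" for x
  by (rule continuous_ge_on_closure[of "{p<..<q}" ?z x k])
   (use cz pq k(2) that in \<open>auto intro!: continuous_intros\<close>)
 have kx: "((%x. s * W x - k * x) has_real_derivative ?z x - k * 1) (at x within {p..q})" if "x \<in> {p..q}" for x
  by (intro DERIV_diff sW[OF that] DERIV_cmult[OF DERIV_ident])
 have "s * W p - k * p <= s * W q - k * q"
  by (rule deriv_within_nonneg_mono[OF less_imp_le[OF pq(1)] kx]) (use k(2) in auto)
 then have kW: "k * (q - p) <= s * W q - s * W p" by (simp add: algebra_simps)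
 have "0 <= k * (q - p)" using k(1) pq by simp
 with kW have W0: "0 <= s * W q - s * W p" by simp
 have "\<bar>(ht q (w q) - ht p (w p)) - (W q - W p)\<bar> <= 3 * \<kappa> * (s * W q - s * W p)"
  by (rule level_bound[OF less_imp_le[OF pq(1)] pq(2) w W sW]) (use nn k(1) s in fastforce)+
 also have "\<dots> <= (3/4) * (s * W q - s * W p)"
  using kappa(2) W0 by (intro mult_right_mono) linarith+
 finally have H: "(s * W q - s * W p) / 4 <= s * (ht q (w q) - ht p (w p))"
  using s by (auto simp: abs_if split: if_splits)
 with kW show "k / 4 * (q - p) <= s * (ht q (w q) - ht p (w p))" by simp
 show "0 < s * (ht q (w q) - ht p (w p))" if "\<And>x. p < x ==> x < q ==> ?z x > 0"
  using deriv_within_pos_mono[OF pq(1) sW that] H by simp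
qed

end

section \<open>Orbits in a flow box\<close>

lemma Ck_SucD: "Ck (Suc k) A ==> Ck k A"
proof (induction k arbitrary: A)
 case 0
 then show ?case
  by (auto simp: continuous_on_eq_continuous_at intro: differentiable_imp_continuous_within)
next
 case (Suc k)
 from Suc.prems have *: "\<forall>x. A differentiable (at x)" "\<And>v. Ck (Suc k) (%x. frechet_derivative A (at x) v)"
  unfolding Ck.simps(2)[of "Suc k"] by blast+
 show ?case unfolding Ck.simps(2)[of k] using *(1) Suc.IH[OF *(2)] by blast
qed

lemma Ck_add: "Ck k A ==> Ck k B ==> Ck k (%x. A x + B x)"
proof (induction k arbitrary: A B)
 case (Suc k)
 have "frechet_derivative (%x. A x + B x) (at x) v = frechet_derivative A (at x) v + frechet_derivative B (at x) v" for x v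
  using Suc.prems by (subst frechet_derivative_at[symmetric, OF has_derivative_add])
   (auto simp: frechet_derivative_works[symmetric])
 with Suc show ?case by (auto intro!: differentiable_add)
qed (auto intro: continuous_intros)

lemma Ck_mult:
 fixes A B :: "'a::real_normed_vector => real"
 shows "Ck k A ==> Ck k B ==> Ck k (%x. A x * B x)"
proof (induction k arbitrary: A B)
 case (Suc k)
 have "frechet_derivative (%x. A x * B x) (at x) v = A x * frechet_derivative B (at x) v + frechet_derivative A (at x) v * B x" for x v
  using Suc.prems by (subst frechet_derivative_at[symmetric, OF has_derivative_mult])
   (auto simp: frechet_derivative_works[symmetric])
 moreover have "Ck k (%x. A x * frechet_derivative B (at x) v + frechet_derivative A (at x) v * B x)" for v
  using Suc Ck_SucD[of k A] Ck_SucD[of k B] by (intro Ck_add Suc.IH) auto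
 ultimately show ?case using Suc.prems by (auto intro!: differentiable_mult)
qed (auto intro: continuous_intros)

lemma Ck_const: "Ck k (%x. c)"
proof (induction k arbitrary: c)
 case (Suc k)
 have "frechet_derivative (%x. c) (at x) v = 0" for x v :: 'a
  by (subst frechet_derivative_at[symmetric, OF has_derivative_const]) simp
 with Suc show ?case by auto
qed auto

lemma Ck_fst: "Ck k (fst :: plane => real)"
proof (cases k)
 case (Suc k')
 have D: "(fst has_derivative fst) (at x)" for x :: plane
  by (rule bounded_linear_imp_has_derivative[OF bounded_linear_fst])
 have "frechet_derivative fst (at x) v = fst v" for x v :: plane
  by (subst frechet_derivative_at[symmetric, OF D]) simp
 moreover have "fst differentiable (at x)" for x :: plane by (rule differentiableI[OF D])
 ultimately show ?thesis using Suc by (simp add: Ck_const)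
qed (auto intro: continuous_intros)

lemma smooth_mult_power_fst:
 assumes "smooth \<phi>"
 shows "smooth (%p :: plane. \<phi> p * fst p ^ m)"
proof -
 have "Ck k (%p :: plane. fst p ^ m)" for k
 proof (induction m)
  case (Suc m)
  then show ?case using Ck_mult[OF Ck_fst Suc] by simp
 qed (simp add: Ck_const)
 with assms show ?thesis unfolding smooth_def by (auto intro: Ck_mult)
qed

text \<open>An orbit segment of a scalar equation, as the inverse of \<open>\<integral> dx / S x\<close>.\<close>

lemma scalar_orbit:
 fixes S :: "real => real"
 assumes qp: "q < p" and cont: "continuous_on {q..p} S" and neg: "\<And>x. x \<in> {q..p} ==> S x < 0"
 obtains T X where "T > 0" "X 0 = p" "X T = q"
  "\<And>t. t \<in> {0..T} ==> (X has_real_derivative S (X t)) (at t within {0..T})"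
  "X ` {0..T} = {q..p}" "\<And>t. t \<in> {0<..<T} ==> q < X t & X t < p"
proof -
 define cl where "cl x = max q (min p x)" for x
 have cl: "cl x \<in> {q..p}" "x \<in> {q..p} ==> cl x = x" for x
  using qp by (auto simp: cl_def)
 \<comment> \<open>The reciprocal speed, frozen outside the interval. Its primitive \<Theta> is the
   time needed to get from \<open>p\<close> to \<open>x\<close> and maps \<open>{q..p}\<close> onto
   \<open>{0..T}\<close>.\<close>
 define s where "s x = inverse (S (cl x))" for x
 have s_neg: "s x < 0" for x using neg[OF cl(1)] by (simp add: s_def)
 have ccl: "continuous_on UNIV cl" unfolding cl_def[abs_def] by (intro continuous_intros)
 have "continuous_on UNIV (%x. S (cl x))"
  by (rule continuous_on_compose2[OF cont ccl]) (use cl in auto)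
 then have "continuous_on UNIV s"
  unfolding s_def[abs_def] by (intro continuous_on_inverse) (use neg[OF cl(1)] less_irrefl in auto, metis less_irrefl)
 then obtain \<Theta> where \<Theta>: "\<And>x. (\<Theta> has_real_derivative s x) (at x)" "\<Theta> p = 0"
  using antiderivative_real_line by blast
 have dec: "\<Theta> y < \<Theta> x" if "x < y" for x y
  by (rule DERIV_neg_imp_decreasing[OF that]) (use \<Theta>(1) s_neg in blast)
 have dec_iff: "\<Theta> y < \<Theta> x \<longleftrightarrow> x < y" for x y
  using dec[of x y] dec[of y x] by (cases x y rule: linorder_cases) auto
 have inj: "inj \<Theta>" by (rule injI) (metis dec_iff linorder_neqE less_irrefl)
 define X where "X = inv \<Theta>"
 have X\<Theta>: "X (\<Theta> x) = x" for x using inj by (simp add: X_def)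
 have c\<Theta>: "isCont \<Theta> x" for x using \<Theta>(1) by (rule DERIV_isCont)
 have \<Theta>X: "\<Theta> (X t) = t" if "\<Theta> b <= t" "t <= \<Theta> a" "a <= b" for t a b
 proof -
  have "\<exists>x\<ge>a. x <= b & \<Theta> x = t" by (rule IVT2) (use that c\<Theta> in auto)
  then show ?thesis using X\<Theta> by auto
 qed
 define T where "T = \<Theta> q"
 have DX: "(X has_real_derivative S (X t)) (at t)" if t: "t \<in> {0..T}" for t
 proof -
  have x: "\<Theta> (X t) = t" using \<Theta>X[of p t q] t \<Theta>(2) qp by (auto simp: T_def)
  have xqp: "X t \<in> {q..p}"
  proof -
   have "\<not> p < X t" using dec_iff[of "X t" p] dec_iff[of p "X t"] x \<Theta>(2) t by auto
   moreover have "\<not> X t < q" using dec_iff[of q "X t"] x t by (metis T_def atLeastAtMost_iff leD)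
   ultimately show ?thesis by auto
  qed
  have "DERIV X t :> inverse (s (X t))"
  proof (rule DERIV_inverse_function[where a = "\<Theta> (p + 1)" and b = "\<Theta> (q - 1)"])
   show "(\<Theta> has_real_derivative s (X t)) (at (X t))" by (rule \<Theta>)
   show "s (X t) ~= 0" using s_neg[of "X t"] by simp
   show "\<Theta> (p + 1) < t" "t < \<Theta> (q - 1)" using x xqp dec[of "X t" "p + 1"] dec[of "q - 1" "X t"] by auto
   show "\<Theta> (X y) = y" if "\<Theta> (p + 1) < y" "y < \<Theta> (q - 1)" for y
    using \<Theta>X[of "p + 1" y "q - 1"] that qp by auto
   have "isCont X (\<Theta> (X t))"
    by (rule isCont_inverse_function2[of "X t - 1" "X t" "X t + 1"]) (use X\<Theta> c\<Theta> in auto)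
   then show "isCont X t" by (simp add: x)
  qed
  then show ?thesis using xqp cl(2) by (simp add: s_def)
 qed
 have range: "q < X t & X t < p" if "t \<in> {0<..<T}" for t
 proof -
  have x: "\<Theta> (X t) = t" using \<Theta>X[of p t q] that \<Theta>(2) qp by (auto simp: T_def)
  show ?thesis using that dec_iff[of p "X t"] dec_iff[of "X t" p] dec_iff[of q "X t"] dec_iff[of "X t" q] x \<Theta>(2)
   by (auto simp: T_def)
 qed
 have T0: "T > 0" using dec[OF qp] \<Theta>(2) by (simp add: T_def)
 have X0: "X 0 = p" "X T = q" using X\<Theta>[of p] X\<Theta>[of q] \<Theta>(2) by (auto simp: T_def)
 have "X ` {0..T} = {q..p}"
 proof (intro subset_antisym subsetI)
  fix x assume "x \<in> X ` {0..T}"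
  then obtain t where "t \<in> {0..T}" "x = X t" by blast
  then show "x \<in> {q..p}" using range[of t] X0 qp by (cases "t = 0 \<or> t = T") auto
 next
  fix x assume x: "x \<in> {q..p}"
  then have "\<Theta> x \<in> {0..T}" using dec_iff[of x p] dec_iff[of p x] dec_iff[of q x] dec_iff[of x q] \<Theta>(2)
   by (auto simp: T_def not_less[symmetric])
  then show "x \<in> X ` {0..T}" using X\<Theta>[of x] by force
 qed
 with that[OF T0 X0 _ _ range] DX show ?thesis
  by (metis has_field_derivative_at_within)
qed

definition clamp_to :: "real => real => real" where
 "clamp_to \<rho> y = max (-\<rho>) (min \<rho> y)"

text \<open>The slope \<open>dy/dx\<close> of the orbits of \<open>(f, g)\<close>, frozen for
  \<open>\<bar>y\<bar> > \<rho>\<close> so that the hypotheses of \<open>graph_ode\<close> can hold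
  for all \<open>y\<close>.\<close>

definition slope :: "(plane => real) => (plane => real) => real => real => real => real" where
 "slope f g \<rho> x y = g (x, clamp_to \<rho> y) / f (x, clamp_to \<rho> y)"

lemma clamp_to: "\<rho> >= 0 ==> clamp_to \<rho> y \<in> {-\<rho>..\<rho>}" "\<bar>y\<bar> <= \<rho> ==> clamp_to \<rho> y = y"
 by (auto simp: clamp_to_def)

lemma clamp_to_lipschitz: "\<bar>clamp_to \<rho> y - clamp_to \<rho> y'\<bar> <= \<bar>y - y'\<bar>"
 by (auto simp: clamp_to_def)

text \<open>Since \<open>f < 0\<close> in the box, orbits run to the left and are graphs over the
  first coordinate, so that \<open>ht\<close> is a first integral of the planar field.\<close>

locale flow_box = graph_ode "slope f g \<rho>" R L K for f g \<rho> R L K +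
 assumes smooth_f: "smooth f" and smooth_g: "smooth g" and R_le: "R <= \<rho>"
  and f_neg: "\<And>x y. \<bar>x\<bar> <= \<rho> ==> \<bar>y\<bar> <= \<rho> ==> f (x, y) < 0"

text \<open>\<open>L\<close> and \<open>K\<close> depend only on \<rho>; the radius \<open>R\<close>
  stays free, so that it can later be made small against the number of steps of the level
  function.\<close>

lemma flow_box_exists:
 assumes "smooth f" "smooth g" "f (0, 0) < 0"
 obtains \<rho>0 where "\<rho>0 > 0"
  "\<And>\<rho>. 0 < \<rho> ==> \<rho> <= \<rho>0 ==>
   \<exists>L K. L > 0 & K > 0 & (\<forall>R. 0 < R --> R <= \<rho> --> 16 * R * L <= 1 --> flow_box f g \<rho> R L K)"
proof -
 have "isCont f (0, 0)" using smooth_isCont[OF assms(1)] .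
 then have "\<forall>\<^sub>F p in at (0, 0). f p < 0"
  unfolding isCont_def using assms(3) by (rule order_tendstoD)
 then obtain d where d: "d > 0" "\<And>p. p ~= (0, 0) ==> dist p (0, 0) < d ==> f p < 0"
  unfolding eventually_at by auto
 show ?thesis
 proof (rule that[of "d / 4"])
  show "d / 4 > 0" using d by simp
  fix \<rho> assume \<rho>: "0 < \<rho>" "\<rho> <= d / 4"
  have neg: "f (x, y) < 0" if "\<bar>x\<bar> <= \<rho>" "\<bar>y\<bar> <= \<rho>" for x y
  proof (cases "(x, y) = (0, 0)")
   case False
   have "dist (x, y) (0, 0) <= \<bar>x\<bar> + \<bar>y\<bar>"
    using norm_Pair_le[of x y] by (simp add: dist_norm zero_prod_def[symmetric])
   with that \<rho> d(1) have "dist (x, y) (0, 0) < d" by linarith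
   with d(2) False show ?thesis by blast
  qed (use assms in simp)
  let ?B = "{-\<rho>..\<rho>} \<times> {-\<rho>..\<rho>}"
  have B: "compact ?B" "convex ?B" "?B ~= {}" using \<rho> by (auto intro: compact_Times convex_Times)
  obtain Lf where Lf: "Lf > 0" "\<And>p q. p \<in> ?B ==> q \<in> ?B ==> \<bar>f p - f q\<bar> <= Lf * norm (p - q)"
   using smooth_lipschitz[OF assms(1) B(1,2)] by blast
  obtain Lg where Lg: "Lg > 0" "\<And>p q. p \<in> ?B ==> q \<in> ?B ==> \<bar>g p - g q\<bar> <= Lg * norm (p - q)"
   using smooth_lipschitz[OF assms(2) B(1,2)] by blast
  obtain z where z: "z \<in> ?B" "\<And>p. p \<in> ?B ==> f p <= f z"
   using continuous_attains_sup[OF B(1,3) smooth_continuous_on[OF assms(1)]] by blast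
  define f0 where "f0 = - f z"
  have f0: "f0 > 0" "\<And>p. p \<in> ?B ==> \<bar>f p\<bar> >= f0"
   using neg z by (force simp: f0_def)+
  obtain zg where zg: "\<And>p. p \<in> ?B ==> \<bar>g p\<bar> <= \<bar>g zg\<bar>"
   using continuous_attains_sup[OF B(1,3), of "%p. \<bar>g p\<bar>"] smooth_continuous_on[OF assms(2)]
   by (metis continuous_on_rabs)
  define M where "M = \<bar>g zg\<bar> + 1"
  obtain zf where zf: "\<And>p. p \<in> ?B ==> \<bar>f p\<bar> <= \<bar>f zf\<bar>"
   using continuous_attains_sup[OF B(1,3), of "%p. \<bar>f p\<bar>"] smooth_continuous_on[OF assms(1)]
   by (metis continuous_on_rabs)
  define N where "N = \<bar>f zf\<bar> + 1"
  have M: "M > 0" "\<And>p. p \<in> ?B ==> \<bar>g p\<bar> <= M" using zg by (force simp: M_def)+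
  have N: "N > 0" "\<And>p. p \<in> ?B ==> \<bar>f p\<bar> <= N" using zf by (force simp: N_def)+
  define L where "L = (Lg * N + M * Lf) / f0\<^sup>2"
  have L: "L > 0" using Lg Lf M N f0 by (simp add: L_def add_pos_pos)
  have mem: "(x, clamp_to \<rho> y) \<in> ?B" if "x \<in> {-\<rho>..\<rho>}" for x y
   using that clamp_to(1)[of \<rho> y] \<rho> by auto
  have quot: "\<bar>g p / f p - g q / f q\<bar> <= L * norm (p - q)" if pq: "p \<in> ?B" "q \<in> ?B" for p q
  proof -
   have nz: "f p ~= 0" "f q ~= 0" using f0 pq by fastforce+
   have "g p / f p - g q / f q = ((g p - g q) * f q - g q * (f p - f q)) / (f p * f q)"
    using nz by (simp add: field_simps)
   then have "\<bar>g p / f p - g q / f q\<bar> = \<bar>(g p - g q) * f q - g q * (f p - f q)\<bar> / (\<bar>f p\<bar> * \<bar>f q\<bar>)"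
    by (simp add: abs_mult)
   also have "\<dots> <= (Lg * norm (p - q) * N + M * (Lf * norm (p - q))) / (\<bar>f p\<bar> * \<bar>f q\<bar>)"
   proof (rule divide_right_mono)
    have "\<bar>(g p - g q) * f q\<bar> <= Lg * norm (p - q) * N" "\<bar>g q * (f p - f q)\<bar> <= M * (Lf * norm (p - q))"
     unfolding abs_mult using Lg Lf M N pq by (auto intro!: mult_mono)
    then show "\<bar>(g p - g q) * f q - g q * (f p - f q)\<bar> <= Lg * norm (p - q) * N + M * (Lf * norm (p - q))"
     by linarith
   qed simp
   also have "\<dots> <= (Lg * norm (p - q) * N + M * (Lf * norm (p - q))) / (f0 * f0)"
    using f0(1) f0(2)[OF pq(1)] f0(2)[OF pq(2)] Lg Lf M N
    by (intro divide_left_mono mult_mono add_nonneg_nonneg mult_nonneg_nonneg) auto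
   also have "\<dots> = L * norm (p - q)" by (simp add: L_def power2_eq_square algebra_simps add_divide_distrib)
   finally show ?thesis .
  qed
  show "\<exists>L K. L > 0 & K > 0 & (\<forall>R. 0 < R --> R <= \<rho> --> 16 * R * L <= 1 --> flow_box f g \<rho> R L K)"
  proof (rule exI[of _ L], rule exI[of _ "M / f0"], intro conjI allI impI)
   fix R assume R: "0 < R" "R <= \<rho>" "16 * R * L <= 1"
   show "flow_box f g \<rho> R L (M / f0)"
   proof
    have c: "continuous_on ({-R..R} \<times> UNIV) (%p. (fst p, clamp_to \<rho> (snd p)))"
     unfolding clamp_to_def by (intro continuous_intros)
    have "continuous_on ({-R..R} \<times> UNIV) (%p. h (fst p, clamp_to \<rho> (snd p)))" if "smooth h" for h :: "plane => real"
     by (rule continuous_on_compose2[OF smooth_continuous_on[OF that, of UNIV] c]) auto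
    moreover have "f (fst p, clamp_to \<rho> (snd p)) ~= 0" if "p \<in> {-R..R} \<times> UNIV" for p
    proof -
     have "fst p \<in> {-\<rho>..\<rho>}" using that R by auto
     from f0(2)[OF mem[OF this], of "snd p"] f0(1) show ?thesis by auto
    qed
    ultimately show "continuous_on ({-R..R} \<times> UNIV) (%p. slope f g \<rho> (fst p) (snd p))"
     unfolding slope_def using assms by (intro continuous_on_divide) blast+
    fix x y y' assume x: "x \<in> {-R..R}"
    then have x': "x \<in> {-\<rho>..\<rho>}" using R by auto
    have "\<bar>slope f g \<rho> x y - slope f g \<rho> x y'\<bar> <= L * norm ((x, clamp_to \<rho> y) - (x, clamp_to \<rho> y'))"
     unfolding slope_def by (rule quot[OF mem[OF x'] mem[OF x']])
    also have "norm ((x, clamp_to \<rho> y) - (x, clamp_to \<rho> y')) <= \<bar>y - y'\<bar>"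
     using clamp_to_lipschitz by (simp add: norm_Pair)
    finally show "\<bar>slope f g \<rho> x y - slope f g \<rho> x y'\<bar> <= L * \<bar>y - y'\<bar>"
     using L by (simp add: mult_left_mono)
    show "\<bar>slope f g \<rho> x y\<bar> <= M / f0"
     unfolding slope_def abs_divide using M f0 mem[OF x'] by (intro frac_le) auto
   qed (use R L assms neg in auto)
  qed (use L M f0 in auto)
 qed
qed

context flow_box
begin

abbreviation "box_R \<equiv> {-R..R} \<times> {-\<rho>..\<rho>}"

lemma slope_eq: "\<bar>y\<bar> <= \<rho> ==> slope f g \<rho> x y = g (x, y) / f (x, y)"
 by (simp add: slope_def clamp_to)

lemma f_neg_box: "p \<in> box_R ==> f p < 0"
 using f_neg[of "fst p" "snd p"] R_le by auto

lemma solves_components: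
 assumes "solves (upper_field f g) orb I" "t \<in> I"
 shows "((%t. fst (orb t)) has_real_derivative f (orb t)) (at t within I)"
  "((%t. snd (orb t)) has_real_derivative g (orb t)) (at t within I)"
 using assms bounded_linear.has_vector_derivative[OF bounded_linear_fst, of orb "upper_field f g (orb t)" "at t within I"]
  bounded_linear.has_vector_derivative[OF bounded_linear_snd, of orb "upper_field f g (orb t)" "at t within I"]
 by (auto simp: solves_def has_real_derivative_iff_has_vector_derivative upper_field_def split: prod.splits)

lemma fst_decreasing:
 assumes "solves (upper_field f g) orb {a..b}" "orb ` {a..b} \<subseteq> box_R" "a <= s" "s < t" "t <= b"
 shows "fst (orb t) < fst (orb s)"
proof -
 have "- fst (orb s) < - fst (orb t)"
 proof (rule deriv_within_pos_mono[OF assms(4), where F = "%t. - fst (orb t)" and F' = "%t. - f (orb t)"])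
  show "((%t. - fst (orb t)) has_real_derivative - f (orb x)) (at x within {s..t})" if "x \<in> {s..t}" for x
   using solves_components(1)[OF solves_subset[OF assms(1)], of "{s..t}" x] that assms(3,5)
   by (auto intro: derivative_intros)
  show "- f (orb x) > 0" if "s < x" "x < t" for x
  proof -
   have "orb x \<in> box_R" using assms that by (auto simp: image_subset_iff)
   from f_neg_box[OF this] show ?thesis by simp
  qed
 qed
 then show ?thesis by simp
qed

text \<open>The vertical distance \<open>D\<close> from the solution graph through the point at time
  \<open>s\<close> satisfies \<open>\<bar>D'\<bar> \<le> B * L * \<bar>D\<bar>\<close>, so it stays
  \<open>0\<close> by Gronwall.\<close>

lemma ht_constant_on_orbit:
 assumes sol: "solves (upper_field f g) orb {a..b}" and box: "orb ` {a..b} \<subseteq> box_R"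
  and st: "s \<in> {a..b}" "t \<in> {a..b}"
 shows "ht (fst (orb t)) (snd (orb t)) = ht (fst (orb s)) (snd (orb s))"
proof -
 have b: "fst (orb t) \<in> {-R..R}" "\<bar>snd (orb t)\<bar> <= \<rho>" if "t \<in> {a..b}" for t
  using box that by (auto simp: image_subset_iff mem_Times_iff abs_le_iff minus_le_iff)
 define u where "u = \<Phi> (fst (orb s)) (snd (orb s))"
 have u: "sol u" "u (fst (orb s)) = snd (orb s)"
  using Phi_sol[OF b(1)[OF st(1)]] Phi_start[OF b(1)[OF st(1)]] by (auto simp: u_def)
 define D where "D t = snd (orb t) - u (fst (orb t))" for t
 define D' where "D' t = g (orb t) - slope f g \<rho> (fst (orb t)) (u (fst (orb t))) * f (orb t)" for t
 have DD: "(D has_real_derivative D' t) (at t within {a..b})" if t: "t \<in> {a..b}" for t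
 proof -
  have "(u has_real_derivative slope f g \<rho> (fst (orb t)) (u (fst (orb t)))) (at (fst (orb t)) within (%t. fst (orb t)) ` {a..b})"
   by (rule DERIV_subset[of _ _ _ "{-R..R}"]) (use u(1) b(1) t in \<open>auto simp: sol_def\<close>)
  from DERIV_image_chain[OF this solves_components(1)[OF sol t]]
  show ?thesis unfolding D_def[abs_def] D'_def o_def
   by (intro derivative_intros solves_components(2)[OF sol t])
 qed
 obtain B where B: "\<And>t. t \<in> {a..b} ==> \<bar>f (orb t)\<bar> <= B"
 proof -
  have "continuous_on {a..b} (%t. f (orb t))"
   by (rule continuous_on_compose2[OF smooth_continuous_on[OF smooth_f, of UNIV] solves_continuous_on[OF sol]]) auto
  then have "bounded ((%t. f (orb t)) ` {a..b})"
   by (intro compact_imp_bounded compact_continuous_image) auto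
  then obtain B where "\<forall>x\<in>(%t. f (orb t)) ` {a..b}. norm x <= B" unfolding bounded_iff by blast
  then show ?thesis using that[of B] by simp
 qed
 have "\<bar>D' t\<bar> <= (B * L) * \<bar>D t\<bar>" if t: "t \<in> {a..b}" for t
 proof -
  have nz: "f (orb t) ~= 0" using f_neg_box[of "orb t"] box t by (auto simp: image_subset_iff)
  have "g (orb t) = slope f g \<rho> (fst (orb t)) (snd (orb t)) * f (orb t)"
   using slope_eq[OF b(2)[OF t], of "fst (orb t)"] nz by simp
  then have "D' t = f (orb t) * (slope f g \<rho> (fst (orb t)) (snd (orb t)) - slope f g \<rho> (fst (orb t)) (u (fst (orb t))))"
   by (simp add: D'_def algebra_simps)
  then have "\<bar>D' t\<bar> <= B * (L * \<bar>D t\<bar>)"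
   using lip[OF b(1)[OF t], of "snd (orb t)" "u (fst (orb t))"] B[OF t]
   by (auto simp: abs_mult D_def intro!: mult_mono)
  then show ?thesis by (simp add: mult.assoc)
 qed
 then have "norm (D t) <= exp (B * L * \<bar>t - s\<bar>) * norm (D s)"
  using DD st by (intro gronwall_norm[where a = a and b = b and u' = D'])
   (auto simp: has_real_derivative_iff_has_vector_derivative)
 then have "D t = 0" using u(2) by (simp add: D_def)
 then have "snd (orb t) = u (fst (orb t))" by (simp add: D_def)
 then show ?thesis using ht_Phi[OF b(1)[OF st(2)] b(1)[OF st(1)], of "snd (orb s)"] by (simp add: u_def)
qed

text \<open>The converse passage: time is recovered from \<open>x' = f (x, u x)\<close> along the
  graph, so a solution graph that stays in the box is traced by an orbit.\<close>

lemma graph_orbit: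
 assumes u: "sol u" and qp: "q < p" "q \<in> {-R..R}" "p \<in> {-R..R}" and ub: "\<And>x. x \<in> {q..p} ==> \<bar>u x\<bar> <= \<rho>"
 obtains T orb where "T > 0" "solves (upper_field f g) orb {0..T}" "orb 0 = (p, u p)" "orb T = (q, u q)"
  "orb ` {0..T} = (%x. (x, u x)) ` {q..p}"
  "\<And>t. t \<in> {0<..<T} ==> q < fst (orb t) & fst (orb t) < p & snd (orb t) = u (fst (orb t))"
proof -
 have du: "(u has_real_derivative slope f g \<rho> x (u x)) (at x within {q..p})" if "x \<in> {q..p}" for x
  by (rule DERIV_subset[of _ _ _ "{-R..R}"]) (use u that qp in \<open>auto simp: sol_def\<close>)
 have cu: "continuous_on {q..p} u" by (rule DERIV_continuous_on[OF du])
 have c: "continuous_on {q..p} (%x. f (x, u x))"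
  by (rule continuous_on_compose2[OF smooth_continuous_on[OF smooth_f, of UNIV]])
   (auto intro!: continuous_intros cu)
 have neg: "f (x, u x) < 0" if "x \<in> {q..p}" for x
  using f_neg_box[of "(x, u x)"] ub[OF that] that qp by (auto simp: abs_le_iff)
 obtain T X where X: "T > 0" "X 0 = p" "X T = q"
  "\<And>t. t \<in> {0..T} ==> (X has_real_derivative f (X t, u (X t))) (at t within {0..T})"
  "X ` {0..T} = {q..p}" "\<And>t. t \<in> {0<..<T} ==> q < X t & X t < p"
  by (rule scalar_orbit[OF qp(1) c neg], assumption) (rule that)
 define orb where "orb t = (X t, u (X t))" for t
 show ?thesis
 proof (rule that[of T orb])
  show "solves (upper_field f g) orb {0..T}" unfolding solves_def
  proof
   fix t assume t: "t \<in> {0..T}"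
   then have Xt: "X t \<in> {q..p}" using X(5) by blast
   have "(u has_real_derivative slope f g \<rho> (X t) (u (X t))) (at (X t) within X ` {0..T})"
    using du[OF Xt] X(5) by simp
   from DERIV_image_chain[OF this X(4)[OF t]]
   have "((%t. u (X t)) has_real_derivative slope f g \<rho> (X t) (u (X t)) * f (X t, u (X t))) (at t within {0..T})"
    by (simp add: o_def)
   also have "slope f g \<rho> (X t) (u (X t)) * f (X t, u (X t)) = g (X t, u (X t))"
    using slope_eq[OF ub[OF Xt]] neg[OF Xt] by simp
   finally show "(orb has_vector_derivative upper_field f g (orb t)) (at t within {0..T})"
    using X(4)[OF t] unfolding orb_def[abs_def] upper_field_def has_real_derivative_iff_has_vector_derivative
    by (auto intro: has_vector_derivative_Pair)
  qed
  show "orb ` {0..T} = (%x. (x, u x)) ` {q..p}" unfolding orb_def X(5)[symmetric] by auto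
 qed (use X in \<open>auto simp: orb_def\<close>)
qed

end

section \<open>The grazing orbit of the upper field\<close>

definition cplx :: "plane => complex" where
 "cplx p = Complex (fst p) (snd p)"

lemma bounded_linear_cplx: "bounded_linear cplx"
proof -
 have "bounded_linear (%p. of_real (fst p) + \<i> * of_real (snd p) :: complex)"
  by (intro bounded_linear_add bounded_linear_const_mult bounded_linear_compose[OF bounded_linear_of_real]
    bounded_linear_fst bounded_linear_snd)
 moreover have "cplx = (%p. of_real (fst p) + \<i> * of_real (snd p))"
  by (auto simp: cplx_def complex_eq_iff)
 ultimately show ?thesis by simp
qed

lemma cplx_continuous_on: "continuous_on S cplx"
 using bounded_linear_cplx by (rule linear_continuous_on)

lemma cplx_simps [simp]: "Re (cplx p) = fst p" "Im (cplx p) = snd p" "cplx p = cplx q \<longleftrightarrow> p = q"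
 "cplx (0, 0) = 0"
 by (auto simp: cplx_def prod_eq_iff complex_eq_iff)

lemma cplx_surj: "\<exists>p. z = cplx p"
 by (rule exI[of _ "(Re z, Im z)"]) (simp add: cplx_def)

lemma orbit_path_eq: "orbit_path orb T s = cplx (orb (T * s))"
 by (simp add: orbit_path_def cplx_def)

lemma periodic_int:
 fixes orb :: "real => plane"
 assumes "\<And>t. orb (t + T) = orb t"
 shows "orb (t + of_int k * T) = orb t"
proof -
 interpret periodic_fun_simple orb T by standard (rule assms)
 show ?thesis by (rule plus_of_int)
qed

text \<open>Both times are reduced by \<open>r\<close> into \<open>{0..<T}\<close>, where the orbit
  is injective.\<close>

lemma periodic_solution_eq_iff:
 assumes "periodic_solution Z orb T"
 shows "orb s = orb t \<longleftrightarrow> (\<exists>k::int. t = s + of_int k * T)"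
proof
 have T: "T > 0" and per: "\<And>t. orb (t + T) = orb t" and inj: "inj_on orb {0..<T}"
  using assms by (auto simp: periodic_solution_def)
 assume eq: "orb s = orb t"
 define r where "r x = x + of_int (- \<lfloor>x / T\<rfloor>) * T" for x
 have r: "r x \<in> {0..<T}" for x
 proof -
  have "of_int \<lfloor>x / T\<rfloor> <= x / T" "x / T < of_int \<lfloor>x / T\<rfloor> + 1" by linarith+
  then have "of_int \<lfloor>x / T\<rfloor> * T <= x" "x < (of_int \<lfloor>x / T\<rfloor> + 1) * T"
   unfolding pos_le_divide_eq[OF T] pos_divide_less_eq[OF T] by auto
  then show ?thesis by (simp add: r_def algebra_simps)
 qed
 have "orb (r x) = orb x" for x unfolding r_def by (rule periodic_int[where orb = orb and T = T, OF per])
 with eq have "r s = r t" using inj r by (metis inj_onD)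
 then have "t = s + of_int (\<lfloor>t / T\<rfloor> - \<lfloor>s / T\<rfloor>) * T" by (simp add: r_def algebra_simps)
 then show "\<exists>k::int. t = s + of_int k * T" by blast
next
 have per: "\<And>t. orb (t + T) = orb t" using assms by (auto simp: periodic_solution_def)
 assume "\<exists>k::int. t = s + of_int k * T"
 then show "orb s = orb t" using periodic_int[where orb = orb and T = T, OF per] by metis
qed

lemma periodic_solution_shift:
 assumes "periodic_solution Z orb T"
 shows "periodic_solution Z (%t. orb (t + d)) T"
proof -
 have T: "T > 0" and per: "\<And>t. orb (t + T) = orb t" and sol: "solves Z orb UNIV"
  using assms by (auto simp: periodic_solution_def)
 have "solves Z (%t. orb (t + d)) UNIV" by (rule solves_shift[OF sol]) auto
 moreover have "orb (t + T + d) = orb (t + d)" for t using per[of "t + d"] by (simp add: algebra_simps)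
 moreover have "inj_on (%t. orb (t + d)) {0..<T}"
 proof (rule inj_onI)
  fix s t assume st: "s \<in> {0..<T}" "t \<in> {0..<T}" "orb (s + d) = orb (t + d)"
  then obtain k :: int where k: "t = s + of_int k * T"
   using periodic_solution_eq_iff[OF assms] by fastforce
  have "\<bar>of_int k * T\<bar> < 1 * T" using k st by auto
  then have "\<bar>real_of_int k\<bar> < 1" using T by (simp add: abs_mult)
  then have "k = 0" by linarith
  with k show "s = t" by simp
 qed
 ultimately show ?thesis using T by (simp add: periodic_solution_def)
qed

lemma range_shift: "range (%t. orb (t + d :: real)) = range orb"
 by (auto simp: image_iff) (metis diff_add_cancel)

lemma periodic_path:
 assumes "periodic_solution Z orb T"
 shows "simple_path (orbit_path orb T)" "pathfinish (orbit_path orb T) = pathstart (orbit_path orb T)"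
  "path_image (orbit_path orb T) = cplx ` range orb"
proof -
 have T: "T > 0" and per: "\<And>t. orb (t + T) = orb t" and sol: "solves Z orb UNIV"
  using assms by (auto simp: periodic_solution_def)
 have "continuous_on {0..1} (%s. orb (T * s))"
  by (rule continuous_on_compose2[OF solves_continuous_on[OF sol]]) (auto intro!: continuous_intros)
 then have cont: "path (orbit_path orb T)" unfolding path_def orbit_path_eq[abs_def]
  by (rule continuous_on_compose2[OF cplx_continuous_on[of UNIV]]) auto
 show "simple_path (orbit_path orb T)" unfolding simple_path_def loop_free_def
 proof (intro conjI cont ballI impI)
  fix x y :: real assume xy: "x \<in> {0..1}" "y \<in> {0..1}" and "orbit_path orb T x = orbit_path orb T y"
  then have "orb (T * x) = orb (T * y)" by (simp add: orbit_path_eq)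
  then obtain k :: int where "T * y = T * x + of_int k * T"
   using periodic_solution_eq_iff[OF assms] by blast
  then have "T * (y - x - of_int k) = 0" by (simp add: algebra_simps)
  then have k: "y = x + of_int k" using T by simp
  then have "of_int k <= (1::real)" "of_int k >= (-1::real)" using xy by auto
  then have "k = 0 \<or> k = 1 \<or> k = -1" by linarith
  with k xy show "x = y \<or> x = 0 & y = 1 \<or> x = 1 & y = 0" by auto
 qed
 show "pathfinish (orbit_path orb T) = pathstart (orbit_path orb T)"
  using per[of 0] by (simp add: pathfinish_def pathstart_def orbit_path_eq)
 show "path_image (orbit_path orb T) = cplx ` range orb"
 proof (intro subset_antisym subsetI)
  fix z assume "z \<in> cplx ` range orb"
  then obtain t where t: "z = cplx (orb t)" by blast
  let ?s = "t / T - of_int \<lfloor>t / T\<rfloor>"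
  have "T * ?s = t + of_int (- \<lfloor>t / T\<rfloor>) * T" using T by (simp add: field_simps)
  then have "orb (T * ?s) = orb t" using periodic_int[where orb = orb and T = T and t = t and k = "- \<lfloor>t / T\<rfloor>", OF per] by simp
  moreover have "?s \<in> {0..1}" by (auto simp: less_imp_le) linarith
  ultimately show "z \<in> path_image (orbit_path orb T)"
   unfolding path_image_def t orbit_path_eq[abs_def] by (metis (no_types, lifting) image_eqI)
 qed (auto simp: path_image_def orbit_path_eq)
qed

text \<open>Moving the starting time by \<open>d\<close> is \<open>shiftpath\<close> by the
  fractional part of \<open>d / T\<close>. This allows the origin to be placed at time
  \<open>0\<close>.\<close>

lemma winding_number_orbit_shift:
 assumes "periodic_solution Z orb T" "z \<notin> cplx ` range orb"
 shows "winding_number (orbit_path (%t. orb (t + d)) T) z = winding_number (orbit_path orb T) z"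
proof -
 have T: "T > 0" and per: "\<And>t. orb (t + T) = orb t"
  using assms by (auto simp: periodic_solution_def)
 define k where "k = \<lfloor>d / T\<rfloor>"
 define a where "a = d / T - of_int k"
 have a: "a \<in> {0..1}" by (auto simp: a_def k_def less_imp_le) linarith
 have d: "d = T * a + of_int k * T" using T by (simp add: a_def field_simps)
 have "orbit_path (%t. orb (t + d)) T = shiftpath a (orbit_path orb T)"
 proof
  fix s
  have "orb (T * s + d) = orb (T * (a + s))"
   using periodic_int[where orb = orb and T = T and t = "T * (a + s)" and k = k, OF per] d by (simp add: algebra_simps)
  moreover have "orb (T * (a + s)) = orb (T * (a + s - 1))"
   using per[of "T * (a + s - 1)"] by (simp add: algebra_simps)
  ultimately show "orbit_path (%t. orb (t + d)) T s = shiftpath a (orbit_path orb T) s"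
   by (auto simp: orbit_path_eq shiftpath_def)
 qed
 then show ?thesis
  using winding_number_shiftpath[of "orbit_path orb T" z a] periodic_path[OF assms(1)] assms(2) a
  by (simp add: simple_path_imp_path)
qed

text \<open>The clock is set so that the orbit is at the origin at time \<open>0\<close>.
  \<open>gx_O\<close> expresses contact order \<open>1\<close> of the upper field there,
  \<open>wn\<close> the clockwise orientation.\<close>

locale grazing_orbit =
 fixes U L :: "plane set" and f g :: "plane => real" and orb :: "real => plane" and T :: real
 assumes smooth_f: "smooth f" and smooth_g: "smooth g" and open_U: "open U" and bounded_U: "bounded U"
  and L_U: "L \<subseteq> U" and L_upper: "\<And>p. p \<in> L ==> p = (0, 0) \<or> snd p > 0"
  and g_O: "g (0, 0) = 0" and f_O: "f (0, 0) ~= 0" and gx_O: "dx g (0, 0) ~= 0"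
  and per: "periodic_solution (upper_field f g) orb T" and range_orb: "range orb = L" and orb_0: "orb 0 = (0, 0)"
  and wn: "\<And>z. z \<in> inside (cplx ` L) ==> winding_number (orbit_path orb T) z = -1"
  and stable: "stable_limit_cycle (upper_field f g) L"
begin

lemma T_pos: "T > 0" and orb_T: "orb (t + T) = orb t" and orb_sol: "solves (upper_field f g) orb I"
 using per solves_subset[of _ orb UNIV I] by (auto simp: periodic_solution_def)

lemma orb_D: "(orb has_vector_derivative upper_field f g (orb t)) (at t)"
 using orb_sol[of UNIV] by (simp add: solves_def)

lemma orb_chain:
 "smooth A ==> ((%t. A (orb t)) has_real_derivative f (orb t) * dx A (orb t) + g (orb t) * dy A (orb t)) (at t)"
 using smooth_chain_solves[OF _ orb_D, of A t] by (simp add: upper_field_def split: prod.splits)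

lemma fst_orb_D: "((%t. fst (orb t)) has_real_derivative f (orb t)) (at t)"
 and snd_orb_D: "((%t. snd (orb t)) has_real_derivative g (orb t)) (at t)"
 using bounded_linear.has_vector_derivative[OF bounded_linear_fst orb_D]
  bounded_linear.has_vector_derivative[OF bounded_linear_snd orb_D]
 by (auto simp: has_real_derivative_iff_has_vector_derivative upper_field_def split: prod.splits)

lemma orb_continuous: "continuous_on S orb"
 using solves_continuous_on[OF orb_sol] .

lemma continuous_along: "smooth A ==> continuous_on S (%t. A (orb t))"
 by (rule continuous_on_compose2[OF smooth_continuous_on[of A UNIV] orb_continuous]) auto

lemma snd_orb_nonneg: "snd (orb t) >= 0"
 using L_upper[of "orb t"] range_orb by fastforce

lemma snd_orb_eq_0_iff: "snd (orb t) = 0 \<longleftrightarrow> orb t = (0, 0)"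
 using L_upper[of "orb t"] range_orb by fastforce

lemma compact_L: "compact L"
proof -
 have "cplx ` L = path_image (orbit_path orb T)" using periodic_path(3)[OF per] range_orb by simp
 then have "compact (cplx ` L)"
  using periodic_path(1)[OF per] by (simp add: compact_path_image simple_path_imp_path)
 moreover have "L = (%z. (Re z, Im z)) ` (cplx ` L)" by (auto simp: image_image)
 moreover have "continuous_on (cplx ` L) (%z. (Re z, Im z))" by (intro continuous_intros)
 ultimately show ?thesis using compact_continuous_image by metis
qed

definition gdot :: "real => real" where
 "gdot t = f (orb t) * dx g (orb t) + g (orb t) * dy g (orb t)"

definition fdot :: "real => real" where
 "fdot t = f (orb t) * dx f (orb t) + g (orb t) * dy f (orb t)"

lemma gdot_continuous: "continuous_on S gdot" and fdot_continuous: "continuous_on S fdot"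
 unfolding gdot_def[abs_def] fdot_def[abs_def]
 by (intro continuous_intros continuous_along smooth_f smooth_g smooth_dx smooth_dy)+

lemma g_D: "((%t. g (orb t)) has_real_derivative gdot t) (at t)"
 and f_D: "((%t. f (orb t)) has_real_derivative fdot t) (at t)"
 using orb_chain[OF smooth_g] orb_chain[OF smooth_f] by (auto simp: gdot_def fdot_def)

lemma near_0:
 assumes "continuous_on UNIV h" "h (0::real) < (c::real)"
 obtains d where "d > 0" "\<And>t. \<bar>t\<bar> <= d ==> h t < c"
proof -
 have "isCont h 0" using assms by (simp add: continuous_on_eq_continuous_at)
 then have "\<forall>\<^sub>F t in at 0. h t < c" unfolding isCont_def using assms(2) by (rule order_tendstoD)
 then obtain d where d: "d > 0" "\<And>t. t ~= 0 ==> dist t 0 < d ==> h t < c"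
  unfolding eventually_at by auto
 show ?thesis
 proof (rule that[of "d / 2"])
  show "h t < c" if "\<bar>t\<bar> <= d / 2" for t
   using d(2)[of t] d(1) that assms(2) by (cases "t = 0") (auto simp: dist_real_def)
 qed (use d in simp)
qed

text \<open>\<open>gdot 0\<close> is the second derivative of the height at the origin, where the
  orbit is tangent to the axis; a negative value would push the orbit below the axis.\<close>

lemma gdot_0_pos: "gdot 0 > 0"
proof (rule ccontr)
 assume "\<not> gdot 0 > 0"
 moreover have "gdot 0 ~= 0" using f_O gx_O by (simp add: gdot_def orb_0 g_O)
 ultimately have "gdot 0 < 0" by simp
 then obtain d where d: "d > 0" "\<And>t. \<bar>t\<bar> <= d ==> gdot t < 0" using near_0[OF gdot_continuous] by blast
 have g_neg: "g (orb t) < 0" if "0 < t" "t <= d" for t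
 proof -
  have "g (orb t) < g (orb 0)"
   by (rule DERIV_neg_imp_decreasing[OF that(1)]) (use d(2) that g_D in \<open>auto intro!: exI\<close>)
  then show ?thesis by (simp add: orb_0 g_O)
 qed
 have "snd (orb d) < snd (orb 0)"
 proof (rule DERIV_neg_imp_decreasing_open[OF d(1), where f = "%t. snd (orb t)"])
  show "\<exists>y. ((%t. snd (orb t)) has_real_derivative y) (at x) & y < 0" if "0 < x" "x < d" for x
   using snd_orb_D[of x] g_neg[of x] that by auto
  show "continuous_on {0..d} (%t. snd (orb t))" by (intro continuous_intros orb_continuous)
 qed
 with snd_orb_nonneg[of d] show False by (simp add: orb_0)
qed

text \<open>Along the orbit, \<open>x * g - y * f\<close> is the angular momentum about the origin.
  Its derivative \<open>x * gdot - y * fdot\<close> has the sign of \<open>t\<close>, because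
  \<open>x\<close> is of order \<open>t\<close>, \<open>gdot\<close> is bounded below and
  \<open>y\<close> is of order \<open>t * t\<close>; so its minimum \<open>0\<close> is at time
  \<open>0\<close>. The case \<open>f (0, 0) > 0\<close> is going to be refuted by this.\<close>

lemma cross_nonneg:
 assumes f0: "f (0, 0) > 0"
 obtains \<tau> where "\<tau> > 0" "\<And>t. \<bar>t\<bar> <= \<tau> ==> f (orb t) > 0"
  "\<And>t. \<bar>t\<bar> <= \<tau> ==> fst (orb t) * g (orb t) - snd (orb t) * f (orb t) >= 0"
proof -
 define k where "k = gdot 0"
 define F0 where "F0 = f (0, 0)"
 define M where "M = \<bar>fdot 0\<bar> + 1"
 have k: "k > 0" using gdot_0_pos by (simp add: k_def)
 obtain d1 where d1: "d1 > 0" "\<And>t. \<bar>t\<bar> <= d1 ==> - f (orb t) < - F0 / 2"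
  by (rule near_0[of "%t. - f (orb t)" "- F0 / 2"])
   (use f0 continuous_on_minus[OF continuous_along[OF smooth_f]] in \<open>auto simp: orb_0 F0_def\<close>)
 obtain d2 where d2: "d2 > 0" "\<And>t. \<bar>t\<bar> <= d2 ==> gdot t < 2 * k"
  by (rule near_0[OF gdot_continuous, of "2 * k"]) (use k in \<open>auto simp: k_def\<close>)
 obtain d3 where d3: "d3 > 0" "\<And>t. \<bar>t\<bar> <= d3 ==> - gdot t < - (k / 2)"
  by (rule near_0[of "%t. - gdot t" "- (k / 2)"])
   (use k in \<open>auto intro!: continuous_intros gdot_continuous simp: k_def\<close>)
 obtain d4 where d4: "d4 > 0" "\<And>t. \<bar>t\<bar> <= d4 ==> \<bar>fdot t\<bar> < M"
  by (rule near_0[of "%t. \<bar>fdot t\<bar>" M]) (auto intro!: continuous_intros fdot_continuous simp: M_def)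
 \<comment> \<open>The entry \<open>F0 / (8 * M)\<close> makes the error
   \<open>2 * k * M * \<bar>t\<bar> ^ 3\<close> at most \<open>F0 * k * t * t / 4\<close>, which is
   the lower bound of the main term of \<open>t * cr' t\<close>.\<close>
 define \<tau> where "\<tau> = Min {d1, d2, d3, d4, F0 / (8 * M)}"
 have M: "M > 0" by (simp add: M_def)
 have \<tau>: "\<tau> > 0" "\<tau> <= d1" "\<tau> <= d2" "\<tau> <= d3" "\<tau> <= d4" "\<tau> <= F0 / (8 * M)"
  using d1 d2 d3 d4 f0 M by (auto simp: \<tau>_def F0_def)
 have F: "f (orb t) > F0 / 2" and G1: "k / 2 < gdot t" "gdot t < 2 * k" and F1: "\<bar>fdot t\<bar> <= M"
  if "\<bar>t\<bar> <= \<tau>" for t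
  using d1(2)[of t] d2(2)[of t] d3(2)[of t] d4(2)[of t] that \<tau> by auto
 have G: "\<bar>g (orb t)\<bar> <= 2 * k * \<bar>t\<bar>" if t: "\<bar>t\<bar> <= \<tau>" for t
 proof -
  have "\<bar>g (orb t) - g (orb 0)\<bar> <= (2 * k) * \<bar>t - 0\<bar>"
  proof (rule deriv_within_diff_bound[where p = "-\<bar>t\<bar>" and q = "\<bar>t\<bar>"])
   fix s assume s: "s \<in> {-\<bar>t\<bar>..\<bar>t\<bar>}"
   show "((%t. g (orb t)) has_real_derivative gdot s) (at s within {-\<bar>t\<bar>..\<bar>t\<bar>})"
    by (rule has_field_derivative_at_within[OF g_D])
   have "\<bar>s\<bar> <= \<tau>" using s t by auto
   from G1[OF this] k show "\<bar>gdot s\<bar> <= 2 * k" by auto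
  qed auto
  then show ?thesis by (simp add: orb_0 g_O)
 qed
 have Y: "\<bar>snd (orb t)\<bar> <= 2 * k * \<bar>t\<bar> * \<bar>t\<bar>" if t: "\<bar>t\<bar> <= \<tau>" for t
 proof -
  have "\<bar>snd (orb t) - snd (orb 0)\<bar> <= (2 * k * \<bar>t\<bar>) * \<bar>t - 0\<bar>"
  proof (rule deriv_within_diff_bound[where p = "-\<bar>t\<bar>" and q = "\<bar>t\<bar>"])
   fix s assume s: "s \<in> {-\<bar>t\<bar>..\<bar>t\<bar>}"
   show "((%t. snd (orb t)) has_real_derivative g (orb s)) (at s within {-\<bar>t\<bar>..\<bar>t\<bar>})"
    by (rule has_field_derivative_at_within[OF snd_orb_D])
   have "\<bar>s\<bar> <= \<tau>" using s t by auto
   from G[OF this] show "\<bar>g (orb s)\<bar> <= 2 * k * \<bar>t\<bar>"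
    by (rule order_trans) (use s k in \<open>auto intro!: mult_left_mono\<close>)
  qed auto
  then show ?thesis by (simp add: orb_0)
 qed
 have X: "t * fst (orb t) >= F0 / 2 * (t * t)" if t: "\<bar>t\<bar> <= \<tau>" for t
 proof (cases "t >= 0")
  case True
  have "fst (orb 0) - F0 / 2 * 0 <= fst (orb t) - F0 / 2 * t"
  proof (rule DERIV_nonneg_imp_nondecreasing[OF True, where f = "%t. fst (orb t) - F0 / 2 * t"])
   fix x assume "0 <= x" "x <= t"
   then have "\<bar>x\<bar> <= \<tau>" using t by auto
   from F[OF this] show "\<exists>y. ((%t. fst (orb t) - F0 / 2 * t) has_real_derivative y) (at x) & y >= 0"
    by (intro exI[of _ "f (orb x) - F0 / 2"]) (auto intro!: derivative_eq_intros fst_orb_D)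
  qed
  then have "t * (F0 / 2 * t) <= t * fst (orb t)" using True by (intro mult_left_mono) (auto simp: orb_0)
  then show ?thesis by (simp add: algebra_simps)
 next
  case False
  have "fst (orb t) - F0 / 2 * t <= fst (orb 0) - F0 / 2 * 0"
  proof (rule DERIV_nonneg_imp_nondecreasing[where f = "%t. fst (orb t) - F0 / 2 * t"])
   fix x assume "t <= x" "x <= 0"
   then have "\<bar>x\<bar> <= \<tau>" using t by auto
   from F[OF this] show "\<exists>y. ((%t. fst (orb t) - F0 / 2 * t) has_real_derivative y) (at x) & y >= 0"
    by (intro exI[of _ "f (orb x) - F0 / 2"]) (auto intro!: derivative_eq_intros fst_orb_D)
  qed (use False in auto)
  then have "t * (F0 / 2 * t) <= t * fst (orb t)" using False by (intro mult_left_mono_neg) (auto simp: orb_0)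
  then show ?thesis by (simp add: algebra_simps)
 qed
 define cr where "cr t = fst (orb t) * g (orb t) - snd (orb t) * f (orb t)" for t
 define cr' where "cr' t = fst (orb t) * gdot t - snd (orb t) * fdot t" for t
 have Dcr: "(cr has_real_derivative cr' t) (at t)" for t
  unfolding cr_def[abs_def] cr'_def
  by (auto intro!: derivative_eq_intros fst_orb_D snd_orb_D g_D f_D)
 have sgn: "t * cr' t >= 0" if t: "\<bar>t\<bar> <= \<tau>" for t
 proof -
  have "F0 / 2 * (t * t) * (k / 2) <= (t * fst (orb t)) * gdot t"
  proof (rule mult_mono[OF X[OF t]])
   have "0 <= F0 / 2 * (t * t)" using f0 by (simp add: F0_def)
   then show "0 <= t * fst (orb t)" using X[OF t] by linarith
  qed (use G1[OF t] k in auto)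
  moreover have "\<bar>(t * snd (orb t)) * fdot t\<bar> <= (\<bar>t\<bar> * (2 * k * \<bar>t\<bar> * \<bar>t\<bar>)) * M"
   unfolding abs_mult using Y[OF t] F1[OF t] by (intro mult_mono) (auto simp: abs_mult intro!: mult_mono)
  moreover have "(\<bar>t\<bar> * (2 * k * \<bar>t\<bar> * \<bar>t\<bar>)) * M <= F0 / 2 * (t * t) * (k / 2)"
  proof -
   have "\<bar>t\<bar> * (8 * M) <= F0" using order_trans[OF t \<tau>(6)] M by (simp add: field_simps)
   then have "(\<bar>t\<bar> * (8 * M)) * (t * t * k / 4) <= F0 * (t * t * k / 4)"
    using k by (intro mult_right_mono) auto
   then show ?thesis by (simp add: algebra_simps)
  qed
  ultimately show ?thesis unfolding cr'_def by (auto simp: algebra_simps)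
 qed
 have "cr t >= 0" if t: "\<bar>t\<bar> <= \<tau>" for t
 proof (cases "t >= 0")
  case True
  have "cr 0 <= cr t"
  proof (rule DERIV_nonneg_imp_increasing_open[OF True, of cr])
   fix x assume "0 < x" "x < t"
   with sgn[of x] t show "\<exists>y. (cr has_real_derivative y) (at x) & 0 <= y"
    using Dcr by (intro exI[of _ "cr' x"]) (auto simp: zero_le_mult_iff)
  qed (rule DERIV_at_continuous_on[OF Dcr])
  then show ?thesis by (simp add: cr_def orb_0)
 next
  case False
  have "cr 0 <= cr t"
  proof (rule DERIV_nonpos_imp_decreasing_open[of t 0 cr])
   fix x assume "t < x" "x < 0"
   with sgn[of x] t show "\<exists>y. (cr has_real_derivative y) (at x) & y <= 0"
    using Dcr by (intro exI[of _ "cr' x"]) (auto simp: zero_le_mult_iff)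
  qed (use False in \<open>auto intro: DERIV_at_continuous_on[OF Dcr]\<close>)
  then show ?thesis by (simp add: cr_def orb_0)
 qed
 moreover have "f (orb t) > 0" if "\<bar>t\<bar> <= \<tau>" for t using F[OF that] f0 by (simp add: F0_def)
 ultimately show ?thesis using \<tau>(1) by (intro that[of \<tau>]) (auto simp: cr_def)
qed

end

section \<open>The orbit runs to the left at the origin\<close>

context grazing_orbit
begin

lemma winding_eq:
 assumes "z \<notin> cplx ` L"
 shows "winding_number (orbit_path (%t. orb (t + d)) T) z \<in> {0, -1}"
proof -
 have S: "simple_path (orbit_path orb T)" "pathfinish (orbit_path orb T) = pathstart (orbit_path orb T)"
  "path_image (orbit_path orb T) = cplx ` L"
  using periodic_path[OF per] range_orb by auto
 have "winding_number (orbit_path orb T) z \<in> {0, -1}"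
 proof (cases "z \<in> inside (cplx ` L)")
  case False
  with assms have "z \<in> outside (cplx ` L)" using inside_Un_outside[of "cplx ` L"] by blast
  then have "winding_number (orbit_path orb T) z = 0"
   using winding_number_zero_in_outside[of "orbit_path orb T" z] S by (simp add: simple_path_imp_path)
  then show ?thesis by simp
 qed (simp add: wn)
 then show ?thesis using winding_number_orbit_shift[OF per, of z d] assms range_orb by simp
qed

text \<open>If the orbit moved to the right at the origin, then the part of it away from the origin would
 turn by a positive angle around the origin, as it stays in the upper half-plane; the part near the
 origin turns by a nonnegative angle around points slightly above it. This contradicts that
 all winding numbers are \<open>0\<close> or \<open>-1\<close>.\<close>

lemma f_O_neg: "f (0, 0) < 0"
proof (rule ccontr)
 assume "\<not> f (0, 0) < 0"
 with f_O have f0: "f (0, 0) > 0" by simp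
 obtain \<tau>1 where \<tau>1: "\<tau>1 > 0" "\<And>t. \<bar>t\<bar> <= \<tau>1 ==> f (orb t) > 0"
  "\<And>t. \<bar>t\<bar> <= \<tau>1 ==> fst (orb t) * g (orb t) - snd (orb t) * f (orb t) >= 0"
  using cross_nonneg[OF f0] by blast
 define \<tau> where "\<tau> = min \<tau>1 (T / 4)"
 have \<tau>: "0 < \<tau>" "\<tau> <= \<tau>1" "4 * \<tau> <= T" using \<tau>1(1) T_pos by (auto simp: \<tau>_def)
 define P where "P = orbit_path (%t. orb (t + - \<tau>)) T"
 \<comment> \<open>The closed path starts at time \<open>- \<tau>\<close>. Up to the fraction
   \<open>b\<close> of the period it is the short piece \<open>p2\<close> through the origin,
   afterwards the piece \<open>p1\<close> in the open upper half-plane.\<close>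
 define b where "b = 2 * \<tau> / T"
 have b: "0 < b" "b < 1" "T * b = 2 * \<tau>" using \<tau> T_pos by (auto simp: b_def)
 have P: "P s = cplx (orb (T * s - \<tau>))" for s by (simp add: P_def orbit_path_eq)
 have DP: "(P has_vector_derivative cplx (T *\<^sub>R upper_field f g (orb (T * s - \<tau>)))) (at s)" for s
 proof -
  have "((%s. orb (T * s - \<tau>)) has_vector_derivative T *\<^sub>R upper_field f g (orb (T * s - \<tau>))) (at s)"
   by (rule vector_diff_chain_at[unfolded o_def, where f = "%s. T * s - \<tau>" and g = orb])
    (auto intro!: derivative_eq_intros orb_D)
  from bounded_linear.has_vector_derivative[OF bounded_linear_cplx this]
  show ?thesis by (simp add: P[abs_def])
 qed
 have vP: "valid_path P"
  unfolding valid_path_def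
 proof (rule C1_differentiable_imp_piecewise)
  have "continuous_on {0..1} (%s. orb (T * s - \<tau>))"
   by (rule continuous_on_compose2[OF orb_continuous[of UNIV]]) (auto intro!: continuous_intros)
  then have "continuous_on {0..1} (%s. f (orb (T * s - \<tau>)))" "continuous_on {0..1} (%s. g (orb (T * s - \<tau>)))"
   by (auto intro!: continuous_on_compose2[OF smooth_continuous_on[OF smooth_f, of UNIV]]
     continuous_on_compose2[OF smooth_continuous_on[OF smooth_g, of UNIV]])
  then have "continuous_on {0..1} (%s. T *\<^sub>R (f (orb (T * s - \<tau>)), g (orb (T * s - \<tau>))))"
   by (intro continuous_intros)
  then have "continuous_on {0..1} (%s. T *\<^sub>R upper_field f g (orb (T * s - \<tau>)))"
   by (simp add: upper_field_def split_beta)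
  from continuous_on_compose2[OF cplx_continuous_on[of UNIV] this]
  have "continuous_on {0..1} (%s. cplx (T *\<^sub>R upper_field f g (orb (T * s - \<tau>))))" by auto
  with DP show "P C1_differentiable_on {0..1}"
   unfolding C1_differentiable_on_def
   by (intro exI[of _ "%s. cplx (T *\<^sub>R upper_field f g (orb (T * s - \<tau>)))"]) simp
 qed
 have pim: "path_image P = cplx ` L"
  using periodic_path(3)[OF periodic_solution_shift[OF per, of "- \<tau>"]] range_shift[of orb "- \<tau>"] range_orb
  by (simp add: P_def)
 define p1 where "p1 = subpath b 1 P"
 define p2 where "p2 = subpath 0 b P"
 have vp: "valid_path p1" "valid_path p2" unfolding p1_def p2_def using b vP by (auto intro: valid_path_subpath)
 have p1: "p1 s = cplx (orb (\<tau> + (T - 2 * \<tau>) * s))" for s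
 proof -
  have "T * ((1 - b) * s + b) - \<tau> = \<tau> + (T - 2 * \<tau>) * s"
   using b(3) by (simp add: algebra_simps)
  then show ?thesis by (simp add: p1_def subpath_def P)
 qed
 have p1_up: "Im z > 0" if zp: "z \<in> path_image p1" for z
 proof -
  obtain s where s: "0 <= s" "s <= 1" "z = cplx (orb (\<tau> + (T - 2 * \<tau>) * s))"
   using zp by (auto simp: path_image_def p1)
  let ?t = "\<tau> + (T - 2 * \<tau>) * s"
  have le: "(T - 2 * \<tau>) * s <= T - 2 * \<tau>" using s \<tau> by (intro mult_left_le) auto
  have ge: "0 <= (T - 2 * \<tau>) * s" using s \<tau> by (intro mult_nonneg_nonneg) auto
  have t: "0 < ?t" using ge \<tau> by linarith
  have t': "?t < T" using le \<tau> by linarith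
  have "snd (orb ?t) ~= 0"
  proof
   assume "snd (orb ?t) = 0"
   then have "orb 0 = orb ?t" using snd_orb_eq_0_iff[of ?t] orb_0 by simp
   then obtain k :: int where k: "?t = 0 + of_int k * T" using periodic_solution_eq_iff[OF per] by blast
   with t t' have "0 < real_of_int k * T" "real_of_int k * T < 1 * T" by auto
   then have "0 < k" "k < 1" using T_pos by (auto simp: zero_less_mult_iff)
   then show False by linarith
  qed
  then show ?thesis using snd_orb_nonneg[of ?t] s by simp
 qed
 have fst_inc: "fst (orb s) < fst (orb t)" if "-\<tau> <= s" "s < t" "t <= \<tau>" for s t
 proof (rule DERIV_pos_imp_increasing[OF that(2), where f = "%t. fst (orb t)"])
  fix x assume "s <= x" "x <= t"
  then have "\<bar>x\<bar> <= \<tau>1" using that \<tau> by auto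
  then show "\<exists>y. ((%t. fst (orb t)) has_real_derivative y) (at x) & 0 < y"
   using \<tau>1(2) fst_orb_D by blast
 qed
 have ends: "pathstart p1 = cplx (orb \<tau>)" "pathfinish p1 = cplx (orb (- \<tau>))"
 proof -
  show "pathstart p1 = cplx (orb \<tau>)" by (simp add: pathstart_def p1)
  show "pathfinish p1 = cplx (orb (- \<tau>))"
   using orb_T[of "- \<tau>"] by (simp add: pathfinish_def p1 algebra_simps)
 qed
 have "0 \<notin> path_image p1" using p1_up by force
 \<comment> \<open>\<open>Ln\<close> is a primitive of \<open>1 / z\<close> on the upper half-plane,
   so the turning of \<open>p1\<close> about \<open>0\<close> is the difference of the arguments of
   its ends, and \<open>p1\<close> leads from the right quadrant to the left one.\<close>
 have rw1: "Re (winding_number p1 0) = (Im (Ln (cplx (orb (-\<tau>)))) - Im (Ln (cplx (orb \<tau>)))) / (2 * pi)"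
 proof -
  have "((%z. 1 / z) has_contour_integral (Ln (pathfinish p1) - Ln (pathstart p1))) p1"
  proof (rule contour_integral_primitive[where S = "{z. Im z > 0}"])
   fix z assume "z \<in> {z. Im z > 0}"
   then have "z \<notin> \<real>\<^sub>\<le>\<^sub>0" by (simp add: complex_nonpos_Reals_iff)
   then show "(Ln has_field_derivative 1 / z) (at z within {z. 0 < Im z})"
    by (auto intro!: derivative_eq_intros simp: divide_inverse)
  qed (use vp p1_up in auto)
  then have "contour_integral p1 (%w. 1 / (w - 0)) = Ln (cplx (orb (-\<tau>))) - Ln (cplx (orb \<tau>))"
   by (simp add: contour_integral_unique ends)
  then show ?thesis using Re_winding_number[OF vp(1) \<open>0 \<notin> path_image p1\<close>] by simp
 qed
 have "Re (winding_number p1 0) > 0"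
 proof -
  have x: "fst (orb \<tau>) > 0" "fst (orb (-\<tau>)) < 0"
   using fst_inc[of 0 \<tau>] fst_inc[of "-\<tau>" 0] \<tau> by (auto simp: orb_0)
  have nz: "cplx (orb \<tau>) ~= 0" "cplx (orb (-\<tau>)) ~= 0" using x by (auto simp: complex_eq_iff)
  have "pathstart p1 \<in> path_image p1" "pathfinish p1 \<in> path_image p1" by auto
  then have y: "snd (orb (-\<tau>)) > 0" using p1_up[of "pathfinish p1"] ends by simp
  have "\<bar>Im (Ln (cplx (orb \<tau>)))\<bar> < pi / 2" using Re_Ln_pos_lt[OF nz(1)] x by simp
  moreover have "\<not> \<bar>Im (Ln (cplx (orb (-\<tau>))))\<bar> < pi / 2" using Re_Ln_pos_lt[OF nz(2)] x by simp
  moreover have "0 < Im (Ln (cplx (orb (-\<tau>))))" using Im_Ln_pos_lt[OF nz(2)] y by simp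
  ultimately show ?thesis unfolding rw1 by (intro divide_pos_pos) auto
 qed
 moreover have "isCont (winding_number p1) 0"
  using continuous_at_winding_number[OF valid_path_imp_path[OF vp(1)] \<open>0 \<notin> path_image p1\<close>] .
 then have "isCont (%z. Re (winding_number p1 z)) 0" by (rule bounded_linear.isCont[OF bounded_linear_Re])
 ultimately have ev: "\<forall>\<^sub>F z in at 0. Re (winding_number p1 z) > 0"
  unfolding isCont_def by (intro order_tendstoD) auto
 then obtain d where d: "d > 0" "\<And>z. z ~= 0 ==> dist z 0 < d ==> Re (winding_number p1 z) > 0"
  unfolding eventually_at by auto
 have "open (- path_image p1)" using closed_path_image[OF valid_path_imp_path[OF vp(1)]] by (rule open_Compl)
 then obtain d' where d': "d' > 0" "ball 0 d' \<subseteq> - path_image p1"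
  using \<open>0 \<notin> path_image p1\<close> openE[of "- path_image p1" 0] by auto
 define \<eta> where "\<eta> = min d d' / 2"
 \<comment> \<open>A point just above the origin: close enough for \<open>p1\<close> to keep its
   positive turning by continuity, and off \<open>p2\<close>, which meets the vertical axis only at
   the origin.\<close>
 define z where "z = Complex 0 \<eta>"
 have \<eta>: "\<eta> > 0" "\<eta> < d" "\<eta> < d'" using d d' by (auto simp: \<eta>_def)
 have z: "z ~= 0" "norm z = \<eta>" using \<eta> by (auto simp: z_def complex_eq_iff cmod_def)
 have p2: "p2 s = cplx (orb (2 * \<tau> * s - \<tau>))" for s
  using b(3) by (simp add: p2_def subpath_def P mult.assoc[symmetric])
 have z_off: "z \<notin> path_image p2"
 proof
  assume "z \<in> path_image p2"
  then obtain s where s: "0 <= s" "s <= 1" "z = cplx (orb (2 * \<tau> * s - \<tau>))" by (auto simp: path_image_def p2)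
  let ?t = "2 * \<tau> * s - \<tau>"
  have "2 * \<tau> * s <= 2 * \<tau>" using s \<tau> by (intro mult_left_le) auto
  moreover have "0 <= 2 * \<tau> * s" using s \<tau> by (intro mult_nonneg_nonneg) auto
  ultimately have t: "- \<tau> <= ?t" "?t <= \<tau>" by auto
  have "fst (orb ?t) = 0" using arg_cong[OF s(3), of Re] by (simp add: z_def)
  then have "\<not> ?t < 0" "\<not> 0 < ?t" using fst_inc[of ?t 0] fst_inc[of 0 ?t] t \<tau> by (simp_all only: orb_0) auto
  then have "?t = 0" by linarith
  then have "z = 0" using s(3) orb_0 by (metis cplx_simps(4))
  with z show False by simp
 qed
 have "z \<notin> path_image p1" using d'(2) \<eta> z by (auto simp: subset_iff dist_norm)
 have "path_image P = path_image p2 \<union> path_image p1"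
 proof -
  have "{0..b} \<union> {b..1} = {0..1}" using b by auto
  then have "P ` {0..b} \<union> P ` {b..1} = P ` {0..1}" by (metis image_Un)
  moreover have "path_image p2 = P ` {0..b}" "path_image p1 = P ` {b..1}"
   using b by (simp_all add: p1_def p2_def path_image_subpath)
  ultimately show ?thesis by (simp add: path_image_def)
 qed
 with z_off \<open>z \<notin> path_image p1\<close> have zP: "z \<notin> path_image P" by auto
 have "winding_number p2 z + winding_number p1 z = winding_number P z"
  using winding_number_subpath_combine[OF valid_path_imp_path[OF vP] zP, of 0 b 1] b
  by (simp add: p1_def p2_def subpath_trivial)
 moreover have "Re (winding_number P z) <= 0"
  using winding_eq[of z "- \<tau>"] zP pim by (auto simp: P_def)
 moreover have "Re (winding_number p1 z) > 0" using d(2)[OF z(1)] z \<eta> by simp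
 moreover have "0 <= Re (winding_number p2 z)"
 proof (rule winding_number_pos_le[OF vp(2) z_off])
  fix s :: real assume s: "0 < s" "s < 1"
  let ?t = "2 * \<tau> * s - \<tau>"
  have "2 * \<tau> * s <= 2 * \<tau>" using s \<tau> by (intro mult_left_le) auto
  moreover have "0 <= 2 * \<tau> * s" using s \<tau> by (intro mult_nonneg_nonneg) auto
  ultimately have t: "\<bar>?t\<bar> <= \<tau>1" using \<tau> by linarith
  have "((%s. orb (2 * \<tau> * s - \<tau>)) has_vector_derivative (2 * \<tau>) *\<^sub>R upper_field f g (orb ?t)) (at s)"
   by (rule vector_diff_chain_at[unfolded o_def, where f = "%s. 2 * \<tau> * s - \<tau>" and g = orb])
    (auto intro!: derivative_eq_intros orb_D)
  from bounded_linear.has_vector_derivative[OF bounded_linear_cplx this]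
  have "vector_derivative p2 (at s) = cplx ((2 * \<tau>) *\<^sub>R upper_field f g (orb ?t))"
   by (intro vector_derivative_at) (simp add: p2[abs_def])
  \<comment> \<open>The angular momentum about \<open>z\<close> is that about the origin plus
    \<open>\<eta> * f\<close>, and both terms are nonnegative along \<open>p2\<close>.\<close>
  moreover have "0 <= (2 * \<tau>) * ((fst (orb ?t) * g (orb ?t) - snd (orb ?t) * f (orb ?t)) + \<eta> * f (orb ?t))"
   using \<tau>1(2,3)[OF t] \<eta> \<tau> by (intro mult_nonneg_nonneg add_nonneg_nonneg) auto
  ultimately show "0 <= Im (vector_derivative p2 (at s) * cnj (p2 s - z))"
   by (simp add: p2 z_def upper_field_def split_beta algebra_simps)
 qed
 ultimately show False by (metis add_pos_nonneg add.commute not_less plus_complex.simps(1))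
qed

lemma gx_O_neg: "dx g (0, 0) < 0"
proof -
 have "0 < f (0, 0) * dx g (0, 0)" using gdot_0_pos by (simp add: gdot_def orb_0 g_O)
 with f_O_neg show ?thesis by (simp add: zero_less_mult_iff)
qed

lemma orbit_off_L:
 assumes "solves (upper_field f g) \<eta> {0..t}" "\<eta> 0 \<notin> L" "s \<in> {0..t}"
 shows "\<eta> s \<notin> L"
proof
 assume "\<eta> s \<in> L"
 then obtain a where a: "\<eta> s = orb a" using range_orb by auto
 have "solves (upper_field f g) (%u. orb (u + (a - s))) {0..t}" by (rule solves_shift[OF orb_sol[of UNIV]]) auto
 from solves_unique[OF smooth_f smooth_g assms(1) this assms(3), of 0] a assms(3)
 have "\<eta> 0 = orb (a - s)" by auto
 with assms(2) range_orb show False by auto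
qed

text \<open>A connected set off the Jordan curve lies in one component of its complement. Membership
  in the inside is thereby transported along orbits and along segments.\<close>

lemma connected_inside:
 assumes "connected A" "A \<inter> L = {}" "p \<in> A" "q \<in> A" "cplx p \<in> inside (cplx ` L)"
 shows "cplx q \<in> inside (cplx ` L)"
proof -
 have "connected (cplx ` A)" using assms(1) cplx_continuous_on connected_continuous_image by blast
 moreover have "cplx ` A \<inter> cplx ` L = {}" using assms(2) by auto
 ultimately have "cplx ` A \<subseteq> inside (cplx ` L) \<or> cplx ` A \<subseteq> outside (cplx ` L)"
  using connectedD[of "cplx ` A" "inside (cplx ` L)" "outside (cplx ` L)"]
   inside_Un_outside[of "cplx ` L"] inside_Int_outside[of "cplx ` L"]
   Jordan_inside_outside[OF periodic_path(1,2)[OF per]] periodic_path(3)[OF per] range_orb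
  by (smt (verit) Int_commute Int_empty_right disjoint_iff subsetI Un_iff Compl_iff)
 then show ?thesis using assms inside_Int_outside[of "cplx ` L"] by blast
qed

end

section \<open>The return map of the grazing orbit\<close>

text \<open>Around time \<open>0\<close> the orbit is in the flow box; \<open>x2\<close> measures
  how far it has moved sideways at the times \<open>\<tau>\<close> and \<open>- \<tau>\<close>, and
  \<open>2 * y1\<close> bounds its height from below between \<open>\<tau>\<close> and
  \<open>T - \<tau>\<close>. \<open>E p\<close> is the orbit from \<open>p\<close>, \<open>C\<close>
  its Lipschitz constant in \<open>p\<close> over slightly more than one period, and \<delta> is so
  small that \<open>C * \<delta>\<close> stays within all these margins.\<close>

locale return_setup = grazing_orbit U L f g orb T + flow_box f g \<rho> R Lc K
 for U L :: "plane set" and f g :: "plane => real" and orb :: "real => plane" and T \<rho> R Lc K :: real +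
 fixes \<tau> x2 y1 C \<delta> :: real and E :: "plane => real => plane"
 assumes gx_neg: "\<And>x y. \<bar>x\<bar> <= \<rho> ==> \<bar>y\<bar> <= \<rho> ==> dx g (x, y) < 0"
  and \<tau>: "\<tau> > 0" "8 * \<tau> <= T"
  and near: "\<And>t. \<bar>t\<bar> <= 4 * \<tau> ==> \<bar>fst (orb t)\<bar> <= R / 2 & \<bar>snd (orb t)\<bar> <= \<rho> / 2"
  and far: "\<And>t. \<tau> <= t ==> t <= T - \<tau> ==> snd (orb t) >= 2 * y1"
  and x2: "fst (orb \<tau>) < - 2 * x2" "fst (orb (- \<tau>)) > 2 * x2" and pos: "x2 > 0" "y1 > 0" "\<delta> > 0" "C >= 1"
  and E_sol: "\<And>p. norm p < \<delta> ==> solves (upper_field f g) (E p) {0..}"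
  and E_0: "\<And>p. norm p < \<delta> ==> E p 0 = p"
  and E_lip: "\<And>p q t. norm p < \<delta> ==> norm q < \<delta> ==> 0 <= t ==> t <= T + 4 * \<tau> ==>
   norm (E p t - E q t) <= C * norm (p - q)"
  and small_\<delta>: "C * \<delta> <= R / 2" "C * \<delta> <= \<rho> / 2" "C * \<delta> <= y1" "C * \<delta> <= x2" "K * \<delta> < y1"
begin

abbreviation "Z \<equiv> upper_field f g"

definition hp :: "plane => real" where
 "hp p = ht (fst p) (snd p)"

text \<open>The level on which the orbit arrives after the fixed time \<open>T\<close>. At times
  near \<open>T\<close> the orbit is in the box again, where its level does not change, so this is
  also the level at any crossing of a transversal there.\<close>

definition rr :: "plane => real" where
 "rr p = hp (E p T)"

lemma norm_components: "\<bar>fst p\<bar> <= norm (p :: plane)" "\<bar>snd p\<bar> <= norm p"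
 by (metis norm_fst_le norm_snd_le prod.collapse real_norm_def)+

lemma \<delta>_le: "\<delta> <= C * \<delta>" "\<delta> <= R" "\<delta> <= y1" "\<delta> <= x2" "K >= 0"
proof -
 have "1 * \<delta> <= C * \<delta>" using pos by (intro mult_right_mono) auto
 then show "\<delta> <= C * \<delta>" "\<delta> <= R" "\<delta> <= y1" "\<delta> <= x2" using small_\<delta> R_pos by auto
 show "K >= 0" using bound[OF zero_mem, of 0] by simp
qed

lemma fst_mem: "norm (p :: plane) < \<delta> ==> fst p \<in> {-R..R}"
 using norm_components(1)[of p] \<delta>_le by auto

lemma E_sol': "norm p < \<delta> ==> 0 <= a ==> solves Z (E p) {a..b}"
 by (rule solves_subset[OF E_sol]) auto

lemma E_O: "0 <= t ==> E (0, 0) t = orb t"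
 using solves_unique[OF smooth_f smooth_g E_sol'[of "(0, 0)" 0 t] orb_sol, of 0 t] E_0[of "(0, 0)"] orb_0 pos
 by (simp add: zero_prod_def[symmetric])

lemma E_close:
 assumes "norm p < \<delta>" "0 <= t" "t <= T + 4 * \<tau>"
 shows "norm (E p t - orb t) <= C * norm p"
 using E_lip[OF assms(1), of "(0, 0)" t] assms(2,3) E_O[OF assms(2)] pos by (simp add: zero_prod_def[symmetric])

lemma E_close':
 assumes "norm p < \<delta>" "0 <= t" "t <= T + 4 * \<tau>"
 shows "\<bar>fst (E p t) - fst (orb t)\<bar> < C * \<delta>" "\<bar>snd (E p t) - snd (orb t)\<bar> < C * \<delta>"
proof -
 have "norm (E p t - orb t) < C * \<delta>"
  using E_close[OF assms] assms(1) pos by (smt (verit) mult_less_cancel_left_pos)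
 with norm_components[of "E p t - orb t"]
 show "\<bar>fst (E p t) - fst (orb t)\<bar> < C * \<delta>" "\<bar>snd (E p t) - snd (orb t)\<bar> < C * \<delta>" by auto
qed

lemma orb_near_T: "\<bar>t - T\<bar> <= 4 * \<tau> ==> \<bar>fst (orb t)\<bar> <= R / 2 & \<bar>snd (orb t)\<bar> <= \<rho> / 2"
 using near[of "t - T"] orb_T[of "t - T"] by simp

lemma E_box:
 assumes "norm p < \<delta>" "0 <= t & t <= 4 * \<tau> \<or> T - 4 * \<tau> <= t & t <= T + 4 * \<tau>"
 shows "E p t \<in> box_R"
proof -
 have t: "0 <= t" "t <= T + 4 * \<tau>" using assms(2) \<tau> by auto
 have "\<bar>fst (orb t)\<bar> <= R / 2 & \<bar>snd (orb t)\<bar> <= \<rho> / 2"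
  using assms(2) near[of t] orb_near_T[of t] by auto
 with E_close'[OF assms(1) t] small_\<delta> show ?thesis by (auto simp: mem_Times_iff)
qed

lemma hp_start:
 assumes "norm p < \<delta>" "0 <= t" "t <= 4 * \<tau>"
 shows "hp (E p t) = hp p"
proof -
 have "E p ` {0..4 * \<tau>} \<subseteq> box_R" by (rule image_subsetI) (use E_box[OF assms(1)] in auto)
 from ht_constant_on_orbit[OF E_sol'[OF assms(1)] this, of 0 t] assms \<tau> E_0[OF assms(1)]
 show ?thesis by (simp add: hp_def)
qed

lemma hp_return:
 assumes "norm p < \<delta>" "T - 4 * \<tau> <= t" "t <= T + 4 * \<tau>"
 shows "hp (E p t) = rr p"
proof -
 have "E p ` {T - 4 * \<tau>..T + 4 * \<tau>} \<subseteq> box_R" by (rule image_subsetI) (use E_box[OF assms(1)] in auto)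
 from ht_constant_on_orbit[OF E_sol'[OF assms(1)] this, of T t] assms \<tau>
 show ?thesis by (simp add: hp_def rr_def)
qed

lemma hp_eq_imp_eq: "fst p \<in> {-R..R} ==> fst q = fst p ==> hp p = hp q ==> p = q"
 using ht_eq_iff[of "fst p" "snd p" "snd q"] by (simp add: hp_def prod_eq_iff)

lemma E_fst_continuous: "norm p < \<delta> ==> 0 <= a ==> continuous_on {a..b} (%t. fst (E p t))"
 by (intro continuous_intros solves_continuous_on[OF E_sol'])

text \<open>Within time \<tau> the orbit from \<open>p\<close> moves left past \<open>fst q\<close>,
  staying on the level of \<open>q\<close>; points with the same abscissa and level
  coincide.\<close>

lemma reach:
 assumes p: "norm p < \<delta>" and q: "norm q < \<delta>" and "fst q <= fst p" "hp q = hp p"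
 obtains t where "0 <= t" "t <= \<tau>" "E p t = q"
proof -
 have "\<bar>fst (E p \<tau>) - fst (orb \<tau>)\<bar> < C * \<delta>" using E_close'(1)[OF p, of \<tau>] \<tau> by auto
 then have "fst (E p \<tau>) < - x2" using x2 small_\<delta> by linarith
 moreover have "- x2 < fst q" using norm_components(1)[of q] q \<delta>_le by linarith
 ultimately have "\<exists>t\<ge>0. t <= \<tau> & fst (E p t) = fst q"
  using \<tau> assms E_0[OF p] by (intro IVT2') (auto intro!: E_fst_continuous)
 then obtain t where t: "0 <= t" "t <= \<tau>" "fst (E p t) = fst q" by blast
 have "E p t = q"
  using hp_eq_imp_eq[of q "E p t"] fst_mem[OF q] t hp_start[OF p, of t] \<tau> assms by simp
 with t that show ?thesis by blast
qed

lemma E_shift: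
 assumes "norm p < \<delta>" "norm q < \<delta>" "0 <= t" "E p t = q" "0 <= s"
 shows "E p (s + t) = E q s"
proof -
 have "solves Z (%u. E p (u + t)) {0..s}"
  by (rule solves_shift[OF E_sol[OF assms(1)]]) (use assms in auto)
 from solves_unique[OF smooth_f smooth_g this E_sol'[OF assms(2), of 0 s], of 0 s] assms E_0[OF assms(2)]
 show ?thesis by auto
qed

text \<open>Of two points on one level, one flows into the other, and the time this takes is within
  the span after \<open>T\<close> on which the level is constant.\<close>

lemma rr_cong:
 assumes p: "norm p < \<delta>" and q: "norm q < \<delta>" and "hp q = hp p"
 shows "rr p = rr q"
proof -
 have *: "rr p = rr q" if pq: "norm p < \<delta>" "norm q < \<delta>" "fst q <= fst p" "hp q = hp p" for p q
 proof -
  obtain t where t: "0 <= t" "t <= \<tau>" "E p t = q" by (rule reach[OF pq])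
  have "E p (T + t) = E q T" by (rule E_shift[OF pq(1,2) t(1,3)]) (use T_pos in simp)
  with hp_return[OF pq(1), of "T + t"] t \<tau> show ?thesis by (simp add: rr_def)
 qed
 show ?thesis using *[OF p q] *[OF q p] assms(3) by (cases "fst q <= fst p") auto
qed

lemma E_T_small: "C * norm p < \<delta> ==> norm p < \<delta> & norm (E p T) < \<delta>"
proof -
 assume C: "C * norm p < \<delta>"
 have "1 * norm p <= C * norm p" using pos by (intro mult_right_mono) auto
 with C have p: "norm p < \<delta>" by simp
 have "orb T = 0" using orb_T[of 0] orb_0 by (simp add: zero_prod_def)
 with E_close[OF p, of T] T_pos \<tau> C have "norm (E p T) < \<delta>" by auto
 with p show ?thesis by simp
qed

text \<open>If the return levels agree, one of \<open>E p T\<close> and \<open>E q T\<close> flows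
  to the other in a time \<open>t\<close>, and backward uniqueness transports this to
  \<open>p\<close> and \<open>q\<close>. As abscissae strictly decrease along orbits,
  \<open>fst p = fst q\<close> forces \<open>t = 0\<close>.\<close>

lemma rr_inj:
 assumes p: "C * norm p < \<delta>" and q: "C * norm q < \<delta>" and "fst p = fst q" and eq: "rr p = rr q"
 shows "p = q"
proof -
 have *: "p = q" if pq: "C * norm p < \<delta>" "C * norm q < \<delta>" "fst p = fst q" "rr p = rr q" "fst (E q T) <= fst (E p T)" for p q
 proof -
  have n: "norm p < \<delta>" "norm (E p T) < \<delta>" "norm q < \<delta>" "norm (E q T) < \<delta>"
   using E_T_small pq by auto
  obtain t where t: "0 <= t" "t <= \<tau>" "E (E p T) t = E q T"
   by (rule reach[OF n(2,4) pq(5)]) (use pq in \<open>auto simp: rr_def\<close>)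
  have pT: "E p (t + T) = E q T"
   using E_shift[OF n(1,2) _ refl t(1)] T_pos t by simp
  have "solves Z (%u. E p (u + t)) {0..T}"
   by (rule solves_shift[OF E_sol[OF n(1)]]) (use t in auto)
  from solves_unique[OF smooth_f smooth_g this E_sol'[OF n(3), of 0 T], of T 0] pT T_pos
  have "E p t = q" using E_0[OF n(3)] by (auto simp: add.commute)
  moreover have "t = 0"
  proof (rule ccontr)
   assume "t ~= 0"
   have "E p ` {0..\<tau>} \<subseteq> box_R" by (rule image_subsetI) (use E_box[OF n(1)] \<tau> in auto)
   with t \<open>t ~= 0\<close> have "fst (E p t) < fst (E p 0)"
    by (intro fst_decreasing[OF E_sol'[OF n(1), of 0 \<tau>]]) auto
   with \<open>E p t = q\<close> pq(3) E_0[OF n(1)] show False by simp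
  qed
  ultimately show ?thesis using E_0[OF n(1)] by simp
 qed
 show ?thesis using *[OF p q] *[OF q p] assms by (cases "fst (E q T) <= fst (E p T)") auto
qed

lemma hp_lipschitz:
 assumes "fst p \<in> {-R..R}" "fst q \<in> {-R..R}"
 shows "\<bar>hp p - hp q\<bar> <= 2 * (1 + K) * norm (p - q)"
proof -
 have "\<bar>hp p - hp q\<bar> <= 2 * (\<bar>snd p - snd q\<bar> + K * \<bar>fst p - fst q\<bar>)"
  unfolding hp_def by (rule ht_lipschitz[OF assms])
 also have "\<dots> <= 2 * (norm (p - q) + K * norm (p - q))"
  using norm_components[of "p - q"] \<delta>_le(5) by (intro mult_left_mono add_mono) auto
 finally show ?thesis by (simp add: algebra_simps)
qed

lemma hp_O: "hp (0, 0) = 0"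
 by (simp add: hp_def ht_0)

lemma hp_axis: "hp (0, s) = s"
 by (simp add: hp_def ht_0)

lemma rr_lipschitz:
 assumes "norm p < \<delta>" "norm q < \<delta>"
 shows "\<bar>rr p - rr q\<bar> <= 2 * (1 + K) * C * norm (p - q)"
proof -
 have "fst (E p T) \<in> {-R..R}" "fst (E q T) \<in> {-R..R}"
  using E_box[OF assms(1), of T] E_box[OF assms(2), of T] \<tau> by (auto simp: mem_Times_iff)
 from hp_lipschitz[OF this] have "\<bar>rr p - rr q\<bar> <= 2 * (1 + K) * norm (E p T - E q T)" by (simp add: rr_def)
 also have "\<dots> <= 2 * (1 + K) * (C * norm (p - q))"
  using E_lip[OF assms, of T] T_pos \<tau> \<delta>_le(5) by (intro mult_left_mono) auto
 finally show ?thesis by (simp add: mult.assoc)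
qed

lemma rr_O: "rr (0, 0) = 0"
 using E_O[of T] T_pos orb_T[of 0] orb_0 by (simp add: rr_def hp_O)

section \<open>The two sides of the grazing orbit in terms of levels\<close>

lemma hp_on_L: "q \<in> L ==> snd q < 2 * y1 ==> hp q = 0"
proof -
 assume q: "q \<in> L" "snd q < 2 * y1"
 then obtain s where s: "q = orb s" using range_orb by auto
 \<comment> \<open>The representative of \<open>s\<close> modulo \<open>T\<close> between
   \<open>- \<tau>\<close> and \<open>T - \<tau>\<close>. The height bound excludes the times from
   \<open>\<tau>\<close> on, so the point is on the piece through the origin.\<close>
 define t where "t = s + \<tau> - of_int \<lfloor>(s + \<tau>) / T\<rfloor> * T - \<tau>"
 have "of_int \<lfloor>(s + \<tau>) / T\<rfloor> <= (s + \<tau>) / T" "(s + \<tau>) / T < of_int \<lfloor>(s + \<tau>) / T\<rfloor> + 1" by linarith+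
 then have "of_int \<lfloor>(s + \<tau>) / T\<rfloor> * T <= s + \<tau>" "s + \<tau> < (of_int \<lfloor>(s + \<tau>) / T\<rfloor> + 1) * T"
  unfolding pos_le_divide_eq[OF T_pos] pos_divide_less_eq[OF T_pos] by auto
 then have t: "- \<tau> <= t" "t < T - \<tau>" by (auto simp: t_def algebra_simps)
 have "\<exists>k::int. t = s + of_int k * T"
  by (rule exI[of _ "- \<lfloor>(s + \<tau>) / T\<rfloor>"]) (simp add: t_def)
 then have "orb s = orb t" using periodic_solution_eq_iff[OF per] by blast
 with s have qt: "q = orb t" by simp
 have "t < \<tau>" using far[of t] q t qt by force
 have "orb ` {-\<tau>..\<tau>} \<subseteq> box_R"
 proof (rule image_subsetI)
  fix t assume "t \<in> {-\<tau>..\<tau>}"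
  then have "\<bar>t\<bar> <= 4 * \<tau>" by auto
  from near[OF this] R_pos R_le show "orb t \<in> box_R" by (auto simp: mem_Times_iff)
 qed
 from ht_constant_on_orbit[OF orb_sol this, of 0 t] t \<open>t < \<tau>\<close>
 show ?thesis by (simp add: qt hp_def orb_0 ht_0)
qed

lemma hp_eq_0_imp_L:
 assumes "norm q < \<delta>" "hp q = 0"
 shows "q \<in> L"
proof (cases "fst q <= 0")
 case True
 then obtain t where "0 <= t" "E (0, 0) t = q"
  using reach[of "(0, 0)" q] assms pos hp_O by (auto simp: zero_prod_def[symmetric])
 then show ?thesis using E_O range_orb by auto
next
 case False
 then obtain t where t: "0 <= t" "E q t = (0, 0)"
  using reach[of q "(0, 0)"] assms pos hp_O by (auto simp: zero_prod_def[symmetric])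
 have "(0, 0) \<in> L" using range_orb orb_0 by (metis rangeI)
 with orbit_off_L[OF E_sol'[OF assms(1), of 0 t], of t] t E_0[OF assms(1)] show ?thesis by auto
qed

text \<open>The vertical half-line below \<open>p\<close> carries only negative levels, hence misses
  \<open>L\<close>, and it is unbounded, while the inside is bounded.\<close>

lemma below_not_inside:
 assumes "\<bar>fst p\<bar> <= R" "snd p < 2 * y1" "hp p < 0"
 shows "cplx p \<notin> inside (cplx ` L)"
proof
 assume "cplx p \<in> inside (cplx ` L)"
 define A where "A = {q :: plane. fst q = fst p & snd q <= snd p}"
 have x: "fst p \<in> {-R..R}" using assms by auto
 have "A = (%y. (fst p, y)) ` {..snd p}" by (auto simp: A_def image_iff prod_eq_iff)
 moreover have "connected ((%y. (fst p, y)) ` {..snd p})"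
  by (intro connected_continuous_image continuous_intros) auto
 ultimately have "connected A" by simp
 moreover have "A \<inter> L = {}"
 proof -
  have "q \<notin> L" if q: "q \<in> A" for q
  proof
   assume "q \<in> L"
   then have "hp q = 0" using hp_on_L q assms by (auto simp: A_def)
   moreover have "hp q <= hp p" using q ht_le_iff[OF x] by (auto simp: A_def hp_def)
   ultimately show False using assms by simp
  qed
  then show ?thesis by blast
 qed
 moreover have "p \<in> A" by (simp add: A_def)
 ultimately have sub: "cplx q \<in> inside (cplx ` L)" if "q \<in> A" for q
  using connected_inside \<open>cplx p \<in> _\<close> that by blast
 have "bounded (inside (cplx ` L))"
  using Jordan_inside_outside[OF periodic_path(1,2)[OF per]] periodic_path(3)[OF per] range_orb by simp
 then obtain B where B: "\<And>z. z \<in> inside (cplx ` L) ==> norm z <= B" unfolding bounded_iff by blast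
 define q where "q = (fst p, min (snd p) (- \<bar>B\<bar> - 1))"
 have "q \<in> A" by (simp add: q_def A_def)
 from B[OF sub[OF this]] have "\<bar>snd q\<bar> <= B" using abs_Im_le_cmod[of "cplx q"] by simp
 then show False by (auto simp: q_def)
qed

text \<open>The origin is a frontier point of the inside, so some inside point \<open>q\<close> is
  close to it, and its level is positive. Two vertical segments and a horizontal one at height
  \<open>y1\<close> form an arch from \<open>q\<close> to \<open>p\<close>; its points have positive
  level and height below \<open>2 * y1\<close>, so it avoids \<open>L\<close>.\<close>

lemma above_inside:
 assumes "\<bar>fst p\<bar> < \<delta>" "snd p <= y1" "hp p > 0"
 shows "cplx p \<in> inside (cplx ` L)"
proof -
 have "frontier (inside (cplx ` L)) = cplx ` L"
  using Jordan_inside_outside[OF periodic_path(1,2)[OF per]] periodic_path(3)[OF per] range_orb by simp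
 moreover have "0 \<in> cplx ` L" using range_orb orb_0 by (metis cplx_simps(4) imageI rangeI)
 ultimately have "0 \<in> closure (inside (cplx ` L))" by (auto simp: frontier_def)
 then obtain z where z: "z \<in> inside (cplx ` L)" "dist z 0 < \<delta>"
  using pos unfolding closure_approachable by blast
 obtain q where q: "z = cplx q" using cplx_surj by blast
 have "norm q = norm z" unfolding q by (simp add: norm_prod_def cmod_def)
 then have nq: "norm q < \<delta>" using z by simp
 then have fq: "\<bar>fst q\<bar> < \<delta>" and sq: "snd q <= y1" using norm_components[of q] \<delta>_le by auto
 have "q \<notin> L" using z q inside_no_overlap[of "cplx ` L"] by blast
 then have "hp q ~= 0" using hp_eq_0_imp_L nq by blast
 moreover have "\<not> hp q < 0" using below_not_inside[of q] z q fq sq \<delta>_le pos by auto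
 ultimately have hq: "hp q > 0" by simp
 define V where "V a = {(fst a, y) | y. snd a <= y & y <= y1}" for a :: plane
 define W where "W = {(x, y1) | x. \<bar>x\<bar> < \<delta>}"
 have y1_pos: "ht x y1 > 0" if "\<bar>x\<bar> < \<delta>" for x
 proof -
  have x: "x \<in> {-R..R}" using that \<delta>_le by auto
  have "\<bar>\<Phi> 0 0 x - \<Phi> 0 0 0\<bar> <= K * \<bar>x - 0\<bar>" by (rule Phi_lipschitz[OF zero_mem x zero_mem])
  also have "\<dots> <= K * \<delta>" using that \<delta>_le by (intro mult_left_mono) auto
  also have "\<dots> < y1" by (rule small_\<delta>)
  finally have "\<Phi> 0 0 x < y1" using Phi_start[OF zero_mem] by simp
  then have "ht x (\<Phi> 0 0 x) < ht x y1" using ht_less_iff[OF x] by simp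
  then show ?thesis using ht_Phi[OF x zero_mem] by (simp add: ht_0)
 qed
 have cV: "connected (V a)" for a
 proof -
  have "V a = (%y. (fst a, y)) ` {snd a..y1}" by (auto simp: V_def)
  moreover have "connected ((%y. (fst a, y)) ` {snd a..y1})"
   by (intro connected_continuous_image continuous_intros) auto
  ultimately show ?thesis by simp
 qed
 have cW: "connected W"
 proof -
  have "W = (%x. (x, y1)) ` {-\<delta><..<\<delta>}" by (auto simp: W_def abs_less_iff)
  moreover have "connected ((%x. (x, y1)) ` {-\<delta><..<\<delta>})"
   by (intro connected_continuous_image continuous_intros) auto
  ultimately show ?thesis by simp
 qed
 have VL: "V a \<inter> L = {}" if a: "\<bar>fst a\<bar> < \<delta>" "hp a > 0" for a
 proof -
  have x: "fst a \<in> {-R..R}" using a \<delta>_le by auto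
  have "(fst a, y) \<notin> L" if "snd a <= y" "y <= y1" for y
  proof
   assume "(fst a, y) \<in> L"
   then have "hp (fst a, y) = 0" using hp_on_L that pos by auto
   moreover have "hp a <= hp (fst a, y)" using ht_le_iff[OF x] that by (simp add: hp_def)
   ultimately show False using a by simp
  qed
  then show ?thesis by (auto simp: V_def)
 qed
 have WL: "W \<inter> L = {}"
 proof -
  have "(x, y1) \<notin> L" if "\<bar>x\<bar> < \<delta>" for x
   using hp_on_L[of "(x, y1)"] y1_pos[OF that] pos by (auto simp: hp_def)
  then show ?thesis by (auto simp: W_def)
 qed
 have top: "(fst a, y1) \<in> V a \<inter> W" "a \<in> V a" if "\<bar>fst a\<bar> < \<delta>" "snd a <= y1" for a
  using that by (auto simp: V_def W_def) (metis prod.collapse order_refl)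
 have "connected (V q \<union> W)" by (rule connected_Un[OF cV cW]) (use top[OF fq sq] in auto)
 then have "connected ((V q \<union> W) \<union> V p)" by (rule connected_Un[OF _ cV]) (use top[OF assms(1,2)] in auto)
 moreover have "((V q \<union> W) \<union> V p) \<inter> L = {}" using VL[OF fq hq] VL[OF assms(1,3)] WL by blast
 ultimately show ?thesis
  using connected_inside[of "(V q \<union> W) \<union> V p" q p] top(2)[OF fq sq] top(2)[OF assms(1,2)] z q by blast
qed

text \<open>Otherwise the orbit would lead from the outside to the inside of \<open>L\<close>
  without meeting \<open>L\<close>.\<close>

lemma rr_nonpos:
 assumes p: "C * norm p < \<delta>" and "hp p < 0"
 shows "rr p <= 0"
proof (rule ccontr)
 assume "\<not> rr p <= 0"
 then have pos_r: "hp (E p T) > 0" by (simp add: rr_def)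
 have n: "norm p < \<delta>" "norm (E p T) < \<delta>" using E_T_small[OF p] by auto
 have ps: "\<bar>fst p\<bar> <= R" "snd p < 2 * y1" using norm_components[of p] n \<delta>_le pos by auto
 have in_q: "cplx (E p T) \<in> inside (cplx ` L)"
  by (rule above_inside) (use norm_components[of "E p T"] n pos_r \<delta>_le in auto)
 have "p \<notin> L" using hp_on_L[of p] ps assms by auto
 have "connected (E p ` {0..T})"
  by (intro connected_continuous_image solves_continuous_on[OF E_sol'[OF n(1)]]) auto
 moreover have "E p ` {0..T} \<inter> L = {}"
  using orbit_off_L[OF E_sol'[OF n(1), of 0 T]] \<open>p \<notin> L\<close> E_0[OF n(1)] by auto
 moreover have "p \<in> E p ` {0..T}" using E_0[OF n(1)] T_pos by (metis atLeastAtMost_iff image_eqI less_imp_le order_refl)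
 ultimately have "cplx p \<in> inside (cplx ` L)"
  using connected_inside[OF _ _ _ _ in_q] T_pos by auto
 with below_not_inside[OF ps assms(2)] show False by blast
qed

section \<open>The return map as a map of levels\<close>

definition r :: "real => real" where
 "r s = rr (0, s)"

lemma norm_axis: "norm (0 :: real, s :: real) = \<bar>s\<bar>"
 by (simp add: norm_Pair)

lemma rr_eq_r: "norm p < \<delta> ==> \<bar>hp p\<bar> < \<delta> ==> rr p = r (hp p)"
 unfolding r_def by (rule rr_cong) (auto simp: norm_axis hp_axis)

lemma r_lipschitz: "\<bar>s\<bar> < \<delta> ==> \<bar>s'\<bar> < \<delta> ==> \<bar>r s - r s'\<bar> <= 2 * (1 + K) * C * \<bar>s - s'\<bar>"
 using rr_lipschitz[of "(0, s)" "(0, s')"] by (simp add: r_def norm_axis)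

lemma r_0: "r 0 = 0"
 by (simp add: r_def rr_O)

text \<open>A continuous injective map of an interval is strictly monotone, and
  \<open>rr_nonpos\<close> at \<open>- \<sigma>\<close> together with \<open>r 0 = 0\<close>
  excludes the decreasing case.\<close>

lemma r_strict_mono:
 assumes "C * \<bar>s\<bar> < \<delta>" "C * \<bar>s'\<bar> < \<delta>" "s < s'"
 shows "r s < r s'"
proof -
 define \<sigma> where "\<sigma> = max \<bar>s\<bar> \<bar>s'\<bar>"
 have \<sigma>: "C * \<sigma> < \<delta>" "\<sigma> > 0" using assms by (auto simp: \<sigma>_def max_def)
 have C: "C * \<bar>u\<bar> < \<delta>" "\<bar>u\<bar> < \<delta>" if "u \<in> {-\<sigma>..\<sigma>}" for u
 proof -
  have "C * \<bar>u\<bar> <= C * \<sigma>" using that pos by (intro mult_left_mono) auto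
  with \<sigma> show *: "C * \<bar>u\<bar> < \<delta>" by simp
  have "1 * \<bar>u\<bar> <= C * \<bar>u\<bar>" using pos by (intro mult_right_mono) auto
  with * show "\<bar>u\<bar> < \<delta>" by simp
 qed
 have "(2 * (1 + K) * C)-lipschitz_on {-\<sigma>..\<sigma>} r"
  using r_lipschitz C \<delta>_le(5) pos by (intro lipschitz_onI) (auto simp: dist_real_def)
 then have "continuous_on {-\<sigma>..\<sigma>} r" by (rule lipschitz_on_continuous_on)
 moreover have "inj_on r {-\<sigma>..\<sigma>}"
 proof (rule inj_onI)
  fix u v assume "u \<in> {-\<sigma>..\<sigma>}" "v \<in> {-\<sigma>..\<sigma>}" "r u = r v"
  then have "(0, u) = (0 :: real, v)" using C by (intro rr_inj) (auto simp: norm_axis r_def)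
  then show "u = v" by simp
 qed
 ultimately have "strict_mono_on {-\<sigma>..\<sigma>} r \<or> strict_antimono_on {-\<sigma>..\<sigma>} r"
  using injective_eq_monotone_map[of "{-\<sigma>..\<sigma>}" r] by (auto simp: is_interval_cc)
 moreover have "\<not> strict_antimono_on {-\<sigma>..\<sigma>} r"
 proof
  assume "strict_antimono_on {-\<sigma>..\<sigma>} r"
  from monotone_onD[OF this, of "-\<sigma>" 0] have "r 0 < r (-\<sigma>)" using \<sigma> by auto
  moreover have "r (-\<sigma>) <= 0"
   unfolding r_def using C[of "-\<sigma>"] \<sigma> by (intro rr_nonpos) (auto simp: norm_axis hp_axis)
  ultimately show False using r_0 by simp
 qed
 ultimately have "strict_mono_on {-\<sigma>..\<sigma>} r" by blast
 then show ?thesis by (rule monotone_onD) (use assms(3) in \<open>auto simp: \<sigma>_def\<close>)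
qed

lemma return_to_axis:
 assumes "C * \<bar>s\<bar> < \<delta>"
 obtains t where "T - \<tau> <= t" "E (0, s) t = (0, r s)"
proof -
 have s: "norm (0 :: real, s) < \<delta>" using E_T_small[of "(0, s)"] assms by (simp add: norm_axis)
 have "\<bar>fst (E (0, s) (T - \<tau>)) - fst (orb (T - \<tau>))\<bar> < C * \<delta>"
  "\<bar>fst (E (0, s) (T + \<tau>)) - fst (orb (T + \<tau>))\<bar> < C * \<delta>"
  using E_close'(1)[OF s] \<tau> by auto
 then have "fst (E (0, s) (T - \<tau>)) > 0" "fst (E (0, s) (T + \<tau>)) < 0"
  using x2 small_\<delta> orb_T[of \<tau>] orb_T[of "- \<tau>"] pos by (auto simp: add.commute)
 then have "\<exists>t\<ge>T - \<tau>. t <= T + \<tau> & fst (E (0, s) t) = 0"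
  using \<tau> by (intro IVT2') (auto intro!: E_fst_continuous[OF s])
 then obtain t where t: "T - \<tau> <= t" "t <= T + \<tau>" "fst (E (0, s) t) = 0" by blast
 have "hp (E (0, s) t) = r s" using hp_return[OF s, of t] t \<tau> by (simp add: r_def)
 then have "E (0, s) t = (0, r s)"
  using hp_eq_imp_eq[of "(0, r s)" "E (0, s) t"] t R_pos by (simp add: hp_axis)
 with t that show ?thesis by blast
qed

text \<open>Otherwise the iterates of the return map would stay away from the stable orbit.\<close>

lemma r_less:
 obtains \<sigma> where "\<sigma> > 0" "C * \<sigma> < \<delta>" "\<And>s. 0 < s ==> s < \<sigma> ==> r s < s"
proof -
 define B where "B = 2 * (1 + K) * C"
 have B: "B > 0" using \<delta>_le(5) pos by (simp add: B_def)
 define \<sigma>1 where "\<sigma>1 = min (\<delta> / (2 * C)) (y1 / B)"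
 have \<sigma>1: "\<sigma>1 > 0" "B * \<sigma>1 <= y1" using pos B by (auto simp: \<sigma>1_def min_def field_simps)
 have "C * \<sigma>1 <= C * (\<delta> / (2 * C))" using pos by (intro mult_left_mono) (auto simp: \<sigma>1_def)
 then have C\<sigma>1: "C * \<sigma>1 < \<delta>" using pos by simp
 have "1 * \<sigma>1 <= C * \<sigma>1" using \<sigma>1 pos by (intro mult_right_mono) auto
 with C\<sigma>1 have "\<sigma>1 < \<delta>" by simp
 have notL: "(0, s) \<notin> L" if "0 < s" "s <= y1" for s
  using hp_on_L[of "(0, s)"] that pos by (auto simp: hp_axis)
 have "closed L" using compact_L compact_imp_closed by blast
 have L_ne: "L ~= {}" using range_orb by auto
 have dist_pos: "\<exists>d>0. \<forall>s. a <= s & s <= y1 --> d <= infdist (0, s) L" if a: "0 < a" "a <= y1" for a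
 proof -
  have "continuous_on {a..y1} (%s. infdist (0 :: real, s) L)" by (intro continuous_intros)
  then obtain m where m: "m \<in> {a..y1}" "\<And>s. s \<in> {a..y1} ==> infdist (0, m) L <= infdist (0, s) L"
   using continuous_attains_inf[of "{a..y1}" "%s. infdist (0 :: real, s) L"] a(2) by auto
  have "infdist (0, m) L > 0"
   using notL[of m] m that infdist_pos_not_in_closed[OF \<open>closed L\<close> L_ne] by auto
  with m show ?thesis by (intro exI[of _ "infdist (0, m) L"]) auto
 qed
 obtain d where d: "d > 0" "\<And>s. \<sigma>1 <= s ==> s <= y1 ==> d <= infdist (0, s) L"
  using dist_pos[of \<sigma>1] \<sigma>1 \<open>\<sigma>1 < \<delta>\<close> \<delta>_le by auto
 \<comment> \<open>A tube around \<open>L\<close> that contains no \<open>(0, s)\<close> with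
   \<open>\<sigma>1 \<le> s \<le> y1\<close>: an iterate of \<open>r\<close> in it that does not
   exceed \<open>y1\<close> is below \<open>\<sigma>1\<close> again, where \<open>r\<close> is
   monotone.\<close>
 define W where "W = {p :: plane. infdist p L < d}"
 have "open W" unfolding W_def by (intro open_Collect_less continuous_intros)
 moreover have "L \<subseteq> W" using d by (auto simp: W_def)
 ultimately obtain V where V: "open V" "L \<subseteq> V"
  "\<And>p. p \<in> V ==> \<exists>\<eta>. solves Z \<eta> {0..} & \<eta> 0 = p & (\<forall>t\<ge>0. \<eta> t \<in> W) & ((%t. infdist (\<eta> t) L) \<longlongrightarrow> 0) at_top"
  using stable unfolding stable_limit_cycle_def by meson
 have "(0, 0) \<in> V" using V range_orb orb_0 by (metis rangeI subsetD)
 then obtain e where e: "e > 0" "ball (0, 0) e \<subseteq> V" using V(1) openE by blast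
 define \<sigma> where "\<sigma> = min \<sigma>1 e"
 have "r s < s" if s: "0 < s" "s < \<sigma>" for s
 proof (rule ccontr)
  assume rs: "\<not> r s < s"
  have sd: "norm (0 :: real, s) < \<delta>" using s \<open>\<sigma>1 < \<delta>\<close> by (auto simp: norm_axis \<sigma>_def)
  have "(0, s) \<in> V" using e s by (auto simp: \<sigma>_def dist_norm norm_axis subset_iff)
  then obtain \<eta> where \<eta>: "solves Z \<eta> {0..}" "\<eta> 0 = (0, s)" "\<And>t. t >= 0 ==> \<eta> t \<in> W"
   "((%t. infdist (\<eta> t) L) \<longlongrightarrow> 0) at_top" using V(3) by blast
  have \<eta>E: "\<eta> t = E (0, s) t" if "t >= 0" for t
   using solves_unique[OF smooth_f smooth_g solves_subset[OF \<eta>(1), of "{0..t}"] E_sol'[OF sd, of 0 t], of 0 t]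
    \<eta>(2) E_0[OF sd] that by auto
  have small: "C * \<bar>u\<bar> < \<delta>" if "0 < u" "u < \<sigma>1" for u
  proof -
   have "C * \<bar>u\<bar> <= C * \<sigma>1" using that pos by (intro mult_left_mono) auto
   with C\<sigma>1 show ?thesis by linarith
  qed
  \<comment> \<open>If \<open>s \<le> r s\<close>, monotonicity keeps every iterate at or above
    \<open>s\<close>. Each return takes at least \<open>T - \<tau> \<ge> T / 2\<close>, so such
    points occur at arbitrarily late times, against convergence to \<open>L\<close>.\<close>
  have iter: "\<exists>t u. t >= real n * (T / 2) & s <= u & u < \<sigma>1 & E (0, s) t = (0, u)" for n :: nat
  proof (induction n)
   case 0
   show ?case using E_0[OF sd] s by (intro exI[of _ 0] exI[of _ s]) (auto simp: \<sigma>_def)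
  next
   case (Suc n)
   then obtain t u where tu: "t >= real n * (T / 2)" "s <= u" "u < \<sigma>1" "E (0, s) t = (0, u)" by blast
   have t0: "t >= 0" using tu(1) T_pos by (meson divide_nonneg_pos less_imp_le mult_nonneg_nonneg of_nat_0_le_iff order_trans zero_less_numeral)
   have Cu: "C * \<bar>u\<bar> < \<delta>" using small[of u] tu s by simp
   obtain t' where t': "T - \<tau> <= t'" "E (0, u) t' = (0, r u)" by (rule return_to_axis[OF Cu])
   have t'0: "t' >= 0" using t' \<tau> by linarith
   have ud: "norm (0 :: real, u) < \<delta>" using E_T_small[of "(0, u)"] Cu by (simp add: norm_axis)
   have Es: "E (0, s) (t' + t) = (0, r u)" using E_shift[OF sd ud t0 tu(4) t'0] t'(2) by simp
   have "r s <= r u"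
   proof (cases "s = u")
    case False
    then show ?thesis using r_strict_mono[of s u] small[of s] small[of u] tu s
     by (auto simp: \<sigma>_def)
   qed auto
   then have ru: "s <= r u" using rs by simp
   have "\<bar>r u - r 0\<bar> <= B * \<bar>u - 0\<bar>"
    unfolding B_def using tu s \<open>\<sigma>1 < \<delta>\<close> pos by (intro r_lipschitz) auto
   also have "\<dots> <= B * \<sigma>1" using tu s B by (intro mult_left_mono) auto
   finally have "r u <= y1" using \<sigma>1(2) r_0 by auto
   moreover have "(0, r u) \<in> W" using \<eta>(3)[of "t' + t"] \<eta>E[of "t' + t"] Es t0 t'0 by simp
   ultimately have "r u < \<sigma>1" using d(2)[of "r u"] by (force simp: W_def)
   moreover have "real (Suc n) * (T / 2) <= t' + t" using tu(1) t'(1) \<tau> by (simp add: field_simps)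
   ultimately show ?case using ru Es by blast
  qed
  obtain d2 where d2: "d2 > 0" "\<And>u. s <= u ==> u <= y1 ==> d2 <= infdist (0, u) L"
   using dist_pos[of s] s \<open>\<sigma>1 < \<delta>\<close> \<delta>_le by (auto simp: \<sigma>_def)
  have "\<forall>\<^sub>F t in at_top. infdist (\<eta> t) L < d2" using \<eta>(4) d2(1) by (rule order_tendstoD)
  then obtain t0 where t0: "\<And>t. t >= t0 ==> infdist (\<eta> t) L < d2" unfolding eventually_at_top_linorder by blast
  obtain n :: nat where n: "real n * (T / 2) > max t0 0"
   using reals_Archimedean3[of "T / 2"] T_pos by auto
  obtain t u where tu: "t >= real n * (T / 2)" "s <= u" "u < \<sigma>1" "E (0, s) t = (0, u)" using iter by blast
  have "infdist (0, u) L < d2" using t0[of t] \<eta>E[of t] tu n by auto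
  with d2(2)[of u] tu \<open>\<sigma>1 < \<delta>\<close> \<delta>_le show False by auto
 qed
 moreover have "C * \<sigma> < \<delta>"
 proof -
  have "C * \<sigma> <= C * \<sigma>1" using pos by (intro mult_left_mono) (auto simp: \<sigma>_def)
  with C\<sigma>1 show ?thesis by simp
 qed
 ultimately show ?thesis using that[of \<sigma>] e \<sigma>1 by (auto simp: \<sigma>_def)
qed

end

text \<open>Stability, applied with \<open>U\<close> as the neighbourhood, supplies forward orbits
  that stay in a bounded set; one Lipschitz constant on a ball around \<open>U\<close> then gives
  the dependence on initial values by Gronwall.\<close>

lemma (in grazing_orbit) return_setup_exists:
 obtains \<rho> R Lc K \<tau> x2 y1 C \<delta> E where "return_setup U L f g orb T \<rho> R Lc K \<tau> x2 y1 C \<delta> E"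
proof -
 obtain \<rho>0 where \<rho>0: "\<rho>0 > 0"
  "\<And>\<rho>. 0 < \<rho> ==> \<rho> <= \<rho>0 ==>
   \<exists>L K. L > 0 & K > 0 & (\<forall>R. 0 < R --> R <= \<rho> --> 16 * R * L <= 1 --> flow_box f g \<rho> R L K)"
  by (rule flow_box_exists[OF smooth_f smooth_g f_O_neg]) (rule that)
 have "isCont (dx g) (0, 0)" using smooth_isCont[OF smooth_dx[OF smooth_g]] .
 then have "\<forall>\<^sub>F p in at (0, 0). dx g p < 0"
  unfolding isCont_def using gx_O_neg by (rule order_tendstoD)
 then obtain d where d: "d > 0" "\<And>p. p ~= (0, 0) ==> dist p (0, 0) < d ==> dx g p < 0"
  unfolding eventually_at by auto
 define \<rho> where "\<rho> = min \<rho>0 (d / 4)"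
 have \<rho>: "\<rho> > 0" "\<rho> <= \<rho>0" "\<rho> <= d / 4" using \<rho>0 d by (auto simp: \<rho>_def)
 have gx: "dx g (x, y) < 0" if "\<bar>x\<bar> <= \<rho>" "\<bar>y\<bar> <= \<rho>" for x y
 proof (cases "(x, y) = (0, 0)")
  case False
  have "dist (x, y) (0, 0) <= \<bar>x\<bar> + \<bar>y\<bar>"
   using norm_Pair_le[of x y] by (simp add: dist_norm zero_prod_def[symmetric])
  with that \<rho> d(1) have "dist (x, y) (0, 0) < d" by linarith
  with d(2) False show ?thesis by blast
 qed (use gx_O_neg in simp)
 obtain Lc K where LK: "Lc > 0" "K > 0" "\<And>R. 0 < R ==> R <= \<rho> ==> 16 * R * Lc <= 1 ==> flow_box f g \<rho> R Lc K"
  using \<rho>0(2)[OF \<rho>(1,2)] by blast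
 define R where "R = min \<rho> (1 / (16 * Lc))"
 have R: "0 < R" "R <= \<rho>" "16 * R * Lc <= 1"
 proof -
  have "R <= 1 / (16 * Lc)" by (simp add: R_def)
  then show "16 * R * Lc <= 1" using LK by (simp add: field_simps)
 qed (use \<rho> LK in \<open>auto simp: R_def\<close>)
 interpret fb: flow_box f g \<rho> R Lc K using LK(3)[OF R] .
 obtain d1 where d1: "d1 > 0" "\<And>t. \<bar>t\<bar> <= d1 ==> \<bar>fst (orb t)\<bar> < R / 2"
  by (rule near_0[of "%t. \<bar>fst (orb t)\<bar>" "R / 2"]) (use R in \<open>auto intro!: continuous_intros orb_continuous simp: orb_0\<close>)
 obtain d2 where d2: "d2 > 0" "\<And>t. \<bar>t\<bar> <= d2 ==> \<bar>snd (orb t)\<bar> < \<rho> / 2"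
  by (rule near_0[of "%t. \<bar>snd (orb t)\<bar>" "\<rho> / 2"]) (use \<rho> in \<open>auto intro!: continuous_intros orb_continuous simp: orb_0\<close>)
 define \<tau> where "\<tau> = min (min d1 d2 / 4) (T / 8)"
 have \<tau>: "\<tau> > 0" "8 * \<tau> <= T" "4 * \<tau> <= d1" "4 * \<tau> <= d2" using d1 d2 T_pos by (auto simp: \<tau>_def)
 have near: "\<bar>fst (orb t)\<bar> <= R / 2 & \<bar>snd (orb t)\<bar> <= \<rho> / 2" if "\<bar>t\<bar> <= 4 * \<tau>" for t
  using d1(2)[of t] d2(2)[of t] that \<tau> by auto
 have "orb ` {-\<tau>..\<tau>} \<subseteq> fb.box_R"
 proof (rule image_subsetI)
  fix t assume "t \<in> {-\<tau>..\<tau>}"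
  then have "\<bar>t\<bar> <= 4 * \<tau>" by auto
  from near[OF this] R show "orb t \<in> fb.box_R" by (auto simp: mem_Times_iff)
 qed
 from fb.fst_decreasing[OF orb_sol this] \<tau> have fst: "fst (orb \<tau>) < 0" "0 < fst (orb (- \<tau>))"
  using orb_0 by (metis fst_conv less_eq_real_def neg_less_0_iff_less order_refl)+
 define x2 where "x2 = min (- fst (orb \<tau>)) (fst (orb (- \<tau>))) / 4"
 have x2: "x2 > 0" "fst (orb \<tau>) < - 2 * x2" "fst (orb (- \<tau>)) > 2 * x2" using fst by (auto simp: x2_def)
 have "continuous_on {\<tau>..T - \<tau>} (%t. snd (orb t))" by (intro continuous_intros orb_continuous)
 then obtain m where m: "m \<in> {\<tau>..T - \<tau>}" "\<And>t. t \<in> {\<tau>..T - \<tau>} ==> snd (orb m) <= snd (orb t)"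
  using continuous_attains_inf[of "{\<tau>..T - \<tau>}" "%t. snd (orb t)"] \<tau> by auto
 have "snd (orb m) > 0"
 proof (rule ccontr)
  assume "\<not> snd (orb m) > 0"
  then have "orb 0 = orb m" using snd_orb_eq_0_iff[of m] snd_orb_nonneg[of m] orb_0 by simp
  then obtain k :: int where k: "m = 0 + of_int k * T" using periodic_solution_eq_iff[OF per] by blast
  have "\<tau> <= real_of_int k * T" "real_of_int k * T <= T - \<tau>" using m(1) unfolding k by auto
  then have "0 < real_of_int k * T" "real_of_int k * T < 1 * T" using \<tau> by linarith+
  then have "0 < k" "real_of_int k < 1" using T_pos by (auto simp: zero_less_mult_iff simp del: mult_1)
  then show False by linarith
 qed
 define y1 where "y1 = snd (orb m) / 2"
 have y1: "y1 > 0" "\<And>t. \<tau> <= t ==> t <= T - \<tau> ==> snd (orb t) >= 2 * y1"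
  using \<open>snd (orb m) > 0\<close> m by (auto simp: y1_def)
 obtain V where V: "open V" "L \<subseteq> V"
  "\<And>p. p \<in> V ==> \<exists>\<eta>. solves (upper_field f g) \<eta> {0..} & \<eta> 0 = p & (\<forall>t\<ge>0. \<eta> t \<in> U) \<and>
   ((%t. infdist (\<eta> t) L) \<longlongrightarrow> 0) at_top"
  using stable open_U L_U unfolding stable_limit_cycle_def by meson
 have "(0, 0) \<in> V" using V range_orb orb_0 by (metis rangeI subsetD)
 then obtain e where e: "e > 0" "ball (0, 0) e \<subseteq> V" using V(1) openE by blast
 define E where "E p = (SOME \<eta>. solves (upper_field f g) \<eta> {0..} & \<eta> 0 = p & (\<forall>t\<ge>0. \<eta> t \<in> U))" for p
 have E: "solves (upper_field f g) (E p) {0..} & E p 0 = p & (\<forall>t\<ge>0. E p t \<in> U)" if "norm p < e" for p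
 proof -
  have "p \<in> ball (0, 0) e" using that by (simp add: dist_norm norm_minus_commute flip: zero_prod_def)
  then have "p \<in> V" using e by blast
  from V(3)[OF this] have "\<exists>\<eta>. solves (upper_field f g) \<eta> {0..} & \<eta> 0 = p & (\<forall>t\<ge>0. \<eta> t \<in> U)" by blast
  from someI_ex[OF this] show ?thesis unfolding E_def .
 qed
 obtain B0 where B0: "U \<subseteq> cball 0 B0" using bounded_U unfolding bounded_iff by (auto simp: subset_iff)
 obtain B where B: "B > 0"
  "\<And>p q. p \<in> cball 0 B0 ==> q \<in> cball 0 B0 ==> norm (upper_field f g p - upper_field f g q) <= B * norm (p - q)"
  by (rule upper_field_lipschitz[OF smooth_f smooth_g compact_cball[of 0 B0] convex_cball[of 0 B0]]) (rule that)
 define C where "C = exp (B * (T + 4 * \<tau>))"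
 have C: "C >= 1" using B T_pos \<tau> by (simp add: C_def)
 have E_lip: "norm (E p t - E q t) <= C * norm (p - q)"
  if "norm p < e" "norm q < e" "0 <= t" "t <= T + 4 * \<tau>" for p q t
 proof -
  have "norm (E p t - E q t) <= exp (B * \<bar>t - 0\<bar>) * norm (E p 0 - E q 0)"
  proof (rule gronwall_solutions[where Z = "upper_field f g" and a = 0 and b = t and K = "cball 0 B0"])
   show "solves (upper_field f g) (E p) {0..t}" "solves (upper_field f g) (E q) {0..t}"
    using E[OF that(1)] E[OF that(2)] by (auto intro: solves_subset[of _ _ "{0..}"])
   show "E p ` {0..t} \<subseteq> cball 0 B0" "E q ` {0..t} \<subseteq> cball 0 B0"
    using E[OF that(1)] E[OF that(2)] B0 by (auto simp del: mem_cball)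
  qed (use B that in auto)
  also have "\<dots> <= C * norm (p - q)"
   using E[OF that(1)] E[OF that(2)] that(3,4) B unfolding C_def by (intro mult_mono) auto
  finally show ?thesis .
 qed
 \<comment> \<open>\<open>e\<close> guarantees the orbits \<open>E p\<close>, each further entry one
   margin; the last keeps the solution graph of level \<open>0\<close> below the height
   \<open>y1\<close>.\<close>
 define \<delta> where "\<delta> = Min {e, R / 2 / C, \<rho> / 2 / C, y1 / C, x2 / C, y1 / (2 * K)}"
 have \<delta>0: "\<delta> > 0" using e R \<rho> y1 x2 C LK by (auto simp: \<delta>_def)
 have \<delta>: "\<delta> <= e" "\<delta> <= R / 2 / C" "\<delta> <= \<rho> / 2 / C" "\<delta> <= y1 / C" "\<delta> <= x2 / C" "\<delta> <= y1 / (2 * K)"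
  unfolding \<delta>_def by (intro Min_le; simp)+
 show ?thesis
 proof (rule that[of \<rho> R Lc K \<tau> x2 y1 C \<delta> E], unfold_locales)
  show "C * \<delta> <= R / 2" "C * \<delta> <= \<rho> / 2" "C * \<delta> <= y1" "C * \<delta> <= x2"
   using \<delta>(2-5) C unfolding atomize_conj by (simp add: pos_le_divide_eq mult.commute mult.left_commute)
  have "K * \<delta> <= y1 / 2" using \<delta>(6) LK by (simp add: field_simps)
  with y1 show "K * \<delta> < y1" by simp
 qed (use gx \<tau> near y1 x2 \<delta>0 C E E_lip \<delta>(1) in \<open>auto\<close>)
qed

text \<open>In unshifted coordinates the perturbation by \<alpha> makes \<open>y = \<alpha>\<close>
  the switching line. The last clause keeps the arc in a tube around \<open>L\<close> whose radius
  is proportional to \<open>\<bar>x\<bar> + \<alpha>\<close>.\<close>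

definition landing_arc :: "(plane => real) => (plane => real) => plane set => real => real => real =>
  real => (real => plane) => real => bool" where
 "landing_arc f g L \<alpha> C x a \<eta> T \<longleftrightarrow> 0 < T & solves (upper_field f g) \<eta> {0..T} & \<eta> 0 = (x, \<alpha>) & \<eta> T = (a, \<alpha>) \<and>
  (\<forall>t. 0 < t & t < T --> snd (\<eta> t) > \<alpha>) & (\<forall>t. 0 <= t & t <= T --> infdist (\<eta> t) L <= C * (\<bar>x\<bar> + \<alpha>))"

text \<open>\<open>c\<close> is the tangency of the upper field with the line
  \<open>y = \<alpha>\<close> and \<open>A\<close> the return map from the left of \<open>c\<close>
  to its right. \<open>C\<close> will be uniform in \<alpha>, whereas the Lipschitz constant
  \<open>B\<close> of \<open>A\<close> may depend on \<alpha>.\<close>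

definition landing :: "(plane => real) => (plane => real) => plane set => real => real => real => real =>
  (real => real) => bool" where
 "landing f g L x0 \<alpha> C c A \<longleftrightarrow> \<bar>c\<bar> < x0 & \<bar>c\<bar> <= C * \<alpha> & g (c, \<alpha>) = 0 \<and>
  (\<forall>x. - x0 <= x & x < c --> g (x, \<alpha>) > 0) & (\<forall>x. c < x & x <= x0 --> g (x, \<alpha>) < 0) \<and>
  (\<forall>x. - x0 <= x & x <= c --> c < A x & (\<exists>\<eta> T. landing_arc f g L \<alpha> C x (A x) \<eta> T)) \<and>
  (\<forall>x x'. - x0 <= x & x < x' & x' <= c --> A x' < A x) \<and>
  (\<exists>B>0. \<forall>x x'. - x0 <= x & x <= c & - x0 <= x' & x' <= c --> \<bar>A x - A x'\<bar> <= B * \<bar>x - x'\<bar>)"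

section \<open>The landing map for a shifted switching line\<close>

context return_setup
begin

lemma g_decreasing:
 assumes "\<bar>y\<bar> <= \<rho>" "- \<rho> <= x" "x < x'" "x' <= \<rho>"
 shows "g (x', y) < g (x, y)"
proof (rule DERIV_neg_imp_decreasing[OF assms(3), where f = "%x. g (x, y)"])
 fix t assume t: "x <= t" "t <= x'"
 have "((%x. g (x, y)) has_real_derivative 1 * dx g (t, y) + 0 * dy g (t, y)) (at t)"
  by (rule smooth_chain[OF smooth_g]) auto
 moreover have "dx g (t, y) < 0" using gx_neg[of t y] assms t by auto
 ultimately show "\<exists>d. ((%x. g (x, y)) has_real_derivative d) (at t) & d < 0" by auto
qed

lemma g_slope:
 obtains k where "k > 0"
  "\<And>x x' y. \<bar>y\<bar> <= \<rho> ==> - \<rho> <= x ==> x <= x' ==> x' <= \<rho> ==> k * (x' - x) <= g (x, y) - g (x', y)"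
proof -
 let ?B = "{-\<rho>..\<rho>} \<times> {-\<rho>..\<rho>}"
 have \<rho>: "\<rho> > 0" using R_pos R_le by simp
 have "compact ?B" "?B ~= {}" using \<rho> by (auto intro: compact_Times)
 then obtain z where z: "z \<in> ?B" "\<And>p. p \<in> ?B ==> dx g p <= dx g z"
  using continuous_attains_sup[OF _ _ smooth_continuous_on[OF smooth_dx[OF smooth_g]], of ?B] by blast
 define k where "k = - dx g z"
 have k: "k > 0" using gx_neg[of "fst z" "snd z"] z(1) by (auto simp: k_def)
 show ?thesis
 proof (rule that[OF k])
  fix x x' y assume *: "\<bar>y\<bar> <= \<rho>" "- \<rho> <= x" "x <= x'" "x' <= \<rho>"
  have "g (x', y) + k * x' <= g (x, y) + k * x"
  proof (rule DERIV_nonpos_imp_nonincreasing[OF *(3), where f = "%x. g (x, y) + k * x"])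
   fix t assume t: "x <= t" "t <= x'"
   have "((%x. g (x, y)) has_real_derivative 1 * dx g (t, y) + 0 * dy g (t, y)) (at t)"
    by (rule smooth_chain[OF smooth_g]) auto
   then have "((%x. g (x, y) + k * x) has_real_derivative dx g (t, y) + k) (at t)"
    by (auto intro!: derivative_eq_intros)
   moreover have "(t, y) \<in> ?B" using * t by auto
   then have "dx g (t, y) + k <= 0" using z(2)[of "(t, y)"] by (simp add: k_def)
   ultimately show "\<exists>d. ((%x. g (x, y) + k * x) has_real_derivative d) (at t) & d <= 0" by blast
  qed
  then show "k * (x' - x) <= g (x, y) - g (x', y)" by (simp add: algebra_simps)
 qed
qed

text \<open>Let \<open>H x\<close> be the level of \<open>(x, \<alpha>)\<close>: it increases up to
  \<open>c\<close>, decreases after it, and \<open>H c \<ge> \<alpha> > 0\<close>. Since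
  \<open>r s < s\<close> for small \<open>s > 0\<close>, the return level \<open>r (H x)\<close>
  stays below the peak \<open>H c\<close>, so the returning orbit has to cross the line right of
  \<open>c\<close>, where \<open>H (A x) = r (H x)\<close>. The monotonicity of \<open>A\<close>
  follows from that of \<open>H\<close> and of \<open>r\<close>.\<close>

lemma landing_exists:
 obtains xb where "xb > 0"
  "\<And>x0. 0 < x0 ==> x0 <= xb ==> \<exists>ab>0. \<exists>C>0. \<forall>\<alpha>. 0 < \<alpha> & \<alpha> < ab --> (\<exists>c A. landing f g L x0 \<alpha> C c A)"
proof -
 have \<rho>: "\<rho> > 0" using R_pos R_le by simp
 obtain \<sigma> where \<sigma>: "\<sigma> > 0" "C * \<sigma> < \<delta>" "\<And>s. 0 < s ==> s < \<sigma> ==> r s < s" by (rule r_less) (rule that)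
 define B where "B = 2 * (1 + K)"
 have B: "B > 0" using \<delta>_le(5) by (simp add: B_def)
 obtain k where k: "k > 0"
  "\<And>x x' y. \<bar>y\<bar> <= \<rho> ==> - \<rho> <= x ==> x <= x' ==> x' <= \<rho> ==> k * (x' - x) <= g (x, y) - g (x', y)"
  by (rule g_slope) (rule that)
 obtain Lg where Lg: "Lg > 0"
  "\<And>p q. p \<in> cball 0 \<rho> ==> q \<in> cball 0 \<rho> ==> \<bar>g p - g q\<bar> <= Lg * norm (p - q)"
  by (rule smooth_lipschitz[OF smooth_g compact_cball[of 0 \<rho>] convex_cball[of 0 \<rho>]]) (rule that)
 define m where "m = min (\<delta> / (2 * C)) (\<sigma> / (2 * B))"
 have m: "m > 0" using pos \<sigma> B by (simp add: m_def)
 have p_small: "C * norm p < \<delta>" "norm p < \<delta>" "\<bar>hp p\<bar> < \<sigma>" if "norm p < m" for p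
 proof -
  have "C * norm p <= C * (\<delta> / (2 * C))" using that pos by (intro mult_left_mono) (auto simp: m_def)
  then show "C * norm p < \<delta>" using pos by simp
  then show n: "norm p < \<delta>" using E_T_small by blast
  have "\<bar>hp p - hp (0, 0)\<bar> <= B * norm (p - (0, 0))" unfolding B_def by (rule hp_lipschitz[OF fst_mem[OF n]]) (use R_pos in auto)
  also have "\<dots> <= B * (\<sigma> / (2 * B))" using that B by (intro mult_left_mono) (auto simp: m_def zero_prod_def[symmetric])
  also have "\<dots> < \<sigma>" using B \<sigma> by simp
  finally show "\<bar>hp p\<bar> < \<sigma>" by (simp add: hp_O)
 qed
 have \<sigma>_le: "\<bar>s\<bar> < \<sigma> ==> \<bar>s\<bar> < \<delta> & C * \<bar>s\<bar> < \<delta>" for s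
 proof -
  assume "\<bar>s\<bar> < \<sigma>"
  then have "C * \<bar>s\<bar> <= C * \<sigma>" using pos by (intro mult_left_mono) auto
  with \<sigma> have "C * \<bar>s\<bar> < \<delta>" by simp
  moreover have "1 * \<bar>s\<bar> <= C * \<bar>s\<bar>" using pos by (intro mult_right_mono) auto
  ultimately show ?thesis by simp
 qed
 show ?thesis
 proof (rule that[of "min (m / 2) (R / 2)"])
  show "min (m / 2) (R / 2) > 0" using m R_pos by simp
  fix x0 assume x0: "0 < x0" "x0 <= min (m / 2) (R / 2)"
  have x0R: "x0 <= R" "x0 <= \<rho>" "x0 <= m / 2" using x0 R_le R_pos by auto
  have "g (x0, 0) < 0" "g (- x0, 0) > 0"
   using g_decreasing[of 0 0 x0] g_decreasing[of 0 "- x0" 0] x0 x0R \<rho> g_O by auto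
  have ev: "\<forall>\<^sub>F y in at_right 0. P (g (x, y))" if "P = (%u. u < 0) \<or> P = (%u. u > 0)" "P (g (x, 0))" for P x
  proof -
   have "isCont (%y. g (x, y)) 0"
    by (rule isCont_o2[OF _ smooth_isCont[OF smooth_g]]) (intro continuous_intros)
   then have "((%y. g (x, y)) \<longlongrightarrow> g (x, 0)) (at_right 0)"
    unfolding isCont_def by (rule filterlim_mono) (auto simp: at_le)
   with that show ?thesis by (auto dest: order_tendstoD)
  qed
  have "\<forall>\<^sub>F y in at_right 0. g (x0, y) < 0 & g (- x0, y) > 0 & y < min (min (m / 2) y1) \<rho>"
   using ev[of "%u. u < 0" x0] ev[of "%u. u > 0" "- x0"] \<open>g (x0, 0) < 0\<close> \<open>g (- x0, 0) > 0\<close>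
    eventually_at_right_real[of 0 "min (min (m / 2) y1) \<rho>"] m pos \<rho>
   by (auto intro!: eventually_conj elim: eventually_mono)
  then obtain ab where ab: "ab > 0" "\<And>y. 0 < y ==> y < ab ==>
    g (x0, y) < 0 & g (- x0, y) > 0 & y < min (min (m / 2) y1) \<rho>"
   unfolding eventually_at_right_field by blast
  define C1 where "C1 = max C (Lg / k)"
  show "\<exists>ab>0. \<exists>C>0. \<forall>\<alpha>. 0 < \<alpha> & \<alpha> < ab --> (\<exists>c A. landing f g L x0 \<alpha> C c A)"
  proof (rule exI[of _ ab], intro conjI ab(1), rule exI[of _ C1], intro conjI allI impI)
   show "C1 > 0" using pos by (auto simp: C1_def)
   fix \<alpha> assume "0 < \<alpha> & \<alpha> < ab"
   then have \<alpha>: "0 < \<alpha>" "g (x0, \<alpha>) < 0" "g (- x0, \<alpha>) > 0" "\<alpha> < m / 2" "\<alpha> < y1" "\<alpha> < \<rho>"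
    using ab(2)[of \<alpha>] by auto
   have \<alpha>\<rho>: "\<bar>\<alpha>\<bar> <= \<rho>" using \<alpha> by simp
   have "continuous_on {- x0..x0} (%x. g (x, \<alpha>))"
    by (rule continuous_on_compose2[OF smooth_continuous_on[OF smooth_g, of UNIV]]) (auto intro!: continuous_intros)
   then have "\<exists>c\<ge>- x0. c <= x0 & g (c, \<alpha>) = 0"
    using \<alpha> x0 by (intro IVT2') auto
   then obtain c where c: "- x0 <= c" "c <= x0" "g (c, \<alpha>) = 0" by blast
   have c': "\<bar>c\<bar> < x0" using c \<alpha> by (cases "c = x0 \<or> c = - x0") auto
   have gpos: "g (x, \<alpha>) > 0" if "- \<rho> <= x" "x < c" for x
    using g_decreasing[OF \<alpha>\<rho> that] c x0R by auto
   have gneg: "g (x, \<alpha>) < 0" if "c < x" "x <= \<rho>" for x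
    using g_decreasing[OF \<alpha>\<rho> _ that] c x0R by auto
   have cC: "\<bar>c\<bar> <= C1 * \<alpha>"
   proof -
    have "\<bar>g (0, \<alpha>) - g (0, 0)\<bar> <= Lg * norm ((0 :: real, \<alpha>) - (0, 0))"
     using \<alpha> \<rho> by (intro Lg) (auto simp: norm_axis zero_prod_def[symmetric])
    then have "\<bar>g (0, \<alpha>)\<bar> <= Lg * \<alpha>" using \<alpha> by (simp add: g_O norm_axis)
    moreover have "k * \<bar>c\<bar> <= \<bar>g (0, \<alpha>)\<bar>"
     using k(2)[OF \<alpha>\<rho>, of 0 c] k(2)[OF \<alpha>\<rho>, of c 0] c x0R \<rho> by (cases "c >= 0") auto
    ultimately have "\<bar>c\<bar> <= Lg / k * \<alpha>" using k(1) by (simp add: field_simps)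
    also have "\<dots> <= C1 * \<alpha>" using \<alpha> by (intro mult_right_mono) (auto simp: C1_def)
    finally show ?thesis .
   qed
   define H where "H x = ht x \<alpha>" for x
   have sl: "slope f g \<rho> x \<alpha> = g (x, \<alpha>) / f (x, \<alpha>)" for x by (rule slope_eq[OF \<alpha>\<rho>])
   have fn: "f (x, \<alpha>) < 0" if "\<bar>x\<bar> <= R" for x using f_neg[of x \<alpha>] that R_le \<alpha>\<rho> by auto
   have inc: "H x < H x'" if "- R <= x" "x < x'" "x' <= c" for x x'
   proof -
    have "g (t, \<alpha>) > 0 & f (t, \<alpha>) < 0" if t: "x < t" "t < x'" for t
     using gpos[of t] fn[of t] t \<open>- R <= x\<close> \<open>x' <= c\<close> R_le c x0R by auto
    then have "0 < 1 * (0 - slope f g \<rho> t \<alpha>)" if "x < t" "t < x'" for t using that by (simp add: sl divide_pos_neg)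
    from level_slope(2)[where w = "%_. \<alpha>" and w' = "%_. 0" and s = 1 and k = 0, OF that(2) _ _ _ _ _ less_imp_le[OF this] this] that c x0R
    show ?thesis by (simp add: H_def)
   qed
   have dec: "H x' < H x" if "c <= x" "x < x'" "x' <= R" for x x'
   proof -
    have "g (t, \<alpha>) < 0 & f (t, \<alpha>) < 0" if t: "x < t" "t < x'" for t
     using gneg[of t] fn[of t] t \<open>c <= x\<close> \<open>x' <= R\<close> R_le c x0R by auto
    then have "0 < - 1 * (0 - slope f g \<rho> t \<alpha>)" if "x < t" "t < x'" for t using that by (simp add: sl divide_neg_neg)
    from level_slope(2)[where w = "%_. \<alpha>" and w' = "%_. 0" and s = "- 1" and k = 0, OF that(2) _ _ _ _ _ less_imp_le[OF this] this] that c x0R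
    show ?thesis by (simp add: H_def)
   qed
   have Hc: "H c >= \<alpha>"
    using inc[of 0 c] dec[of c 0] R_pos by (cases c "0 :: real" rule: linorder_cases) (auto simp: H_def ht_0)
   have pn: "norm (x, \<alpha>) < m" if "\<bar>x\<bar> <= x0" for x
    using norm_Pair_le[of x \<alpha>] that \<alpha> x0R by auto
   have hpH: "hp (x, \<alpha>) = H x" for x by (simp add: hp_def H_def)
   have rH: "rr (x, \<alpha>) = r (H x)" "\<bar>H x\<bar> < \<sigma>" if "\<bar>x\<bar> <= x0" for x
    using p_small[OF pn[OF that]] rr_eq_r[of "(x, \<alpha>)"] \<sigma>_le by (auto simp: hpH)
   have rHc: "r (H x) < H c" if "- x0 <= x" "x <= c" for x
   proof (cases "H x > 0")
    case True
    have "\<bar>x\<bar> <= x0" using that c' by auto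
    then have "r (H x) < H x" using \<sigma>(3)[OF True] rH(2)[of x] by auto
    also have "H x <= H c" using inc[of x c] that x0R by (cases "x = c") auto
    finally show ?thesis .
   next
    case False
    have "\<bar>x\<bar> <= x0" using that c' by auto
    then have "C * \<bar>H x\<bar> < \<delta>" using \<sigma>_le rH(2) by blast
    from r_strict_mono[OF this, of 0] have "H x < 0 ==> r (H x) < r 0" using pos by simp
    then have "r (H x) <= r 0" using False by (cases "H x = 0") auto
    with r_0 Hc \<alpha> show ?thesis by simp
   qed
   have "\<exists>a \<eta> T. c < a & a <= R & H a = r (H x) & landing_arc f g L \<alpha> C1 x a \<eta> T"
    if x: "- x0 <= x" "x <= c" for x
   proof -
    let ?p = "(x, \<alpha>)"
    have xx0: "\<bar>x\<bar> <= x0" using x c' by auto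
    have p: "norm ?p < \<delta>" using p_small[OF pn[OF xx0]] by blast
    have close: "\<bar>fst (E ?p (T - \<tau>)) - fst (orb (T - \<tau>))\<bar> < C * \<delta>"
     "\<bar>fst (E ?p (T + \<tau>)) - fst (orb (T + \<tau>))\<bar> < C * \<delta>"
     using E_close'(1)[OF p] \<tau> by auto
    have cx2: "\<bar>c\<bar> < x2" using c' x0R p_small(2)[of "(x0, 0)"] \<delta>_le x0(1) m by (auto simp: norm_Pair)
    have ends: "fst (E ?p (T - \<tau>)) >= c" "fst (E ?p (T + \<tau>)) <= c"
     using close x2 small_\<delta> orb_T[of \<tau>] orb_T[of "- \<tau>"] cx2 by (auto simp: add.commute)
    then have "\<exists>t\<ge>T - \<tau>. t <= T + \<tau> & fst (E ?p t) = c"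
     using \<tau> by (intro IVT2') (auto intro!: E_fst_continuous[OF p])
    then obtain t2 where t2: "T - \<tau> <= t2" "t2 <= T + \<tau>" "fst (E ?p t2) = c" by blast
    have hret: "ht (fst (E ?p t)) (snd (E ?p t)) = r (H x)" if "T - \<tau> <= t" "t <= T + \<tau>" for t
     using hp_return[OF p, of t] that \<tau> rH(1)[OF xx0] by (simp add: hp_def)
    have memR: "fst (E ?p t) \<in> {-R..R}" if "0 <= t & t <= 4 * \<tau> \<or> T - 4 * \<tau> <= t & t <= T + 4 * \<tau>" for t
     using E_box[OF p that] by (auto simp: mem_Times_iff)
    have cR: "c \<in> {-R..R}" using c x0R by auto
    \<comment> \<open>Over the abscissa \<open>c\<close> the orbit is already below the line, so it
      has crossed the line before; this crossing is the landing time \<open>t1\<close>.\<close>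
    have low2: "snd (E ?p t2) < \<alpha>"
    proof -
     have "ht c (snd (E ?p t2)) < ht c \<alpha>" using hret[OF t2(1,2)] t2(3) rHc[OF x] by (simp add: H_def)
     then show ?thesis using ht_less_iff[OF cR] by simp
    qed
    have "\<bar>snd (E ?p t) - snd (orb t)\<bar> < C * \<delta>" if "0 <= t" "t <= T + 4 * \<tau>" for t
     using E_close'(2)[OF p that] .
    then have high: "snd (E ?p t) > \<alpha>" if "\<tau> <= t" "t <= T - \<tau>" for t
     using far[OF that] small_\<delta> \<alpha>(5) that \<tau> by (smt (verit))
    have "snd (E ?p (T - \<tau>)) > \<alpha>" by (rule high) (use \<tau> in linarith)+
    then have "\<exists>t\<ge>T - \<tau>. t <= t2 & snd (E ?p t) = \<alpha>"
     using t2 \<tau> low2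
     by (intro IVT2') (auto intro!: continuous_intros solves_continuous_on[OF E_sol'[OF p]])
    then obtain t1 where t1: "T - \<tau> <= t1" "t1 <= t2" "snd (E ?p t1) = \<alpha>" by blast
    have t1p: "0 < t1" using t1 \<tau> by linarith
    define a where "a = fst (E ?p t1)"
    have Ha: "H a = r (H x)" using hret[of t1] t1 t2 by (simp add: H_def a_def)
    have fdec: "fst (E ?p t) < fst (E ?p s)" if "u <= s" "s < t" "t <= v"
     "u = 0 & v = \<tau> \<or> u = T - \<tau> & v = T + \<tau>" for s t u v
    proof (rule fst_decreasing[OF E_sol'[OF p, of u v] _ that(1-3)])
     show "E ?p ` {u..v} \<subseteq> box_R" by (rule image_subsetI, rule E_box[OF p]) (use that(4) \<tau> in auto)
    qed (use that(4) \<tau> in auto)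
    have "c <= a" using fdec[of "T - \<tau>" t1 t2 "T + \<tau>"] t1 t2 by (cases "t1 = t2") (auto simp: a_def)
    moreover have "a ~= c" using Ha rHc[OF x] by auto
    ultimately have ca: "c < a" by simp
    have aR: "a <= R" using memR[of t1] t1 t2 \<tau> by (auto simp: a_def)
    \<comment> \<open>Near the start the line rises in level towards \<open>x\<close>, so further
      left it is below the orbit; in the middle the height bound of the far part applies; near the
      end the line falls in level to the right of \<open>a\<close>.\<close>
    have above: "snd (E ?p t) > \<alpha>" if t: "0 < t" "t < t1" for t
    proof -
     consider "t <= \<tau>" | "\<tau> <= t" "t <= T - \<tau>" | "T - \<tau> <= t" by linarith
     then show ?thesis
     proof cases
      case 1
      have fx: "fst (E ?p t) < x" using fdec[of 0 0 t \<tau>] t 1 E_0[OF p] by simp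
      have mem: "fst (E ?p t) \<in> {-R..R}" using memR[of t] t 1 \<tau> by auto
      have "ht (fst (E ?p t)) (snd (E ?p t)) = H x"
       using hp_start[OF p, of t] t 1 \<tau> by (simp add: hp_def H_def)
      also have "H (fst (E ?p t)) < H x" using inc[OF _ fx x(2)] mem by auto
      ultimately have "ht (fst (E ?p t)) \<alpha> < ht (fst (E ?p t)) (snd (E ?p t))" by (simp add: H_def)
      then show ?thesis using ht_less_iff[OF mem] by simp
     next
      case 3
      have tt: "t <= T + \<tau>" using t t1 t2 by linarith
      have fx: "a < fst (E ?p t)" using fdec[of "T - \<tau>" t t1 "T + \<tau>"] 3 t t1 t2 by (simp add: a_def)
      have mem: "fst (E ?p t) \<in> {-R..R}" using memR[of t] tt 3 \<tau> by auto
      have "H (fst (E ?p t)) < H a" using dec[OF _ fx] ca mem by auto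
      then have "ht (fst (E ?p t)) \<alpha> < ht (fst (E ?p t)) (snd (E ?p t))"
       using hret[OF 3 tt] Ha by (simp add: H_def)
      then show ?thesis using ht_less_iff[OF mem] by simp
     qed (use high in blast)
    qed
    have tube: "infdist (E ?p t) L <= C1 * (\<bar>x\<bar> + \<alpha>)" if "0 <= t" "t <= t1" for t
    proof -
     have "orb t \<in> L" using range_orb by auto
     then have "infdist (E ?p t) L <= dist (E ?p t) (orb t)" by (rule infdist_le)
     also have "\<dots> <= C * norm ?p" using E_close[OF p, of t] that t1 t2 \<tau> by (simp add: dist_norm)
     also have "\<dots> <= C1 * (\<bar>x\<bar> + \<alpha>)"
      using norm_Pair_le[of x \<alpha>] \<alpha> pos by (intro mult_mono) (auto simp: C1_def)
     finally show ?thesis .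
    qed
    have "E ?p t1 = (a, \<alpha>)" using t1 by (simp add: a_def prod_eq_iff)
    then show ?thesis using ca aR Ha t1p E_sol'[OF p, of 0 t1] E_0[OF p] above tube unfolding landing_arc_def
     by (intro exI[of _ a] exI[of _ "E ?p"] exI[of _ t1]) auto
   qed
   then obtain A where A: "\<And>x. - x0 <= x ==> x <= c ==> c < A x & A x <= R & H (A x) = r (H x) \<and>
     (\<exists>\<eta> T. landing_arc f g L \<alpha> C1 x (A x) \<eta> T)"
    by metis
   have A_dec: "A x' < A x" if "- x0 <= x" "x < x'" "x' <= c" for x x'
   proof -
    have xx: "\<bar>x\<bar> <= x0" "\<bar>x'\<bar> <= x0" using that c' by auto
    have "H x < H x'" using inc[of x x'] that x0R by auto
    then have "r (H x) < r (H x')" using r_strict_mono \<sigma>_le rH(2)[OF xx(1)] rH(2)[OF xx(2)] by blast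
    then have "H (A x) < H (A x')" using A[of x] A[of x'] that by simp
    then show ?thesis using dec[of "A x" "A x'"] A[of x] A[of x'] that
     by (cases "A x" "A x'" rule: linorder_cases) auto
   qed
   have A_lip: "\<exists>B>0. \<forall>x x'. - x0 <= x & x <= c & - x0 <= x' & x' <= c --> \<bar>A x - A x'\<bar> <= B * \<bar>x - x'\<bar>"
   proof -
    \<comment> \<open>\<open>A c\<close> is strictly right of \<open>c\<close>, so on
      \<open>{A c..R}\<close>, which contains all landing points, the orbits cross the line with a
      slope bounded away from \<open>0\<close>.\<close>
    have Ac: "c < A c" "A c <= R" using A[of c] c by auto
    have cs: "continuous_on {A c..R} (%x. slope f g \<rho> x \<alpha>)"
     by (rule continuous_on_compose2[OF cont, of "{A c..R}" "%x. (x, \<alpha>)", simplified])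
      (use Ac c x0R in \<open>auto intro!: continuous_intros\<close>)
    obtain z where z: "z \<in> {A c..R}" "\<And>x. x \<in> {A c..R} ==> slope f g \<rho> z \<alpha> <= slope f g \<rho> x \<alpha>"
     using continuous_attains_inf[OF compact_Icc _ cs] Ac by auto
    define k1 where "k1 = slope f g \<rho> z \<alpha>"
    have k1: "k1 > 0"
    proof -
     have "g (z, \<alpha>) < 0" "f (z, \<alpha>) < 0" using gneg[of z] fn[of z] z(1) Ac R_le c x0R by auto
     then show ?thesis by (simp add: k1_def sl divide_neg_neg)
    qed
    have low: "k1 / 4 * (q - p) <= H p - H q" if "A c <= p" "p <= q" "q <= R" for p q
    proof (cases "p = q")
     case False
     have "k1 <= - 1 * (0 - slope f g \<rho> x \<alpha>)" if "p < x" "x < q" for x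
      using z(2)[of x] that \<open>A c <= p\<close> \<open>q <= R\<close> by (simp add: k1_def)
     from level_slope(1)[where w = "%_. \<alpha>" and w' = "%_. 0" and s = "- 1", OF _ _ _ _ _ _ this] that False Ac c x0R k1 show ?thesis by (simp add: H_def)
    qed simp
    define B2 where "B2 = 4 / k1 * (2 * (1 + K) * C * (2 * K)) + 1"
    have main: "\<bar>A x - A x'\<bar> <= B2 * \<bar>x - x'\<bar>" if "- x0 <= x" "x <= c" "- x0 <= x'" "x' <= c" for x x'
    proof -
     have xx: "\<bar>x\<bar> <= x0" "\<bar>x'\<bar> <= x0" using that c' by auto
     have AA: "A c <= A x" "A c <= A x'" "A x <= R" "A x' <= R"
      using A_dec[of x c] A_dec[of x' c] A[of x] A[of x'] that by (cases "x = c"; cases "x' = c"; force)+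
     have "k1 / 4 * \<bar>A x - A x'\<bar> <= \<bar>H (A x) - H (A x')\<bar>"
      using low[of "A x" "A x'"] low[of "A x'" "A x"] AA by (cases "A x <= A x'") (auto simp: abs_if)
     also have "\<dots> = \<bar>r (H x) - r (H x')\<bar>" using A that by simp
     also have "\<dots> <= 2 * (1 + K) * C * \<bar>H x - H x'\<bar>"
      by (rule r_lipschitz) (use \<sigma>_le rH(2)[OF xx(1)] rH(2)[OF xx(2)] in auto)
     also have "\<dots> <= 2 * (1 + K) * C * (2 * K * \<bar>x - x'\<bar>)"
     proof (rule mult_left_mono)
      have "x \<in> {-R..R}" "x' \<in> {-R..R}" using xx x0R by auto
      from ht_lipschitz[OF this, of \<alpha> \<alpha>] show "\<bar>H x - H x'\<bar> <= 2 * K * \<bar>x - x'\<bar>" by (simp add: H_def)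
     qed (use \<delta>_le pos in auto)
     finally have "\<bar>A x - A x'\<bar> <= 4 / k1 * (2 * (1 + K) * C * (2 * K)) * \<bar>x - x'\<bar>"
      using k1 by (simp add: field_simps)
     also have "\<dots> <= B2 * \<bar>x - x'\<bar>" by (intro mult_right_mono) (auto simp: B2_def)
     finally show ?thesis .
    qed
    moreover have "B2 > 0" using k1 \<delta>_le pos by (auto simp: B2_def intro!: add_nonneg_pos mult_nonneg_nonneg)
    ultimately show ?thesis by blast
   qed
   have "landing f g L x0 \<alpha> C1 c A"
    unfolding landing_def
    using c c' cC gpos gneg x0R A A_dec A_lip by (intro conjI allI impI) auto
   then show "\<exists>c A. landing f g L x0 \<alpha> C1 c A" by blast
  qed
 qed
qed

end

section \<open>Loops made of upper, lower and sliding pieces\<close>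

text \<open>Each piece has its own clock starting at \<open>0\<close>, and the pieces are
  concatenated at the partial sums of their durations. Disjointness is asked for half-open time
  intervals, since the end of a piece belongs to the next one.\<close>

lemma loop_from_pieces:
 assumes n: "n >= 1" and T: "\<And>i. i < n ==> T i > 0"
  and pc: "\<And>i. i < n ==> is_piece U Xp Xm (\<kappa> i) (G i) 0 (T i)"
  and glue: "\<And>i. i < n ==> G i (T i) = G (Suc i mod n) 0"
  and inj: "\<And>i. i < n ==> inj_on (G i) {0..<T i}"
  and disj: "\<And>i j. i < j ==> j < n ==> G i ` {0..<T i} \<inter> G j ` {0..<T j} = {}"
 obtains \<tau> orb where "loop_curve U Xp Xm n \<kappa> \<tau> orb" "orb ` {\<tau> 0..\<tau> n} = (\<Union>i<n. G i ` {0..T i})"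
  "\<And>i. i < n ==> orb (\<tau> i) = G i 0"
proof -
 define \<tau> where "\<tau> k = (\<Sum>i<k. T i)" for k
 have \<tau>0: "\<tau> 0 = 0" and \<tau>S: "\<tau> (Suc k) = \<tau> k + T k" for k by (auto simp: \<tau>_def)
 have \<tau>_le: "\<tau> i <= \<tau> j" if "i <= j" "j <= n" for i j
  using that
 proof (induction j)
  case (Suc j)
  then show ?case using T[of j] \<tau>S[of j] by (cases "i = Suc j") auto
 qed auto
 define ix where "ix t = (LEAST i. t < \<tau> (Suc i))" for t
 have ix: "ix t = i" if "i < n" "\<tau> i <= t" "t < \<tau> (Suc i)" for i t
  unfolding ix_def
 proof (rule Least_equality[where P = "%i. t < \<tau> (Suc i)"])
  fix j assume "t < \<tau> (Suc j)"
  then show "i <= j" using \<tau>_le[of "Suc j" i] that by (cases "i <= j") auto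
 qed (use that in auto)
 define orb where "orb t = (if t < \<tau> n then G (ix t) (t - \<tau> (ix t)) else G 0 0)" for t
 have orb: "orb t = G i (t - \<tau> i)" if "i < n" "\<tau> i <= t" "t < \<tau> (Suc i)" for i t
  using ix[OF that] \<tau>_le[of "Suc i" n] that by (auto simp: orb_def)
 have orbstart: "orb (\<tau> i) = G i 0" if "i < n" for i
  using orb[OF that, of "\<tau> i"] T[OF that] \<tau>S[of i] by simp
 have orbn: "orb (\<tau> n) = G 0 0" by (simp add: orb_def)
 have orbcl: "orb t = G i (t - \<tau> i)" if "i < n" "t \<in> {\<tau> i..\<tau> (Suc i)}" for i t
 proof (cases "t < \<tau> (Suc i)")
  case False
  then have t: "t = \<tau> (Suc i)" using that by auto
  have "orb (\<tau> (Suc i)) = G (Suc i mod n) 0"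
   using orbstart[of "Suc i"] orbn that(1) by (cases "Suc i = n") auto
  with t glue[OF that(1)] \<tau>S[of i] show ?thesis by simp
 qed (use orb that in auto)
 have contG: "continuous_on {0..T i} (G i)" if "i < n" for i
  using pc[OF that] by (cases "\<kappa> i") (auto simp: regular_segment_def sliding_segment_def intro: solves_continuous_on)
 have shift: "(%t. t - \<tau> i) ` {\<tau> i..\<tau> (Suc i)} = {0..T i}" for i
  using \<tau>S[of i] by (auto simp: image_iff intro!: bexI[of _ "_ + \<tau> i"])
 have solves_sh: "solves Z (%t. G i (t - \<tau> i)) ((%t. t + \<tau> i) ` I)" if "solves Z (G i) I" for Z i I
 proof -
  have "solves Z (%t. G i (t + - \<tau> i)) ((%t. t + \<tau> i) ` I)" by (rule solves_shift[OF that]) auto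
  then show ?thesis by simp
 qed
 have piece: "is_piece U Xp Xm (\<kappa> i) orb (\<tau> i) (\<tau> (Suc i))" if i: "i < n" for i
 proof -
  have eq: "\<And>t. t \<in> {\<tau> i..\<tau> (Suc i)} ==> orb t = G i (t - \<tau> i)" using orbcl[OF i] .
  have I1: "(%t. t + \<tau> i) ` {0..T i} = {\<tau> i..\<tau> (Suc i)}" using \<tau>S[of i] by simp
  have I2: "(%t. t + \<tau> i) ` {0<..<T i} = {\<tau> i<..<\<tau> (Suc i)}" using \<tau>S[of i]
   by (auto simp: image_iff intro!: bexI[of _ "_ - \<tau> i"])
  have reg: "regular_segment U Z S orb (\<tau> i) (\<tau> (Suc i))" if "regular_segment U Z S (G i) 0 (T i)" for Z S
  proof -
   have "solves Z (G i) {0..T i}" using that by (simp add: regular_segment_def)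
   from solves_sh[OF this] have "solves Z (%t. G i (t - \<tau> i)) {\<tau> i..\<tau> (Suc i)}" unfolding I1 .
   then have "solves Z orb {\<tau> i..\<tau> (Suc i)}"
    by (subst solves_cong[of _ orb "%t. G i (t - \<tau> i)"]) (auto simp: eq)
   moreover have "t - \<tau> i \<in> {0..T i}" if "t \<in> {\<tau> i..\<tau> (Suc i)}" for t using that \<tau>S[of i] by auto
   moreover have "t - \<tau> i \<in> {0<..<T i}" if "t \<in> {\<tau> i<..<\<tau> (Suc i)}" for t using that \<tau>S[of i] by auto
   ultimately show ?thesis using that eq[of "\<tau> i"] eq[of "\<tau> (Suc i)"] T[OF i] \<tau>S[of i]
    unfolding regular_segment_def using eq by auto
  qed
  show ?thesis
  proof (cases "\<kappa> i")
   case Sliding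
   then have sl: "sliding_segment U Xp Xm (G i) 0 (T i)" using pc[OF i] by simp
   have "continuous_on {\<tau> i..\<tau> (Suc i)} orb"
   proof (rule continuous_on_eq)
    show "continuous_on {\<tau> i..\<tau> (Suc i)} (%t. G i (t - \<tau> i))"
     by (rule continuous_on_compose2[OF contG[OF i]]) (use shift[of i] in \<open>auto intro!: continuous_intros\<close>)
   qed (simp add: eq)
   moreover have "solves (sliding_field Xp Xm) orb {\<tau> i<..<\<tau> (Suc i)}"
   proof -
    have "solves (sliding_field Xp Xm) (G i) {0<..<T i}" using sl by (simp add: sliding_segment_def)
    from solves_sh[OF this]
    have "solves (sliding_field Xp Xm) (%t. G i (t - \<tau> i)) {\<tau> i<..<\<tau> (Suc i)}" unfolding I2 .
    then show ?thesis by (subst solves_cong[of _ orb "%t. G i (t - \<tau> i)"]) (auto simp: eq)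
   qed
   moreover have "t - \<tau> i \<in> {0<..<T i}" if "t \<in> {\<tau> i<..<\<tau> (Suc i)}" for t using that \<tau>S[of i] by auto
   ultimately have "sliding_segment U Xp Xm orb (\<tau> i) (\<tau> (Suc i))"
    using sl eq[of "\<tau> i"] eq[of "\<tau> (Suc i)"] T[OF i] \<tau>S[of i] unfolding sliding_segment_def using eq by auto
   with Sliding show ?thesis by simp
  qed (use pc[OF i] reg in auto)
 qed
 have cover: "\<exists>i<k. \<tau> i <= t & t < \<tau> (Suc i)" if "0 <= t" "t < \<tau> k" "k <= n" for t k
  using that
 proof (induction k)
  case (Suc k)
  then show ?case by (cases "t < \<tau> k") (auto intro: less_SucI)
 qed (simp add: \<tau>0)
 have cover': "{\<tau> 0..\<tau> n} = (\<Union>i<n. {\<tau> i..\<tau> (Suc i)})"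
 proof (intro subset_antisym subsetI)
  fix t assume t: "t \<in> {\<tau> 0..\<tau> n}"
  show "t \<in> (\<Union>i<n. {\<tau> i..\<tau> (Suc i)})"
  proof (cases "t < \<tau> n")
   case True
   then obtain i where "i < n" "\<tau> i <= t" "t < \<tau> (Suc i)" using cover[of t n] t \<tau>0 by auto
   then show ?thesis by (auto intro!: bexI[of _ i])
  next
   case False
   obtain k where "n = Suc k" using n by (cases n) auto
   with False t \<tau>_le[of k n] show ?thesis by (auto intro!: bexI[of _ k])
  qed
 next
  fix t assume "t \<in> (\<Union>i<n. {\<tau> i..\<tau> (Suc i)})"
  then obtain i where i: "i < n" "\<tau> i <= t" "t <= \<tau> (Suc i)" by auto
  with \<tau>_le[of 0 i] \<tau>_le[of "Suc i" n] show "t \<in> {\<tau> 0..\<tau> n}" by auto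
 qed
 have cont: "continuous_on {\<tau> 0..\<tau> n} orb"
  unfolding cover'
 proof (rule continuous_on_closed_Union)
  fix i assume i: "i \<in> {..<n}"
  then have eq: "\<And>t. t \<in> {\<tau> i..\<tau> (Suc i)} ==> orb t = G i (t - \<tau> i)" using orbcl by auto
  show "continuous_on {\<tau> i..\<tau> (Suc i)} orb"
  proof (rule continuous_on_eq)
   show "continuous_on {\<tau> i..\<tau> (Suc i)} (%t. G i (t - \<tau> i))"
    by (rule continuous_on_compose2[OF contG]) (use i shift[of i] in \<open>auto intro!: continuous_intros\<close>)
  qed (simp add: eq)
 qed auto
 have injo: "inj_on orb {\<tau> 0..<\<tau> n}"
 proof (rule inj_onI)
  fix s t assume st: "s \<in> {\<tau> 0..<\<tau> n}" "t \<in> {\<tau> 0..<\<tau> n}" "orb s = orb t"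
  obtain i where i: "i < n" "\<tau> i <= s" "s < \<tau> (Suc i)" using cover[of s n] st \<tau>0 by auto
  obtain j where j: "j < n" "\<tau> j <= t" "t < \<tau> (Suc j)" using cover[of t n] st \<tau>0 by auto
  have mi: "s - \<tau> i \<in> {0..<T i}" and mj: "t - \<tau> j \<in> {0..<T j}" using i j \<tau>S by auto
  have eq: "G i (s - \<tau> i) = G j (t - \<tau> j)" using st(3) orb[OF i] orb[OF j] by simp
  have "i = j"
  proof (rule ccontr)
   assume "i ~= j"
   then consider "i < j" | "j < i" by linarith
   then show False
   proof cases
    case 1
    from disj[OF this j(1)] imageI[OF mi, of "G i"] imageI[OF mj, of "G j"] eq show False by auto
   next
    case 2
    from disj[OF this i(1)] imageI[OF mi, of "G i"] imageI[OF mj, of "G j"] eq show False by auto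
   qed
  qed
  then have "s - \<tau> i = t - \<tau> i" using eq inj_onD[OF inj[OF i(1)] _ mi] mj by blast
  then show "s = t" by simp
 qed
 have im: "orb ` {\<tau> 0..\<tau> n} = (\<Union>i<n. G i ` {0..T i})"
 proof -
  have "orb ` {\<tau> i..\<tau> (Suc i)} = G i ` {0..T i}" if "i < n" for i
  proof -
   have "orb ` {\<tau> i..\<tau> (Suc i)} = (%t. G i (t - \<tau> i)) ` {\<tau> i..\<tau> (Suc i)}"
    by (rule image_cong[OF refl orbcl[OF that]])
   also have "\<dots> = G i ` ((%t. t - \<tau> i) ` {\<tau> i..\<tau> (Suc i)})" by (rule image_image[symmetric])
   finally show ?thesis unfolding shift .
  qed
  then show ?thesis unfolding cover' by (auto simp: image_UN)
 qed
 show ?thesis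
 proof (rule that[of \<tau> orb])
  show "loop_curve U Xp Xm n \<kappa> \<tau> orb"
   unfolding loop_curve_def using n cont injo piece orbn orbstart[of 0] by auto
 qed (use im orbstart in auto)
qed

text \<open>What the loop combinatorics needs to know about the system near the grazing orbit: an
  upper arc in \<open>N0\<close> leads from some \<open>x \<le> c\<close> to \<open>A x\<close>
  along \<open>UA x\<close>, and a lower arc joins two axis points of equal \<open>H\<close> with
  larger values between. Uniqueness covers all arcs in \<open>N0\<close>, existence of upper arcs
  starts at \<open>xe\<close>, from where on they are known to lie in \<open>U\<close>.\<close>

locale half_maps =
 fixes U :: "plane set" and Xp Xm :: vfield and N0 :: "plane set" and x0 c xe :: real
  and A H v :: "real => real" and UA :: "real => plane set" and LA :: "real => real => plane set"
 assumes axis: "\<And>x. (x, 0) \<in> N0 ==> \<bar>x\<bar> < x0" and axis_U: "\<And>x. \<bar>x\<bar> < x0 ==> (x, 0) \<in> U"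
  and c: "\<bar>c\<bar> < x0" and A_gt: "\<And>x. - x0 < x ==> x <= c ==> c < A x"
  and A_dec: "\<And>x x'. - x0 < x ==> x < x' ==> x' <= c ==> A x' < A x"
  and Xp_snd: "\<And>x. \<bar>x\<bar> < x0 ==> sgn (snd (Xp (x, 0))) = sgn (c - x)"
  and Xm_snd: "\<And>x. \<bar>x\<bar> < x0 ==> sgn (snd (Xm (x, 0))) = sgn (v x)"
  and X_fst: "\<And>x. \<bar>x\<bar> < x0 ==> fst (Xp (x, 0)) < 0" "\<And>x. \<bar>x\<bar> < x0 ==> fst (Xm (x, 0)) < 0"
  and X_cont: "continuous_on UNIV (%x. Xp (x, 0))" "continuous_on UNIV (%x. Xm (x, 0))"
  and upper_unique: "\<And>orb a b. regular_segment U Xp (Sigma_plus U) orb a b ==> orb ` {a..b} \<subseteq> N0 ==>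
   \<exists>x. - x0 < x & x <= c & orb a = (x, 0) & orb b = (A x, 0) & orb ` {a..b} = UA x"
  and lower_unique: "\<And>orb a b. regular_segment U Xm (Sigma_minus U) orb a b ==> orb ` {a..b} \<subseteq> N0 ==>
   \<exists>p q. - x0 < q & q < p & p < x0 & orb a = (p, 0) & orb b = (q, 0) & H q = H p \<and>
    (\<forall>x. q < x & x < p --> H p < H x) & orb ` {a..b} = LA p q"
  and xe: "- x0 < xe"
  and upper_exists: "\<And>x. xe <= x ==> x <= c ==> \<exists>orb T. T > 0 & regular_segment U Xp (Sigma_plus U) orb 0 T \<and>
   inj_on orb {0..<T} & orb 0 = (x, 0) & orb T = (A x, 0) & orb ` {0..T} = UA x"
  and lower_exists: "\<And>p q. - x0 < q ==> q < p ==> p < x0 ==> H q = H p ==>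
   (\<And>x. q < x ==> x < p ==> H p < H x) ==> \<exists>orb T. T > 0 & regular_segment U Xm (Sigma_minus U) orb 0 T \<and>
   inj_on orb {0..<T} & orb 0 = (p, 0) & orb T = (q, 0) & orb ` {0..T} = LA p q"
begin

text \<open>Reduces a loop in \<open>N0\<close> to a cyclic word over abscissae. Lower and sliding
  pieces run to the left, upper pieces jump over \<open>c\<close> to the right.\<close>

definition piece_rel :: "piece => real => real => bool" where
 "piece_rel k p q = (case k of
  Upper => - x0 < p & p <= c & q = A p
 | Lower => - x0 < q & q < p & p < x0 & H q = H p & (\<forall>x. q < x & x < p --> H p < H x)
 | Sliding => - x0 < q & q < p & p < x0 & (\<forall>x. q < x & x < p --> v x * (c - x) < 0))"

definition piece_img :: "piece => real => real => plane set" where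
 "piece_img k p q = (case k of Upper => UA p | Lower => LA p q | Sliding => {q..p} \<times> {0})"

lemma product_sign:
 assumes "\<bar>x\<bar> < x0"
 shows "snd (Xp (x, 0)) * snd (Xm (x, 0)) < 0 \<longleftrightarrow> v x * (c - x) < 0"
  "snd (Xp (x, 0)) * snd (Xm (x, 0)) > 0 \<longleftrightarrow> v x * (c - x) > 0"
  "snd (Xp (x, 0)) * snd (Xm (x, 0)) = 0 \<longleftrightarrow> v x * (c - x) = 0"
proof -
 have "sgn (snd (Xp (x, 0)) * snd (Xm (x, 0))) = sgn (v x * (c - x))"
  using Xp_snd[OF assms] Xm_snd[OF assms] by (simp add: sgn_mult)
 then show "snd (Xp (x, 0)) * snd (Xm (x, 0)) < 0 \<longleftrightarrow> v x * (c - x) < 0"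
  "snd (Xp (x, 0)) * snd (Xm (x, 0)) > 0 \<longleftrightarrow> v x * (c - x) > 0"
  "snd (Xp (x, 0)) * snd (Xm (x, 0)) = 0 \<longleftrightarrow> v x * (c - x) = 0"
  by (metis sgn_less, metis sgn_greater, metis sgn_eq_0_iff)
qed

text \<open>The sliding field is a convex combination of two fields with negative first component.
  The weak inequalities include the end of a sliding zone, where one of the fields is
  tangent.\<close>

lemma sliding_field_neg:
 assumes "\<bar>x\<bar> < x0" "snd (Xp (x, 0)) <= 0 & snd (Xm (x, 0)) >= 0 \<or> snd (Xp (x, 0)) >= 0 & snd (Xm (x, 0)) <= 0"
  "snd (Xp (x, 0)) ~= snd (Xm (x, 0))"
 shows "fst (sliding_field Xp Xm (x, 0)) < 0"
proof -
 let ?fp = "fst (Xp (x, 0))" and ?fm = "fst (Xm (x, 0))" and ?gp = "snd (Xp (x, 0))" and ?gm = "snd (Xm (x, 0))"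
 have f: "?fp < 0" "?fm < 0" using X_fst assms by auto
 have "(?fp * ?gm - ?fm * ?gp) / (?gm - ?gp) < 0"
 proof (cases "?gm - ?gp > 0")
  case True
  then have g: "?gp <= 0" "?gm >= 0" using assms(2) by auto
  have "?fp * ?gm <= 0" "?fm * ?gp >= 0" using f g by (auto simp: mult_nonpos_nonneg mult_nonpos_nonpos)
  moreover have "?fp * ?gm ~= 0 \<or> ?fm * ?gp ~= 0" using f assms(3) by auto
  ultimately have "?fp * ?gm - ?fm * ?gp < 0" by linarith
  with True show ?thesis by (rule divide_neg_pos[rotated])
 next
  case False
  then have neg: "?gm - ?gp < 0" using assms(3) by auto
  then have g: "?gp >= 0" "?gm <= 0" using assms(2) by auto
  have "?fp * ?gm >= 0" "?fm * ?gp <= 0" using f g by (auto simp: mult_nonpos_nonneg mult_nonpos_nonpos)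
  moreover have "?fp * ?gm ~= 0 \<or> ?fm * ?gp ~= 0" using f assms(3) by auto
  ultimately have "?fp * ?gm - ?fm * ?gp > 0" by linarith
  with neg show ?thesis by (simp add: divide_pos_neg)
 qed
 then show ?thesis by (simp add: sliding_field_def)
qed

lemma sliding_unique:
 assumes "sliding_segment U Xp Xm orb a b" "orb ` {a..b} \<subseteq> N0"
 shows "\<exists>p q. orb a = (p, 0) & orb b = (q, 0) & piece_rel Sliding p q & orb ` {a..b} = {q..p} \<times> {0}"
proof -
 have ab: "a < b" and cont: "continuous_on {a..b} orb" and sol: "solves (sliding_field Xp Xm) orb {a<..<b}"
  and ends: "snd (orb a) = 0" "snd (orb b) = 0" and reg: "\<And>t. t \<in> {a<..<b} ==> orb t \<in> sliding_region U Xp Xm"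
  using assms(1) by (auto simp: sliding_segment_def Sigma_zero_def)
 have snd0: "snd (orb t) = 0" if "t \<in> {a..b}" for t
  using ends reg[of t] that by (cases "t = a \<or> t = b") (auto simp: sliding_region_def Sigma_zero_def)
 have orbeq: "orb t = (fst (orb t), 0)" if "t \<in> {a..b}" for t using snd0[OF that] by (simp add: prod_eq_iff)
 have bd: "\<bar>fst (orb t)\<bar> < x0" if "t \<in> {a..b}" for t
  using axis[of "fst (orb t)"] orbeq[OF that] assms(2) that by (metis image_subset_iff)
 have sl: "snd (Xp (fst (orb t), 0)) * snd (Xm (fst (orb t), 0)) < 0" if "t \<in> {a<..<b}" for t
 proof -
  have "t \<in> {a..b}" using that by auto
  from orbeq[OF this] reg[OF that] show ?thesis by (metis (mono_tags, lifting) mem_Collect_eq sliding_region_def)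
 qed
 have dec: "fst (orb t) < fst (orb s)" if st: "a <= s" "s < t" "t <= b" for s t
 proof (rule DERIV_neg_imp_decreasing_open[OF st(2), where f = "%t. fst (orb t)"])
  fix x assume "s < x" "x < t"
  then have x: "x \<in> {a<..<b}" "x \<in> {a..b}" using st by auto
  have "(orb has_vector_derivative sliding_field Xp Xm (orb x)) (at x)"
   using sol x(1) at_within_open[OF x(1) open_greaterThanLessThan] unfolding solves_def by metis
  then have "((%t. fst (orb t)) has_real_derivative fst (sliding_field Xp Xm (orb x))) (at x)"
   unfolding has_real_derivative_iff_has_vector_derivative
   by (rule bounded_linear.has_vector_derivative[OF bounded_linear_fst])
  moreover have "fst (sliding_field Xp Xm (fst (orb x), 0)) < 0"
   using sl[OF x(1)] by (intro sliding_field_neg bd x) (auto simp: mult_less_0_iff)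
  ultimately show "\<exists>y. ((%t. fst (orb t)) has_real_derivative y) (at x) & y < 0"
   using orbeq[OF x(2)] by metis
 next
  show "continuous_on {s..t} (%t. fst (orb t))"
   by (intro continuous_intros continuous_on_subset[OF cont]) (use st in auto)
 qed
 define p where "p = fst (orb a)"
 define q where "q = fst (orb b)"
 have qp: "q < p" using dec[of a b] ab by (simp add: p_def q_def)
 have hit: "\<exists>t\<in>{a..b}. fst (orb t) = x" if "q <= x" "x <= p" for x
 proof -
  have "\<exists>t\<ge>a. t <= b & fst (orb t) = x"
   using that ab by (intro IVT2') (auto simp: p_def q_def intro!: continuous_intros cont)
  then show ?thesis by auto
 qed
 have rel: "v x * (c - x) < 0" if x: "q < x" "x < p" for x
 proof -
  obtain t where t: "t \<in> {a..b}" "fst (orb t) = x" using hit[of x] x by auto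
  then have "t \<in> {a<..<b}" using x by (cases "t = a \<or> t = b") (auto simp: p_def q_def)
  from sl[OF this] t product_sign(1)[of x] bd[OF t(1)] show ?thesis by simp
 qed
 have "orb ` {a..b} = {q..p} \<times> {0}"
 proof (intro subset_antisym subsetI)
  fix z assume "z \<in> orb ` {a..b}"
  then obtain t where t: "t \<in> {a..b}" "z = orb t" by auto
  have "fst (orb t) <= p" using dec[of a t] t by (cases "t = a") (auto simp: p_def)
  moreover have "q <= fst (orb t)" using dec[of t b] t by (cases "t = b") (auto simp: q_def)
  ultimately show "z \<in> {q..p} \<times> {0}" using t snd0[OF t(1)] by (auto simp: mem_Times_iff)
 next
  fix z assume "z \<in> {q..p} \<times> {0 :: real}"
  then obtain t where "t \<in> {a..b}" "fst (orb t) = fst z" "snd z = 0" using hit[of "fst z"] by (auto simp: mem_Times_iff)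
  then have "z = orb t" using snd0[of t] by (simp add: prod_eq_iff)
  with \<open>t \<in> {a..b}\<close> show "z \<in> orb ` {a..b}" by blast
 qed
 moreover have "piece_rel Sliding p q"
  using qp rel bd[of a] bd[of b] ab by (auto simp: piece_rel_def p_def q_def)
 ultimately show ?thesis using orbeq[of a] orbeq[of b] ab by (auto simp: p_def q_def)
qed

lemma piece_data:
 assumes "is_piece U Xp Xm k orb a b" "orb ` {a..b} \<subseteq> N0"
 shows "\<exists>p q. orb a = (p, 0) & orb b = (q, 0) & piece_rel k p q & orb ` {a..b} = piece_img k p q"
proof (cases k)
 case Upper
 with upper_unique[of orb a b] assms show ?thesis by (auto simp: piece_rel_def piece_img_def)
next
 case Lower
 with lower_unique[of orb a b] assms show ?thesis by (auto simp: piece_rel_def piece_img_def)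
next
 case Sliding
 with sliding_unique[of orb a b] assms show ?thesis by (auto simp: piece_img_def)
qed

lemma loop_data:
 assumes "loop_curve U Xp Xm n \<kappa> \<tau> orb" "orb ` {\<tau> 0..\<tau> n} \<subseteq> N0"
 obtains s where "\<And>i. i < n ==> orb (\<tau> i) = (s i, 0)" "\<And>i. i < n ==> \<bar>s i\<bar> < x0"
  "\<And>i. i < n ==> piece_rel (\<kappa> i) (s i) (s (Suc i mod n))"
  "orb ` {\<tau> 0..\<tau> n} = (\<Union>i<n. piece_img (\<kappa> i) (s i) (s (Suc i mod n)))"
proof -
 have n: "n >= 1" and pc: "\<And>i. i < n ==> is_piece U Xp Xm (\<kappa> i) orb (\<tau> i) (\<tau> (Suc i))" and cl: "orb (\<tau> n) = orb (\<tau> 0)"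
  using assms(1) by (auto simp: loop_curve_def)
 have step: "\<tau> i < \<tau> (Suc i)" if "i < n" for i
  using pc[OF that] by (cases "\<kappa> i") (auto simp: regular_segment_def sliding_segment_def)
 have mono: "\<tau> i <= \<tau> j" if "i <= j" "j <= n" for i j
  using that
 proof (induction j)
  case (Suc j)
  then show ?case using step[of j] by (cases "i = Suc j") auto
 qed auto
 have sub: "{\<tau> i..\<tau> (Suc i)} \<subseteq> {\<tau> 0..\<tau> n}" if "i < n" for i
  using mono[of 0 i] mono[of "Suc i" n] that by auto
 have "\<forall>i<n. \<exists>p q. orb (\<tau> i) = (p, 0) & orb (\<tau> (Suc i)) = (q, 0) & piece_rel (\<kappa> i) p q \<and>
   orb ` {\<tau> i..\<tau> (Suc i)} = piece_img (\<kappa> i) p q"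
  using piece_data[OF pc] sub assms(2) by (meson image_mono order_trans)
 then obtain p q where pq: "\<And>i. i < n ==> orb (\<tau> i) = (p i, 0)" "\<And>i. i < n ==> orb (\<tau> (Suc i)) = (q i, 0)"
  "\<And>i. i < n ==> piece_rel (\<kappa> i) (p i) (q i)" "\<And>i. i < n ==> orb ` {\<tau> i..\<tau> (Suc i)} = piece_img (\<kappa> i) (p i) (q i)"
  by metis
 have q: "q i = p (Suc i mod n)" if "i < n" for i
 proof (cases "Suc i = n")
  case True
  then show ?thesis using pq(2)[OF that] pq(1)[of 0] cl n by auto
 next
  case False
  then show ?thesis using pq(2)[OF that] pq(1)[of "Suc i"] that by auto
 qed
 have cover: "{\<tau> 0..\<tau> n} = (\<Union>i<n. {\<tau> i..\<tau> (Suc i)})"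
 proof (intro subset_antisym subsetI)
  fix t assume t: "t \<in> {\<tau> 0..\<tau> n}"
  have "\<exists>i<k. t \<in> {\<tau> i..\<tau> (Suc i)}" if "1 <= k" "k <= n" "t <= \<tau> k" for k
   using that
  proof (induction k)
   case (Suc k)
   then show ?case using t by (cases "k = 0"; cases "t <= \<tau> k") (auto intro: less_SucI)
  qed simp
  from this[of n] n t show "t \<in> (\<Union>i<n. {\<tau> i..\<tau> (Suc i)})" by auto
 next
  fix t assume "t \<in> (\<Union>i<n. {\<tau> i..\<tau> (Suc i)})"
  then obtain i where "i < n" "t \<in> {\<tau> i..\<tau> (Suc i)}" by blast
  with sub show "t \<in> {\<tau> 0..\<tau> n}" by blast
 qed
 show ?thesis
 proof (rule that[of p])
  show "orb ` {\<tau> 0..\<tau> n} = (\<Union>i<n. piece_img (\<kappa> i) (p i) (p (Suc i mod n)))"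
   unfolding cover image_UN using pq(4) q by auto
  show "\<bar>p i\<bar> < x0" if "i < n" for i
  proof (rule axis)
   have "\<tau> i \<in> {\<tau> 0..\<tau> n}" using mono[of 0 i] mono[of i n] that by auto
   then show "(p i, 0) \<in> N0" using assms(2) pq(1)[OF that] by (metis image_subset_iff)
  qed
 qed (use pq q in auto)
qed

end

section \<open>Cyclic words and isolated crossing cycles\<close>

lemma finite_argmax:
 fixes f :: "'a => real"
 assumes "finite S" "S ~= {}"
 obtains i where "i \<in> S" "\<And>j. j \<in> S ==> f j <= f i"
proof -
 have "Max (f ` S) \<in> f ` S" using assms by (intro Max_in) auto
 then obtain i where "i \<in> S" "Max (f ` S) = f i" by auto
 then show ?thesis using that[of i] Max_ge[of "f ` S"] assms by (metis finite_imageI imageI)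
qed

text \<open>The cyclic predecessor: many exclusion arguments walk backwards from an extremal vertex
  of the loop.\<close>

definition pre :: "nat => nat => nat" where
 "pre n i = (if i = 0 then n - 1 else i - 1)"

lemma pre: "i < n ==> pre n i < n" "i < n ==> Suc (pre n i) mod n = i"
 by (auto simp: pre_def)

context half_maps
begin

lemma upper_axis:
 assumes "xe <= x" "x <= c" "p \<in> UA x" "snd p = 0"
 shows "p = (x, 0) \<or> p = (A x, 0)"
proof -
 obtain orb T where g: "T > 0" "regular_segment U Xp (Sigma_plus U) orb 0 T" "orb 0 = (x, 0)" "orb T = (A x, 0)" "orb ` {0..T} = UA x"
  using upper_exists[OF assms(1,2)] by blast
 then obtain t where t: "t \<in> {0..T}" "p = orb t" using assms(3) by blast
 have "t \<notin> {0<..<T}" using g(2) t assms(4) by (force simp: regular_segment_def Sigma_plus_def)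
 then have "t = 0 \<or> t = T" using t by auto
 with t g show ?thesis by auto
qed

lemma lower_axis:
 assumes "- x0 < q" "q < p" "p < x0" "H q = H p" "\<And>x. q < x ==> x < p ==> H p < H x"
  and "z \<in> LA p q" "snd z = 0"
 shows "z = (p, 0) \<or> z = (q, 0)"
proof -
 obtain orb T where g: "T > 0" "regular_segment U Xm (Sigma_minus U) orb 0 T" "orb 0 = (p, 0)" "orb T = (q, 0)" "orb ` {0..T} = LA p q"
  using lower_exists[OF assms(1-5)] by blast
 then obtain t where t: "t \<in> {0..T}" "z = orb t" using assms(6) by blast
 have "t \<notin> {0<..<T}" using g(2) t assms(7) by (force simp: regular_segment_def Sigma_minus_def)
 then have "t = 0 \<or> t = T" using t by auto
 with t g show ?thesis by auto
qed

text \<open>The return map \<open>x \<mapsto> x'\<close> with \<open>H x' = H (A x)\<close> contracts the level \<open>H\<close>, so its fixed point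
 is the only periodic point in the slot.\<close>

lemma crossing_cycle:
 assumes slot: "xe <= a" "a < b" "b < c" "A a < x0"
  and vL: "\<And>x. a <= x ==> x <= b ==> v x > 0" and vR: "\<And>y. A b <= y ==> y <= A a ==> v y < 0"
  and Hb: "H (A b) < H b" and Ha: "H a < H (A a)"
  and cont: "continuous_on {a..b} (%x. H x - H (A x))"
  and contr: "\<And>x x'. x \<in> {a..b} ==> x' \<in> {a..b} ==> x ~= x' ==> \<bar>H (A x) - H (A x')\<bar> < \<bar>H x - H x'\<bar>"
  and left: "\<And>x x'. a <= x ==> x < x' ==> x' <= c ==> H x < H x'"
  and right: "\<And>y x. A b <= y ==> y <= A a ==> c <= x ==> x < y ==> H y < H x"
  and N0: "\<And>x. x \<in> {a..b} ==> UA x \<union> LA (A x) x \<subseteq> interior N0"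
 obtains x where "a < x" "x < b" "H x = H (A x)" "crossing_limit_cycle U Xp Xm (UA x \<union> LA (A x) x)"
  "(x, 0) \<in> UA x"
proof -
 have "\<exists>x\<ge>a. x <= b & H x - H (A x) = 0"
  using slot Ha Hb by (intro IVT' cont) auto
 then obtain x where x: "a <= x" "x <= b" "H x = H (A x)" by auto
 have ax: "a < x" "x < b" using x Ha Hb by (auto simp: less_le)
 have xc: "- x0 < x" "x < c" "xe <= x" using ax slot xe by auto
 have AA: "A b < A x" "A x < A a" "c < A b"
  using A_dec[of x b] A_dec[of a x] A_gt[of b] ax slot xe xc by auto
 have Ax: "c < A x" "A x < x0" using AA slot by auto
 have between: "H (A x) < H y" if "x < y" "y < A x" for y
  using left[of x y] right[of "A x" y] that ax AA x by (cases "y <= c") auto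
 obtain orb1 T1 where g1: "T1 > 0" "regular_segment U Xp (Sigma_plus U) orb1 0 T1" "inj_on orb1 {0..<T1}"
  "orb1 0 = (x, 0)" "orb1 T1 = (A x, 0)" "orb1 ` {0..T1} = UA x"
  using upper_exists[of x] xc by auto
 obtain orb2 T2 where g2: "T2 > 0" "regular_segment U Xm (Sigma_minus U) orb2 0 T2" "inj_on orb2 {0..<T2}"
  "orb2 0 = (A x, 0)" "orb2 T2 = (x, 0)" "orb2 ` {0..T2} = LA (A x) x"
  using lower_exists[of x "A x"] xc Ax x(3) between by auto
 define C where "C = UA x \<union> LA (A x) x"
 have co: "crossing_periodic_orbit U Xp Xm C"
 proof -
  define G where "G i = (if i = 0 then orb1 else orb2)" for i :: nat
  define T where "T i = (if i = 0 then T1 else T2)" for i :: nat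
  define \<kappa> where "\<kappa> i = (if i = 0 then Upper else Lower)" for i :: nat
  have up: "snd (orb1 t) > 0" if "0 < t" "t < T1" for t
   using g1(2) that by (auto simp: regular_segment_def Sigma_plus_def)
  have low: "snd (orb2 t) < 0" if "0 < t" "t < T2" for t
   using g2(2) that by (auto simp: regular_segment_def Sigma_minus_def)
  have disj: "orb1 ` {0..<T1} \<inter> orb2 ` {0..<T2} = {}"
  proof -
   have "orb1 s ~= orb2 t" if "s \<in> {0..<T1}" "t \<in> {0..<T2}" for s t
   proof (cases "s = 0"; cases "t = 0")
    assume "s = 0" "t = 0"
    then show ?thesis using g1 g2 xc Ax by auto
   next
    assume "s = 0" "t ~= 0"
    then show ?thesis using g1(4) low[of t] that by (metis atLeastLessThan_iff less_irrefl order_le_less snd_conv)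
   next
    assume "s ~= 0" "t = 0"
    then show ?thesis using g2(4) up[of s] that by (metis atLeastLessThan_iff less_irrefl order_le_less snd_conv)
   next
    assume "s ~= 0" "t ~= 0"
    then show ?thesis using up[of s] low[of t] that by (metis atLeastLessThan_iff less_asym order_le_less)
   qed
   then show ?thesis by (simp add: disjoint_iff image_iff) (metis atLeastLessThan_iff)
  qed
  have i2: "i < 2 ==> i = 0 \<or> i = 1" for i :: nat by auto
  obtain \<tau> orb where loop: "loop_curve U Xp Xm 2 \<kappa> \<tau> orb" "orb ` {\<tau> 0..\<tau> 2} = (\<Union>i<2. G i ` {0..T i})"
   "\<And>i. i < 2 ==> orb (\<tau> i) = G i 0"
  proof (rule loop_from_pieces[of 2 T U Xp Xm \<kappa> G])
   show "is_piece U Xp Xm (\<kappa> i) (G i) 0 (T i)" if "i < 2" for i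
    using i2[OF that] g1 g2 by (auto simp: \<kappa>_def G_def T_def)
   show "G i (T i) = G (Suc i mod 2) 0" if "i < 2" for i
    using i2[OF that] g1 g2 by (auto simp: G_def T_def)
   show "G i ` {0..<T i} \<inter> G j ` {0..<T j} = {}" if "i < j" "j < 2" for i j
    using i2[of i] i2[of j] that disj by (auto simp: G_def T_def)
  qed (use i2 g1 g2 in \<open>auto simp: G_def T_def\<close>)
  have "{..<2::nat} = {0, 1}" by auto
  then have im: "(\<Union>i<2. G i ` {0..T i}) = C" using g1 g2 by (auto simp: G_def T_def C_def)
  have "(x, 0) \<in> crossing_region U Xp Xm"
   unfolding crossing_region_def Sigma_zero_def
   using axis_U[of x] product_sign(2)[of x] vL[of x] xc x c by auto
  moreover have "(A x, 0) \<in> crossing_region U Xp Xm"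
   unfolding crossing_region_def Sigma_zero_def
   using axis_U[of "A x"] product_sign(2)[of "A x"] vR[of "A x"] AA Ax c by (auto simp: mult_neg_neg)
  ultimately have "orb (\<tau> i) \<in> crossing_region U Xp Xm" if "i < 2" for i
   using loop(3)[OF that] i2[OF that] g1 g2 by (auto simp: G_def)
  with loop im show ?thesis unfolding crossing_periodic_orbit_def
   by (intro exI[of _ 2] exI[of _ \<kappa>] exI[of _ \<tau>] exI[of _ orb]) (auto simp: \<kappa>_def)
 qed
 \<comment> \<open>A neighbourhood whose trace on the axis consists of the open slot and its image
   under \<open>A\<close>, so a crossing orbit in it can have its vertices only there.\<close>
 define V where "V = interior N0 \<inter> ({p. snd p ~= 0} \<union> {p. a < fst p & fst p < b} \<union> {p. A b < fst p & fst p < A a})"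
 have "open V"
  unfolding V_def by (intro open_Int open_interior open_Un open_Collect_neq open_Collect_conj open_Collect_less continuous_intros)
 have CV: "C \<subseteq> V"
 proof
  fix p assume p: "p \<in> C"
  then have "p \<in> interior N0" using N0[of x] x by (auto simp: C_def)
  moreover have "p = (x, 0) \<or> p = (A x, 0)" if "snd p = 0"
   using p upper_axis[of x p] lower_axis[of x "A x" p] that xc Ax x(3) between by (auto simp: C_def)
  ultimately show "p \<in> V" using ax AA by (auto simp: V_def)
 qed
 have uniq: "C' = C" if C': "crossing_periodic_orbit U Xp Xm C'" "C' \<subseteq> V" for C'
 proof -
  obtain n \<kappa> \<tau> orb where loop: "loop_curve U Xp Xm n \<kappa> \<tau> orb" "C' = orb ` {\<tau> 0..\<tau> n}" "\<And>i. i < n ==> \<kappa> i ~= Sliding"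
   using C'(1) unfolding crossing_periodic_orbit_def by blast
  have n: "n >= 1" using loop(1) by (simp add: loop_curve_def)
  have "orb ` {\<tau> 0..\<tau> n} \<subseteq> N0" using C'(2) loop(2) interior_subset by (auto simp: V_def)
  then obtain s where s: "\<And>i. i < n ==> orb (\<tau> i) = (s i, 0)" "\<And>i. i < n ==> \<bar>s i\<bar> < x0"
   "\<And>i. i < n ==> piece_rel (\<kappa> i) (s i) (s (Suc i mod n))"
   "orb ` {\<tau> 0..\<tau> n} = (\<Union>i<n. piece_img (\<kappa> i) (s i) (s (Suc i mod n)))"
   by (rule loop_data[OF loop(1)]) (rule that)
  have le: "\<tau> i <= \<tau> j" if "i <= j" "j <= n" for i j
   using that
  proof (induction j)
   case (Suc j)
   have "\<tau> j < \<tau> (Suc j)" if "j < n" using loop(1) that unfolding loop_curve_def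
    by (cases "\<kappa> j") (auto simp: regular_segment_def sliding_segment_def)
   with Suc show ?case by (cases "i = Suc j") auto
  qed auto
  have mem: "s i \<in> {a<..<b} \<or> s i \<in> {A b<..<A a}" if "i < n" for i
  proof -
   have "\<tau> i \<in> {\<tau> 0..\<tau> n}" using le[of 0 i] le[of i n] that by auto
   then have "(s i, 0) \<in> V" using C'(2) loop(2) s(1)[OF that] by (metis image_eqI subsetD)
   then show ?thesis by (auto simp: V_def)
  qed
  have nx: "Suc i mod n < n" for i using n by simp
  have L: "\<kappa> i = Upper & s (Suc i mod n) = A (s i)" if i: "i < n" "s i \<in> {a<..<b}" for i
  proof -
   have "\<kappa> i ~= Lower"
   proof
    assume "\<kappa> i = Lower"
    then have r: "s (Suc i mod n) < s i" "\<And>x. s (Suc i mod n) < x ==> x < s i ==> H (s i) < H x"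
     using s(3)[OF i(1)] by (auto simp: piece_rel_def)
    obtain y where y: "max a (s (Suc i mod n)) < y" "y < s i" using r(1) i(2) dense[of "max a (s (Suc i mod n))" "s i"] by auto
    with r(2)[of y] left[of y "s i"] i slot show False by auto
   qed
   then have "\<kappa> i = Upper" using loop(3)[OF i(1)] by (cases "\<kappa> i") auto
   with s(3)[OF i(1)] show ?thesis by (simp add: piece_rel_def)
  qed
  have Rr: "\<kappa> i = Lower & s (Suc i mod n) \<in> {a<..<b} & H (s (Suc i mod n)) = H (s i)"
   if i: "i < n" "s i \<in> {A b<..<A a}" for i
  proof -
   have "\<kappa> i ~= Upper" using s(3)[OF i(1)] i(2) AA by (auto simp: piece_rel_def)
   then have k: "\<kappa> i = Lower" using loop(3)[OF i(1)] by (cases "\<kappa> i") auto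
   then have r: "s (Suc i mod n) < s i" "H (s (Suc i mod n)) = H (s i)"
    using s(3)[OF i(1)] by (auto simp: piece_rel_def)
   have "s (Suc i mod n) \<notin> {A b<..<A a}" using right[of "s i" "s (Suc i mod n)"] r i AA by auto
   with mem[OF nx[of i]] k r show ?thesis by auto
  qed
  have disjoint_zones: "\<not> (y \<in> {a<..<b} & y \<in> {A b<..<A a})" for y using slot AA by auto
  define I where "I = {i. i < n & s i \<in> {a<..<b}}"
  have "I ~= {}"
  proof -
   have "0 < n" using n by simp
   then show ?thesis using mem[of 0] Rr[of 0] nx[of 0] by (auto simp: I_def)
  qed
  \<comment> \<open>Two pieces back from a left vertex there is a left vertex \<open>s k\<close>
    again, with an upper and then a lower piece between: the left vertices form an orbit of the
    return map, read backwards.\<close>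
  have two: "\<exists>k\<in>I. s (pre n i) = A (s k) & pre n i < n & H (s i) = H (A (s k))" if i: "i \<in> I" for i
  proof -
   have i': "i < n" "s i \<in> {a<..<b}" using i by (auto simp: I_def)
   define j where "j = pre n i"
   have j: "j < n" "Suc j mod n = i" using pre[OF i'(1)] by (auto simp: j_def)
   have "s j \<notin> {a<..<b}"
   proof
    assume "s j \<in> {a<..<b}"
    with L[OF j(1)] j have "s i = A (s j)" by simp
    then show False using A_gt[of "s j"] \<open>s j \<in> _\<close> i' slot xe by auto
   qed
   then have sj: "s j \<in> {A b<..<A a}" using mem[OF j(1)] by blast
   define k where "k = pre n j"
   have k: "k < n" "Suc k mod n = j" using pre[OF j(1)] by (auto simp: k_def)
   have "s k \<notin> {A b<..<A a}" using Rr[OF k(1)] k sj disjoint_zones by auto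
   then have sk: "s k \<in> {a<..<b}" using mem[OF k(1)] by blast
   have "s j = A (s k)" using L[OF k(1) sk] k by simp
   moreover have "H (s i) = H (s j)" using Rr[OF j(1) sj] j by simp
   ultimately show ?thesis using k sk j by (auto simp: I_def j_def intro!: bexI[of _ k])
  qed
  have "finite I" by (simp add: I_def)
  \<comment> \<open>At the left vertex whose level is farthest from \<open>H x\<close>, the
    contraction contradicts maximality unless its predecessor is \<open>x\<close> itself; then the
    largest distance is \<open>0\<close>.\<close>
  then obtain i where i: "i \<in> I" "\<And>j. j \<in> I ==> \<bar>H (s j) - H x\<bar> <= \<bar>H (s i) - H x\<bar>"
   using finite_argmax[OF _ \<open>I ~= {}\<close>, of "%i. \<bar>H (s i) - H x\<bar>"] by blast
  obtain k where k: "k \<in> I" "H (s i) = H (A (s k))" using two[OF i(1)] by blast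
  have "s k = x"
  proof (rule ccontr)
   assume "s k ~= x"
   then have "\<bar>H (A (s k)) - H (A x)\<bar> < \<bar>H (s k) - H x\<bar>" using contr[of "s k" x] k x by (auto simp: I_def)
   with i(2)[OF k(1)] k(2) x(3) show False by simp
  qed
  then have zero: "H (s i) = H x" using k x(3) by simp
  have all: "s j = x" if "j \<in> I" for j
  proof (rule ccontr)
   assume "s j ~= x"
   moreover have "H (s j) = H x" using i(2)[OF that] zero by simp
   ultimately show False using left[of "s j" x] left[of x "s j"] that ax slot
    by (cases "s j" x rule: linorder_cases) (auto simp: I_def)
  qed
  have img: "piece_img (\<kappa> j) (s j) (s (Suc j mod n)) = (if j \<in> I then UA x else LA (A x) x)" if j: "j < n" for j
  proof (cases "j \<in> I")
   case True
   then show ?thesis using L[OF j] all[OF True] by (auto simp: I_def piece_img_def)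
  next
   case False
   then have sj: "s j \<in> {A b<..<A a}" using mem[OF j] j by (auto simp: I_def)
   have nj: "Suc j mod n \<in> I" using Rr[OF j sj] nx by (simp add: I_def)
   have "s j = A x"
   proof -
    have "pre n (Suc j mod n) = j" using j by (cases "Suc j = n") (auto simp: pre_def)
    then show ?thesis using two[OF nj] all by auto
   qed
   then show ?thesis using False Rr[OF j sj] all[OF nj] by (simp add: piece_img_def)
  qed
  obtain i0 where i0: "i0 \<in> I" using \<open>I ~= {}\<close> by blast
  have "pre n i0 < n" "pre n i0 \<notin> I"
  proof -
   have i0n: "i0 < n" using i0 by (simp add: I_def)
   show "pre n i0 < n" using pre(1)[OF i0n] .
   obtain k where "k \<in> I" "s (pre n i0) = A (s k)" using two[OF i0] by blast
   then have "s (pre n i0) = A x" using all[of k] by simp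
   then show "pre n i0 \<notin> I" using Ax slot by (simp add: I_def)
  qed
  then have ne: "\<exists>j<n. j \<notin> I" by blast
  have "i0 < n" using i0 by (simp add: I_def)
  have "(\<Union>i<n. piece_img (\<kappa> i) (s i) (s (Suc i mod n))) = (\<Union>i<n. if i \<in> I then UA x else LA (A x) x)"
   by (rule SUP_cong[OF refl]) (simp add: img)
  also have "\<dots> = C"
  proof (rule subset_antisym)
   show "(\<Union>i<n. if i \<in> I then UA x else LA (A x) x) \<subseteq> C" unfolding C_def by (rule UN_least) simp
   have "UA x \<subseteq> (\<Union>i<n. if i \<in> I then UA x else LA (A x) x)"
    by (rule order_trans[OF _ UN_upper[of i0]]) (use i0 \<open>i0 < n\<close> in simp_all)
   moreover obtain j where "j < n" "j \<notin> I" using ne by blast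
   then have "LA (A x) x \<subseteq> (\<Union>i<n. if i \<in> I then UA x else LA (A x) x)"
    by (intro order_trans[OF _ UN_upper[of j]]) simp_all
   ultimately show "C \<subseteq> (\<Union>i<n. if i \<in> I then UA x else LA (A x) x)" unfolding C_def by (rule Un_least)
  qed
  finally have "(\<Union>i<n. piece_img (\<kappa> i) (s i) (s (Suc i mod n))) = C" .
  with loop(2) s(4) show ?thesis by simp
 qed
 have "crossing_limit_cycle U Xp Xm C"
  unfolding crossing_limit_cycle_def using co \<open>open V\<close> CV uniq by blast
 moreover have "(x, 0) \<in> UA x" using g1(1,4,6) by (metis atLeastAtMost_iff image_eqI less_imp_le order_refl)
 ultimately show ?thesis using that[of x] ax x(3) by (simp add: C_def)
qed

end

text \<open>The loop of zone \<open>j\<close> slides to the tangent point \<open>e j\<close>,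
  follows a lower arc to \<open>xs j\<close> and an upper arc back into the zone. Beyond
  \<open>em\<close> and \<open>ep\<close> sliding is possible too, and \<open>outer\<close> lists
  the reasons why no loop uses it: a barrier \<open>B\<close> that lower arcs do not reach, with
  \<open>A B < ep\<close>; or no right outer region and, from \<open>A em\<close> on, levels too low
  for a lower arc to start; or no outer regions at all.\<close>

locale sliding_design = half_maps +
 fixes l :: nat and e e' xs :: "nat => real" and em ep :: real
 assumes e: "\<And>j. j < l ==> c < e j & e j < e' j & e' j < x0" and sep: "\<And>i j. i < j ==> j < l ==> e' i < e j"
  and v0: "\<And>j. j < l ==> v (e j) = 0 & v (e' j) = 0"
  and v_slide: "\<And>j x. j < l ==> e j < x ==> x < e' j ==> v x > 0"
  and em: "em < c" "- x0 < em ==> v em = 0" and ep: "c < ep" "ep < x0 ==> v ep = 0"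
  and zone: "\<And>x. \<bar>x\<bar> < x0 ==> v x * (c - x) < 0 ==> (\<exists>j<l. e j < x & x < e' j) \<or> ep < x \<or> x < em"
  and H_left: "\<And>x x'. - x0 < x ==> em <= x ==> x < x' ==> x' <= c ==> H x < H x'"
  and H_far_left: "\<And>x x'. - x0 < x ==> x < x' ==> x' <= em ==> H x' < H x"
  and H_slide: "\<And>j x x'. j < l ==> e j <= x ==> x < x' ==> x' <= e' j ==> H x < H x'"
  and H_far_right: "\<And>x x'. ep <= x ==> x < x' ==> x' < x0 ==> H x < H x'"
  and xs: "\<And>j. j < l ==> xe <= xs j & em < xs j & xs j < c & H (xs j) = H (e j)"
  and xs_between: "\<And>j x. j < l ==> xs j < x ==> x < e j ==> H (e j) < H x"
  and A_xs: "\<And>j. j < l ==> e j < A (xs j) & A (xs j) < e' j"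
  and outer: "(\<exists>B. em < B & - x0 < B & B <= c & A B < ep & (\<forall>p. c < p & p < x0 --> H B < H p)) \<or>
   (x0 <= ep & - x0 < em & (\<forall>j<l. e' j < A em) \<and>
    (\<forall>y. A em <= y & y < x0 --> H y < H em & (\<forall>x. c <= x & x < y --> H y < H x))) \<or>
   (x0 <= ep & em <= - x0)"
begin

definition cyc :: "nat => (nat => piece) => (nat => real) => bool" where
 "cyc n \<kappa> s \<longleftrightarrow> n >= 1 & (\<forall>i<n. \<bar>s i\<bar> < x0 & piece_rel (\<kappa> i) (s i) (s (Suc i mod n)))"

text \<open>Sliding cannot cross a zero of \<open>v\<close>, so the region that contains the
  midpoint contains the whole piece.\<close>

lemma slide_class:
 assumes "piece_rel Sliding p q"
 shows "(\<exists>j<l. e j <= q & p <= e' j) \<or> ep <= q \<or> p <= em"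
proof -
 have r: "- x0 < q" "q < p" "p < x0" "\<And>x. q < x ==> x < p ==> v x * (c - x) < 0"
  using assms by (auto simp: piece_rel_def)
 let ?m = "(p + q) / 2"
 have m: "q < ?m" "?m < p" "\<bar>?m\<bar> < x0" using r by auto
 from zone[OF m(3) r(4)[OF m(1,2)]] consider j where "j < l" "e j < ?m" "?m < e' j" | "ep < ?m" | "?m < em" by blast
 then show ?thesis
 proof cases
  case 1
  have "e j <= q" using r(4)[of "e j"] v0[OF 1(1)] 1 m by (cases "q < e j") auto
  moreover have "p <= e' j" using r(4)[of "e' j"] v0[OF 1(1)] 1 m by (cases "e' j < p") auto
  ultimately show ?thesis using 1 by blast
 next
  case 2
  have "ep <= q" using r(4)[of ep] ep 2 m by (cases "q < ep") auto
  then show ?thesis by blast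
 next
  case 3
  have "p <= em" using r(4)[of em] em 3 m r(1) by (cases "em < p") auto
  then show ?thesis by blast
 qed
qed

text \<open>Immediately left of its start a lower arc has points of larger \<open>H\<close>, so it
  cannot start where \<open>H\<close> increases up to the start. Left of \<open>em\<close>, where
  \<open>H\<close> decreases, there is no second point of equal level for it to end at.\<close>

lemma lower_start:
 assumes "piece_rel Lower p q"
 shows "c < p" "\<not> ep < p" "\<And>j. j < l ==> \<not> (e j < p & p <= e' j)"
proof -
 have r: "- x0 < q" "q < p" "p < x0" "H q = H p" "\<And>x. q < x ==> x < p ==> H p < H x"
  using assms by (auto simp: piece_rel_def)
 show "c < p"
 proof (rule ccontr)
  assume pc: "\<not> c < p"
  show False
  proof (cases "em < p")
   case True
   obtain y where "max q em < y" "y < p" using dense[of "max q em" p] r True by auto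
   have "H p < H y" using r(5)[of y] \<open>max q em < y\<close> \<open>y < p\<close> by simp
   moreover have "H y < H p" using H_left[of y p] r pc \<open>max q em < y\<close> \<open>y < p\<close> by simp
   ultimately show False by simp
  next
   case False
   then show False using H_far_left[of q p] r by auto
  qed
 qed
 show "\<not> ep < p"
 proof
  assume "ep < p"
  obtain y where "max q ep < y" "y < p" using dense[of "max q ep" p] r \<open>ep < p\<close> by auto
  then have "H p < H y" using r(5)[of y] by simp
  moreover have "H y < H p" using H_far_right[of y p] r(3) \<open>max q ep < y\<close> \<open>y < p\<close> by simp
  ultimately show False by simp
 qed
 show "\<not> (e j < p & p <= e' j)" if j: "j < l" for j
 proof
  assume "e j < p & p <= e' j"
  moreover then obtain y where y: "max q (e j) < y" "y < p" using dense[of "max q (e j)" p] r by auto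
  ultimately have "H y < H p" using H_slide[OF j, of y p] by simp
  moreover have "H p < H y" using r(5)[of y] y by simp
  ultimately show False by simp
 qed
qed

lemma upper_end: "piece_rel Upper p q ==> c < q"
 using A_gt by (auto simp: piece_rel_def)

text \<open>By extremality. With a barrier \<open>B\<close>, the rightmost start of a far-left
  sliding piece needs a predecessor ending there, which only a sliding piece from further right can
  be; and the far-right region is out of reach, as upper pieces land left of \<open>A B\<close>. In
  the second case the leftmost start of a far-left sliding piece is followed by an upper piece
  landing beyond \<open>A em\<close>, from where no piece continues.\<close>

lemma slide_in_zone:
 assumes "cyc n \<kappa> s" "i < n" "\<kappa> i = Sliding"
 shows "\<exists>j<l. e j <= s (Suc i mod n) & s i <= e' j"
proof -
 have n: "n >= 1" and bd: "\<And>i. i < n ==> \<bar>s i\<bar> < x0"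
  and rel: "\<And>i. i < n ==> piece_rel (\<kappa> i) (s i) (s (Suc i mod n))"
  using assms(1) by (auto simp: cyc_def)
 have nx: "Suc i mod n < n" for i using n by simp
 have no_left: "\<not> (i < n & \<kappa> i = Sliding & s i <= em)"
  and no_right: "\<not> (i < n & \<kappa> i = Sliding & ep <= s (Suc i mod n))"
  if hA: "em < B" "- x0 < B" "B <= c" "A B < ep" "\<And>p. c < p ==> p < x0 ==> H B < H p" for B i
 proof -
  \<comment> \<open>A lower arc from \<open>p\<close> that reached or passed over \<open>B\<close>
    would give \<open>H p \<le> H B\<close>, but every level right of \<open>c\<close> exceeds
    \<open>H B\<close>.\<close>
  have lower_end: "B < q" if "piece_rel Lower p q" for p q
  proof (rule ccontr)
   assume "\<not> B < q"
   have r: "q < p" "p < x0" "H q = H p" "\<And>x. q < x ==> x < p ==> H p < H x"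
    using that by (auto simp: piece_rel_def)
   have "H B < H p" using hA(5)[of p] lower_start(1)[OF that] r by simp
   moreover have "q = B \<or> q < B" using \<open>\<not> B < q\<close> by auto
   ultimately show False using r(3) r(4)[of B] hA(3) lower_start(1)[OF that] by auto
  qed
  have nl: "\<not> (i < n & \<kappa> i = Sliding & s i <= em)" for i
  proof
   define S where "S = {i. i < n & \<kappa> i = Sliding & s i <= em}"
   assume "i < n & \<kappa> i = Sliding & s i <= em"
   then have "finite S" "S ~= {}" by (auto simp: S_def)
   then obtain i where i: "i \<in> S" "\<And>j. j \<in> S ==> s j <= s i" using finite_argmax[of S s] by blast
   then have i': "i < n" "\<kappa> i = Sliding" "s i <= em" by (auto simp: S_def)
   let ?j = "pre n i"
   have j: "?j < n" "Suc ?j mod n = i" using pre[OF i'(1)] by auto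
   have rj: "piece_rel (\<kappa> ?j) (s ?j) (s i)" using rel[OF j(1)] j(2) by simp
   show False
   proof (cases "\<kappa> ?j")
    case Upper
    then show False using upper_end[of "s ?j" "s i"] rj i'(3) em by auto
   next
    case Lower
    then show False using lower_end[of "s ?j" "s i"] rj i'(3) hA(1) by auto
   next
    case Sliding
    then have sl: "piece_rel Sliding (s ?j) (s i)" using rj by simp
    then have less: "s i < s ?j" by (simp add: piece_rel_def)
    from slide_class[OF sl] have "s ?j <= em"
     using i'(3) em(1) ep(1) e by force
    then have "?j \<in> S" using Sliding j by (simp add: S_def)
    with i(2) less show False by fastforce
   qed
  qed
  show "\<not> (i < n & \<kappa> i = Sliding & s i <= em)" by (rule nl)
  have upper_bd: "A (s i) < ep" if iu: "i < n" "\<kappa> i = Upper" for i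
  proof -
   let ?j = "pre n i"
   have j: "?j < n" "Suc ?j mod n = i" using pre[OF iu(1)] by auto
   have rj: "piece_rel (\<kappa> ?j) (s ?j) (s i)" using rel[OF j(1)] j(2) by simp
   have si: "s i <= c" "- x0 < s i" using rel[OF iu(1)] iu(2) by (auto simp: piece_rel_def)
   have "B < s i"
   proof (cases "\<kappa> ?j")
    case Upper
    then show ?thesis using upper_end[of "s ?j" "s i"] rj si by auto
   next
    case Lower
    then show ?thesis using lower_end[of "s ?j" "s i"] rj by auto
   next
    case Sliding
    then have sl: "piece_rel Sliding (s ?j) (s i)" using rj by simp
    have "\<not> s ?j <= em" using nl[of ?j] Sliding j by blast
    with slide_class[OF sl] si ep(1) e show ?thesis by force
   qed
   then have "A (s i) < A B" using A_dec[OF hA(2), of "s i"] si by auto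
   with hA(4) show ?thesis by simp
  qed
  show "\<not> (i < n & \<kappa> i = Sliding & ep <= s (Suc i mod n))"
  proof
   define S where "S = {i. i < n & \<kappa> i = Sliding & ep <= s (Suc i mod n)}"
   assume "i < n & \<kappa> i = Sliding & ep <= s (Suc i mod n)"
   then have "finite S" "S ~= {}" by (auto simp: S_def)
   then obtain i where i: "i \<in> S" "\<And>j. j \<in> S ==> s j <= s i" using finite_argmax[of S s] by blast
   then have i': "i < n" "\<kappa> i = Sliding" "ep <= s (Suc i mod n)" by (auto simp: S_def)
   have epi: "ep < s i" using rel[OF i'(1)] i' by (auto simp: piece_rel_def)
   let ?j = "pre n i"
   have j: "?j < n" "Suc ?j mod n = i" using pre[OF i'(1)] by auto
   have rj: "piece_rel (\<kappa> ?j) (s ?j) (s i)" using rel[OF j(1)] j(2) by simp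
   show False
   proof (cases "\<kappa> ?j")
    case Upper
    then show False using upper_bd[OF j(1)] rj epi by (auto simp: piece_rel_def)
   next
    case Lower
    then show False using lower_start(2)[of "s ?j" "s i"] rj epi by (auto simp: piece_rel_def)
   next
    case Sliding
    then have "?j \<in> S" using j epi by (simp add: S_def)
    moreover have "s i < s ?j" using rj Sliding by (simp add: piece_rel_def)
    ultimately show False using i(2) by fastforce
   qed
  qed
 qed
 have rb: "\<not> ep <= s (Suc i mod n)" if "x0 <= ep" for i
  using bd[OF nx[of i]] that by auto
 have sl: "piece_rel Sliding (s i) (s (Suc i mod n))" using rel[OF assms(2)] assms(3) by simp
 consider B where "em < B" "- x0 < B" "B <= c" "A B < ep" "\<And>p. c < p ==> p < x0 ==> H B < H p"
  | "x0 <= ep" "- x0 < em" "\<And>j. j < l ==> e' j < A em"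
   "\<And>y. A em <= y ==> y < x0 ==> H y < H em & (\<forall>x. c <= x & x < y --> H y < H x)"
  | "x0 <= ep" "em <= - x0"
  using outer by blast
 then show ?thesis
 proof cases
  case 1
  from no_left[OF 1] no_right[OF 1] slide_class[OF sl] assms(2,3) show ?thesis by blast
 next
  case 2
  have "\<not> (i < n & \<kappa> i = Sliding & s i <= em)" for i
  proof
   define S where "S = {i. i < n & \<kappa> i = Sliding & s i <= em}"
   assume "i < n & \<kappa> i = Sliding & s i <= em"
   then have "finite S" "S ~= {}" by (auto simp: S_def)
   then obtain i where i: "i \<in> S" "\<And>j. j \<in> S ==> - s j <= - s i"
    using finite_argmax[of S "%i. - s i"] by blast
   then have i': "i < n" "\<kappa> i = Sliding" "s i <= em" by (auto simp: S_def)
   let ?k = "Suc i mod n"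
   have q: "s ?k < s i" using rel[OF i'(1)] i'(2) by (simp add: piece_rel_def)
   have rk: "piece_rel (\<kappa> ?k) (s ?k) (s (Suc ?k mod n))" using rel[OF nx[of i]] .
   show False
   proof (cases "\<kappa> ?k")
    case Sliding
    then have "?k \<in> S" using q i' nx by (simp add: S_def)
    with i(2) q show False by fastforce
   next
    case Lower
    then show False using lower_start(1)[of "s ?k"] rk q i'(3) em by auto
   next
    case Upper
    let ?m = "Suc ?k mod n"
    have y: "s ?m = A (s ?k)" "- x0 < s ?k" using rk Upper by (auto simp: piece_rel_def)
    have "A em < A (s ?k)" using A_dec[of "s ?k" em] y q i'(3) em by auto
    then have ym: "A em < s ?m" "c < s ?m" using y A_gt[of em] 2(2) em by auto
    have rm: "piece_rel (\<kappa> ?m) (s ?m) (s (Suc ?m mod n))" using rel[OF nx[of ?k]] .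
    have ys: "H (s ?m) < H em" "\<And>x. c <= x ==> x < s ?m ==> H (s ?m) < H x"
     using 2(4)[of "s ?m"] ym bd[OF nx[of ?k]] by auto
    show False
    proof (cases "\<kappa> ?m")
     case Upper
     then show False using rm ym by (auto simp: piece_rel_def)
    next
     case Sliding
     then have "piece_rel Sliding (s ?m) (s (Suc ?m mod n))" using rm by simp
     from slide_class[OF this] rb[OF 2(1)] ym em(1) 2(3) show False by fastforce
    next
     case Lower
     let ?q = "s (Suc ?m mod n)"
     have r: "- x0 < ?q" "?q < s ?m" "H ?q = H (s ?m)" using rm Lower by (auto simp: piece_rel_def)
     show False
     proof (cases "?q < c")
      case True
      have "H em <= H ?q"
       using H_far_left[of ?q em] H_left[of em ?q] r True 2(2) by (cases "?q" em rule: linorder_cases) auto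
      with r ys(1) show False by simp
     next
      case False
      with ys(2)[of ?q] r show False by simp
     qed
    qed
   qed
  qed
  with rb[OF 2(1)] slide_class[OF sl] assms(2,3) show ?thesis by blast
 next
  case 3
  have "\<not> s i <= em" using bd[OF assms(2)] 3 by auto
  with rb[OF 3(1)] slide_class[OF sl] show ?thesis by blast
 qed
qed

definition slide_loop :: "nat => plane set" where
 "slide_loop j = UA (xs j) \<union> LA (e j) (xs j) \<union> {e j..A (xs j)} \<times> {0}"

lemma slide_start:
 assumes "piece_rel k p q" "j < l" "e j < p" "p <= e' j"
 shows "k = Sliding" "e j <= q"
proof -
 have "k ~= Upper" using assms e[OF assms(2)] by (auto simp: piece_rel_def)
 moreover have "k ~= Lower" using lower_start(3)[of p q j] assms by auto
 ultimately show k: "k = Sliding" by (cases k) auto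
 with assms have sl: "piece_rel Sliding p q" by simp
 show "e j <= q"
 proof (rule ccontr)
  assume q: "\<not> e j <= q"
  have "\<And>x. q < x ==> x < p ==> v x * (c - x) < 0" using sl by (auto simp: piece_rel_def)
  from this[of "e j"] q assms v0[OF assms(2)] show False by auto
 qed
qed

text \<open>Sliding from \<open>e j\<close> would lead to the left, out of zone \<open>j\<close>,
  where no sliding region adjoins. The end of the lower arc is forced, because \<open>xs j\<close>
  is the first point to the left on the level of \<open>e j\<close>.\<close>

lemma tangent_start:
 assumes "piece_rel k (e j) q" "j < l"
 shows "k = Lower" "q = xs j"
proof -
 have "k ~= Upper" using assms e[OF assms(2)] by (auto simp: piece_rel_def)
 moreover have "k ~= Sliding"
 proof
  assume "k = Sliding"
  then have sl: "piece_rel Sliding (e j) q" using assms by simp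
  then have less: "q < e j" "\<And>x. q < x ==> x < e j ==> v x * (c - x) < 0" by (auto simp: piece_rel_def)
  have "e j < x0" "e j <= ep \<or> ep < x0" using e[OF assms(2)] by auto
  from slide_class[OF sl] show False
  proof (elim disjE exE conjE)
   fix i assume i: "i < l" "e i <= q" "e j <= e' i"
   have "i < j \<or> i = j \<or> j < i" by linarith
   then show False using sep[of i j] sep[of j i] i less e[OF i(1)] e[OF assms(2)] assms(2) by auto
  next
   assume "ep <= q"
   obtain y where y: "q < y" "y < e j" using dense[OF less(1)] by blast
   have "H y < H (e j)" using H_far_right[of y "e j"] \<open>ep <= q\<close> y e[OF assms(2)] by auto
   moreover have "H (e j) < H y" using xs_between[OF assms(2), of y] xs[OF assms(2)] y \<open>ep <= q\<close> ep by auto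
   ultimately show False by simp
  next
   assume "e j <= em"
   then show False using e[OF assms(2)] em by auto
  qed
 qed
 ultimately show k: "k = Lower" by (cases k) auto
 then have r: "- x0 < q" "q < e j" "H q = H (e j)" "\<And>x. q < x ==> x < e j ==> H (e j) < H x"
  using assms by (auto simp: piece_rel_def)
 show "q = xs j"
  using r(4)[of "xs j"] xs_between[OF assms(2), of q] r xs[OF assms(2)] e[OF assms(2)]
  by (cases q "xs j" rule: linorder_cases) auto
qed

lemma left_start:
 assumes "piece_rel k (xs j) q" "j < l"
 shows "k = Upper" "q = A (xs j)"
proof -
 have "k ~= Lower" using lower_start(1)[of "xs j" q] assms xs[OF assms(2)] by auto
 moreover have "k ~= Sliding"
 proof
  assume "k = Sliding"
  then have sl: "piece_rel Sliding (xs j) q" using assms by simp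
  then have "q < xs j" by (simp add: piece_rel_def)
  with slide_class[OF sl] xs[OF assms(2)] em(1) ep(1) e show False by force
 qed
 ultimately show "k = Upper" by (cases k) auto
 with assms show "q = A (xs j)" by (simp add: piece_rel_def)
qed

text \<open>From a vertex in zone \<open>j\<close> the continuation is forced, up to cutting the
  sliding part into several pieces: the states \<open>st\<close> are closed under successors and by
  periodicity contain every vertex. It remains to see that all three kinds of pieces occur and that
  the sliding pieces together cover the segment from \<open>e j\<close> to \<open>A (xs j)\<close>
  and nothing more.\<close>

lemma loop_eq:
 assumes "cyc n \<kappa> s" "i0 < n" "\<kappa> i0 = Sliding"
 obtains j where "j < l" "(\<Union>i<n. piece_img (\<kappa> i) (s i) (s (Suc i mod n))) = slide_loop j"
proof -
 have n: "n >= 1" and rel: "\<And>i. i < n ==> piece_rel (\<kappa> i) (s i) (s (Suc i mod n))"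
  using assms(1) by (auto simp: cyc_def)
 have nx: "Suc i mod n < n" for i using n by simp
 obtain j where j: "j < l" "e j <= s (Suc i0 mod n)" "s i0 <= e' j" using slide_in_zone[OF assms] by blast
 have st: "e j < s i0" using rel[OF assms(2)] assms(3) j by (auto simp: piece_rel_def)
 define st where "st p \<longleftrightarrow> e j < p & p <= e' j \<or> p = e j \<or> p = xs j" for p
 have st_step: "st (s (Suc i mod n))" if "i < n" "st (s i)" for i
  using that(2) unfolding st_def
 proof (elim disjE conjE)
  assume *: "e j < s i" "s i <= e' j"
  from slide_start[OF rel[OF that(1)] j(1) *] rel[OF that(1)] * show
   "e j < s (Suc i mod n) & s (Suc i mod n) <= e' j \<or> s (Suc i mod n) = e j \<or> s (Suc i mod n) = xs j"
   by (auto simp: piece_rel_def)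
 next
  assume "s i = e j"
  with tangent_start[OF _ j(1)] rel[OF that(1)] show
   "e j < s (Suc i mod n) & s (Suc i mod n) <= e' j \<or> s (Suc i mod n) = e j \<or> s (Suc i mod n) = xs j" by metis
 next
  assume "s i = xs j"
  with left_start[OF _ j(1)] rel[OF that(1)] A_xs[OF j(1)] show
   "e j < s (Suc i mod n) & s (Suc i mod n) <= e' j \<or> s (Suc i mod n) = e j \<or> s (Suc i mod n) = xs j"
   by (metis less_imp_le)
 qed
 have st_iter: "st (s ((i0 + k) mod n))" for k
 proof (induction k)
  case 0
  show ?case using st j assms(2) by (simp add: st_def)
 next
  case (Suc k)
  have "(i0 + Suc k) mod n = Suc ((i0 + k) mod n) mod n" by (simp add: mod_Suc_eq)
  with st_step[of "(i0 + k) mod n"] Suc n show ?case by simp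
 qed
 have all: "st (s i)" if "i < n" for i
 proof -
  have "(i0 + (n + i - i0)) mod n = i" using that assms(2) by simp
  with st_iter[of "n + i - i0"] show ?thesis by simp
 qed
 have kinds: "(\<kappa> i = Sliding & e j < s i & e j <= s (Suc i mod n) & s (Suc i mod n) < s i) \<or>
   (\<kappa> i = Lower & s i = e j & s (Suc i mod n) = xs j) \<or> (\<kappa> i = Upper & s i = xs j & s (Suc i mod n) = A (xs j))"
  if i: "i < n" for i
  using all[OF i] unfolding st_def
 proof (elim disjE conjE)
  assume *: "e j < s i" "s i <= e' j"
  from slide_start[OF rel[OF i] j(1) *] rel[OF i] * show ?thesis by (auto simp: piece_rel_def)
 next
  assume "s i = e j"
  with tangent_start[OF _ j(1)] rel[OF i] show ?thesis by metis
 next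
  assume "s i = xs j"
  with left_start[OF _ j(1)] rel[OF i] show ?thesis by metis
 qed
 have xse: "xs j < e j" using xs[OF j(1)] e[OF j(1)] by auto
 \<comment> \<open>The leftmost vertex cannot start a sliding piece. If it starts an upper piece it
   is \<open>xs j\<close>, and no sliding or upper piece ends there.\<close>
 have ex_lower: "\<exists>i<n. \<kappa> i = Lower"
 proof (rule ccontr)
  assume no: "\<not> (\<exists>i<n. \<kappa> i = Lower)"
  obtain i where i: "i \<in> {..<n}" "\<And>k. k \<in> {..<n} ==> - s k <= - s i"
   using finite_argmax[of "{..<n}" "%i. - s i"] n by (auto simp: lessThan_empty_iff)
  show False
  proof (cases "\<kappa> i = Sliding")
   case True
   then have "s (Suc i mod n) < s i" using kinds[of i] i(1) by auto
   with i(2)[of "Suc i mod n"] nx show False by auto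
  next
   case False
   then have "s i = xs j" using kinds[of i] i(1) no by auto
   let ?k = "pre n i"
   have k: "?k < n" "Suc ?k mod n = i" using pre[of i n] i(1) by auto
   then show False using kinds[OF k(1)] no \<open>s i = xs j\<close> xse A_xs[OF j(1)] by auto
  qed
 qed
 then obtain i1 where i1: "i1 < n" "\<kappa> i1 = Lower" by blast
 let ?i2 = "Suc i1 mod n"
 let ?i3 = "Suc ?i2 mod n"
 have s1: "s i1 = e j" "s ?i2 = xs j" using kinds[OF i1(1)] i1 by auto
 have k2: "\<kappa> ?i2 = Upper" "s ?i3 = A (xs j)" using kinds[OF nx[of i1]] s1(2) xse by auto
 have k3: "\<kappa> ?i3 = Sliding" using kinds[OF nx[of ?i2]] k2(2) A_xs[OF j(1)] xse by auto
 define S where "S = {i. i < n & \<kappa> i = Sliding}"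
 \<comment> \<open>The rightmost sliding start beyond \<open>A (xs j)\<close> would need a
   predecessor ending there, and that is a sliding piece starting still further right.\<close>
 have sl_start: "s i <= A (xs j)" if "i < n" "\<kappa> i = Sliding" for i
 proof (rule ccontr)
  assume "\<not> s i <= A (xs j)"
  then have "i \<in> S" using that by (simp add: S_def)
  then obtain i where i: "i \<in> S" "\<And>k. k \<in> S ==> s k <= s i" "\<not> s i <= A (xs j)"
   using finite_argmax[of S s] \<open>\<not> s i <= A (xs j)\<close>
   by (metis (no_types, lifting) S_def empty_iff finite_nat_set_iff_bounded mem_Collect_eq order_trans)
  let ?k = "pre n i"
  have k: "?k < n" "Suc ?k mod n = i" using pre[of i n] i(1) by (auto simp: S_def)
  have "s i > e j" using i(3) A_xs[OF j(1)] by simp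
  then have "\<kappa> ?k = Sliding & s i < s ?k" using kinds[OF k(1)] k i(3) xse by auto
  with i(2)[of ?k] k show False by (auto simp: S_def)
 qed
 have "(\<Union>i<n. piece_img (\<kappa> i) (s i) (s (Suc i mod n))) = slide_loop j"
 proof (rule subset_antisym)
  show "(\<Union>i<n. piece_img (\<kappa> i) (s i) (s (Suc i mod n))) \<subseteq> slide_loop j"
  proof (rule UN_least)
   fix i assume "i \<in> {..<n}"
   then have i: "i < n" by simp
   from kinds[OF i] show "piece_img (\<kappa> i) (s i) (s (Suc i mod n)) \<subseteq> slide_loop j"
   proof (elim disjE conjE)
    assume "\<kappa> i = Sliding" "e j <= s (Suc i mod n)"
    then show ?thesis using sl_start[OF i] by (auto simp: piece_img_def slide_loop_def)
   qed (auto simp: piece_img_def slide_loop_def)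
  qed
  have up: "UA (xs j) \<subseteq> (\<Union>i<n. piece_img (\<kappa> i) (s i) (s (Suc i mod n)))"
   by (rule order_trans[OF _ UN_upper[of ?i2]]) (use k2 s1 nx in \<open>auto simp: piece_img_def\<close>)
  have low: "LA (e j) (xs j) \<subseteq> (\<Union>i<n. piece_img (\<kappa> i) (s i) (s (Suc i mod n)))"
   by (rule order_trans[OF _ UN_upper[of i1]]) (use i1 s1 in \<open>auto simp: piece_img_def\<close>)
  have "(z, 0) \<in> (\<Union>i<n. piece_img (\<kappa> i) (s i) (s (Suc i mod n)))" if z: "e j <= z" "z <= A (xs j)" for z
  proof -
   \<comment> \<open>Of the sliding pieces starting at or right of \<open>z\<close>, the one with
     the leftmost start ends at or left of \<open>z\<close>, since otherwise its successor would
     belong to \<open>Q\<close> as well.\<close>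
   define Q where "Q = {i. i < n & \<kappa> i = Sliding & z <= s i}"
   have "?i3 \<in> Q" using k2 k3 z nx by (simp add: Q_def)
   moreover have "finite Q" by (simp add: Q_def)
   ultimately obtain i where i: "i \<in> Q" "\<And>k. k \<in> Q ==> - s k <= - s i"
    using finite_argmax[of Q "%i. - s i"] by blast
   then have i': "i < n" "\<kappa> i = Sliding" "z <= s i" by (auto simp: Q_def)
   have ki: "e j <= s (Suc i mod n)" "s (Suc i mod n) < s i" using kinds[OF i'(1)] i'(2) by auto
   have "s (Suc i mod n) <= z"
   proof (rule ccontr)
    assume lt: "\<not> s (Suc i mod n) <= z"
    then have "\<kappa> (Suc i mod n) = Sliding" using kinds[OF nx[of i]] z xse by auto
    then have "Suc i mod n \<in> Q" using lt nx by (simp add: Q_def)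
    with i(2) ki show False by fastforce
   qed
   with i' show ?thesis by (auto simp: piece_img_def intro!: bexI[of _ i])
  qed
  then have "{e j..A (xs j)} \<times> {0} \<subseteq> (\<Union>i<n. piece_img (\<kappa> i) (s i) (s (Suc i mod n)))" by auto
  with up low show "slide_loop j \<subseteq> (\<Union>i<n. piece_img (\<kappa> i) (s i) (s (Suc i mod n)))"
   unfolding slide_loop_def by (intro Un_least)
 qed
 with j that show ?thesis by blast
qed

lemma sliding_loop_in_N0:
 assumes "sliding_loop U Xp Xm C" "C \<subseteq> N0"
 shows "\<exists>j<l. C = slide_loop j"
proof -
 obtain n \<kappa> \<tau> orb i0 where loop: "loop_curve U Xp Xm n \<kappa> \<tau> orb" "C = orb ` {\<tau> 0..\<tau> n}" "i0 < n" "\<kappa> i0 = Sliding"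
  using assms(1) unfolding sliding_loop_def by blast
 have n: "n >= 1" using loop(1) by (simp add: loop_curve_def)
 obtain s where s: "\<And>i. i < n ==> orb (\<tau> i) = (s i, 0)" "\<And>i. i < n ==> \<bar>s i\<bar> < x0"
  "\<And>i. i < n ==> piece_rel (\<kappa> i) (s i) (s (Suc i mod n))"
  "orb ` {\<tau> 0..\<tau> n} = (\<Union>i<n. piece_img (\<kappa> i) (s i) (s (Suc i mod n)))"
  by (rule loop_data[OF loop(1)]) (use assms loop in auto)
 have "cyc n \<kappa> s" using n s by (simp add: cyc_def)
 from loop_eq[OF this loop(3,4)] s(4) loop(2) show ?thesis by metis
qed

section \<open>Existence and number of the sliding loops\<close>

lemma slide_exists:
 assumes j: "j < l" and y: "e j < y" "y < e' j"
 obtains orb T where "T > 0" "sliding_segment U Xp Xm orb 0 T" "inj_on orb {0..<T}" "orb 0 = (y, 0)" "orb T = (e j, 0)"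
  "orb ` {0..T} = {e j..y} \<times> {0}"
proof -
 have bd: "\<bar>x\<bar> < x0" if "x \<in> {e j..y}" for x using that y e[OF j] c by auto
 have gp: "snd (Xp (x, 0)) < 0" if "x \<in> {e j..y}" for x
 proof -
  have "sgn (snd (Xp (x, 0))) = -1" using Xp_snd[OF bd[OF that]] that e[OF j] by simp
  then show ?thesis by (simp add: sgn_if split: if_splits)
 qed
 have gm: "snd (Xm (x, 0)) >= 0" if "x \<in> {e j..y}" for x
 proof -
  have "v x >= 0" using v0[OF j] v_slide[OF j, of x] that y by (cases "x = e j") auto
  then show ?thesis using Xm_snd[OF bd[OF that]] by (metis sgn_less linorder_not_le)
 qed
 \<comment> \<open>The sliding speed is negative on the closed interval, the tangent point
   \<open>e j\<close> included: there \<open>v\<close> vanishes, but the upper field still points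
   down. So \<open>e j\<close> is reached in finite time.\<close>
 define S where "S x = fst (sliding_field Xp Xm (x, 0))" for x
 have neg: "S x < 0" if "x \<in> {e j..y}" for x
  unfolding S_def using gp[OF that] gm[OF that] by (intro sliding_field_neg bd that) auto
 have cX: "continuous_on {e j..y} (%x. Xp (x, 0))" "continuous_on {e j..y} (%x. Xm (x, 0))"
  using X_cont continuous_on_subset by blast+
 have cS: "continuous_on {e j..y} S"
  unfolding S_def sliding_field_def fst_conv
  by (intro continuous_intros cX) (use gp gm in force)
 obtain T X where X: "T > 0" "X 0 = y" "X T = e j"
  "\<And>t. t \<in> {0..T} ==> (X has_real_derivative S (X t)) (at t within {0..T})"
  "X ` {0..T} = {e j..y}" "\<And>t. t \<in> {0<..<T} ==> e j < X t & X t < y"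
  by (rule scalar_orbit[OF y(1) cS neg], assumption) (rule that)
 define orb where "orb t = (X t, 0 :: real)" for t
 have Xc: "continuous_on {0..T} X" by (rule DERIV_continuous_on[OF X(4)])
 have sol: "solves (sliding_field Xp Xm) orb {0..T}"
  unfolding solves_def
 proof
  fix t assume t: "t \<in> {0..T}"
  have "sliding_field Xp Xm (orb t) = (S (X t), 0)" by (simp add: S_def orb_def sliding_field_def)
  moreover have "(orb has_vector_derivative (S (X t), 0)) (at t within {0..T})"
   unfolding orb_def[abs_def] using X(4)[OF t]
   by (intro has_vector_derivative_Pair) (auto simp: has_real_derivative_iff_has_vector_derivative)
  ultimately show "(orb has_vector_derivative sliding_field Xp Xm (orb t)) (at t within {0..T})" by simp
 qed
 have dec: "X t < X s" if "s \<in> {0..T}" "t \<in> {0..T}" "s < t" for s t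
 proof -
  have "- X s < - X t"
  proof (rule deriv_within_pos_mono[OF that(3), where F = "%t. - X t" and F' = "%t. - S (X t)"])
   show "((%t. - X t) has_real_derivative - S (X x)) (at x within {s..t})" if "x \<in> {s..t}" for x
    by (intro derivative_intros has_real_derivative_within_subset[OF X(4)]) (use that \<open>s \<in> _\<close> \<open>t \<in> _\<close> in auto)
   show "- S (X x) > 0" if "s < x" "x < t" for x
   proof -
    have "x \<in> {0..T}" using that \<open>s \<in> _\<close> \<open>t \<in> _\<close> by auto
    then have "X x \<in> {e j..y}" using X(5) by blast
    from neg[OF this] show ?thesis by simp
   qed
  qed
  then show ?thesis by simp
 qed
 have "inj_on orb {0..<T}"
 proof (rule inj_onI)
  fix s t assume "s \<in> {0..<T}" "t \<in> {0..<T}" "orb s = orb t"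
  then show "s = t" using dec[of s t] dec[of t s] by (cases s t rule: linorder_cases) (auto simp: orb_def)
 qed
 moreover have "sliding_segment U Xp Xm orb 0 T"
  unfolding sliding_segment_def
 proof (intro conjI X(1) ballI)
  show "continuous_on {0..T} orb" unfolding orb_def[abs_def] by (intro continuous_intros Xc)
  show "solves (sliding_field Xp Xm) orb {0<..<T}" by (rule solves_subset[OF sol]) auto
  show "orb 0 \<in> Sigma_zero U" "orb T \<in> Sigma_zero U"
   using X(2,3) axis_U[OF bd[of y]] axis_U[OF bd[of "e j"]] y by (auto simp: orb_def Sigma_zero_def)
  fix t assume "t \<in> {0<..<T}"
  then have x: "e j < X t" "X t < y" using X(6) by auto
  then have b: "\<bar>X t\<bar> < x0" using bd[of "X t"] by simp
  have "v (X t) * (c - X t) < 0" using v_slide[OF j, of "X t"] x y e[OF j] by (intro mult_pos_neg) auto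
  with product_sign(1)[OF b] axis_U[OF b] show "orb t \<in> sliding_region U Xp Xm"
   by (simp add: sliding_region_def Sigma_zero_def orb_def)
 qed
 moreover have "orb ` {0..T} = {e j..y} \<times> {0}"
  unfolding X(5)[symmetric] orb_def by auto
 ultimately show ?thesis using X by (intro that[of T orb]) (auto simp: orb_def)
qed

lemma slide_loop_exists:
 assumes j: "j < l"
 shows "sliding_loop U Xp Xm (slide_loop j)"
proof -
 note X = xs[OF j] and E = e[OF j] and AX = A_xs[OF j]
 obtain orb1 T1 where g1: "T1 > 0" "regular_segment U Xp (Sigma_plus U) orb1 0 T1" "inj_on orb1 {0..<T1}"
  "orb1 0 = (xs j, 0)" "orb1 T1 = (A (xs j), 0)" "orb1 ` {0..T1} = UA (xs j)"
  using upper_exists[of "xs j"] X by auto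
 obtain orb2 T2 where g2: "T2 > 0" "sliding_segment U Xp Xm orb2 0 T2" "inj_on orb2 {0..<T2}"
  "orb2 0 = (A (xs j), 0)" "orb2 T2 = (e j, 0)" "orb2 ` {0..T2} = {e j..A (xs j)} \<times> {0}"
  by (rule slide_exists[OF j, of "A (xs j)"]) (use AX in auto)
 obtain orb3 T3 where g3: "T3 > 0" "regular_segment U Xm (Sigma_minus U) orb3 0 T3" "inj_on orb3 {0..<T3}"
  "orb3 0 = (e j, 0)" "orb3 T3 = (xs j, 0)" "orb3 ` {0..T3} = LA (e j) (xs j)"
  using lower_exists[of "xs j" "e j"] X E xe xs_between[OF j] by auto
 define G where "G i = (if i = 0 then orb1 else if i = 1 then orb2 else orb3)" for i :: nat
 define T where "T i = (if i = 0 then T1 else if i = 1 then T2 else T3)" for i :: nat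
 define \<kappa> where "\<kappa> i = (if i = 0 then Upper else if i = 1 then Sliding else Lower)" for i :: nat
 have i3: "i < 3 ==> i = 0 \<or> i = 1 \<or> i = 2" for i :: nat by auto
 have up: "orb1 t = (xs j, 0) \<or> snd (orb1 t) > 0" if "t \<in> {0..<T1}" for t
  using g1(2,4) that by (cases "t = 0") (auto simp: regular_segment_def Sigma_plus_def)
 have low: "orb3 t = (e j, 0) \<or> snd (orb3 t) < 0" if "t \<in> {0..<T3}" for t
  using g3(2,4) that by (cases "t = 0") (auto simp: regular_segment_def Sigma_minus_def)
 have mid: "snd (orb2 t) = 0 & e j <= fst (orb2 t)" if "t \<in> {0..<T2}" for t
 proof -
  have "orb2 t \<in> {e j..A (xs j)} \<times> {0}" using g2(6) that by (metis atLeastAtMost_iff atLeastLessThan_iff imageI less_imp_le)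
  then show ?thesis by (auto simp: mem_Times_iff)
 qed
 \<comment> \<open>The half-open sliding piece must not contain the start \<open>e j\<close> of the
   lower piece; its interior points are in the sliding region, where \<open>v\<close> is not
   \<open>0\<close>.\<close>
 have mid': "orb2 t ~= (e j, 0)" if "t \<in> {0..<T2}" for t
 proof
  assume *: "orb2 t = (e j, 0)"
  have "t ~= 0" using * g2(4) AX by auto
  then have "orb2 t \<in> sliding_region U Xp Xm" using g2(2) that by (auto simp: sliding_segment_def)
  then have "snd (Xp (e j, 0)) * snd (Xm (e j, 0)) < 0" using * by (simp add: sliding_region_def)
  moreover have "\<bar>e j\<bar> < x0" using E c by auto
  ultimately show False using product_sign(1)[of "e j"] v0[OF j] by simp
 qed
 have d12: "orb1 s ~= orb2 t" if "s \<in> {0..<T1}" "t \<in> {0..<T2}" for s t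
 proof
  assume "orb1 s = orb2 t"
  then have "orb1 s = (xs j, 0)" using up[OF that(1)] mid[OF that(2)] by auto
  with \<open>orb1 s = orb2 t\<close> have "fst (orb2 t) = xs j" by (metis fst_conv)
  then show False using mid[OF that(2)] X E by auto
 qed
 have d13: "orb1 s ~= orb3 t" if "s \<in> {0..<T1}" "t \<in> {0..<T3}" for s t
 proof
  assume "orb1 s = orb3 t"
  then have "snd (orb3 t) >= 0" "snd (orb3 t) = 0 ==> fst (orb3 t) = xs j"
   using up[OF that(1)] by (metis less_imp_le order_refl snd_conv, metis fst_conv less_irrefl)
  then show False using low[OF that(2)] X E by (metis fst_conv less_asym less_irrefl not_le order_less_trans snd_conv)
 qed
 have d23: "orb2 s ~= orb3 t" if "s \<in> {0..<T2}" "t \<in> {0..<T3}" for s t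
  using mid[OF that(1)] mid'[OF that(1)] low[OF that(2)] by auto
 have D: "orb1 ` {0..<T1} \<inter> orb2 ` {0..<T2} = {}" "orb1 ` {0..<T1} \<inter> orb3 ` {0..<T3} = {}" "orb2 ` {0..<T2} \<inter> orb3 ` {0..<T3} = {}"
  using d12 d13 d23 by blast+
 obtain \<tau> orb where loop: "loop_curve U Xp Xm 3 \<kappa> \<tau> orb" "orb ` {\<tau> 0..\<tau> 3} = (\<Union>i<3. G i ` {0..T i})"
  "\<And>i. i < 3 ==> orb (\<tau> i) = G i 0"
 proof (rule loop_from_pieces[of 3 T U Xp Xm \<kappa> G])
  show "is_piece U Xp Xm (\<kappa> i) (G i) 0 (T i)" if "i < 3" for i
   using i3[OF that] g1 g2 g3 by (auto simp: \<kappa>_def G_def T_def)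
  show "G i (T i) = G (Suc i mod 3) 0" if "i < 3" for i
   using i3[OF that] g1 g2 g3 by (auto simp: G_def T_def)
  show "G i ` {0..<T i} \<inter> G j ` {0..<T j} = {}" if "i < j" "j < 3" for i j
   using i3[of i] i3[of j] that D by (auto simp: G_def T_def)
 qed (use i3 g1 g2 g3 in \<open>auto simp: G_def T_def\<close>)
 have "{..<3::nat} = {0, 1, 2}" by auto
 then have "(\<Union>i<3. G i ` {0..T i}) = slide_loop j" using g1 g2 g3 by (auto simp: G_def T_def slide_loop_def)
 moreover have tp: "tangent_point U Xp Xm (orb (\<tau> 2))"
 proof -
  have b: "\<bar>e j\<bar> < x0" using E c by auto
  have "orb (\<tau> 2) = (e j, 0)" using loop(3)[of 2] g3 by (simp add: G_def)
  then show ?thesis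
   using axis_U[OF b] product_sign(3)[OF b] v0[OF j] X_fst[OF b] by (auto simp: tangent_point_def Sigma_zero_def)
 qed
 moreover from tp have "\<exists>i<3. tangent_point U Xp Xm (orb (\<tau> i))" by (intro exI[of _ 2]) simp
 moreover have "\<exists>i<3. \<kappa> i = Sliding" by (intro exI[of _ 1]) (simp add: \<kappa>_def)
 ultimately have "loop_curve U Xp Xm 3 \<kappa> \<tau> orb & slide_loop j = orb ` {\<tau> 0..\<tau> 3} \<and>
   (\<exists>i<3. \<kappa> i = Sliding) & (\<exists>i<3. tangent_point U Xp Xm (orb (\<tau> i)))"
  using loop(1,2) by simp
 then show ?thesis unfolding sliding_loop_def by blast
qed

lemma slide_loop_inj: "inj_on slide_loop {..<l}"
proof (rule inj_onI)
 have *: False if ij: "i < l" "j < l" "i ~= j" "slide_loop i = slide_loop j" for i j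
 proof -
  have "(e j, 0) \<in> slide_loop j" using A_xs[OF ij(2)] by (auto simp: slide_loop_def)
  then have "(e j, 0) \<in> slide_loop i" using ij by simp
  then have "e j = xs i \<or> e j \<in> {e i..A (xs i)}"
   using upper_axis[of "xs i" "(e j, 0)"] lower_axis[of "xs i" "e i" "(e j, 0)"] xs[OF ij(1)] e[OF ij(1)] xe
    xs_between[OF ij(1)] A_xs[OF ij(1)]
   by (auto simp: slide_loop_def)
  then show False using xs[OF ij(1)] e[OF ij(1)] e[OF ij(2)] A_xs[OF ij(1)] sep[of i j] sep[of j i] ij
   by (cases i j rule: linorder_cases) auto
 qed
 show "i = j" if "i \<in> {..<l}" "j \<in> {..<l}" "slide_loop i = slide_loop j" for i j
  using *[of i j] that by auto
qed

lemma beta_s_eq: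
 assumes "N \<subseteq> N0" "\<And>j. j < l ==> slide_loop j \<subseteq> N"
 shows "beta_s U Xp Xm N = enat l"
proof -
 have "{C. sliding_loop U Xp Xm C & C \<subseteq> N} = slide_loop ` {..<l}"
 proof (intro subset_antisym subsetI)
  fix C assume "C \<in> {C. sliding_loop U Xp Xm C & C \<subseteq> N}"
  then show "C \<in> slide_loop ` {..<l}" using sliding_loop_in_N0[of C] assms(1) by blast
 next
  fix C assume "C \<in> slide_loop ` {..<l}"
  then obtain j where "j < l" "C = slide_loop j" by blast
  then show "C \<in> {C. sliding_loop U Xp Xm C & C \<subseteq> N}" using slide_loop_exists[of j] assms(2)[of j] by simp
 qed
 then show ?thesis using slide_loop_inj by (simp add: beta_s_def number_of_def card_image)
qed

end

section \<open>The \<open>C\<^sup>1\<close> distance of the perturbation\<close>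

text \<open>The partial derivatives are asked for as witnesses, because the values of
  \<open>deriv\<close> in \<open>C1_dist\<close> are determined only once they exist.\<close>

definition C1_small :: "(plane => real) => plane => real => bool" where
 "C1_small F p e \<longleftrightarrow> (\<exists>a b. ((%x. F (x, snd p)) has_real_derivative a) (at (fst p)) \<and>
  ((%y. F (fst p, y)) has_real_derivative b) (at (snd p)) & \<bar>F p\<bar> + \<bar>a\<bar> + \<bar>b\<bar> <= e)"

lemma C1_dist_le:
 assumes "U ~= {}" "\<And>p. p \<in> closure U ==> C1_small (%q. P q - Q q) p e"
 shows "C1_dist U P Q <= e"
 unfolding C1_dist_def
proof (rule cSUP_least)
 fix p assume "p \<in> closure U"
 then obtain a b where "((%x. P (x, snd p) - Q (x, snd p)) has_real_derivative a) (at (fst p))"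
  "((%y. P (fst p, y) - Q (fst p, y)) has_real_derivative b) (at (snd p))" "\<bar>P p - Q p\<bar> + \<bar>a\<bar> + \<bar>b\<bar> <= e"
  using assms(2) unfolding C1_small_def by blast
 then show "\<bar>P p - Q p\<bar> + \<bar>partial_x (%q. P q - Q q) p\<bar> + \<bar>partial_y (%q. P q - Q q) p\<bar> <= e"
  by (simp add: partial_x_def partial_y_def DERIV_imp_deriv)
qed (use assms(1) in auto)

text \<open>The \<open>C\<^sup>1\<close> size of the difference is a continuous function of the point and of the values of
 \<open>w\<close>, \<open>w'\<close>, \<open>w''\<close> there, and vanishes if these values do.\<close>

definition shear_close :: "plane set => real => (plane => real) => (plane => real) => real => bool" where
 "shear_close U e A D d \<longleftrightarrow> (\<forall>p\<in>closure U. \<forall>w w1 w2.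
  (\<forall>x. (w has_real_derivative w1 x) (at x)) & (\<forall>x. (w1 has_real_derivative w2 x) (at x)) \<and>
  \<bar>w (fst p)\<bar> < d & \<bar>w1 (fst p)\<bar> < d & \<bar>w2 (fst p)\<bar> < d -->
  C1_small (%q. A (fst q, snd q + w (fst q)) - A q - D (fst q, snd q + w (fst q)) * w1 (fst q)) p e)"

lemma shear_close_mono: "shear_close U e A D d ==> d' <= d ==> shear_close U e A D d'"
 unfolding shear_close_def by (meson order_less_le_trans)

text \<open>Uniform continuity of \<open>\<Psi>\<close> on the compact set \<open>S\<close> yields a
  bound that depends only on the values of \<open>w\<close>, \<open>w1\<close>, \<open>w2\<close> at
  the point and is therefore the same for all shears.\<close>

lemma shear_close_exists:
 fixes A D :: "plane => real"
 assumes A: "smooth A" and D: "smooth D" and U: "bounded U" and "e > 0"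
 obtains d where "d > 0" "shear_close U e A D d"
proof -
 define S where "S = closure U \<times> {-1..1::real} \<times> {-1..1::real} \<times> {-1..1::real}"
 define \<Psi> where "\<Psi> = (%(p, t, t1, t2). let q = (fst p, snd p + t) in \<bar>A q - A p - D q * t1\<bar> +
   \<bar>(1 * dx A q + t1 * dy A q) - (1 * dx A p + 0 * dy A p) - ((1 * dx D q + t1 * dy D q) * t1 + t2 * D q)\<bar> +
   \<bar>(0 * dx A q + 1 * dy A q) - (0 * dx A p + 1 * dy A p) - ((0 * dx D q + 1 * dy D q) * t1 + 0 * D q)\<bar>)"
 have c: "continuous_on S (%z. B (fst (fst z), snd (fst z) + fst (snd z)))" "continuous_on S (%z. B (fst z))"
  if "smooth B" for B :: "plane => real"
  by (rule continuous_on_compose2[OF smooth_continuous_on[OF that, of UNIV]]; (intro continuous_intros)?; simp)+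
 have "compact S" unfolding S_def using U by (intro compact_Times) auto
 moreover have "continuous_on S \<Psi>"
  unfolding \<Psi>_def case_prod_unfold Let_def by (intro continuous_intros c A D smooth_dx smooth_dy)
 ultimately have "uniformly_continuous_on S \<Psi>" by (rule compact_uniformly_continuous[rotated])
 from this[unfolded uniformly_continuous_on_def, rule_format, OF \<open>e > 0\<close>]
 obtain \<delta> where \<delta>: "\<delta> > 0" "\<forall>z\<in>S. \<forall>z'\<in>S. dist z' z < \<delta> --> dist (\<Psi> z') (\<Psi> z) < e" by blast
 show ?thesis
 proof (rule that[of "min 1 (\<delta> / 3)"])
  show "shear_close U e A D (min 1 (\<delta> / 3))"
   unfolding shear_close_def
  proof (intro ballI allI impI, elim conjE)
  fix p w w1 w2 assume p: "p \<in> closure U" and w: "\<forall>x. (w has_real_derivative w1 x) (at x)" "\<forall>x. (w1 has_real_derivative w2 x) (at x)"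
   and wd: "\<bar>w (fst p)\<bar> < min 1 (\<delta> / 3)" "\<bar>w1 (fst p)\<bar> < min 1 (\<delta> / 3)" "\<bar>w2 (fst p)\<bar> < min 1 (\<delta> / 3)"
  let ?x = "fst p" and ?y = "snd p"
  let ?q = "(?x, ?y + w ?x)" and ?t = "(w ?x, w1 ?x, w2 ?x)"
  have X: "((%x. A (x, ?y + w x) - A (x, ?y) - D (x, ?y + w x) * w1 x) has_real_derivative (1 * dx A ?q + w1 ?x * dy A ?q) -
    (1 * dx A (?x, ?y) + 0 * dy A (?x, ?y)) - ((1 * dx D ?q + w1 ?x * dy D ?q) * w1 ?x + w2 ?x * D ?q)) (at ?x)"
   by (intro DERIV_diff DERIV_mult smooth_chain A D) (auto intro!: derivative_eq_intros w[rule_format])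
  have Y: "((%y. A (?x, y + w ?x) - A (?x, y) - D (?x, y + w ?x) * w1 ?x) has_real_derivative (0 * dx A ?q + 1 * dy A ?q) -
    (0 * dx A (?x, ?y) + 1 * dy A (?x, ?y)) - ((0 * dx D ?q + 1 * dy D ?q) * w1 ?x + 0 * D ?q)) (at ?y)"
   by (intro DERIV_diff DERIV_mult smooth_chain A D) (auto intro!: derivative_eq_intros)
  have "norm (0 :: plane, ?t) <= norm (0 :: plane) + (norm (w ?x) + (norm (w1 ?x) + norm (w2 ?x)))"
   by (intro order_trans[OF norm_Pair_le] add_left_mono order_refl)
  then have "dist (p, ?t) (p, 0) < \<delta>" using wd by (simp add: dist_norm)
  moreover have "(p, ?t) \<in> S" "(p, 0) \<in> S" using p wd by (auto simp: S_def zero_prod_def abs_less_iff)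
  ultimately have "dist (\<Psi> (p, ?t)) (\<Psi> (p, 0)) < e" using \<delta>(2) by blast
  then have "\<Psi> (p, ?t) <= e" by (simp add: \<Psi>_def zero_prod_def dist_real_def)
  then show "C1_small (%q. A (fst q, snd q + w (fst q)) - A q - D (fst q, snd q + w (fst q)) * w1 (fst q)) p e"
   unfolding C1_small_def fst_conv snd_conv prod.collapse \<Psi>_def case_prod_conv Let_def using X Y unfolding prod.collapse by blast
  qed
 qed (use \<delta> in simp)
qed

text \<open>All four components are differences of the form treated by \<open>shear_close\<close>:
  for the upper field with the constant shear \<alpha>, for the second lower component with
  \<open>D = fm\<close>, which accounts for the term with the derivative of the shear. Four times
  \<open>\<epsilon> / 5\<close> stays below \<epsilon>.\<close>

lemma perturbation_small:
 assumes U: "bounded U" "U ~= {}" and sm: "smooth fp" "smooth gp" "smooth fm" "smooth \<phi>" and "\<epsilon> > 0"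
 obtains \<delta> where "\<delta> > 0"
  "\<And>\<alpha> w w1 w2. \<bar>\<alpha>\<bar> < \<delta> ==> \<forall>x. (w has_real_derivative w1 x) (at x) ==> \<forall>x. (w1 has_real_derivative w2 x) (at x) ==>
   \<forall>x. \<bar>w x\<bar> < \<delta> & \<bar>w1 x\<bar> < \<delta> & \<bar>w2 x\<bar> < \<delta> ==>
   system_dist U (perturbed_upper fp gp \<alpha>) (perturbed_lower fm \<phi> (replicate m 0) w) (upper_field fp gp) (lower_field fm \<phi> m) < \<epsilon>"
proof -
 define G where "G p = \<phi> p * fst p ^ m" for p :: plane
 have G: "smooth G" unfolding G_def[abs_def] by (rule smooth_mult_power_fst[OF sm(4)])
 have Z: "smooth (%_ :: plane. 0 :: real)" by (simp add: smooth_def Ck_const)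
 have e: "\<epsilon> / 5 > 0" using assms(7) by simp
 obtain d1 d2 d3 d4 where d: "d1 > 0" "d2 > 0" "d3 > 0" "d4 > 0" and close: "shear_close U (\<epsilon> / 5) fp (%_. 0) d1"
  "shear_close U (\<epsilon> / 5) gp (%_. 0) d2" "shear_close U (\<epsilon> / 5) fm (%_. 0) d3" "shear_close U (\<epsilon> / 5) G fm d4"
  using shear_close_exists[OF _ _ U(1) e] sm G Z by metis
 define d where "d = min (min d1 d2) (min d3 d4)"
 have d: "d > 0" "d <= d1" "d <= d2" "d <= d3" "d <= d4" using d by (auto simp: d_def)
 have close: "shear_close U (\<epsilon> / 5) fp (%_. 0) d" "shear_close U (\<epsilon> / 5) gp (%_. 0) d"
  "shear_close U (\<epsilon> / 5) fm (%_. 0) d" "shear_close U (\<epsilon> / 5) G fm d"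
  by (rule shear_close_mono[OF close(1) d(2)], rule shear_close_mono[OF close(2) d(3)],
   rule shear_close_mono[OF close(3) d(4)], rule shear_close_mono[OF close(4) d(5)])
 have small: "C1_dist U P Q <= \<epsilon> / 5"
  if "shear_close U (\<epsilon> / 5) A D d" "\<forall>x. (w has_real_derivative w1 x) (at x)" "\<forall>x. (w1 has_real_derivative w2 x) (at x)"
   "\<forall>x. \<bar>w x\<bar> < d & \<bar>w1 x\<bar> < d & \<bar>w2 x\<bar> < d"
   "\<And>q. P q - Q q = A (fst q, snd q + w (fst q)) - A q - D (fst q, snd q + w (fst q)) * w1 (fst q)" for A D P Q w w1 w2
  by (rule C1_dist_le[OF U(2)], unfold that(5)) (use that(1-4) in \<open>unfold shear_close_def, blast\<close>)
 show ?thesis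
 proof (rule that[OF d(1)])
  fix \<alpha> and w w1 w2 :: "real => real"
  assume \<alpha>: "\<bar>\<alpha>\<bar> < d" and w: "\<forall>x. (w has_real_derivative w1 x) (at x)" "\<forall>x. (w1 has_real_derivative w2 x) (at x)"
   and wd: "\<forall>x. \<bar>w x\<bar> < d & \<bar>w1 x\<bar> < d & \<bar>w2 x\<bar> < d"
  have dw: "deriv w = w1" using w by (auto intro: DERIV_imp_deriv)
  note upper = small[of _ _ "%_. \<alpha>" "%_. 0" "%_. 0"] and lower = small[OF _ w wd]
  have "C1_dist U (fst \<circ> perturbed_upper fp gp \<alpha>) (fst \<circ> upper_field fp gp) <= \<epsilon> / 5"
   "C1_dist U (snd \<circ> perturbed_upper fp gp \<alpha>) (snd \<circ> upper_field fp gp) <= \<epsilon> / 5"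
   by (rule upper[OF close(1)] upper[OF close(2)]; use \<alpha> d in \<open>simp add: perturbed_upper_def upper_field_def case_prod_unfold\<close>)+
  moreover have "C1_dist U (fst \<circ> perturbed_lower fm \<phi> (replicate m 0) w) (fst \<circ> lower_field fm \<phi> m) <= \<epsilon> / 5"
   by (rule lower[OF close(3)]) (simp add: perturbed_lower_def lower_field_def case_prod_unfold)
  moreover have "C1_dist U (snd \<circ> perturbed_lower fm \<phi> (replicate m 0) w) (snd \<circ> lower_field fm \<phi> m) <= \<epsilon> / 5"
   by (rule lower[OF close(4)]) (simp add: perturbed_lower_def lower_field_def case_prod_unfold dw G_def)
  ultimately show "system_dist U (perturbed_upper fp gp \<alpha>) (perturbed_lower fm \<phi> (replicate m 0) w) (upper_field fp gp) (lower_field fm \<phi> m) < \<epsilon>"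
   unfolding system_dist_def using assms(7) by linarith
 qed
qed

section \<open>Sheared vector fields\<close>

definition shear :: "(real => real) => plane => plane" where
 "shear w p = (fst p, snd p + w (fst p))"

lemma fst_shear [simp]: "fst (shear w p) = fst p" and snd_shear [simp]: "snd (shear w p) = snd p + w (fst p)"
 by (auto simp: shear_def)

lemma unshear [simp]: "shear (%x. - w x) (shear w p) = p" "shear w (shear (%x. - w x) p) = p"
 by (auto simp: prod_eq_iff)

lemma shear_has_vector_derivative:
 assumes "(w has_real_derivative w1) (at (fst (orb t)))" "(orb has_vector_derivative D) (at t within I)"
 shows "((%t. shear w (orb t)) has_vector_derivative (fst D, snd D + fst D * w1)) (at t within I)"
proof -
 have 1: "((%t. fst (orb t)) has_real_derivative fst D) (at t within I)"
  "((%t. snd (orb t)) has_real_derivative snd D) (at t within I)"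
  using assms(2) by (auto simp: has_real_derivative_iff_has_vector_derivative
    intro: bounded_linear.has_vector_derivative[OF bounded_linear_fst] bounded_linear.has_vector_derivative[OF bounded_linear_snd])
 have "((%t. w (fst (orb t))) has_real_derivative w1 * fst D) (at t within I)"
  by (rule DERIV_chain2[OF assms(1) 1(1)])
 from DERIV_add[OF 1(2) this] 1(1) show ?thesis
  unfolding shear_def has_real_derivative_iff_has_vector_derivative
  by (intro has_vector_derivative_Pair) (simp_all add: mult.commute)
qed

text \<open>The term \<open>- f * w1\<close> is what the chain rule produces, so
  \<open>shear w\<close> maps orbits of \<open>Z\<close> to orbits of \<open>(f, g)\<close>; the
  shear by \<open>- w\<close> is its inverse and gives the other direction.\<close>

lemma solves_shear:
 assumes w: "\<And>x. (w has_real_derivative w1 x) (at x)"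
  and Z: "\<And>p. Z p = (f (shear w p), g (shear w p) - f (shear w p) * w1 (fst p))"
 shows "solves Z orb I \<longleftrightarrow> solves (upper_field f g) (%t. shear w (orb t)) I"
 unfolding solves_def
proof (intro ball_cong refl iffI)
 fix t assume "(orb has_vector_derivative Z (orb t)) (at t within I)"
 from shear_has_vector_derivative[OF w this]
 show "((%t. shear w (orb t)) has_vector_derivative upper_field f g (shear w (orb t))) (at t within I)"
  by (simp add: Z upper_field_def case_prod_unfold)
next
 fix t assume "((%t. shear w (orb t)) has_vector_derivative upper_field f g (shear w (orb t))) (at t within I)"
 from shear_has_vector_derivative[OF DERIV_minus[OF w] this]
 show "(orb has_vector_derivative Z (orb t)) (at t within I)"
  by (simp add: Z upper_field_def case_prod_unfold)
qed

lemma perturbed_upper_shear: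
 "perturbed_upper f g \<alpha> p = (f (shear (%_. \<alpha>) p), g (shear (%_. \<alpha>) p) - f (shear (%_. \<alpha>) p) * 0)"
 by (simp add: perturbed_upper_def shear_def case_prod_unfold)

lemma perturbed_lower_shear:
 assumes "\<And>x. (w has_real_derivative w1 x) (at x)"
 shows "perturbed_lower f \<phi> (replicate m 0) w p =
  (f (shear w p), (%p. \<phi> p * fst p ^ m) (shear w p) - f (shear w p) * w1 (fst p))"
proof -
 have "deriv w x = w1 x" for x using assms by (rule DERIV_imp_deriv)
 moreover have "(\<Prod>i<m. fst p - replicate m 0 ! i) = fst p ^ m" by simp
 ultimately show ?thesis by (simp add: perturbed_lower_def shear_def case_prod_unfold)
qed

lemma solves_perturbed_upper:
 "solves (perturbed_upper f g \<alpha>) orb I \<longleftrightarrow> solves (upper_field f g) (%t. shear (%_. \<alpha>) (orb t)) I"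
 by (rule solves_shear[where ?w1.0 = "%_. 0"]) (rule DERIV_const, rule perturbed_upper_shear)

lemma solves_perturbed_lower:
 assumes "\<And>x. (w has_real_derivative w1 x) (at x)"
 shows "solves (perturbed_lower f \<phi> (replicate m 0) w) orb I \<longleftrightarrow>
  solves (upper_field f (%p. \<phi> p * fst p ^ m)) (%t. shear w (orb t)) I"
 by (rule solves_shear[OF assms perturbed_lower_shear[OF assms]])

section \<open>The shear profile\<close>

context flow_box
begin

lemma f_away_from_0:
 obtains k where "k > 0" "\<And>p. p \<in> {-\<rho>..\<rho>} \<times> {-\<rho>..\<rho>} ==> \<bar>f p\<bar> >= k"
proof -
 let ?B = "{-\<rho>..\<rho>} \<times> {-\<rho>..\<rho>}"
 have "\<rho> > 0" using R_pos R_le by simp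
 then have "compact ?B" "?B ~= {}" by (auto intro: compact_Times)
 then obtain z where z: "z \<in> ?B" "\<And>p. p \<in> ?B ==> f p <= f z"
  using continuous_attains_sup[OF _ _ smooth_continuous_on[OF smooth_f], of ?B] by blast
 have "f z < 0" using f_neg[of "fst z" "snd z"] z(1) by (auto simp: mem_Times_iff)
 then show ?thesis using that[of "- f z"] z(2) by force
qed

text \<open>The profile solves \<open>w' = \<theta> (F(x, w) + \<eta> z)\<close> with a cutoff \<open>\<theta>\<close>: where \<open>\<theta> = 1\<close> the graph of \<open>w\<close>
 crosses the orbits of the lower field at the prescribed rate \<open>\<eta> z\<close>, and \<open>m \<ge> 2\<close> makes
 \<open>w\<close>, \<open>w'\<close>, \<open>w''\<close> small with the support of \<open>\<theta>\<close>.\<close>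

definition profile :: "real => real => (real => real) => real => (real => real) => (real => real) => (real => real) =>
  (real => real) => bool" where
 "profile \<epsilon> h z \<eta> w w1 w2 \<theta> \<longleftrightarrow> (\<forall>k. ck_on k UNIV w) & (\<forall>x. (w has_real_derivative w1 x) (at x)) \<and>
  (\<forall>x. (w1 has_real_derivative w2 x) (at x)) & (\<forall>x. \<bar>w x\<bar> < \<epsilon> & \<bar>w1 x\<bar> < \<epsilon> & \<bar>w2 x\<bar> < \<epsilon>) \<and>
  (\<forall>x. 0 <= \<theta> x & \<theta> x <= 1) & (\<forall>x. \<bar>x\<bar> <= h --> \<theta> x = 1) \<and>
  (\<forall>x\<in>{-R..R}. w1 x - slope f g \<rho> x (w x) = \<eta> * \<theta> x * z x - (1 - \<theta> x) * slope f g \<rho> x (w x))"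

text \<open>\<open>F\<close> vanishes to order \<open>m\<close> at \<open>0\<close>: on the support
  \<open>\<bar>x\<bar> \<le> s\<close> of the cutoff it is of order \<open>s * s\<close> and its
  derivative along the graph of order \<open>s\<close>, and the derivative of the cutoff costs one
  division by \<open>s\<close>. So the contributions of \<open>F\<close> to \<open>w\<close>,
  \<open>w1\<close>, \<open>w2\<close> are at most \<open>D1 * s\<close>, those of \<open>z\<close>,
  once \<open>s\<close> is fixed, at most \<open>D2 * \<eta>\<close>; each is made smaller than
  \<open>E / 2\<close>.\<close>

lemma profile_exists:
 assumes g: "g = (%p. \<phi> p * fst p ^ m)" and \<phi>: "smooth \<phi>" and m: "m >= 2" and \<epsilon>: "\<epsilon> > 0"
 obtains s0 where "s0 > 0" "s0 <= R"
  "\<And>s z. 0 < s ==> s < s0 ==> (\<forall>k. ck_on k UNIV z) ==> \<exists>\<eta>>0. \<exists>w w1 w2 \<theta>. profile \<epsilon> (s / 2) z \<eta> w w1 w2 \<theta>"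
proof -
 let ?B = "{-\<rho>..\<rho>} \<times> {-\<rho>..\<rho>} :: plane set"
 let ?F = "slope f g \<rho>"
 have cB: "compact ?B" by (intro compact_Times) auto
 have \<rho>: "\<rho> > 0" using R_pos R_le by simp
 obtain k where k: "k > 0" "\<And>p. p \<in> ?B ==> \<bar>f p\<bar> >= k" by (rule f_away_from_0) (rule that)
 obtain B where B: "B > 0" "\<And>p. p \<in> ?B ==> \<bar>f p\<bar> <= B & \<bar>dx f p\<bar> <= B & \<bar>dy f p\<bar> <= B & \<bar>\<phi> p\<bar> <= B & \<bar>dx \<phi> p\<bar> <= B & \<bar>dy \<phi> p\<bar> <= B"
 proof -
  let ?Q = "%p. \<bar>f p\<bar> + \<bar>dx f p\<bar> + \<bar>dy f p\<bar> + \<bar>\<phi> p\<bar> + \<bar>dx \<phi> p\<bar> + \<bar>dy \<phi> p\<bar>"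
  have "continuous_on ?B ?Q" by (intro continuous_intros smooth_continuous_on smooth_f \<phi> smooth_dx smooth_dy)
  then have "bounded (?Q ` ?B)" using cB compact_continuous_image compact_imp_bounded by blast
  then obtain B where "B > 0" "\<forall>z\<in>?Q ` ?B. norm z <= B" unfolding bounded_pos by blast
  then show ?thesis by (intro that[of B]) force+
 qed
 define Cs where "Cs = B / k"
 define C2 where "C2 = 4 * (B * B) / (k * k)"
 have Cs: "Cs > 0" and C2: "C2 > 0" using B k by (auto simp: Cs_def C2_def)
 obtain ct :: "real => real" where ct: "\<And>k S. ck_on k S ct" "\<And>x. 0 <= ct x" "\<And>x. ct x <= 1"
  "\<And>x. \<bar>x\<bar> <= 1/2 ==> ct x = 1" "\<And>x. \<bar>x\<bar> >= 1 ==> ct x = 0" by (rule smooth_plateau) (rule that)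
 have "ck_on (Suc 0) UNIV ct" by (rule ct)
 then obtain ct' where ct': "\<And>x. (ct has_real_derivative ct' x) (at x)" "continuous_on UNIV ct'" by auto
 have "bounded (ct' ` {-1..1})" by (intro compact_imp_bounded compact_continuous_image continuous_on_subset[OF ct'(2)]) auto
 then obtain Ct where Ct: "Ct > 0" "\<forall>y\<in>ct' ` {-1..1}. norm y <= Ct" unfolding bounded_pos by blast
 define E where "E = min \<epsilon> (min 1 \<rho>)"
 have E: "E > 0" "E <= \<epsilon>" "E <= 1" "E <= \<rho>" using \<epsilon> \<rho> by (auto simp: E_def)
 define D1 where "D1 = (Ct * Cs + C2 + Cs * real m + Cs) * (1 + R)"
 have D1: "D1 > 0" using Ct Cs C2 R_pos unfolding D1_def by (intro mult_pos_pos add_pos_nonneg add_pos_pos) auto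
 define s0 where "s0 = min (min 1 R) (E / (2 * D1))"
 show ?thesis
 proof (rule that[of s0])
  show "s0 > 0" "s0 <= R" using D1 E R_pos by (auto simp: s0_def)
  fix s :: real and z assume s: "0 < s" "s < s0" and z: "\<forall>k. ck_on k UNIV z"
  have sR: "s < R" "s < 1" "D1 * s < E / 2" using s D1 by (auto simp: s0_def field_simps)
  from z have "ck_on (Suc 0) UNIV z" by blast
  then obtain z' where z': "\<And>x. (z has_real_derivative z' x) (at x)" "continuous_on UNIV z'" by auto
  have zc: "continuous_on UNIV z" by (rule DERIV_at_continuous_on[of UNIV z z']) (use z' in auto)
  have "bounded (z ` {-R..R} \<union> z' ` {-R..R})"
   unfolding bounded_Un by (intro conjI compact_imp_bounded compact_continuous_image continuous_on_subset[OF z'(2)] continuous_on_subset[OF zc]) auto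
  then obtain Bz where Bz: "Bz > 0" "\<And>x. x \<in> {-R..R} ==> \<bar>z x\<bar> <= Bz" "\<And>x. x \<in> {-R..R} ==> \<bar>z' x\<bar> <= Bz"
   unfolding bounded_pos by (metis UnCI image_eqI real_norm_def)
  define D2 where "D2 = (Ct * Bz / s + 2 * Bz) * (1 + R)"
  have D2: "D2 > 0" using Ct Bz s R_pos unfolding D2_def by (intro mult_pos_pos add_pos_pos divide_pos_pos) auto
  define \<theta> where "\<theta> x = ct (x / s)" for x
  have \<theta>: "0 <= \<theta> x" "\<theta> x <= 1" "\<bar>x\<bar> <= s / 2 ==> \<theta> x = 1" "\<bar>x\<bar> >= s ==> \<theta> x = 0" for x
   using ct(2-5)[of "x / s"] s by (auto simp: \<theta>_def field_simps)
  have \<theta>ck: "ck_on k UNIV \<theta>" for k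
   unfolding \<theta>_def[abs_def] divide_inverse by (rule ck_on_compose[OF _ ct(1)]) auto
  have \<theta>': "(\<theta> has_real_derivative ct' (x / s) / s) (at x)" for x
  proof -
   have "((%x. x / s) has_real_derivative 1 / s) (at x)" using s by (auto intro!: derivative_eq_intros)
   from DERIV_chain2[OF ct'(1) this] show ?thesis by (simp add: \<theta>_def[abs_def])
  qed
  define \<eta> where "\<eta> = E / (4 * D2)"
  have \<eta>: "0 < \<eta>" "D2 * \<eta> < E / 2" using D2 E by (auto simp: \<eta>_def)
  have "\<exists>w w1 w2 \<theta>. profile \<epsilon> (s / 2) z \<eta> w w1 w2 \<theta>"
  proof -
   define G where "G x y = \<theta> x * (?F x y + \<eta> * z x)" for x y
   have Fh: "?F x y = \<phi> (x, clamp_to \<rho> y) / f (x, clamp_to \<rho> y) * x ^ m" for x y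
    by (simp add: slope_def g)
   have Fb: "\<bar>?F x y\<bar> <= Cs * \<bar>x\<bar> ^ m" if "\<bar>x\<bar> <= R" for x y
   proof -
    have "(x, clamp_to \<rho> y) \<in> ?B" using clamp_to(1)[of \<rho> y] \<rho> that R_le by (auto simp: abs_le_iff)
    then have "\<bar>\<phi> (x, clamp_to \<rho> y)\<bar> / \<bar>f (x, clamp_to \<rho> y)\<bar> <= B / k"
     using B k by (intro frac_le) auto
    then have "\<bar>\<phi> (x, clamp_to \<rho> y)\<bar> / \<bar>f (x, clamp_to \<rho> y)\<bar> * \<bar>x\<bar> ^ m <= B / k * \<bar>x\<bar> ^ m"
     by (rule mult_right_mono) simp
    then show ?thesis unfolding Fh Cs_def abs_mult abs_divide power_abs .
   qed
   have pw: "\<bar>x\<bar> ^ m <= s * s" "\<bar>x\<bar> ^ (m - 1) <= s" "s * s <= s" if "\<bar>x\<bar> <= s" for x :: real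
   proof -
    have "\<bar>x\<bar> ^ m <= s ^ m" "\<bar>x\<bar> ^ (m - 1) <= s ^ (m - 1)" using that by (auto intro: power_mono)
    moreover have "s ^ m <= s ^ 2" "s ^ (m - 1) <= s ^ 1" using s sR m by (intro power_decreasing; simp)+
    ultimately show "\<bar>x\<bar> ^ m <= s * s" "\<bar>x\<bar> ^ (m - 1) <= s" "s * s <= s"
     using s sR by (auto simp: power2_eq_square intro: mult_left_le)
   qed
   define b where "b = Cs * s * s + \<eta> * Bz"
   have b: "b >= 0" using Cs s \<eta> Bz by (simp add: b_def)
   have Gb: "\<bar>G x y\<bar> <= b" if "\<bar>x\<bar> <= R" for x y
   proof (cases "\<bar>x\<bar> <= s")
    case True
    have "\<bar>?F x y\<bar> <= Cs * (s * s)"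
     by (rule order_trans[OF Fb[OF that]]) (use pw[OF True] Cs in \<open>auto intro: mult_left_mono\<close>)
    moreover have "\<bar>\<eta> * z x\<bar> <= \<eta> * Bz" using Bz(2)[of x] that \<eta> by (auto simp: abs_mult abs_le_iff intro!: mult_left_mono)
    ultimately have "\<bar>?F x y + \<eta> * z x\<bar> <= b" unfolding b_def using abs_triangle_ineq[of "?F x y" "\<eta> * z x"] by linarith
    then have "\<theta> x * \<bar>?F x y + \<eta> * z x\<bar> <= 1 * b" using \<theta>[of x] by (intro mult_mono) auto
    then show ?thesis using \<theta>(1)[of x] by (simp add: G_def abs_mult)
   qed (use \<theta>(4)[of x] b in \<open>simp add: G_def\<close>)
   have ode: "graph_ode G R L b"
   proof
    have cx: "continuous_on S (%p. \<theta> (fst p))" "continuous_on S (%p. z (fst p))" for S :: "plane set"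
     using continuous_on_compose2[OF ck_on_imp_continuous_on[OF \<theta>ck[of 0]] continuous_on_fst[OF continuous_on_id]]
      continuous_on_compose2[OF zc continuous_on_fst[OF continuous_on_id]] by auto
    show "continuous_on ({-R..R} \<times> UNIV) (%p. G (fst p) (snd p))"
     unfolding G_def by (intro continuous_intros cx cont)
    fix x y y' :: real assume x: "x \<in> {-R..R}"
    have "\<bar>G x y - G x y'\<bar> = \<theta> x * \<bar>?F x y - ?F x y'\<bar>"
     using \<theta>(1)[of x] unfolding G_def by (simp add: abs_mult flip: right_diff_distrib)
    also have "\<dots> <= 1 * (L * \<bar>y - y'\<bar>)" using \<theta>[of x] lip[OF x] by (intro mult_mono) auto
    finally show "\<bar>G x y - G x y'\<bar> <= L * \<bar>y - y'\<bar>" by simp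
    show "\<bar>G x y\<bar> <= b" using Gb[of x y] x by auto
   qed (use R_pos L_nonneg small in auto)
   interpret Go: graph_ode G R L b by (rule ode)
   obtain u where u: "Go.sol u" "u 0 = 0" using Go.picard[OF zero_mem] by blast
   have du: "(u has_real_derivative G x (u x)) (at x within {-R..R})" if "x \<in> {-R..R}" for x
    using u(1) that by (simp add: Go.sol_def)
   \<comment> \<open>Freezing \<open>u\<close> outside \<open>{-s..s}\<close> extends it to the
     line. Since \<open>G\<close> vanishes there, \<open>u\<close> is already constant, and nothing
     changes on \<open>{-R..R}\<close>.\<close>
   define w where "w x = u (clamp_to s x)" for x
   have wu: "w x = u x" if "\<bar>x\<bar> <= R" for x
   proof (cases "\<bar>x\<bar> <= s")
    case False
    define c where "c = clamp_to s x"
    have c: "c = (if x > 0 then s else - s)" "c \<in> {-R..R}" using False s sR by (auto simp: clamp_to_def c_def)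
    let ?I = "{min c x..max c x}"
    have "?I \<subseteq> {-R..R}" using that c(2) by auto
    then have D: "(u has_real_derivative G t (u t)) (at t within ?I)" if "t \<in> ?I" for t
     by (intro DERIV_subset[OF du]) (use that in auto)
    have Z: "\<bar>G t (u t)\<bar> <= 0" if "t \<in> ?I" for t
     using that c False \<theta>(4)[of t] s by (auto simp: G_def split: if_splits)
    have "\<bar>u c - u x\<bar> <= 0 * \<bar>c - x\<bar>"
     by (rule deriv_within_diff_bound[where F' = "%t. G t (u t)", OF D Z]) auto
    then show ?thesis by (simp add: w_def c_def)
   qed (simp add: w_def clamp_to)
   have bE: "b * (1 + R) < E"
   proof -
    have "Cs * s * s <= Cs * s" using pw(3)[of 0] s Cs by (simp add: mult.assoc)
    then have "b * (1 + R) <= (Cs * s + \<eta> * Bz) * (1 + R)" unfolding b_def using R_pos by (intro mult_right_mono) auto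
    also have "\<dots> <= D1 * s + D2 * \<eta>"
    proof -
     have "Cs * s * (1 + R) <= D1 * s" unfolding D1_def using Ct Cs C2 R_pos s
      by (auto simp: algebra_simps intro!: add_nonneg_nonneg mult_nonneg_nonneg)
     moreover have "\<eta> * Bz * (1 + R) <= D2 * \<eta>" unfolding D2_def using Ct Bz R_pos s \<eta>
      by (auto simp: algebra_simps intro!: add_nonneg_nonneg mult_nonneg_nonneg divide_nonneg_nonneg)
     ultimately show ?thesis by (simp add: algebra_simps)
    qed
    finally show ?thesis using sR \<eta> by linarith
   qed
   have bE': "b < E" "b * R < E"
   proof -
    have "0 <= b * R" "b * (1 + R) = b + b * R" using b R_pos by (auto simp: algebra_simps)
    with bE b show "b < E" "b * R < E" by linarith+
   qed
   have ub: "\<bar>u x\<bar> < E" if "\<bar>x\<bar> <= R" for x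
   proof -
    have "\<bar>u x - u 0\<bar> <= b * \<bar>x - 0\<bar>"
     by (rule deriv_within_diff_bound[where F' = "%t. G t (u t)", OF du]) (use that Gb R_pos in auto)
    also have "\<dots> <= b * R" using that b by (intro mult_left_mono) auto
    finally show ?thesis using u(2) bE' by simp
   qed
   have wb: "\<bar>w x\<bar> < E" for x
    unfolding w_def using clamp_to(1)[of s x] s sR by (intro ub) auto
   define w1 where "w1 x = G x (w x)" for x
   have w1_0: "w1 x = 0" if "\<bar>x\<bar> >= s" for x using \<theta>(4)[OF that] by (simp add: w1_def G_def)
   have const: "(w has_real_derivative 0) (at x)" if "\<bar>x\<bar> > s" for x
   proof (rule has_field_derivative_transform_within_open[of "%_. w x"])
    show "x \<in> (if x > 0 then {s<..} else {..<-s})" using that s by auto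
    show "\<And>y. y \<in> (if x > 0 then {s<..} else {..<-s}) ==> w x = w y"
     using that s by (auto simp: w_def clamp_to_def split: if_splits)
   qed auto
   have inner: "(w has_real_derivative w1 x) (at x)" if "\<bar>x\<bar> < R" for x
   proof (rule has_field_derivative_transform_within_open[of u])
    have "x \<in> interior {-R..R}" using that by (auto simp: interior_atLeastAtMost_real)
    have xm: "x \<in> {-R..R}" using that by auto
    from du[OF xm] at_within_interior[OF \<open>x \<in> interior {-R..R}\<close>] that wu[of x] show "(u has_real_derivative w1 x) (at x)" by (auto simp: w1_def)
    show "\<And>y. y \<in> {-R<..<R} ==> u y = w y" using wu by auto
   qed (use that in auto)
   have w1: "(w has_real_derivative w1 x) (at x)" for x
    using inner[of x] const[of x] w1_0[of x] sR by (cases "\<bar>x\<bar> < R") auto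
   let ?W = "%x. \<theta> x * (\<phi> (x, w x) / f (x, w x) * x ^ m + \<eta> * z x)"
   have Bw: "(x, w x) \<in> ?B" if "\<bar>x\<bar> <= R" for x
    using that wb[of x] E R_le by (auto simp: abs_le_iff)
   have w1W: "w1 x = ?W x" for x using wb[of x] E by (simp add: w1_def G_def Fh clamp_to)
   have fnz: "f (x, w x) ~= 0" if "\<bar>x\<bar> < R" for x using k(2)[OF Bw[of x]] k(1) that by auto
   let ?S = "{-R<..<R}"
   \<comment> \<open>Bootstrap: \<open>w1\<close> is a smooth expression in \<open>x\<close> and
     \<open>w\<close>, so \<open>w\<close> gains one order of differentiability at each
     step.\<close>
   have ckW: "ck_on k ?S w" for k
   proof (induction k)
    case 0
    show ?case unfolding ck_on.simps(1) by (rule DERIV_at_continuous_on[of ?S w w1]) (rule w1)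
   next
    case (Suc k)
    have "ck_on k ?S ?W"
     by (intro ck_on_mult ck_on_add ck_on_divide ck_on_power ck_on_ident ck_on_const ck_on_compose_plane Suc
       smooth_imp_Ck \<phi> smooth_f ck_on_subset[OF \<theta>ck] ck_on_subset[OF z[rule_format]]) (use fnz in auto)
    then show ?case using w1 unfolding ck_on.simps w1W[symmetric] by auto
   qed
   have ckO: "ck_on k {x. \<bar>x\<bar> > s} w" for k
    by (cases k) (auto intro: DERIV_at_continuous_on[of _ w "%_. 0"] const exI[of _ "%_. 0"])
   have ckw: "ck_on k UNIV w" for k
   proof -
    have "open {x::real. \<bar>x\<bar> > s}" by (intro open_Collect_less continuous_intros)
    from ck_on_Un[OF open_greaterThanLessThan this ckW ckO]
    have "ck_on k (?S \<union> {x. \<bar>x\<bar> > s}) w" .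
    moreover have "?S \<union> {x. \<bar>x\<bar> > s} = UNIV" using sR by auto
    ultimately show ?thesis by simp
   qed
   have "ck_on (Suc (Suc 0)) UNIV w" by (rule ckw)
   then obtain w1' w2 where "\<And>x. (w has_real_derivative w1' x) (at x)" and w2: "\<And>x. (w1' has_real_derivative w2 x) (at x)" by auto
   then have "w1' = w1" using w1 DERIV_unique by blast
   with w2 have w2: "(w1 has_real_derivative w2 x) (at x)" for x by simp
   have w2b: "\<bar>w2 x\<bar> < E" for x
   proof (cases "\<bar>x\<bar> <= s")
    case False
    have "(w1 has_real_derivative 0) (at x)"
    proof (rule has_field_derivative_transform_within_open[of "%_. 0"])
     show "open {x::real. \<bar>x\<bar> > s}" by (intro open_Collect_less continuous_intros)
    qed (use False w1_0 in auto)
    then show ?thesis using DERIV_unique[OF w2] E by simp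
   next
    case True
    then have xR: "\<bar>x\<bar> < R" "\<bar>x\<bar> <= R" using sR by auto
    let ?p = "(x, w x)"
    let ?N = "(1 * dx \<phi> ?p + w1 x * dy \<phi> ?p) * f ?p - \<phi> ?p * (1 * dx f ?p + w1 x * dy f ?p)"
    have dh: "((%x. \<phi> (x, w x) / f (x, w x)) has_real_derivative ?N / (f ?p * f ?p)) (at x)"
     by (intro DERIV_divide smooth_chain[OF \<phi>] smooth_chain[OF smooth_f] w1 DERIV_ident fnz xR)
    let ?h = "\<phi> ?p / f ?p"
    have W': "(?W has_real_derivative ct' (x / s) / s * (?h * x ^ m + \<eta> * z x) +
      (?N / (f ?p * f ?p) * x ^ m + real m * x ^ (m - 1) * ?h + \<eta> * z' x) * \<theta> x) (at x)"
     by (intro DERIV_mult \<theta>' DERIV_add dh DERIV_cmult z'(1)) (use DERIV_pow[of m x UNIV] in simp)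
    have "(w1 has_real_derivative ct' (x / s) / s * (?h * x ^ m + \<eta> * z x) +
      (?N / (f ?p * f ?p) * x ^ m + real m * x ^ (m - 1) * ?h + \<eta> * z' x) * \<theta> x) (at x)"
     using W' by (simp add: w1W[abs_def])
    then have w2x: "w2 x = ct' (x / s) / s * (?h * x ^ m + \<eta> * z x) +
      (?N / (f ?p * f ?p) * x ^ m + real m * x ^ (m - 1) * ?h + \<eta> * z' x) * \<theta> x"
     using DERIV_unique[OF w2] by blast
    have p: "?p \<in> ?B" using Bw xR by simp
    have w1x: "\<bar>w1 x\<bar> <= 1" using Gb[OF xR(2), of "w x"] bE' E by (simp add: w1_def)
    have hb: "\<bar>?h\<bar> <= Cs" unfolding Cs_def abs_divide using p B k by (intro frac_le) auto
    have Nb: "\<bar>?N\<bar> <= 4 * (B * B)"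
    proof -
     note Bp = B(2)[OF p]
     have "\<bar>w1 x * dy \<phi> ?p\<bar> <= 1 * B" "\<bar>w1 x * dy f ?p\<bar> <= 1 * B"
      unfolding abs_mult using w1x Bp by (intro mult_mono; simp)+
     then have "\<bar>1 * dx \<phi> ?p + w1 x * dy \<phi> ?p\<bar> <= 2 * B" "\<bar>1 * dx f ?p + w1 x * dy f ?p\<bar> <= 2 * B"
      using Bp abs_triangle_ineq[of "dx \<phi> ?p" "w1 x * dy \<phi> ?p"] abs_triangle_ineq[of "dx f ?p" "w1 x * dy f ?p"] by auto
     then have "\<bar>(1 * dx \<phi> ?p + w1 x * dy \<phi> ?p) * f ?p\<bar> <= 2 * B * B"
      "\<bar>\<phi> ?p * (1 * dx f ?p + w1 x * dy f ?p)\<bar> <= B * (2 * B)"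
      unfolding abs_mult using Bp B(1) by (intro mult_mono; simp)+
     then show ?thesis by linarith
    qed
    have ff: "k * k <= \<bar>f ?p * f ?p\<bar>" unfolding abs_mult using k(1) k(2)[OF p] by (intro mult_mono) auto
    have T1: "\<bar>?N / (f ?p * f ?p)\<bar> <= C2"
     unfolding C2_def abs_divide using Nb ff k(1) by (intro frac_le) auto
    have P: "\<bar>x ^ m\<bar> <= s * s" "\<bar>x ^ m\<bar> <= s" "\<bar>x ^ (m - 1)\<bar> <= s" using pw[OF True] by (auto simp: power_abs)
    have "\<bar>?h * x ^ m\<bar> <= Cs * (s * s)" unfolding abs_mult[of ?h] using hb P Cs by (intro mult_mono) auto
    moreover have z1: "\<bar>\<eta> * z x\<bar> <= \<eta> * Bz" "\<bar>\<eta> * z' x\<bar> <= \<eta> * Bz"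
     unfolding abs_mult using Bz(2,3)[of x] xR \<eta> by (auto simp: abs_le_iff intro!: mult_left_mono)
    ultimately have "\<bar>?h * x ^ m + \<eta> * z x\<bar> <= Cs * (s * s) + \<eta> * Bz"
     using abs_triangle_ineq[of "?h * x ^ m" "\<eta> * z x"] by linarith
    moreover have "\<bar>ct' (x / s) / s\<bar> <= Ct / s"
    proof -
     have "x / s \<in> {-1..1}" using True s by (auto simp: field_simps abs_le_iff)
     then have "\<bar>ct' (x / s)\<bar> <= Ct" using Ct(2) by auto
     then show ?thesis using s by (simp add: divide_right_mono)
    qed
    ultimately have "\<bar>ct' (x / s) / s * (?h * x ^ m + \<eta> * z x)\<bar> <= Ct / s * (Cs * (s * s) + \<eta> * Bz)"
     unfolding abs_mult[of "ct' (x / s) / s"] using Ct s by (intro mult_mono) auto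
    also have "\<dots> = Ct * Cs * s + Ct * Bz / s * \<eta>" using s by (simp add: field_simps)
    finally have t1: "\<bar>ct' (x / s) / s * (?h * x ^ m + \<eta> * z x)\<bar> <= Ct * Cs * s + Ct * Bz / s * \<eta>" .
    have "\<bar>?N / (f ?p * f ?p) * x ^ m\<bar> <= C2 * s" unfolding abs_mult[of "?N / (f ?p * f ?p)"] using T1 P C2 by (intro mult_mono) auto
    moreover have "\<bar>real m * x ^ (m - 1) * ?h\<bar> <= (real m * s) * Cs"
     unfolding abs_mult using hb P s by (intro mult_mono; simp add: abs_mult)+
    ultimately have "\<bar>?N / (f ?p * f ?p) * x ^ m + real m * x ^ (m - 1) * ?h + \<eta> * z' x\<bar> <= C2 * s + (real m * s) * Cs + \<eta> * Bz"
     using z1(2) by linarith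
    then have "\<bar>(?N / (f ?p * f ?p) * x ^ m + real m * x ^ (m - 1) * ?h + \<eta> * z' x) * \<theta> x\<bar> <= (C2 * s + (real m * s) * Cs + \<eta> * Bz) * 1"
     unfolding abs_mult[of _ "\<theta> x"] using \<theta>(1,2)[of x] C2 Cs s \<eta> Bz(1) by (intro mult_mono) auto
    with t1 have "\<bar>w2 x\<bar> <= Ct * Cs * s + Ct * Bz / s * \<eta> + (C2 * s + (real m * s) * Cs + \<eta> * Bz)"
     unfolding w2x by (intro order_trans[OF abs_triangle_ineq] add_mono) simp_all
    also have "\<dots> = (Ct * Cs + C2 + Cs * real m) * s + (Ct * Bz / s + Bz) * \<eta>" by (simp add: algebra_simps)
    also have "\<dots> <= D1 * s + D2 * \<eta>"
    proof (intro add_mono mult_right_mono)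
     have "Ct * Cs + C2 + Cs * real m <= (Ct * Cs + C2 + Cs * real m + Cs) * 1" using Cs by simp
     also have "\<dots> <= D1" unfolding D1_def using Ct Cs C2 R_pos by (intro mult_left_mono add_nonneg_nonneg) auto
     finally show "Ct * Cs + C2 + Cs * real m <= D1" .
     have "Ct * Bz / s + Bz <= (Ct * Bz / s + 2 * Bz) * 1" using Bz by simp
     also have "\<dots> <= D2" unfolding D2_def using Ct Bz(1) R_pos s by (intro mult_left_mono add_nonneg_nonneg) auto
     finally show "Ct * Bz / s + Bz <= D2" .
    qed (use s \<eta> in auto)
    also have "\<dots> < E" using sR \<eta> by linarith
    finally show ?thesis .
   qed
   have w1b: "\<bar>w1 x\<bar> < E" for x
    using Gb[of x "w x"] bE' w1_0[of x] sR E by (cases "\<bar>x\<bar> <= R") (auto simp: w1_def)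
   show ?thesis
    unfolding profile_def
   proof (rule exI[of _ w], rule exI[of _ w1], rule exI[of _ w2], rule exI[of _ \<theta>], intro conjI allI ballI impI)
    fix x assume "x \<in> {-R..R}"
    show "w1 x - ?F x (w x) = \<eta> * \<theta> x * z x - (1 - \<theta> x) * ?F x (w x)"
     by (simp add: w1_def G_def algebra_simps)
   next
    fix x show "\<bar>w x\<bar> < \<epsilon>" "\<bar>w1 x\<bar> < \<epsilon>" "\<bar>w2 x\<bar> < \<epsilon>"
     using wb[of x] w1b[of x] w2b[of x] E by auto
   qed (use ckw w1 w2 \<theta> in auto)
  qed
  with \<eta>(1) show "\<exists>\<eta>>0. \<exists>w w1 w2 \<theta>. profile \<epsilon> (s / 2) z \<eta> w w1 w2 \<theta>" by blast
 qed
qed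

end

section \<open>The half return maps of the perturbed system\<close>

text \<open>The smallness of \<open>w\<close> and \<open>x0\<close> keeps lower orbits inside the
  flow box, \<open>tube\<close> keeps the upper arcs from \<open>xe\<close> on inside
  \<open>U\<close>. \<open>v\<close> records only the sign of the defect \<open>w1 - F\<close>,
  which on the axis is the sign of the vertical component of the lower field.\<close>

locale perturbed_pair = flow_box fm "%p. \<phi> p * fst p ^ m" \<rho> R L K for fm \<phi> :: "plane => real" and m \<rho> R L K +
 fixes U \<Gamma> N0 :: "plane set" and fp gp :: "plane => real" and x0 \<alpha> C c xe :: real and A w w1 v :: "real => real"
 assumes smooth_fp: "smooth fp" and smooth_gp: "smooth gp" and land: "landing fp gp \<Gamma> x0 \<alpha> C c A"
  and \<alpha>: "\<alpha> > 0" and C: "C > 0" and w: "\<And>x. (w has_real_derivative w1 x) (at x)" and w1_cont: "continuous_on UNIV w1"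
  and w_small: "\<And>x. \<bar>w x\<bar> <= \<rho> / 8" and x0_small: "2 * K * x0 <= \<rho> / 8" and K: "K >= 0" and x0_R: "x0 <= R"
  and box_U: "\<And>x y. \<bar>x\<bar> < x0 ==> \<bar>y\<bar> <= \<rho> ==> (x, y) \<in> U"
  and N0: "\<And>p. p \<in> N0 ==> snd p <= 0 ==> \<bar>fst p\<bar> < x0 & \<bar>snd p\<bar> <= \<rho> / 8"
  and fp_neg: "\<And>x. \<bar>x\<bar> < x0 ==> fp (x, \<alpha>) < 0"
  and xe: "- x0 < xe" "xe <= c" "c <= - xe" and tube: "\<And>p. infdist p \<Gamma> <= C * (\<alpha> - xe) + \<alpha> ==> p \<in> U"
  and v: "\<And>x. \<bar>x\<bar> < x0 ==> sgn (w1 x - slope fm (%p. \<phi> p * fst p ^ m) \<rho> x (w x)) = sgn (v x)"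
begin

abbreviation "gm \<equiv> %p. \<phi> p * fst p ^ m"
abbreviation "Xp \<equiv> perturbed_upper fp gp \<alpha>"
abbreviation "Xm \<equiv> perturbed_lower fm \<phi> (replicate m 0) w"

definition H :: "real => real" where "H x = ht x (w x)"

abbreviation "arc_ok x \<equiv> landing_arc fp gp \<Gamma> \<alpha> C x (A x)"

definition arc :: "real => real => plane" where "arc x = fst (SOME z. arc_ok x (fst z) (snd z))"
definition dur :: "real => real" where "dur x = snd (SOME z. arc_ok x (fst z) (snd z))"

definition UA :: "real => plane set" where
 "UA x = (%t. shear (%_. - \<alpha>) (arc x t)) ` {0..dur x}"

text \<open>The solution graph through \<open>(p, w p)\<close> over \<open>{q..p}\<close>, brought
  back from sheared coordinates.\<close>

definition LA :: "real => real => plane set" where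
 "LA p q = (%x. (x, \<Phi> p (w p) x - w x)) ` {q..p}"

lemma x0_pos: "x0 > 0" and c_bd: "\<bar>c\<bar> < x0" and \<rho>_pos: "\<rho> > 0"
 using land R_pos R_le by (auto simp: landing_def)

lemma arc_ok: "- x0 <= x ==> x <= c ==> arc_ok x (arc x) (dur x)"
proof -
 assume "- x0 <= x" "x <= c"
 then obtain \<eta> T where "arc_ok x \<eta> T" using land unfolding landing_def by blast
 then have "arc_ok x (fst (\<eta>, T)) (snd (\<eta>, T))" by simp
 from someI[of "%z. arc_ok x (fst z) (snd z)", OF this] show ?thesis by (simp add: arc_def dur_def)
qed

lemma A_gt: "- x0 <= x ==> x <= c ==> c < A x"
 and A_dec: "- x0 <= x ==> x < x' ==> x' <= c ==> A x' < A x"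
 using land by (auto simp: landing_def)

lemma Xp_axis: "Xp (x, 0) = (fp (x, \<alpha>), gp (x, \<alpha>))"
 by (simp add: perturbed_upper_def)

lemma Xm_eq: "Xm p = (fm (shear w p), gm (shear w p) - fm (shear w p) * w1 (fst p))"
 by (rule perturbed_lower_shear[OF w])

lemma Xp_sgn: "\<bar>x\<bar> < x0 ==> sgn (snd (Xp (x, 0))) = sgn (c - x)"
 using land by (cases x c rule: linorder_cases) (auto simp: Xp_axis landing_def)

lemma fm_neg: "\<bar>x\<bar> < x0 ==> \<bar>y\<bar> <= \<rho> ==> fm (x, y) < 0"
 using f_neg[of x y] x0_R R_le by auto

lemma Xm_sgn:
 assumes x: "\<bar>x\<bar> < x0"
 shows "sgn (snd (Xm (x, 0))) = sgn (v x)"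
proof -
 have wr: "\<bar>w x\<bar> <= \<rho>" using w_small[of x] \<rho>_pos by auto
 have f: "fm (x, w x) < 0" using fm_neg[OF x wr] .
 have "snd (Xm (x, 0)) = - fm (x, w x) * (w1 x - gm (x, w x) / fm (x, w x))"
  using f by (simp add: Xm_eq shear_def field_simps)
 also have "gm (x, w x) / fm (x, w x) = slope fm gm \<rho> x (w x)" using wr by (simp add: slope_eq)
 finally have "sgn (snd (Xm (x, 0))) = sgn (- fm (x, w x)) * sgn (v x)" using v[OF x] by (simp add: sgn_mult)
 with f show ?thesis by simp
qed

lemma X_fst: "\<bar>x\<bar> < x0 ==> fst (Xp (x, 0)) < 0" "\<bar>x\<bar> < x0 ==> fst (Xm (x, 0)) < 0"
 using fp_neg[of x] fm_neg[of x "w x"] w_small[of x] \<rho>_pos by (auto simp: Xp_axis Xm_eq shear_def)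

lemma X_cont: "continuous_on UNIV (%x. Xp (x, 0))" "continuous_on UNIV (%x. Xm (x, 0))"
proof -
 have cw: "continuous_on UNIV w" by (rule DERIV_at_continuous_on[OF w])
 have *: "continuous_on UNIV (%x. h (x, a x))" if "smooth h" "continuous_on UNIV a" for h a
  by (rule continuous_on_compose2[OF smooth_continuous_on[OF that(1), of UNIV]]) (intro continuous_intros that, simp)
 show "continuous_on UNIV (%x. Xp (x, 0))"
  unfolding Xp_axis by (intro continuous_intros * smooth_fp smooth_gp)
 show "continuous_on UNIV (%x. Xm (x, 0))"
  unfolding Xm_eq shear_def fst_conv snd_conv add_0
  by (intro continuous_intros *[OF smooth_f cw] *[OF smooth_g cw, unfolded fst_conv] w1_cont)
qed

lemma upper_exists:
 assumes x: "xe <= x" "x <= c"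
 shows "\<exists>orb T. T > 0 & regular_segment U Xp (Sigma_plus U) orb 0 T \<and>
   inj_on orb {0..<T} & orb 0 = (x, 0) & orb T = (A x, 0) & orb ` {0..T} = UA x"
proof -
 let ?\<eta> = "arc x" and ?T = "dur x"
 have ok: "0 < ?T" "solves (upper_field fp gp) ?\<eta> {0..?T}" "?\<eta> 0 = (x, \<alpha>)" "?\<eta> ?T = (A x, \<alpha>)"
  "\<And>t. 0 < t ==> t < ?T ==> snd (?\<eta> t) > \<alpha>" "\<And>t. 0 <= t ==> t <= ?T ==> infdist (?\<eta> t) \<Gamma> <= C * (\<bar>x\<bar> + \<alpha>)"
  using arc_ok[of x] x xe unfolding landing_arc_def by auto
 have Ax: "c < A x" using A_gt[of x] x xe by auto
 define orb where "orb t = shear (%_. - \<alpha>) (?\<eta> t)" for t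
 have sh: "shear (%_. \<alpha>) (orb t) = ?\<eta> t" for t by (simp add: orb_def)
 have sol: "solves Xp orb {0..?T}" unfolding solves_perturbed_upper sh by (rule ok(2))
 have inU: "orb t \<in> U" if "0 <= t" "t <= ?T" for t
 proof (rule tube)
  have "infdist (orb t) \<Gamma> <= infdist (?\<eta> t) \<Gamma> + dist (orb t) (?\<eta> t)" by (rule infdist_triangle)
  also have "dist (orb t) (?\<eta> t) = \<alpha>"
   using \<alpha> by (cases "?\<eta> t") (simp add: orb_def shear_def dist_Pair_Pair dist_real_def)
  also have "infdist (?\<eta> t) \<Gamma> <= C * (\<alpha> - xe)"
   by (rule order_trans[OF ok(6)[OF that]]) (use C x xe in \<open>auto intro!: mult_left_mono\<close>)
  finally show "infdist (orb t) \<Gamma> <= C * (\<alpha> - xe) + \<alpha>" by simp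
 qed
 \<comment> \<open>A zero of the field would make the arc constant by uniqueness, but its ends over
   \<open>x\<close> and \<open>A x\<close> differ.\<close>
 have nz: "Xp (orb t) ~= 0" if t: "t \<in> {0..?T}" for t
 proof
  assume "Xp (orb t) = 0"
  then have z: "upper_field fp gp (?\<eta> t) = 0"
   by (simp add: perturbed_upper_shear sh upper_field_def case_prod_unfold)
  have const: "solves (upper_field fp gp) (%_. ?\<eta> t) {0..?T}" by (simp add: solves_def z)
  have "?\<eta> 0 = ?\<eta> t" "?\<eta> ?T = ?\<eta> t"
   using solves_unique[OF smooth_fp smooth_gp ok(2) const t, of 0] solves_unique[OF smooth_fp smooth_gp ok(2) const t, of ?T] ok(1) by auto
  then have "(x, \<alpha>) = (A x, \<alpha>)" using ok(3,4) by metis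
  then show False using Ax x by simp
 qed
 have "inj_on orb {0..<?T}"
 proof -
  \<comment> \<open>If a point were visited twice, backward uniqueness would bring the arc down to
    height \<alpha> at the interior time \<open>t - s\<close>.\<close>
  have *: False if st: "0 <= s" "s < t" "t < ?T" "orb s = orb t" for s t
  proof -
   have eq: "?\<eta> s = ?\<eta> (s + (t - s))" using st(4) sh[of s] sh[of t] by simp
   have 1: "solves (upper_field fp gp) ?\<eta> {0..s}" using ok(2) st by (auto intro: solves_subset)
   have 2: "solves (upper_field fp gp) (%u. ?\<eta> (u + (t - s))) {0..s}"
    by (rule solves_shift[OF ok(2)]) (use st in auto)
   have "?\<eta> 0 = ?\<eta> (0 + (t - s))"
    by (rule solves_unique[OF smooth_fp smooth_gp 1 2 _ eq]) (use st in auto)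
   then have "snd (?\<eta> (t - s)) = \<alpha>" using ok(3) by (metis add_0 snd_conv)
   then show False using ok(5)[of "t - s"] st by auto
  qed
  show ?thesis
  proof (rule inj_onI)
   fix s t assume "s \<in> {0..<?T}" "t \<in> {0..<?T}" "orb s = orb t"
   then show "s = t" using *[of s t] *[of t s] by (cases s t rule: linorder_cases) auto
  qed
 qed
 moreover have "regular_segment U Xp (Sigma_plus U) orb 0 ?T"
  unfolding regular_segment_def Sigma_zero_def Sigma_plus_def
  using sol nz inU inU[of 0] inU[of ?T] ok(1,3,4,5) by (auto simp: orb_def)
 ultimately show ?thesis
  using ok(1,3,4) by (intro exI[of _ orb] exI[of _ ?T]) (auto simp: orb_def UA_def shear_def)
qed

lemma UA_near:
 assumes "- x0 <= x" "x <= c" "p \<in> UA x"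
 shows "infdist p \<Gamma> <= C * (\<bar>x\<bar> + \<alpha>) + \<alpha>"
proof -
 obtain t where t: "0 <= t" "t <= dur x" "p = shear (%_. - \<alpha>) (arc x t)" using assms(3) by (auto simp: UA_def)
 have "infdist p \<Gamma> <= infdist (arc x t) \<Gamma> + dist p (arc x t)" by (rule infdist_triangle)
 also have "dist p (arc x t) = \<alpha>"
  using \<alpha> t(3) by (cases "arc x t") (simp add: shear_def dist_Pair_Pair dist_real_def)
 also have "infdist (arc x t) \<Gamma> <= C * (\<bar>x\<bar> + \<alpha>)" using arc_ok[OF assms(1,2)] t unfolding landing_arc_def by auto
 finally show ?thesis by simp
qed

text \<open>Right of \<open>c\<close> the upper field points down, so the segment starts at some
  \<open>x \<le> c\<close>. From there it agrees with the landing arc, and both end when they come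
  back to height \<alpha>, hence at the same time.\<close>

lemma upper_unique:
 assumes seg: "regular_segment U Xp (Sigma_plus U) orb a b" and N: "orb ` {a..b} \<subseteq> N0"
 shows "\<exists>x. - x0 < x & x <= c & orb a = (x, 0) & orb b = (A x, 0) & orb ` {a..b} = UA x"
proof -
 have ab: "a < b" and sol: "solves Xp orb {a..b}" and ends: "snd (orb a) = 0" "snd (orb b) = 0"
  and up: "\<And>t. a < t ==> t < b ==> snd (orb t) > 0"
  using seg by (auto simp: regular_segment_def Sigma_zero_def Sigma_plus_def)
 define x where "x = fst (orb a)"
 have orba: "orb a = (x, 0)" using ends by (simp add: x_def prod_eq_iff)
 have "orb a \<in> N0" using N ab by auto
 then have xb: "\<bar>x\<bar> < x0" using N0[of "orb a"] ends by (simp add: x_def)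
 define \<beta> where "\<beta> t = shear (%_. \<alpha>) (orb (t + a))" for t
 have \<beta>: "solves (upper_field fp gp) \<beta> {0..b - a}"
  unfolding \<beta>_def by (rule solves_shift[OF sol[unfolded solves_perturbed_upper]]) auto
 have snd\<beta>: "snd (\<beta> t) = snd (orb (t + a)) + \<alpha>" for t by (simp add: \<beta>_def)
 have xc: "x <= c"
 proof (rule ccontr)
  assume "\<not> x <= c"
  then have "gp (x, \<alpha>) < 0" using land xb by (auto simp: landing_def)
  moreover have "((%t. snd (orb t)) has_real_derivative gp (x, \<alpha>)) (at a within {a..b})"
  proof -
   have "(orb has_vector_derivative Xp (x, 0)) (at a within {a..b})"
    using sol ab orba unfolding solves_def by (metis atLeastAtMost_iff less_imp_le order_refl)
   from bounded_linear.has_vector_derivative[OF bounded_linear_snd this] show ?thesis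
    by (simp add: has_real_derivative_iff_has_vector_derivative Xp_axis)
  qed
  ultimately obtain d where d: "d > 0" "\<And>h. 0 < h ==> a + h \<in> {a..b} ==> h < d ==> snd (orb (a + h)) < snd (orb a)"
   using has_real_derivative_neg_dec_right by blast
  define h where "h = min (d / 2) ((b - a) / 2)"
  have "0 < h" "h < d" "h < b - a" using d(1) ab by (auto simp: h_def min_def)
  then show False using d(2)[of h] up[of "a + h"] ends by auto
 qed
 let ?\<eta> = "arc x" and ?T = "dur x"
 have ok: "0 < ?T" "solves (upper_field fp gp) ?\<eta> {0..?T}" "?\<eta> 0 = (x, \<alpha>)" "?\<eta> ?T = (A x, \<alpha>)"
  "\<And>t. 0 < t ==> t < ?T ==> snd (?\<eta> t) > \<alpha>"
  using arc_ok[of x] xc xb unfolding landing_arc_def by auto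
 have st: "\<beta> 0 = ?\<eta> 0" using orba ok(3) by (simp add: \<beta>_def shear_def)
 have eq: "\<beta> t = ?\<eta> t" if "0 <= t" "t <= b - a" "t <= ?T" for t
 proof (rule solves_unique[OF smooth_fp smooth_gp])
  show "solves (upper_field fp gp) \<beta> {0..t}" by (rule solves_subset[OF \<beta>]) (use that in auto)
  show "solves (upper_field fp gp) ?\<eta> {0..t}" by (rule solves_subset[OF ok(2)]) (use that in auto)
 qed (use that st in auto)
 have T: "?T = b - a"
 proof (rule ccontr)
  assume "?T ~= b - a"
  then consider "?T < b - a" | "b - a < ?T" by linarith
  then show False
  proof cases
   case 1
   then show False using eq[of ?T] ok(1,4) snd\<beta>[of ?T] up[of "?T + a"] by auto
  next
   case 2
   then show False using eq[of "b - a"] ok(5)[of "b - a"] snd\<beta>[of "b - a"] ends ab by auto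
  qed
 qed
 have orbeq: "orb t = shear (%_. - \<alpha>) (?\<eta> (t - a))" if "t \<in> {a..b}" for t
 proof -
  have "\<beta> (t - a) = ?\<eta> (t - a)" using eq[of "t - a"] T that by auto
  moreover have "shear (%_. - \<alpha>) (\<beta> (t - a)) = orb t" by (simp add: \<beta>_def)
  ultimately show ?thesis by simp
 qed
 have im: "(%t. t - a) ` {a..b} = {0..?T}" using T by simp
 have "orb ` {a..b} = (%t. shear (%_. - \<alpha>) (?\<eta> (t - a))) ` {a..b}" using orbeq by (intro image_cong) auto
 also have "\<dots> = UA x" unfolding UA_def im[symmetric] image_image by simp
 finally have "orb ` {a..b} = UA x" .
 moreover have "orb b = (A x, 0)" using orbeq[of b] ab T ok(4) by (simp add: shear_def)
 ultimately show ?thesis using orba xc xb by (intro exI[of _ x]) auto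
qed

lemma mem_R: "\<bar>x\<bar> < x0 ==> x \<in> {-R..R}"
 using x0_R by auto

text \<open>The level is constant, equal to \<open>H p\<close>, along the sheared orbit. Below the
  switching line means below the graph of \<open>w\<close>, and \<open>ht\<close> increases with the
  height, which gives \<open>H p < H x\<close> over the interior.\<close>

lemma lower_unique:
 assumes seg: "regular_segment U Xm (Sigma_minus U) orb a b" and N: "orb ` {a..b} \<subseteq> N0"
 shows "\<exists>p q. - x0 < q & q < p & p < x0 & orb a = (p, 0) & orb b = (q, 0) & H q = H p \<and>
    (\<forall>x. q < x & x < p --> H p < H x) & orb ` {a..b} = LA p q"
proof -
 have ab: "a < b" and sol: "solves Xm orb {a..b}" and ends: "snd (orb a) = 0" "snd (orb b) = 0"
  and low: "\<And>t. a < t ==> t < b ==> snd (orb t) < 0"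
  using seg by (auto simp: regular_segment_def Sigma_zero_def Sigma_minus_def)
 have low': "snd (orb t) <= 0" if "t \<in> {a..b}" for t using low[of t] ends that by (cases "t = a \<or> t = b") auto
 have bd: "\<bar>fst (orb t)\<bar> < x0" "\<bar>snd (orb t)\<bar> <= \<rho> / 8" if "t \<in> {a..b}" for t
 proof -
  have "orb t \<in> N0" using N that by blast
  from N0[OF this low'[OF that]] show "\<bar>fst (orb t)\<bar> < x0" "\<bar>snd (orb t)\<bar> <= \<rho> / 8" by auto
 qed
 let ?\<beta> = "%t. shear w (orb t)"
 have \<beta>: "solves (upper_field fm gm) ?\<beta> {a..b}" using sol unfolding solves_perturbed_lower[OF w] .
 have box: "?\<beta> ` {a..b} \<subseteq> {-R..R} \<times> {-\<rho>..\<rho>}"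
 proof (rule image_subsetI)
  fix t assume t: "t \<in> {a..b}"
  have "\<bar>snd (orb t) + w (fst (orb t))\<bar> <= \<rho>"
   using bd(2)[OF t] w_small[of "fst (orb t)"] by linarith
  then show "?\<beta> t \<in> {-R..R} \<times> {-\<rho>..\<rho>}" using mem_R[OF bd(1)[OF t]] by (auto simp: mem_Times_iff abs_le_iff)
 qed
 have dec: "fst (orb t) < fst (orb s)" if "a <= s" "s < t" "t <= b" for s t
  using fst_decreasing[OF \<beta> box that] by simp
 define p where "p = fst (orb a)"
 define q where "q = fst (orb b)"
 have qp: "q < p" using dec[of a b] ab by (simp add: p_def q_def)
 have orbp: "orb a = (p, 0)" and orbq: "orb b = (q, 0)" using ends by (auto simp: p_def q_def prod_eq_iff)
 have pb: "\<bar>p\<bar> < x0" "\<bar>q\<bar> < x0" using bd(1)[of a] bd(1)[of b] ab by (auto simp: p_def q_def)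
 have level: "ht (fst (orb t)) (snd (orb t) + w (fst (orb t))) = H p" if "t \<in> {a..b}" for t
  using ht_constant_on_orbit[OF \<beta> box, of a t] that ab orbp by (simp add: H_def)
 have orbit: "orb t = (fst (orb t), \<Phi> p (w p) (fst (orb t)) - w (fst (orb t)))" if t: "t \<in> {a..b}" for t
 proof -
  let ?x = "fst (orb t)"
  have "ht ?x (\<Phi> p (w p) ?x) = H p" unfolding H_def by (rule ht_Phi[OF mem_R[OF bd(1)[OF t]] mem_R[OF pb(1)]])
  then have "\<Phi> p (w p) ?x = snd (orb t) + w ?x"
   using level[OF t] ht_eq_iff[OF mem_R[OF bd(1)[OF t]]] by metis
  then show ?thesis by (simp add: prod_eq_iff)
 qed
 have hit: "\<exists>t\<in>{a..b}. fst (orb t) = x" if "q <= x" "x <= p" for x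
 proof -
  have "\<exists>t\<ge>a. t <= b & fst (orb t) = x"
   using that ab by (intro IVT2') (auto simp: p_def q_def intro!: continuous_intros solves_continuous_on[OF sol])
  then show ?thesis by auto
 qed
 have "H p < H x" if x: "q < x" "x < p" for x
 proof -
  obtain t where t: "t \<in> {a..b}" "fst (orb t) = x" using hit[of x] x by auto
  then have "t ~= a" "t ~= b" using x by (auto simp: p_def q_def)
  then have "snd (orb t) < 0" using low[of t] t by auto
  then show ?thesis
   using level[OF t(1)] ht_less_iff[OF mem_R[OF bd(1)[OF t(1)]], of "snd (orb t) + w x" "w x"] t(2) by (simp add: H_def)
 qed
 moreover have "H q = H p" using level[of b] ab orbq by (simp add: H_def)
 moreover have "orb ` {a..b} = LA p q"
 proof (intro subset_antisym subsetI)
  fix z assume "z \<in> orb ` {a..b}"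
  then obtain t where t: "t \<in> {a..b}" "z = orb t" by auto
  have "fst (orb t) <= p" using dec[of a t] t by (cases "t = a") (auto simp: p_def)
  moreover have "q <= fst (orb t)" using dec[of t b] t by (cases "t = b") (auto simp: q_def)
  ultimately show "z \<in> LA p q" unfolding LA_def t(2) by (subst orbit[OF t(1)]) auto
 next
  fix z assume "z \<in> LA p q"
  then obtain x where x: "x \<in> {q..p}" "z = (x, \<Phi> p (w p) x - w x)" by (auto simp: LA_def)
  then obtain t where "t \<in> {a..b}" "fst (orb t) = x" using hit[of x] by auto
  with orbit[of t] x(2) have "z = orb t" by simp
  with \<open>t \<in> {a..b}\<close> show "z \<in> orb ` {a..b}" by blast
 qed
 ultimately show ?thesis using qp pb orbp orbq by (intro exI[of _ p] exI[of _ q]) auto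
qed

lemma Phi_near:
 assumes "\<bar>p\<bar> < x0" "\<bar>x\<bar> < x0"
 shows "\<bar>\<Phi> p (w p) x - w p\<bar> <= K * \<bar>x - p\<bar>"
 using Phi_lipschitz[OF mem_R[OF assms(1)] mem_R[OF assms(2)] mem_R[OF assms(1)], of "w p"] Phi_start[OF mem_R[OF assms(1)]] by simp

text \<open>The solution graph \<open>u\<close> through \<open>(p, w p)\<close> lies below the graph
  of \<open>w\<close> where \<open>H p < H x\<close> and meets it again at \<open>q\<close>;
  \<open>graph_orbit\<close> supplies the time.\<close>

lemma lower_exists:
 assumes r: "- x0 < q" "q < p" "p < x0" "H q = H p" "\<And>x. q < x ==> x < p ==> H p < H x"
 shows "\<exists>orb T. T > 0 & regular_segment U Xm (Sigma_minus U) orb 0 T \<and>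
   inj_on orb {0..<T} & orb 0 = (p, 0) & orb T = (q, 0) & orb ` {0..T} = LA p q"
proof -
 define u where "u = \<Phi> p (w p)"
 have b: "\<bar>x\<bar> < x0" if "x \<in> {q..p}" for x using that r by auto
 have bp: "\<bar>p\<bar> < x0" "\<bar>q\<bar> < x0" using b r by auto
 have u: "sol u" "u p = w p" unfolding u_def using Phi_sol[OF mem_R[OF bp(1)]] Phi_start[OF mem_R[OF bp(1)]] by auto
 have hu: "ht x (u x) = H p" if "x \<in> {q..p}" for x
  unfolding u_def H_def by (rule ht_Phi[OF mem_R[OF b[OF that]] mem_R[OF bp(1)]])
 have uq: "u q = w q" using hu[of q] r(2,4) ht_eq_iff[OF mem_R[OF bp(2)], of "u q" "w q"] by (simp add: H_def)
 have ub: "\<bar>u x\<bar> <= \<rho> / 4" if x: "x \<in> {q..p}" for x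
 proof -
  have "\<bar>u x - w p\<bar> <= K * \<bar>x - p\<bar>" unfolding u_def by (rule Phi_near[OF bp(1) b[OF x]])
  also have "\<dots> <= K * (2 * x0)" using b[OF x] bp K by (intro mult_left_mono) auto
  finally show ?thesis using x0_small w_small[of p] by linarith
 qed
 have ub': "\<bar>u x\<bar> <= \<rho>" if "x \<in> {q..p}" for x using ub[OF that] \<rho>_pos by linarith
 obtain T \<beta> where \<beta>: "T > 0" "solves (upper_field fm gm) \<beta> {0..T}" "\<beta> 0 = (p, u p)" "\<beta> T = (q, u q)"
  "\<beta> ` {0..T} = (%x. (x, u x)) ` {q..p}"
  "\<And>t. t \<in> {0<..<T} ==> q < fst (\<beta> t) & fst (\<beta> t) < p & snd (\<beta> t) = u (fst (\<beta> t))"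
  by (rule graph_orbit[OF u(1) r(2) mem_R[OF bp(2)] mem_R[OF bp(1)] ub']) (assumption, rule that)
 define orb where "orb t = shear (%x. - w x) (\<beta> t)" for t
 have sh: "shear w (orb t) = \<beta> t" for t by (simp add: orb_def)
 have sol: "solves Xm orb {0..T}" unfolding solves_perturbed_lower[OF w] sh by (rule \<beta>(2))
 have form: "\<exists>x\<in>{q..p}. \<beta> t = (x, u x)" if "t \<in> {0..T}" for t using \<beta>(5) that by blast
 have inU: "orb t \<in> U" if t: "t \<in> {0..T}" for t
 proof -
  obtain x where x: "x \<in> {q..p}" "\<beta> t = (x, u x)" using form[OF t] by blast
  have "\<bar>u x - w x\<bar> <= \<rho>" using ub[OF x(1)] w_small[of x] \<rho>_pos by linarith
  then show ?thesis using box_U[OF b[OF x(1)]] x(2) by (simp add: orb_def shear_def)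
 qed
 have nz: "Xm (orb t) ~= 0" if t: "t \<in> {0..T}" for t
 proof -
  obtain x where x: "x \<in> {q..p}" "\<beta> t = (x, u x)" using form[OF t] by blast
  have "fm (\<beta> t) < 0" using fm_neg[OF b[OF x(1)] ub'[OF x(1)]] x(2) by simp
  then show ?thesis by (simp add: Xm_eq sh zero_prod_def)
 qed
 have low: "snd (orb t) < 0" if t: "t \<in> {0<..<T}" for t
 proof -
  let ?x = "fst (\<beta> t)"
  have x: "q < ?x" "?x < p" "snd (\<beta> t) = u ?x" using \<beta>(6)[OF t] by auto
  then have "ht ?x (u ?x) < ht ?x (w ?x)" using hu[of ?x] r(5)[of ?x] by (simp add: H_def)
  then have "u ?x < w ?x" using ht_less_iff[OF mem_R[OF b[of ?x]]] x by auto
  then show ?thesis using x by (simp add: orb_def)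
 qed
 have "\<beta> ` {0..T} \<subseteq> {-R..R} \<times> {-\<rho>..\<rho>}"
 proof (rule image_subsetI)
  fix t assume "t \<in> {0..T}"
  then obtain x where x: "x \<in> {q..p}" "\<beta> t = (x, u x)" using form by blast
  then show "\<beta> t \<in> {-R..R} \<times> {-\<rho>..\<rho>}" using mem_R[OF b[OF x(1)]] ub'[OF x(1)] by (auto simp: abs_le_iff)
 qed
 note dec = fst_decreasing[OF \<beta>(2) this]
 have "inj_on orb {0..<T}"
 proof (rule inj_onI)
  fix s t assume st: "s \<in> {0..<T}" "t \<in> {0..<T}" "orb s = orb t"
  then have "fst (\<beta> s) = fst (\<beta> t)" by (metis fst_shear sh)
  then show "s = t" using dec[of s t] dec[of t s] st by (cases s t rule: linorder_cases) auto
 qed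
 moreover have "regular_segment U Xm (Sigma_minus U) orb 0 T"
  unfolding regular_segment_def Sigma_zero_def Sigma_minus_def
  using \<beta>(1) sol nz inU low inU[of 0] inU[of T] \<beta>(3,4) u(2) uq by (auto simp: orb_def shear_def)
 moreover have "orb ` {0..T} = LA p q"
 proof -
  have "orb ` {0..T} = shear (%x. - w x) ` (\<beta> ` {0..T})" by (simp add: orb_def image_image)
  then show ?thesis unfolding \<beta>(5) LA_def image_image u_def by (simp add: shear_def)
 qed
 ultimately show ?thesis
  using \<beta>(1,3,4) u(2) uq by (intro exI[of _ orb] exI[of _ T]) (auto simp: orb_def shear_def)
qed

lemma LA_near:
 assumes "- x0 < q" "q < p" "p < x0" "\<And>x. \<bar>w x\<bar> <= d" "z \<in> LA p q" "(0, 0) \<in> \<Gamma>" "\<bar>p\<bar> <= s" "\<bar>q\<bar> <= s"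
 shows "infdist z \<Gamma> <= s + 2 * K * s + 2 * d"
proof -
 obtain x where x: "x \<in> {q..p}" "z = (x, \<Phi> p (w p) x - w x)" using assms(5) by (auto simp: LA_def)
 have "\<bar>\<Phi> p (w p) x - w p\<bar> <= K * \<bar>x - p\<bar>" by (rule Phi_near) (use x assms in auto)
 also have "\<dots> <= K * (2 * s)" using x assms K by (intro mult_left_mono) auto
 finally have "\<bar>\<Phi> p (w p) x - w x\<bar> <= 2 * K * s + 2 * d" using assms(4)[of x] assms(4)[of p] by linarith
 moreover have "\<bar>x\<bar> <= s" using x assms by auto
 moreover have "infdist z \<Gamma> <= dist z (0, 0)" by (rule infdist_le[OF assms(6)])
 moreover have "dist z (0, 0) <= \<bar>x\<bar> + \<bar>\<Phi> p (w p) x - w x\<bar>"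
  using sqrt_sum_squares_le_sum_abs[of x "\<Phi> p (w p) x - w x"] x(2) by (simp add: dist_Pair_Pair dist_real_def)
 ultimately show ?thesis by linarith
qed

sublocale half_maps U Xp Xm N0 x0 c xe A H v UA LA
proof unfold_locales
 show "\<bar>x\<bar> < x0" if "(x, 0) \<in> N0" for x using N0[OF that] by simp
 show "(x, 0) \<in> U" if "\<bar>x\<bar> < x0" for x using box_U[OF that, of 0] \<rho>_pos by simp
qed (use c_bd A_gt A_dec Xp_sgn Xm_sgn X_fst X_cont upper_unique lower_unique xe upper_exists lower_exists in auto)

end

section \<open>Placing the slots\<close>

text \<open>\<open>bl\<close> is the prescribed rate left of \<open>c\<close>: in units of \<eta>
  the intended level rises from \<open>0\<close> at \<open>q0\<close> to \<open>J + 1\<close> at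
  \<open>c\<close>. The slots are placed by these levels.\<close>

locale slots0 =
 fixes c xe h q0 BA :: real and A bl BL :: "real => real" and J :: nat
 assumes order: "- h < xe" "xe < q0" "q0 < c" and J: "J >= 1"
  and A_above: "\<And>x. xe <= x ==> x <= c ==> c < A x"
  and A_anti: "\<And>x x'. xe <= x ==> x < x' ==> x' <= c ==> A x' < A x"
  and A_lip: "\<And>x x'. xe <= x ==> x <= c ==> xe <= x' ==> x' <= c ==> \<bar>A x - A x'\<bar> <= BA * \<bar>x - x'\<bar>"
  and BA: "BA > 0" and A_h: "A xe < h"
  and bl_bump: "bump_of_mass q0 c (real J + 1) bl BL"
begin

lemmas bl = bump_of_massD[OF bl_bump]

lemma BL_less:
 assumes "q0 <= x" "x < x'" "x' <= c"
 shows "BL x < BL x'"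
proof (rule DERIV_pos_imp_increasing_open[OF assms(2)])
 fix t assume "x < t" "t < x'"
 with assms have "q0 < t" "t < c" by auto
 then show "\<exists>y. (BL has_real_derivative y) (at t) & 0 < y" using bl(2)[of t] bl(4)[of t] by auto
qed (auto intro!: DERIV_at_continuous_on[of _ BL bl] bl(2))

text \<open>Inverse of the rise on the left: the point lying \<open>t\<close> units below the level
  at \<open>c\<close>.\<close>

definition u :: "real => real" where
 "u t = (SOME x. q0 <= x & x <= c & BL x = real J + 1 - t)"

lemma u:
 assumes "0 <= t" "t <= real J + 1"
 shows "q0 <= u t" "u t <= c" "BL (u t) = real J + 1 - t"
proof -
 have "\<exists>x\<ge>q0. x <= c & BL x = real J + 1 - t"
  using assms order bl(6)[of q0] bl(7)[of c]
  by (intro IVT') (auto intro!: DERIV_at_continuous_on[of _ BL bl] bl(2))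
 then have "\<exists>x. q0 <= x & x <= c & BL x = real J + 1 - t" by auto
 from someI_ex[OF this] show "q0 <= u t" "u t <= c" "BL (u t) = real J + 1 - t" by (auto simp: u_def)
qed

lemma u_less:
 assumes "0 <= t" "t < t'" "t' <= real J + 1"
 shows "u t' < u t"
proof (rule ccontr)
 assume "\<not> u t' < u t"
 then have "BL (u t) <= BL (u t')"
  using BL_less[of "u t" "u t'"] u[of t] u[of t'] assms by (cases "u t = u t'") auto
 then show False using u(3)[of t] u(3)[of t'] assms by auto
qed

lemma u_bounds: "0 < t ==> t < real J + 1 ==> q0 < u t & u t < c"
 using u[of t] bl(6)[of "u t"] bl(7)[of "u t"] by (auto simp: less_le)

text \<open>Slot \<open>j\<close> is the set of levels within a quarter unit of
  \<open>J - j\<close>. Its image under \<open>A\<close> will lie on a plateau of level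
  \<open>J - j\<close>, so \<open>H x - H (A x)\<close> changes sign on it.\<close>

definition ul :: "nat => real" where "ul j = u (real j + 5/4)"
definition ur :: "nat => real" where "ur j = u (real j + 3/4)"

lemma slot:
 assumes "j < J"
 shows "q0 < ul j" "ul j < ur j" "ur j < c" "BL (ul j) = real J - real j - 1/4" "BL (ur j) = real J - real j + 1/4"
  "xe < ul j" "xe < ur j" "ul j < c"
proof -
 have j: "real j + 5/4 < real J + 1" using assms by linarith
 show *: "q0 < ul j" "ul j < ur j" "ur j < c" "BL (ul j) = real J - real j - 1/4" "BL (ur j) = real J - real j + 1/4"
  using u_bounds[of "real j + 5/4"] u_bounds[of "real j + 3/4"] u_less[of "real j + 3/4" "real j + 5/4"]
   u(3)[of "real j + 5/4"] u(3)[of "real j + 3/4"] j by (auto simp: ul_def ur_def)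
 show "xe < ul j" "xe < ur j" "ul j < c" using * order by auto
qed

lemma slot_less: "Suc j < J ==> ur (Suc j) < ul j"
 using u_less[of "real j + 5/4" "real j + 7/4"] by (simp add: ul_def ur_def add.commute)

text \<open>\<open>lo j\<close> and \<open>hi j\<close> bound the gap before the image of slot
  \<open>j\<close> on the right of \<open>c\<close>, where the level has to step down; the last gap,
  \<open>j = J\<close>, ends at \<open>A q0\<close>.\<close>

definition lo :: "nat => real" where "lo j = (if j = 0 then c else A (ul (j - 1)))"
definition hi :: "nat => real" where "hi j = (if j < J then A (ur j) else A q0)"

lemma gap:
 assumes "j <= J"
 shows "lo j < hi j"
proof (cases "j = 0")
 case True
 then show ?thesis using A_above[of "ur 0"] slot[of 0] J order by (simp add: lo_def hi_def)
next
 case False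
 show ?thesis
 proof (cases "j < J")
  case True
  then have "ur j < ul (j - 1)" "j - 1 < J" using slot_less[of "j - 1"] False by auto
  then show ?thesis using A_anti[of "ur j" "ul (j - 1)"] True False slot[of j] slot[of "j - 1"] by (simp add: lo_def hi_def)
 next
  case 2: False
  then show ?thesis using A_anti[of q0 "ul (j - 1)"] False assms slot[of "j - 1"] order by (simp add: lo_def hi_def)
 qed
qed

lemma hi_lo: "j < J ==> hi j < lo (Suc j)"
 using A_anti[of "ul j" "ur j"] slot[of j] by (simp add: lo_def hi_def)

lemma lo_mono:
 assumes "i < j" "j <= J"
 shows "hi i < lo j"
 using assms
proof (induction j)
 case (Suc j)
 show ?case
 proof (cases "i = j")
  case False
  then show ?thesis using Suc hi_lo[of j] gap[of j] by auto
 qed (use Suc hi_lo in auto)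
qed auto

lemma lo_c: "j <= J ==> c <= lo j"
 using A_above[of "ul (j - 1)"] slot[of "j - 1"] by (cases j) (auto simp: lo_def)

lemma hi_bound: "j <= J ==> hi j <= A q0" "A q0 < h"
 using A_anti[of q0 "ur j"] slot[of j] A_anti[of xe q0] order A_h by (auto simp: hi_def)

text \<open>Fifths of the gap: the step down happens between \<open>pt j 2\<close> and
  \<open>pt j 3\<close>, sliding zones end at \<open>pt j 1\<close> and start at
  \<open>pt j 4\<close>, so that these stay apart.\<close>

definition pt :: "nat => nat => real" where "pt j i = lo j + real i / 5 * (hi j - lo j)"

lemma pt:
 assumes "j <= J"
 shows "lo j < pt j 1" "pt j 1 < pt j 2" "pt j 2 < pt j 3" "pt j 3 < pt j 4" "pt j 4 < hi j"
 using gap[OF assms] by (auto simp: pt_def field_simps)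

definition e :: "nat => real" where "e j = pt j 4"
definition e' :: "nat => real" where "e' j = pt (Suc j) 1"

lemma zone_order:
 assumes "j < J"
 shows "c < pt j 2" "pt j 2 < pt j 3" "pt j 3 < e j" "e j < A (ur j)" "A (ur j) < A (ul j)" "A (ul j) < e' j" "e' j < pt (Suc j) 2" "e' j < A q0"
proof -
 have j: "j <= J" "Suc j <= J" using assms by auto
 show "c < pt j 2" "pt j 2 < pt j 3" "pt j 3 < e j" using pt[OF j(1)] lo_c[OF j(1)] by (auto simp: e_def)
 show "e j < A (ur j)" using pt[OF j(1)] assms by (simp add: e_def hi_def)
 show "A (ur j) < A (ul j)" using A_anti[of "ul j" "ur j"] slot[OF assms] by simp
 show "A (ul j) < e' j" "e' j < pt (Suc j) 2" using pt[OF j(2)] by (auto simp: e'_def lo_def)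
 show "e' j < A q0" using pt[OF j(2)] hi_bound(1)[OF j(2)] by (simp add: e'_def)
qed

lemma zone_sep: "i < j ==> j < J ==> e' i < e j"
proof -
 assume ij: "i < j" "j < J"
 show "e' i < e j"
 proof (cases "Suc i = j")
  case True
  then show ?thesis using pt[of j] ij by (simp add: e_def e'_def)
 next
  case False
  then have "hi (Suc i) < lo j" using lo_mono[of "Suc i" j] ij by simp
  then show ?thesis using pt[of j] pt[of "Suc i"] ij by (simp add: e_def e'_def)
 qed
qed

lemma pt_zone: "i < J ==> j <= J ==> pt j 3 < e i \<or> e' i < pt j 2"
proof -
 assume ij: "i < J" "j <= J"
 consider "i < j" | "i = j" | "j < i" by linarith
 then show ?thesis
 proof cases
  case 1
  then show ?thesis
  proof (cases "Suc i = j")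
   case False
   then have "hi (Suc i) < lo j" using lo_mono[of "Suc i" j] 1 ij by simp
   then show ?thesis using pt[of j] pt[of "Suc i"] ij by (simp add: e_def e'_def)
  qed (use pt[of j] ij in \<open>auto simp: e'_def\<close>)
 next
  case 3
  then show ?thesis using lo_mono[of j i] pt[of j] pt[of i] ij by (simp add: e_def)
 qed (use pt[of j] ij in \<open>simp add: e_def\<close>)
qed

end

text \<open>\<open>v\<close> is an explicit function with the sign pattern wanted for the defect:
  positive left of \<open>c\<close> and negative right of it, reversed in the \<open>l\<close>
  zones, beyond \<open>pt J 1\<close> if \<open>rb\<close>, and before \<open>q0\<close> if
  \<open>lb\<close>. The step \<open>J\<close> has height \<open>2\<close>; where it is used, it
  takes the level below \<open>0\<close>, the level at \<open>q0\<close>.\<close>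

locale slots = slots0 +
 fixes l :: nat and lb rb :: bool and b Bm :: "nat => real => real" and v :: "real => real"
 assumes l: "l < J"
  and b_bump: "\<And>j. j <= J ==> bump_of_mass (pt j 2) (pt j 3) (if j = J then 2 else 1) (b j) (Bm j)"
  and v: "\<And>x. v x = (c - x) * (\<Prod>j<l. (x - e j) * (x - e' j)) * (if rb then pt J 1 - x else 1) * (if lb then x - q0 else 1)"
begin

lemmas b = bump_of_massD(1-3,5-7)[OF b_bump]

abbreviation "I \<equiv> if rb then {..<J} else {..J}"

lemma I: "finite I" "j \<in> I ==> j <= J" "j < J ==> j \<in> I"
 by (auto split: if_splits)

lemma zone_prod_pos:
 assumes *: "\<And>j. j < l ==> x < e j \<or> e' j < x"
 shows "(\<Prod>j<l. (x - e j) * (x - e' j)) > 0"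
proof (intro Groups_Big.prod_pos)
 fix j assume j: "j \<in> {..<l}"
 then have "j < J" using l by auto
 then have "e j < e' j" using zone_order[of j] by simp
 with *[of j] j show "0 < (x - e j) * (x - e' j)"
  by (auto simp: zero_less_mult_iff)
qed

lemma zone_prod_neg:
 assumes "j < l" "e j < x" "x < e' j"
 shows "(\<Prod>i<l. (x - e i) * (x - e' i)) < 0"
proof -
 have "(\<Prod>i\<in>{..<l} - {j}. (x - e i) * (x - e' i)) > 0"
 proof (intro Groups_Big.prod_pos)
  fix i assume i: "i \<in> {..<l} - {j}"
  then have "i < J" "j < J" using l assms(1) by auto
  moreover have "x < e i \<or> e' i < x"
  proof (cases "i < j")
   case True
   then show ?thesis using zone_sep[of i j] \<open>j < J\<close> assms by auto
  next
   case False
   then have "j < i" using i by auto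
   then show ?thesis using zone_sep[of j i] \<open>i < J\<close> assms by auto
  qed
  moreover have "e i < e' i" using zone_order[OF \<open>i < J\<close>] by simp
  ultimately show "0 < (x - e i) * (x - e' i)" by (auto simp: zero_less_mult_iff)
 qed
 moreover have "(x - e j) * (x - e' j) < 0" using assms by (auto simp: mult_less_0_iff)
 moreover have "(\<Prod>i<l. (x - e i) * (x - e' i)) = (x - e j) * (x - e' j) * (\<Prod>i\<in>{..<l} - {j}. (x - e i) * (x - e' i))"
  by (rule prod.remove) (use assms in auto)
 ultimately show ?thesis by (simp add: mult_neg_pos)
qed

lemma e_above: "j < l ==> c < e j & e j < e' j & e' j < A q0 & e' j <= pt J 1"
proof -
 assume "j < l"
 then have j: "j < J" using l by simp
 have "e' j <= pt J 1"
 proof (cases "Suc j = J")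
  case False
  then show ?thesis using lo_mono[of "Suc j" J] pt[of "Suc j"] pt[of J] j by (simp add: e'_def)
 qed (simp add: e'_def)
 with zone_order[OF j] show ?thesis by auto
qed

lemma pt_J: "c < pt J 1" "pt J 1 < A q0" "j < J ==> pt j 3 < pt J 1"
 using pt[of J] lo_c[of J] hi_bound(1)[of J] lo_mono[of j J] pt[of j] by auto

lemma v_left: "x < c ==> (lb ==> q0 < x) ==> v x > 0"
 using zone_prod_pos[of x] e_above pt_J unfolding v by (force intro!: mult_pos_pos)

lemma v_far_left: "lb ==> x < q0 ==> v x < 0"
proof -
 assume *: "lb" "x < q0"
 have "(\<Prod>j<l. (x - e j) * (x - e' j)) > 0" by (rule zone_prod_pos) (use e_above * order in force)
 then have "(c - x) * (\<Prod>j<l. (x - e j) * (x - e' j)) * (if rb then pt J 1 - x else 1) > 0"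
  using * order pt_J(1) by (intro mult_pos_pos) auto
 then show ?thesis unfolding v using * by (simp add: mult_pos_neg)
qed

lemma v_right:
 assumes "c < x" "\<And>j. j < l ==> x < e j \<or> e' j < x" "rb ==> x < pt J 1"
 shows "v x < 0"
proof -
 have "(\<Prod>j<l. (x - e j) * (x - e' j)) > 0" by (rule zone_prod_pos[OF assms(2)])
 then have "(c - x) * (\<Prod>j<l. (x - e j) * (x - e' j)) < 0" using assms(1) by (simp add: mult_neg_pos)
 then have "(c - x) * (\<Prod>j<l. (x - e j) * (x - e' j)) * ((if rb then pt J 1 - x else 1) * (if lb then x - q0 else 1)) < 0"
  by (rule mult_neg_pos, intro mult_pos_pos) (use assms(1,3) order in auto)
 then show ?thesis by (simp add: v mult.assoc)
qed

lemma v_zone: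
 assumes "j < l" "e j < x" "x < e' j"
 shows "v x > 0"
proof -
 have "c < x" "x < pt J 1" using e_above[OF assms(1)] assms by auto
 then have "(c - x) * (\<Prod>j<l. (x - e j) * (x - e' j)) > 0"
  using zone_prod_neg[OF assms] by (simp add: mult_neg_neg)
 then have "(c - x) * (\<Prod>j<l. (x - e j) * (x - e' j)) * ((if rb then pt J 1 - x else 1) * (if lb then x - q0 else 1)) > 0"
  by (rule mult_pos_pos, intro mult_pos_pos) (use \<open>c < x\<close> \<open>x < pt J 1\<close> order in auto)
 then show ?thesis by (simp add: v mult.assoc)
qed

lemma v_far_right:
 assumes rb "pt J 1 < x"
 shows "v x > 0"
proof -
 have "(\<Prod>j<l. (x - e j) * (x - e' j)) > 0" by (rule zone_prod_pos) (use e_above assms in force)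
 then have "(c - x) * (\<Prod>j<l. (x - e j) * (x - e' j)) < 0" using assms pt_J(1) by (simp add: mult_neg_pos)
 then have "(c - x) * (\<Prod>j<l. (x - e j) * (x - e' j)) * (pt J 1 - x) > 0" using assms by (intro mult_neg_neg) auto
 then have "(c - x) * (\<Prod>j<l. (x - e j) * (x - e' j)) * (pt J 1 - x) * (if lb then x - q0 else 1) > 0"
  by (rule mult_pos_pos) (use assms pt_J(1) order in auto)
 then show ?thesis using assms by (simp add: v)
qed

lemma v_zeros: "v c = 0" "j < l ==> v (e j) = 0" "j < l ==> v (e' j) = 0" "rb ==> v (pt J 1) = 0" "lb ==> v q0 = 0"
 by (auto simp: v)

lemma zone_v: "v x * (c - x) < 0 ==> (\<exists>j<l. e j < x & x < e' j) \<or> (rb & pt J 1 < x) \<or> (lb & x < q0)"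
proof (rule ccontr)
 assume neg: "v x * (c - x) < 0" and no: "\<not> ((\<exists>j<l. e j < x & x < e' j) \<or> (rb & pt J 1 < x) \<or> (lb & x < q0))"
 have "v x ~= 0" "x ~= c" using neg by auto
 then consider "x < c" | "c < x" by linarith
 then show False
 proof cases
  case 1
  have "v x > 0" using v_left[of x] no 1 v_zeros(5) \<open>v x ~= 0\<close> by (metis linorder_less_linear)
  then show False using neg 1 by (simp add: mult_less_0_iff)
 next
  case 2
  have "v x < 0"
   using v_right[OF 2] no v_zeros(2,3,4) \<open>v x ~= 0\<close> by (metis linorder_less_linear)
  then show False using neg 2 by (simp add: mult_less_0_iff)
 qed
qed

text \<open>The bumps produce the steps of the level; the small term \<open>\<tau> * v\<close> fixes
  the sign where they vanish.\<close>

definition z :: "real => real => real" where "z \<tau> x = bl x - (\<Sum>j\<in>I. b j x) + \<tau> * v x"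

definition \<Theta> :: "real => real" where "\<Theta> x = BL x - (\<Sum>j\<in>I. Bm j x)"

definition V :: "real => real" where "V x = BL x + (\<Sum>j\<in>I. Bm j x)"

lemma ck_if: "ck_on k S (%x. if rb then pt J 1 - x else 1)" "ck_on k S (%x. if lb then x - q0 else 1)"
 by (cases rb, auto) (cases lb, auto)

lemma ck_z: "ck_on k S (z \<tau>)"
 unfolding z_def[abs_def] v
 by (intro ck_on_add ck_on_diff ck_on_mult ck_on_sum ck_on_prod bl b(1) I(2) ck_on_const ck_on_ident ck_if)

lemma ck_v: "ck_on k S v"
 unfolding v[abs_def] by (intro ck_on_mult ck_on_diff ck_on_prod ck_on_const ck_on_ident ck_if)

lemma bl_v: "bl x ~= 0 ==> v x > 0"
 using v_left[of x] bl(5)[of x] by force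

lemma b_v: "j \<in> I ==> b j x ~= 0 ==> v x < 0"
proof -
 assume j: "j \<in> I" "b j x ~= 0"
 then have jJ: "j <= J" using I by blast
 have "\<not> (x <= pt j 2 \<or> pt j 3 <= x)" using b(4)[OF jJ, of x] j(2) by blast
 then have x: "pt j 2 < x" "x < pt j 3" by auto
 show "v x < 0"
 proof (rule v_right)
  show "c < x" using pt[OF jJ] lo_c[OF jJ] x by linarith
  show "x < e i \<or> e' i < x" if "i < l" for i using pt_zone[of i j] that l jJ x by force
  show "x < pt J 1" if rb using pt_J(3)[of j] j(1) that x by auto
 qed
qed

text \<open>Each bump lives where \<open>v\<close> has the sign with which the bump enters, so the
  two contributions never compete.\<close>

lemma sgn_z: "\<tau> > 0 ==> sgn (z \<tau> x) = sgn (v x)"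
proof -
 assume \<tau>: "\<tau> > 0"
 have s: "(\<Sum>j\<in>I. b j x) >= 0" by (intro sum_nonneg b I(2))
 consider "v x > 0" | "v x = 0" | "v x < 0" by linarith
 then show ?thesis
 proof cases
  case 1
  then have "(\<Sum>j\<in>I. b j x) = 0" using b_v[of _ x] by (intro sum.neutral) force
  then show ?thesis using 1 \<tau> bl(3)[of x] by (simp add: z_def add_nonneg_pos)
 next
  case 2
  then have "(\<Sum>j\<in>I. b j x) = 0" using b_v[of _ x] by (intro sum.neutral) force
  moreover have "bl x = 0" using bl_v[of x] 2 by force
  ultimately show ?thesis using 2 by (simp add: z_def)
 next
  case 3
  then have "bl x = 0" using bl_v[of x] by force
  moreover have "\<tau> * v x < 0" using 3 \<tau> by (simp add: mult_pos_neg)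
  ultimately have "z \<tau> x < 0" using s unfolding z_def by linarith
  then show ?thesis using 3 by simp
 qed
qed

lemma Bm_mono: "j <= J ==> x <= x' ==> Bm j x <= Bm j x'"
proof -
 assume j: "j <= J" and x: "x <= x'"
 have "\<exists>y. (Bm j has_real_derivative y) (at t) & 0 <= y" for t using b(2)[OF j, of t] b(3)[OF j, of t] by blast
 then show ?thesis by (intro DERIV_nonneg_imp_nondecreasing[OF x])
qed

lemma BL_mono: "x <= x' ==> BL x <= BL x'"
proof -
 assume x: "x <= x'"
 have "\<exists>y. (BL has_real_derivative y) (at t) & 0 <= y" for t using bl(2)[of t] bl(3)[of t] by blast
 then show ?thesis by (intro DERIV_nonneg_imp_nondecreasing[OF x])
qed

lemma Bm_bounds:
 assumes "j <= J"
 shows "0 <= Bm j x" "Bm j x <= (if j = J then 2 else 1)"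
proof -
 have "Bm j (min x (pt j 2)) <= Bm j x" "Bm j x <= Bm j (max x (pt j 3))" by (rule Bm_mono[OF assms]; simp)+
 then show "0 <= Bm j x" "Bm j x <= (if j = J then 2 else 1)"
  using b(5)[OF assms, of "min x (pt j 2)"] b(6)[OF assms, of "max x (pt j 3)"] by auto
qed

lemma V_deriv: "(V has_real_derivative bl x + (\<Sum>j\<in>I. b j x)) (at x)"
 unfolding V_def[abs_def] by (intro DERIV_add bl DERIV_sum b I(2))

lemma \<Theta>_deriv: "(\<Theta> has_real_derivative bl x - (\<Sum>j\<in>I. b j x)) (at x)"
 unfolding \<Theta>_def[abs_def] by (intro DERIV_diff bl DERIV_sum b I(2))

lemma V_bounds: "0 <= V x" "V x <= 2 * real J + 3"
proof -
 have "0 <= BL x" "BL x <= real J + 1"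
 proof -
  have "BL (min x q0) <= BL x" "BL x <= BL (max x c)" by (rule BL_mono; simp)+
  then show "0 <= BL x" "BL x <= real J + 1" using bl(6)[of "min x q0"] bl(7)[of "max x c"] by auto
 qed
 moreover have "0 <= (\<Sum>j\<in>I. Bm j x)" by (intro sum_nonneg Bm_bounds I(2))
 moreover have "(\<Sum>j\<in>I. Bm j x) <= real J + 2"
 proof -
  have "(\<Sum>j\<in>I. Bm j x) <= (\<Sum>j\<le>J. Bm j x)" by (rule sum_mono2) (auto intro: Bm_bounds)
  also have "\<dots> <= (\<Sum>j\<le>J. if j = J then 2 else 1)" by (intro sum_mono Bm_bounds) auto
  also have "\<dots> = real J + 2" by (simp add: lessThan_Suc_atMost[symmetric] sum.If_cases Collect_neg_eq)
  finally show ?thesis .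
 qed
 ultimately show "0 <= V x" "V x <= 2 * real J + 3" unfolding V_def by linarith+
qed

lemma pt_mono: "i <= j ==> j <= J ==> pt i 2 <= pt j 2 & pt i 3 <= pt j 3" "i < j ==> j <= J ==> pt i 3 < pt j 2"
 using lo_mono[of i j] pt[of i] pt[of j] by (cases "i = j"; simp)+

lemma \<Theta>_left: "x <= c ==> \<Theta> x = BL x"
proof -
 assume x: "x <= c"
 have "(\<Sum>j\<in>I. Bm j x) = 0"
 proof (rule sum.neutral, rule ballI)
  fix j assume "j \<in> I"
  then have j: "j <= J" by (rule I)
  then show "Bm j x = 0" using b(5)[OF j, of x] pt[OF j] lo_c[OF j] x by auto
 qed
 then show ?thesis by (simp add: \<Theta>_def)
qed

lemma \<Theta>_before: "c <= x ==> j <= J ==> x <= pt j 2 ==> \<Theta> x >= real J + 1 - real j"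
proof -
 assume x: "c <= x" "j <= J" "x <= pt j 2"
 have "(\<Sum>i\<in>I. Bm i x) <= (\<Sum>i\<in>I. if i < j then 1 else 0)"
 proof (rule sum_mono)
  fix i assume "i \<in> I"
  then have i: "i <= J" by (rule I)
  show "Bm i x <= (if i < j then 1 else 0)"
   using Bm_bounds(2)[OF i, of x] b(5)[OF i, of x] pt_mono(1)[of j i] i x by (cases "i < j") auto
 qed
 also have "\<dots> = real (card (I \<inter> {i. i < j}))" by (simp add: sum.If_cases I(1))
 also have "\<dots> <= real (card {..<j})" by (intro of_nat_mono card_mono) auto
 finally show ?thesis using bl(7)[OF x(1)] by (simp add: \<Theta>_def)
qed

text \<open>If \<open>rb\<close>, the step \<open>J\<close> is left out, so at most \<open>J\<close>
  of the \<open>J + 1\<close> units are lost. The right side thus stays above the level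
  \<open>3/4\<close> of \<open>ul (J - 1)\<close>, which will be the barrier.\<close>

lemma \<Theta>_ge_1: "rb ==> c <= x ==> \<Theta> x >= 1"
proof -
 assume x: "rb" "c <= x"
 have "(\<Sum>i\<in>I. Bm i x) <= (\<Sum>i\<in>I. 1)"
 proof (rule sum_mono)
  fix i assume "i \<in> I"
  then show "Bm i x <= 1" using Bm_bounds(2)[of i x] x(1) by simp
 qed
 also have "\<dots> = real J" using x(1) by simp
 finally show ?thesis using bl(7)[OF x(2)] unfolding \<Theta>_def by linarith
qed

lemma \<Theta>_plateau: "j < J ==> pt j 3 <= x ==> x <= pt (Suc j) 2 ==> \<Theta> x = real J - real j"
proof -
 assume x: "j < J" "pt j 3 <= x" "x <= pt (Suc j) 2"
 have "(\<Sum>i\<in>I. Bm i x) = (\<Sum>i\<in>I. if i <= j then 1 else 0)"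
 proof (rule sum.cong[OF refl])
  fix i assume "i \<in> I"
  then have i: "i <= J" by (rule I)
  show "Bm i x = (if i <= j then 1 else 0)"
   using b(5)[OF i, of x] b(6)[OF i, of x] pt_mono(1)[of i j] pt_mono(1)[of "Suc j" i] i x by (cases "i <= j") auto
 qed
 also have "\<dots> = real (card (I \<inter> {i. i <= j}))" by (simp add: sum.If_cases I(1))
 also have "I \<inter> {i. i <= j} = {..j}" using x by auto
 finally have "(\<Sum>i\<in>I. Bm i x) = real j + 1" by simp
 moreover have "c <= x" using x pt[of j] lo_c[of j] by linarith
 ultimately show ?thesis using bl(7)[of x] by (simp add: \<Theta>_def)
qed

text \<open>Because of the height \<open>2\<close> of the last step, the total loss
  \<open>J + 2\<close> exceeds the gain \<open>J + 1\<close> by one unit, which puts the right end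
  below the level of \<open>q0\<close>.\<close>

lemma \<Theta>_end: "\<not> rb ==> pt J 3 <= x ==> \<Theta> x = - 1"
proof -
 assume x: "\<not> rb" "pt J 3 <= x"
 have "Bm i x = (if i = J then 2 else 1)" if "i <= J" for i using b(6)[OF that, of x] pt_mono(1)[of i J] that x by auto
 then have "(\<Sum>i\<in>I. Bm i x) = (\<Sum>i\<le>J. if i = J then 2 else 1)" using x by (auto intro!: sum.cong)
 also have "\<dots> = real J + 2" by (simp add: lessThan_Suc_atMost[symmetric] sum.If_cases Collect_neg_eq)
 finally have "(\<Sum>i\<in>I. Bm i x) = real J + 2" .
 moreover have "c <= x" using x pt[of J] lo_c[of J] by linarith
 ultimately show ?thesis using bl(7)[of x] by (simp add: \<Theta>_def)
qed

end

section \<open>Counting the loops\<close>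

text \<open>The first \<open>l\<close> slots carry sliding loops, the next \<open>M\<close> crossing
  cycles. The smallness conditions leave \<open>\<eta> / 16\<close> as the error of the level
  against the step function, and \<open>steep\<close> makes the level vary faster on the slots than
  on their images.\<close>

locale design = sl: slots c xe h q0 BA A bl BL J l lb rb b Bm v +
  perturbed_pair fm \<phi> m \<rho> R L K U \<Gamma> N0 fp gp x0 \<alpha> C c xe A w w1 v
 for c xe h q0 BA :: real and A bl BL :: "real => real" and J l :: nat and lb rb :: bool and b Bm :: "nat => real => real"
  and v :: "real => real" and fm \<phi> :: "plane => real" and m :: nat and \<rho> R L K :: real and U \<Gamma> N0 :: "plane set"
  and fp gp :: "plane => real" and x0 \<alpha> C :: real and w w1 :: "real => real" +
 fixes M :: nat and \<eta> \<tau> Bv k :: real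
 assumes M: "l + M <= J" and \<eta>: "\<eta> > 0" and \<tau>: "\<tau> > 0" and h: "h < x0"
  and zeta: "\<And>x. \<bar>x\<bar> <= h ==> w1 x - slope fm (%p. \<phi> p * fst p ^ m) \<rho> x (w x) = \<eta> * sl.z \<tau> x"
  and Bv: "\<And>x. \<bar>x\<bar> <= h ==> \<bar>v x\<bar> <= Bv" and \<tau>_small: "\<tau> * Bv * h <= 1 / 64"
  and kappa_small: "3 * (4 * R * L) * (2 * real J + 4) <= 1 / 32"
  and steep: "k > 0" "\<And>x. sl.ul (J - 1) <= x ==> x <= sl.ur 0 ==> k <= bl x" "8 * (\<tau> * Bv * BA) < k"
begin

abbreviation "F \<equiv> slope fm (%p. \<phi> p * fst p ^ m) \<rho>"

lemma h_pos: "h > 0" and Bv_nonneg: "Bv >= 0"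
proof -
 have "c < A c" using sl.A_above[of c] sl.order by simp
 moreover have "A c < h" using sl.A_anti[of xe c] sl.order sl.A_h by simp
 ultimately show "h > 0" using sl.order by linarith
 then show "Bv >= 0" using Bv[of 0] by simp
qed

lemma w_within: "(w has_real_derivative w1 x) (at x within S)"
 using w[of x] has_field_derivative_at_within by blast

lemma w1_on: "continuous_on S w1"
 using w1_cont continuous_on_subset by blast

lemma sub_R: "- x0 < p ==> q < x0 ==> {p..q} \<subseteq> {-R..R}"
 using x0_R by auto

lemma sub_R_h: "- h <= p ==> q <= h ==> {p..q} \<subseteq> {-R..R}"
 using sub_R[of p q] h by auto

lemma H_incr:
 assumes "- x0 < p" "p < q" "q < x0" "\<And>x. p < x ==> x < q ==> v x > 0"
 shows "H p < H q"
proof -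
 have "0 < 1 * (w1 x - F x (w x))" if x: "p < x" "x < q" for x
  using v[of x] assms(4)[OF x] assms(1,3) x sgn_greater[of "w1 x - F x (w x)"] by (auto simp: abs_less_iff)
 from level_slope(2)[OF assms(2) sub_R[OF assms(1,3)] w_within w1_on _ _ less_imp_le[OF this] this]
 show ?thesis by (simp add: H_def)
qed

lemma H_decr:
 assumes "- x0 < p" "p < q" "q < x0" "\<And>x. p < x ==> x < q ==> v x < 0"
 shows "H q < H p"
proof -
 have "0 < - 1 * (w1 x - F x (w x))" if x: "p < x" "x < q" for x
  using v[of x] assms(4)[OF x] assms(1,3) x sgn_less[of "w1 x - F x (w x)"] by (auto simp: abs_less_iff)
 from level_slope(2)[OF assms(2) sub_R[OF assms(1,3)] w_within w1_on _ _ less_imp_le[OF this] this]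
 show ?thesis by (simp add: H_def)
qed

lemma H_cont: "continuous_on {p..q} H" if "- x0 < p" "q < x0" for p q
proof -
 have "continuous_on {p..q} (%x. (x, w x))" by (intro continuous_intros DERIV_continuous_on[OF w_within])
 from continuous_on_compose2[OF ht_continuous_on this] sub_R[OF that] show ?thesis
  unfolding H_def[abs_def] by (auto simp: image_subset_iff)
qed

lemma z_bound: "\<bar>x\<bar> <= h ==> \<bar>\<eta> * sl.z \<tau> x\<bar> <= \<eta> * (bl x + (\<Sum>j\<in>sl.I. b j x) + \<tau> * Bv)"
proof -
 assume x: "\<bar>x\<bar> <= h"
 have s: "(\<Sum>j\<in>sl.I. b j x) >= 0" by (intro sum_nonneg sl.b sl.I(2))
 have "\<bar>\<tau> * v x\<bar> <= \<tau> * Bv" unfolding abs_mult using \<tau> Bv[OF x] by (simp add: mult_left_mono)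
 then have "\<bar>sl.z \<tau> x\<bar> <= bl x + (\<Sum>j\<in>sl.I. b j x) + \<tau> * Bv"
  using s sl.bl(3)[of x] unfolding sl.z_def by linarith
 then show ?thesis using \<eta> by (simp add: abs_mult)
qed

text \<open>Half of the error, \<open>\<eta> / 32\<close>, comes from \<open>level_bound\<close>
  with a total variation of at most \<open>\<eta> * (2 * real J + 4)\<close>, the other half from
  the term \<open>\<tau> * v\<close>.\<close>

lemma H_step:
 assumes "- h <= p" "p <= h" "- h <= q" "q <= h"
 shows "\<bar>(H q - H p) - \<eta> * (sl.\<Theta> q - sl.\<Theta> p)\<bar> <= \<eta> / 16"
proof -
 have *: "\<bar>(H q - H p) - \<eta> * (sl.\<Theta> q - sl.\<Theta> p)\<bar> <= \<eta> / 16" if pq: "- h <= p" "p <= q" "q <= h" for p q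
 proof -
  have in_h: "\<bar>x\<bar> <= h" if "x \<in> {p..q}" for x using that pq by auto
  have "continuous_on UNIV v" using sl.ck_v[of 0 UNIV] by simp
  then obtain Q where Q: "\<And>x. (Q has_real_derivative v x) (at x)" "Q 0 = 0"
   using antiderivative_real_line by blast
  define W where "W x = \<eta> * (sl.\<Theta> x + \<tau> * Q x)" for x
  define V where "V x = \<eta> * (sl.V x + \<tau> * Bv * x)" for x
  have "(W has_real_derivative \<eta> * ((bl x - (\<Sum>j\<in>sl.I. b j x)) + \<tau> * v x)) (at x)" for x
   unfolding W_def[abs_def] by (intro DERIV_cmult DERIV_add sl.\<Theta>_deriv Q)
  then have W: "(W has_real_derivative w1 x - F x (w x)) (at x within {p..q})" if "x \<in> {p..q}" for x
   using zeta[OF in_h[OF that]] has_field_derivative_at_within by (fastforce simp: sl.z_def)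
  have "(V has_real_derivative \<eta> * ((bl x + (\<Sum>j\<in>sl.I. b j x)) + \<tau> * Bv * 1)) (at x)" for x
   unfolding V_def[abs_def] by (intro DERIV_cmult DERIV_add sl.V_deriv DERIV_ident)
  then have V: "(V has_real_derivative \<eta> * (bl x + (\<Sum>j\<in>sl.I. b j x) + \<tau> * Bv)) (at x within {p..q})" for x
   using has_field_derivative_at_within by fastforce
  have "\<bar>(H q - H p) - (W q - W p)\<bar> <= 3 * (4 * R * L) * (V q - V p)"
   unfolding H_def
   by (rule level_bound[OF pq(2) sub_R_h[OF pq(1,3)] w_within W V]) (use zeta z_bound in_h in auto)
  moreover have "3 * (4 * R * L) * (V q - V p) <= \<eta> * (1 / 32)"
  proof -
   have "\<tau> * Bv * (q - p) <= \<tau> * Bv * (2 * h)" using pq \<tau> Bv_nonneg by (intro mult_left_mono) auto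
   then have "sl.V q - sl.V p + \<tau> * Bv * (q - p) <= 2 * real J + 4"
    using sl.V_bounds(2)[of q] sl.V_bounds(1)[of p] \<tau>_small by linarith
   then have "V q - V p <= \<eta> * (2 * real J + 4)"
    using \<eta> mult_left_mono[of _ _ \<eta>] unfolding V_def by (fastforce simp: algebra_simps)
   then have "3 * (4 * R * L) * (V q - V p) <= 3 * (4 * R * L) * (\<eta> * (2 * real J + 4))"
    using R_pos L_nonneg by (intro mult_left_mono) auto
   also have "\<dots> = \<eta> * (3 * (4 * R * L) * (2 * real J + 4))" by simp
   also have "\<dots> <= \<eta> * (1 / 32)" using kappa_small \<eta> by (intro mult_left_mono) auto
   finally show ?thesis .
  qed
  moreover have "\<bar>(W q - W p) - \<eta> * (sl.\<Theta> q - sl.\<Theta> p)\<bar> <= \<eta> * (1 / 32)"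
  proof -
   have "\<bar>Q q - Q p\<bar> <= Bv * \<bar>q - p\<bar>"
    by (rule deriv_within_diff_bound[where F = Q and F' = v and p = p and q = q])
     (use has_field_derivative_at_within[OF Q(1)] Bv in_h pq in auto)
   also have "\<dots> <= Bv * (2 * h)" using pq Bv_nonneg by (intro mult_left_mono) auto
   finally have "\<tau> * \<bar>Q q - Q p\<bar> <= \<tau> * (Bv * (2 * h))" using \<tau> by (intro mult_left_mono) auto
   also have "\<dots> <= 1 / 32" using \<tau>_small by simp
   finally have "\<eta> * (\<tau> * \<bar>Q q - Q p\<bar>) <= \<eta> * (1 / 32)" using \<eta> by (intro mult_left_mono) auto
   moreover have "(W q - W p) - \<eta> * (sl.\<Theta> q - sl.\<Theta> p) = \<eta> * (\<tau> * (Q q - Q p))" by (simp add: W_def algebra_simps)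
   ultimately show ?thesis using \<eta> \<tau> by (simp add: abs_mult)
  qed
  ultimately show ?thesis by linarith
 qed
 show ?thesis
 proof (cases "p <= q")
  case False
  have "(H q - H p) - \<eta> * (sl.\<Theta> q - sl.\<Theta> p) = - ((H p - H q) - \<eta> * (sl.\<Theta> p - sl.\<Theta> q))" by (simp add: algebra_simps)
  then have "\<bar>(H q - H p) - \<eta> * (sl.\<Theta> q - sl.\<Theta> p)\<bar> = \<bar>(H p - H q) - \<eta> * (sl.\<Theta> p - sl.\<Theta> q)\<bar>" by linarith
  then show ?thesis using *[of q p] assms False by simp
 qed (use * assms in auto)
qed

text \<open>A quarter unit of \<Theta> beats the error of a sixteenth.\<close>

lemma H_less_step:
 assumes "- h <= p" "p <= h" "- h <= q" "q <= h" "sl.\<Theta> q + 1/4 <= sl.\<Theta> p"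
 shows "H q < H p"
proof -
 have "\<eta> * (sl.\<Theta> q - sl.\<Theta> p) <= \<eta> * (- 1/4)" using assms(5) \<eta> by (intro mult_left_mono) auto
 with H_step[OF assms(1-4)] \<eta> show ?thesis by linarith
qed

lemma slotF:
 assumes "j < J"
 shows "xe < sl.ul j" "sl.ul j < sl.ur j" "sl.ur j < c" "q0 < sl.ul j" "c < sl.pt j 2" "sl.pt j 2 < sl.pt j 3" "sl.pt j 3 < sl.e j"
  "sl.e j < A (sl.ur j)" "A (sl.ur j) < A (sl.ul j)" "A (sl.ul j) < sl.e' j" "sl.e' j < sl.pt (Suc j) 2" "sl.e' j < h"
  "A (sl.ul j) < sl.pt J 1" "- h < xe" "c < h"
proof -
 note z = sl.zone_order[OF assms] sl.slot[OF assms]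
 show "xe < sl.ul j" "sl.ul j < sl.ur j" "sl.ur j < c" "q0 < sl.ul j" "c < sl.pt j 2" "sl.pt j 2 < sl.pt j 3" "sl.pt j 3 < sl.e j"
  "sl.e j < A (sl.ur j)" "A (sl.ur j) < A (sl.ul j)" "A (sl.ul j) < sl.e' j" "sl.e' j < sl.pt (Suc j) 2" "- h < xe"
  using z sl.order by auto
 show "sl.e' j < h" using z sl.hi_bound(2) by linarith
 then show "c < h" using z by linarith
 show "A (sl.ul j) < sl.pt J 1"
 proof (cases "Suc j = J")
  case True
  then show ?thesis using sl.pt(1)[of J] by (auto simp: sl.lo_def)
 next
  case False
  then have "sl.hi (Suc j) < sl.lo J" using sl.lo_mono[of "Suc j" J] assms by simp
  then show ?thesis using z sl.pt[of J] sl.pt[of "Suc j"] assms by (simp add: sl.e'_def)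
 qed
qed

lemma \<Theta>_slot:
 assumes "j < J"
 shows "sl.\<Theta> (sl.ul j) = real J - real j - 1/4" "sl.\<Theta> (sl.ur j) = real J - real j + 1/4"
  "sl.pt j 3 <= y ==> y <= sl.e' j ==> sl.\<Theta> y = real J - real j"
 using sl.\<Theta>_left[of "sl.ul j"] sl.\<Theta>_left[of "sl.ur j"] sl.slot[OF assms] slotF[OF assms]
  sl.\<Theta>_plateau[OF assms, of y] by auto

text \<open>The points between \<open>c\<close> and \<open>y\<close> have higher level than
  \<open>y\<close>: before step \<open>j\<close> by a full unit of \<Theta>, from
  \<open>pt j 2\<close> on because \<open>v < 0\<close> there. The latter fails in zone
  \<open>j\<close> if \<open>j < l\<close>, hence the alternative for \<open>y\<close>.\<close>

lemma descend:
 assumes j: "j < J" and y: "sl.pt j 3 <= y" "y <= sl.e j \<or> l <= j & y <= A (sl.ul j)" and x: "c <= x" "x < y"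
 shows "H y < H x"
proof -
 note f = slotF[OF j]
 have yb: "y <= A (sl.ul j)" "y < h" "y <= sl.e' j" using y(2) f by linarith+
 show ?thesis
 proof (cases "x < sl.pt j 2")
  case True
  have "sl.\<Theta> y = real J - real j" using \<Theta>_slot(3)[OF j y(1)] yb by simp
  moreover have "sl.\<Theta> x >= real J + 1 - real j" using sl.\<Theta>_before[OF x(1), of j] True j by simp
  ultimately show ?thesis using x y yb f by (intro H_less_step) auto
 next
  case False
  show ?thesis
  proof (rule H_decr)
   show "- x0 < x" "x < y" "y < x0" using x c_bd yb h by auto
   fix t assume t: "x < t" "t < y"
   show "v t < 0"
   proof (rule sl.v_right)
    show "c < t" using t x by simp
    show "t < sl.pt J 1" using t yb f by linarith
    show "t < sl.e i \<or> sl.e' i < t" if i: "i < l" for i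
    proof (cases i j rule: linorder_cases)
     case less
     have "sl.pt (Suc i) 2 <= sl.pt j 2" using sl.pt_mono(1)[of "Suc i" j] less j by simp
     moreover have "sl.e' i < sl.pt (Suc i) 2" using sl.zone_order(7)[of i] less j by simp
     ultimately have "sl.e' i < sl.pt j 2" by linarith
     then show ?thesis using False t by auto
    next
     case equal
     then show ?thesis using y(2) t i by auto
    next
     case greater
     have "y <= sl.e j" using y(2) greater i by auto
     moreover have "sl.e' j < sl.e i" using sl.zone_sep[OF greater] i sl.l by auto
     ultimately show ?thesis using f t by linarith
    qed
   qed
  qed
 qed
qed

lemma H_left: "- x0 < x ==> (lb ==> q0 <= x) ==> x < x' ==> x' <= c ==> H x < H x'"
 by (rule H_incr) (use c_bd in \<open>auto intro!: sl.v_left\<close>)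

text \<open>All bumps vanish on the image of a slot, so the level is flat there up to the term
  \<open>\<tau> * v\<close>; this is the source of the contraction.\<close>

lemma z_right:
 assumes "j < J" "A (sl.ur j) <= y" "y <= A (sl.ul j)"
 shows "sl.z \<tau> y = \<tau> * v y"
proof -
 note f = slotF[OF assms(1)]
 have "b i y = 0" if "i \<in> sl.I" for i
 proof (rule sl.b(4))
  show i: "i <= J" using that sl.I by blast
  show "y <= sl.pt i 2 \<or> sl.pt i 3 <= y"
  proof (cases "i <= j")
   case True
   then have "sl.pt i 3 <= sl.pt j 3" using sl.pt_mono(1)[of i j] assms by simp
   then show ?thesis using f assms by linarith
  next
   case False
   then have "sl.pt (Suc j) 2 <= sl.pt i 2" using sl.pt_mono(1)[of "Suc j" i] i by simp
   then show ?thesis using f assms by linarith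
  qed
 qed
 moreover have "bl y = 0" using sl.bl(5)[of y] f assms by auto
 ultimately show ?thesis by (simp add: sl.z_def)
qed

text \<open>On the slot the level has slope at least \<open>\<eta> * k / 4\<close>. On its image the
  slope is at most \<open>2 * \<eta> * \<tau> * Bv\<close>, and \<open>A\<close> stretches by at
  most \<open>BA\<close>, so \<open>8 * (\<tau> * Bv * BA) < k\<close> decides.\<close>

lemma contraction:
 assumes j: "j < J" and x: "sl.ul j <= x" "x < x'" "x' <= sl.ur j"
 shows "\<bar>H (A x) - H (A x')\<bar> < \<bar>H x - H x'\<bar>"
proof -
 note f = slotF[OF j]
 have steep': "\<eta> * k <= 1 * (w1 t - F t (w t))" if t: "x < t" "t < x'" for t
 proof -
  have th: "\<bar>t\<bar> <= h" "t < c" "q0 < t" using t x f by auto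
  have J1: "j <= J - 1" "J - 1 < J" "0 < J" using j by auto
  have "sl.ul (J - 1) <= sl.ul j"
  proof (cases "j = J - 1")
   case False
   then have "real j < real (J - 1)" using J1 by linarith
   then show ?thesis using sl.u_less[of "real j + 5/4" "real (J - 1) + 5/4"] J1(3) unfolding sl.ul_def by linarith
  qed simp
  moreover have "sl.ur j <= sl.ur 0"
  proof (cases "j = 0")
   case False
   then show ?thesis using sl.u_less[of "3/4" "real j + 3/4"] j by (auto simp: sl.ur_def)
  qed simp
  ultimately have "k <= bl t" using t x by (intro steep(2)) auto
  moreover have "(\<Sum>j\<in>sl.I. b j t) = 0"
  proof (rule sum.neutral, rule ballI)
   fix i assume "i \<in> sl.I"
   then have i: "i <= J" using sl.I by blast
   then show "b i t = 0" using sl.b(4)[OF i, of t] sl.pt[OF i] sl.lo_c[OF i] th by auto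
  qed
  moreover have "v t > 0" using th by (intro sl.v_left) auto
  then have "\<tau> * v t > 0" using \<tau> by simp
  ultimately have "k <= sl.z \<tau> t" by (simp add: sl.z_def)
  then show ?thesis unfolding zeta[OF th(1)] mult_1 using \<eta> by (intro mult_left_mono) auto
 qed
 have "\<eta> * k / 4 * (x' - x) <= 1 * (H x' - H x)"
  unfolding H_def by (rule level_slope(1)[OF x(2) sub_R_h w_within w1_on _ _ steep']) (use x f \<eta> steep(1) in auto)
 moreover have "\<bar>H (A x) - H (A x')\<bar> <= 2 * (\<eta> * \<tau> * Bv * A x - \<eta> * \<tau> * Bv * A x')"
  unfolding H_def
 proof (rule level_bound'[OF _ _ w_within w1_on, where V = "%y. \<eta> * \<tau> * Bv * y" and v = "%y. \<eta> * \<tau> * Bv"])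
  have AA: "A x' < A x" "A (sl.ur j) <= A x'" "A x <= A (sl.ul j)"
   using sl.A_anti[of x x'] sl.A_anti[of x' "sl.ur j"] sl.A_anti[of "sl.ul j" x] x f
   by (auto simp: le_less)
  show "A x' <= A x" using AA by simp
  show "{A x'..A x} \<subseteq> {-R..R}" by (rule sub_R_h) (use AA f in auto)
  fix y assume y: "y \<in> {A x'..A x}"
  show "((%y. \<eta> * \<tau> * Bv * y) has_real_derivative \<eta> * \<tau> * Bv) (at y within {A x'..A x})"
   by (auto intro!: derivative_eq_intros)
  have yh: "\<bar>y\<bar> <= h" using y AA f by auto
  have "\<bar>\<eta> * (\<tau> * v y)\<bar> <= \<eta> * (\<tau> * Bv)"
   unfolding abs_mult using \<eta> \<tau> Bv[OF yh] by (simp add: mult_left_mono)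
  moreover have "sl.z \<tau> y = \<tau> * v y" using y AA by (intro z_right[OF j]) auto
  ultimately show "\<bar>w1 y - F y (w y)\<bar> <= \<eta> * \<tau> * Bv" unfolding zeta[OF yh] by (simp add: mult.assoc)
 qed
 moreover have "2 * (\<eta> * \<tau> * Bv * A x - \<eta> * \<tau> * Bv * A x') < \<eta> * k / 4 * (x' - x)"
 proof -
  have "\<bar>A x - A x'\<bar> <= BA * \<bar>x - x'\<bar>" using x f by (intro sl.A_lip) auto
  then have "A x - A x' <= BA * (x' - x)" using x by simp
  then have "(2 * \<eta> * \<tau> * Bv) * (A x - A x') <= (2 * \<eta> * \<tau> * Bv) * (BA * (x' - x))"
   using \<eta> \<tau> Bv_nonneg by (intro mult_left_mono) auto
  also have "\<dots> = \<eta> / 4 * (x' - x) * (8 * (\<tau> * Bv * BA))" by simp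
  also have "\<dots> < \<eta> / 4 * (x' - x) * k" using steep(3) \<eta> x by (intro mult_strict_left_mono mult_pos_pos) auto
  finally show ?thesis by (simp add: algebra_simps)
 qed
 ultimately show ?thesis unfolding mult_1 by linarith
qed

lemma A_cont: "xe <= p ==> q <= c ==> continuous_on {p..q} A"
 unfolding continuous_on_iff
proof (intro ballI allI impI)
 fix x d assume a: "xe <= p" "q <= c" "x \<in> {p..q}" "(0::real) < d"
 show "\<exists>d'>0. \<forall>x'\<in>{p..q}. dist x' x < d' --> dist (A x') (A x) < d"
 proof (intro exI[of _ "d / BA"] conjI ballI impI)
  show "0 < d / BA" using a sl.BA by simp
  fix x' assume x': "x' \<in> {p..q}" "dist x' x < d / BA"
  have "\<bar>A x' - A x\<bar> <= BA * \<bar>x' - x\<bar>" using a x' by (intro sl.A_lip) auto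
  also have "\<dots> < d" using x'(2) sl.BA by (simp add: dist_real_def field_simps)
  finally show "dist (A x') (A x) < d" by (simp add: dist_real_def)
 qed
qed

text \<open>The image of slot \<open>j\<close> lies on the plateau \<open>J - j\<close>, while on
  the slot \<Theta> runs from a quarter unit below to a quarter unit above that level.\<close>

lemma crossing_slot:
 assumes j: "l <= j" "j < J" and N: "\<And>x. xe <= x ==> x <= c ==> UA x \<subseteq> interior N0"
  "\<And>p q. - h <= q ==> q < p ==> p <= h ==> LA p q \<subseteq> interior N0"
 obtains x where "sl.ul j < x" "x < sl.ur j" "H x = H (A x)" "crossing_limit_cycle U Xp Xm (UA x \<union> LA (A x) x)"
  "(x, 0) \<in> UA x"
proof (rule crossing_cycle[of "sl.ul j" "sl.ur j"])
 note f = slotF[OF j(2)]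
 have AA: "A (sl.ur j) <= A x" "A x <= A (sl.ul j)" if "x \<in> {sl.ul j..sl.ur j}" for x
  using sl.A_anti[of x "sl.ur j"] sl.A_anti[of "sl.ul j" x] that f by (auto simp: le_less)
 show "xe <= sl.ul j" "sl.ul j < sl.ur j" "sl.ur j < c" "A (sl.ul j) < x0" using f h by auto
 show "v x > 0" if "sl.ul j <= x" "x <= sl.ur j" for x using that f by (intro sl.v_left) auto
 show "v y < 0" if "A (sl.ur j) <= y" "y <= A (sl.ul j)" for y
 proof (rule sl.v_right)
  show "y < sl.e i \<or> sl.e' i < y" if "i < l" for i
   using sl.zone_sep[of i j] that j f \<open>A (sl.ur j) <= y\<close> by auto
 qed (use that f in auto)
 have Th: "sl.\<Theta> (A x) = real J - real j" if "x \<in> {sl.ul j..sl.ur j}" for x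
  using AA[OF that] f by (intro \<Theta>_slot(3)[OF j(2)]) auto
 show "H (A (sl.ur j)) < H (sl.ur j)"
  using Th[of "sl.ur j"] \<Theta>_slot(2)[OF j(2)] f by (intro H_less_step) auto
 show "H (sl.ul j) < H (A (sl.ul j))"
  using Th[of "sl.ul j"] \<Theta>_slot(1)[OF j(2)] f by (intro H_less_step) auto
 have cA: "continuous_on {sl.ul j..sl.ur j} A" using f by (intro A_cont) auto
 have "continuous_on {sl.ul j..sl.ur j} (%x. H (A x))"
  by (rule continuous_on_compose2[OF H_cont[of "A (sl.ur j)" "A (sl.ul j)"] cA]) (use AA f h c_bd in \<open>auto simp: image_subset_iff\<close>)
 moreover have "continuous_on {sl.ul j..sl.ur j} H" using f h c_bd by (intro H_cont) auto
 ultimately show "continuous_on {sl.ul j..sl.ur j} (%x. H x - H (A x))" by (intro continuous_intros)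
 show "\<bar>H (A x) - H (A x')\<bar> < \<bar>H x - H x'\<bar>" if "x \<in> {sl.ul j..sl.ur j}" "x' \<in> {sl.ul j..sl.ur j}" "x ~= x'" for x x'
  using contraction[OF j(2), of x x'] contraction[OF j(2), of x' x] that
  by (cases "x < x'") (auto simp: abs_minus_commute)
 show "H x < H x'" if "sl.ul j <= x" "x < x'" "x' <= c" for x x'
  using that f h by (intro H_left) auto
 show "H y < H x" if "A (sl.ur j) <= y" "y <= A (sl.ul j)" "c <= x" "x < y" for x y
  using that f j by (intro descend[OF j(2)]) auto
 show "UA x \<union> LA (A x) x \<subseteq> interior N0" if "x \<in> {sl.ul j..sl.ur j}" for x
  using N(1)[of x] N(2)[of x "A x"] AA[OF that] that f by auto
qed (rule that)

text \<open>The left end of the lower arc that starts at the tangent point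
  \<open>e j\<close>.\<close>

definition xs :: "nat => real" where
 "xs j = (SOME x. sl.ul j < x & x < sl.ur j & H x = H (sl.e j))"

lemma xs:
 assumes j: "j < J"
 shows "sl.ul j < xs j" "xs j < sl.ur j" "H (xs j) = H (sl.e j)"
proof -
 note f = slotF[OF j]
 have T: "sl.\<Theta> (sl.e j) = real J - real j" using f by (intro \<Theta>_slot(3)[OF j]) auto
 have lt: "H (sl.ul j) < H (sl.e j)" "H (sl.e j) < H (sl.ur j)"
  using T \<Theta>_slot(1,2)[OF j] f by (intro H_less_step; simp)+
 have "\<exists>x\<ge>sl.ul j. x <= sl.ur j & H x = H (sl.e j)"
  using lt f h c_bd by (intro IVT' H_cont) auto
 then obtain x where x: "sl.ul j <= x" "x <= sl.ur j" "H x = H (sl.e j)" by blast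
 then have "sl.ul j < x & x < sl.ur j & H x = H (sl.e j)" using lt by (auto simp: less_le)
 from someI[of "%x. sl.ul j < x & x < sl.ur j & H x = H (sl.e j)", OF this]
 show "sl.ul j < xs j" "xs j < sl.ur j" "H (xs j) = H (sl.e j)" by (auto simp: xs_def)
qed

definition em :: real where "em = (if lb then q0 else - x0)"
definition ep :: real where "ep = (if rb then sl.pt J 1 else x0)"

lemma sliding: "sliding_design U Xp Xm N0 x0 c xe A H v UA LA l sl.e sl.e' xs em ep"
proof unfold_locales
 have lJ: "j < J" if "j < l" for j using that sl.l by simp
 show "c < sl.e j & sl.e j < sl.e' j & sl.e' j < x0" if "j < l" for j using slotF[OF lJ[OF that]] h by auto
 show "sl.e' i < sl.e j" if "i < j" "j < l" for i j using sl.zone_sep that lJ by auto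
 show "v (sl.e j) = 0 & v (sl.e' j) = 0" if "j < l" for j using sl.v_zeros that by auto
 show "v x > 0" if "j < l" "sl.e j < x" "x < sl.e' j" for j x using sl.v_zone that by blast
 show "em < c" using sl.order c_bd by (auto simp: em_def)
 show "v em = 0" if "- x0 < em" using that sl.v_zeros(5) by (auto simp: em_def split: if_splits)
 show "c < ep" using sl.pt_J(1) c_bd by (auto simp: ep_def)
 show "v ep = 0" if "ep < x0" using that sl.v_zeros(4) by (auto simp: ep_def split: if_splits)
 show "(\<exists>j<l. sl.e j < x & x < sl.e' j) \<or> ep < x \<or> x < em" if "\<bar>x\<bar> < x0" "v x * (c - x) < 0" for x
  using sl.zone_v[OF that(2)] by (auto simp: em_def ep_def)
 show "H x < H x'" if "- x0 < x" "em <= x" "x < x'" "x' <= c" for x x'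
  using that unfolding em_def by (intro H_left) auto
 show "H x' < H x" if "- x0 < x" "x < x'" "x' <= em" for x x'
  using that sl.order c_bd by (intro H_decr) (auto simp: em_def split: if_splits intro!: sl.v_far_left)
 show "H x < H x'" if "j < l" "sl.e j <= x" "x < x'" "x' <= sl.e' j" for j x x'
  using that slotF[OF lJ[OF that(1)]] h c_bd by (intro H_incr) (auto intro!: sl.v_zone[of j])
 show far_right: "H x < H x'" if "ep <= x" "x < x'" "x' < x0" for x x'
  using that sl.pt_J(1) c_bd by (intro H_incr) (auto simp: ep_def split: if_splits intro!: sl.v_far_right)
 show "xe <= xs j & em < xs j & xs j < c & H (xs j) = H (sl.e j)" if "j < l" for j
  using xs[OF lJ[OF that]] slotF[OF lJ[OF that]] xe by (auto simp: em_def)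
 show "H (sl.e j) < H x" if "j < l" "xs j < x" "x < sl.e j" for j x
 proof (cases "x <= c")
  case True
  have "H (xs j) < H x" using xs[OF lJ[OF that(1)]] slotF[OF lJ[OF that(1)]] xe True that by (intro H_left) auto
  then show ?thesis using xs(3)[OF lJ[OF that(1)]] by simp
 next
  case False
  then show ?thesis using that slotF[OF lJ[OF that(1)]] by (intro descend[OF lJ[OF that(1)]]) auto
 qed
 show "sl.e j < A (xs j) & A (xs j) < sl.e' j" if "j < l" for j
  using xs[OF lJ[OF that]] slotF[OF lJ[OF that]] sl.A_anti[of "sl.ul j" "xs j"] sl.A_anti[of "xs j" "sl.ur j"] by auto
 have J1: "J - 1 < J" using sl.J by simp
 note f = slotF[OF J1]
 show "(\<exists>B. em < B & - x0 < B & B <= c & A B < ep & (\<forall>p. c < p & p < x0 --> H B < H p)) \<or>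
   (x0 <= ep & - x0 < em & (\<forall>j<l. sl.e' j < A em) \<and>
    (\<forall>y. A em <= y & y < x0 --> H y < H em & (\<forall>x. c <= x & x < y --> H y < H x))) \<or>
   (x0 <= ep & em <= - x0)"
 proof (cases rb)
  case True
  \<comment> \<open>The barrier against the right outer region: \<Theta> is \<open>3/4\<close> here
    and at least \<open>1\<close> on the right up to \<open>h\<close>; from \<open>ep\<close> on the
    level increases.\<close>
  let ?B = "sl.ul (J - 1)"
  have hp: "H ?B < H p" if "c < p" "p <= h" for p
  proof (rule H_less_step)
   show "sl.\<Theta> ?B + 1/4 <= sl.\<Theta> p"
    using \<Theta>_slot(1)[OF J1] sl.\<Theta>_ge_1[OF True, of p] that sl.J by (simp add: of_nat_diff)
  qed (use f that in auto)
  have eph: "c < ep" "ep < h" "ep = sl.pt J 1" using sl.pt_J(1,2) sl.hi_bound(2) True unfolding ep_def by auto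
  have "H ?B < H p" if "c < p" "p < x0" for p
  proof (cases "p <= h")
   case False
   then have "H ep < H p" using far_right[of ep p] eph that by auto
   then show ?thesis using hp[of ep] eph by simp
  qed (use hp that in auto)
  moreover have "em < ?B & - x0 < ?B & ?B <= c & A ?B < ep"
   using f xe eph by (auto simp: em_def)
  ultimately show ?thesis by blast
 next
  case False
  then have ep: "ep = x0" unfolding ep_def by simp
  show ?thesis
  proof (cases lb)
   case True
   then have em: "em = q0" unfolding em_def by simp
   have q: "- x0 < q0" "- h < q0" "q0 < c" "xe < q0" using sl.order h by auto
   have Aq: "A q0 < h" "sl.pt J 3 < A q0" "sl.pt J 2 < sl.pt J 3" "c < sl.pt J 2"
    using sl.hi_bound(2) sl.hi_bound(1)[of J] sl.pt[of J] sl.lo_c[of J] by auto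
   have e'l: "sl.e' j < A q0 & sl.e' j < sl.pt J 2" if "j < l" for j using sl.e_above[OF that] sl.pt[of J] by auto
   have vr: "v t < 0" if "sl.pt J 2 < t" for t
    by (rule sl.v_right) (use that Aq e'l False in \<open>force+\<close>)
   have dec: "H y < H x" if "sl.pt J 2 <= x" "x < y" "y < x0" for x y
    using that Aq c_bd by (intro H_decr vr) auto
   have low: "H y <= H (A q0)" if "A q0 <= y" "y < x0" for y
    using dec[of "A q0" y] that Aq by (cases "y = A q0") auto
   \<comment> \<open>The level ends one unit below that of \<open>q0\<close> and decreases from
     there on, so no lower arc can start at or right of \<open>A q0\<close>.\<close>
   have TA: "sl.\<Theta> (A q0) = - 1" using sl.\<Theta>_end[OF False, of "A q0"] Aq by simp
   have "H (A q0) < H q0"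
   proof (rule H_less_step)
    show "sl.\<Theta> (A q0) + 1/4 <= sl.\<Theta> q0" using TA sl.\<Theta>_left[of q0] sl.bl(6)[of q0] q by simp
   qed (use q Aq in auto)
   moreover have "H y < H x" if "A q0 <= y" "y < x0" "c <= x" "x < y" for x y
   proof (cases "sl.pt J 2 <= x")
    case 2: False
    have "H (A q0) < H x"
    proof (rule H_less_step)
     show "sl.\<Theta> (A q0) + 1/4 <= sl.\<Theta> x" using TA sl.\<Theta>_before[OF that(3), of J] 2 by simp
    qed (use that 2 q Aq in auto)
    then show ?thesis using low[of y] that by simp
   qed (use dec that in auto)
   ultimately show ?thesis using ep em q e'l low by fastforce
  next
   case 2: False
   then show ?thesis using ep unfolding em_def by simp
  qed
 qed
qed

lemma counts:
 assumes N: "N \<subseteq> N0" "\<And>x. xe <= x ==> x <= c ==> UA x \<subseteq> interior N"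
  "\<And>p q. - h <= q ==> q < p ==> p <= h ==> LA p q \<subseteq> interior N" "\<And>x. \<bar>x\<bar> <= h ==> (x, 0) \<in> N"
 shows "beta_s U Xp Xm N = enat l" "enat M <= beta_c U Xp Xm N"
proof -
 have NN: "interior N \<subseteq> N" "interior N \<subseteq> interior N0" using interior_subset interior_mono[OF N(1)] by auto
 interpret sd: sliding_design U Xp Xm N0 x0 c xe A H v UA LA l sl.e sl.e' xs em ep by (rule sliding)
 show "beta_s U Xp Xm N = enat l"
 proof (rule sd.beta_s_eq[OF N(1)])
  fix j assume "j < l"
  then have j: "j < J" using sl.l by simp
  note f = slotF[OF j] and X = xs[OF j]
  have AX: "A (xs j) < A (sl.ul j)" using sl.A_anti[of "sl.ul j" "xs j"] X f by auto
  have "UA (xs j) \<subseteq> N" using N(2)[of "xs j"] NN X f by auto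
  moreover have "LA (sl.e j) (xs j) \<subseteq> N" using N(3)[of "xs j" "sl.e j"] NN X f by auto
  moreover have "{sl.e j..A (xs j)} \<times> {0} \<subseteq> N" using N(4) AX f by force
  ultimately show "sd.slide_loop j \<subseteq> N" by (auto simp: sd.slide_loop_def)
 qed
 have "\<forall>j\<in>{l..<l + M}. \<exists>x. sl.ul j < x & x < sl.ur j & H x = H (A x) \<and>
   crossing_limit_cycle U Xp Xm (UA x \<union> LA (A x) x) & (x, 0) \<in> UA x"
 proof
  fix j assume "j \<in> {l..<l + M}"
  then have j: "l <= j" "j < J" using M by auto
  obtain x where "sl.ul j < x" "x < sl.ur j" "H x = H (A x)" "crossing_limit_cycle U Xp Xm (UA x \<union> LA (A x) x)" "(x, 0) \<in> UA x"
   by (rule crossing_slot[OF j]) (use N(2,3) NN that in blast)+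
  then show "\<exists>x. sl.ul j < x & x < sl.ur j & H x = H (A x) \<and>
   crossing_limit_cycle U Xp Xm (UA x \<union> LA (A x) x) & (x, 0) \<in> UA x" by blast
 qed
 from bchoice[OF this] obtain X where X: "\<forall>j\<in>{l..<l + M}. sl.ul j < X j & X j < sl.ur j & H (X j) = H (A (X j)) \<and>
   crossing_limit_cycle U Xp Xm (UA (X j) \<union> LA (A (X j)) (X j)) & (X j, 0) \<in> UA (X j)" by blast
 define cyc where "cyc j = UA (X j) \<union> LA (A (X j)) (X j)" for j
 have XF: "j < J" "sl.ul j < X j" "X j < sl.ur j" "xe <= X j" "X j < c" "H (X j) = H (A (X j))" "c < A (X j)" "A (X j) < A (sl.ul j)" "A (sl.ul j) < h"
  "A (sl.ur j) < A (X j)"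
  if "j \<in> {l..<l + M}" for j
 proof -
  show j: "j < J" using that M by auto
  note f = slotF[OF j]
  show x: "sl.ul j < X j" "X j < sl.ur j" "H (X j) = H (A (X j))" using X that by auto
  then show "xe <= X j" "X j < c" "A (sl.ul j) < h" using f by auto
  then show "c < A (X j)" using sl.A_above by simp
  show "A (X j) < A (sl.ul j)" "A (sl.ur j) < A (X j)" using sl.A_anti[of "sl.ul j" "X j"] sl.A_anti[of "X j" "sl.ur j"] x f by auto
 qed
 have sub: "cyc j \<subseteq> N" if "j \<in> {l..<l + M}" for j
  using N(2)[of "X j"] N(3)[of "X j" "A (X j)"] XF[OF that] NN sl.order by (auto simp: cyc_def)
 \<comment> \<open>Cycles are told apart by their axis points: \<open>X i\<close> and
   \<open>A (X i)\<close> are the only ones on cycle \<open>i\<close>, and different slots are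
   disjoint.\<close>
 have "inj_on cyc {l..<l + M}"
 proof (rule inj_onI)
  have *: "i = j" if ij: "i \<in> {l..<l + M}" "j \<in> {l..<l + M}" "i < j \<or> i = j" "cyc i = cyc j" for i j
  proof (rule ccontr)
   assume "i ~= j"
   then have "i < j" using ij by simp
   have "X j < X i"
   proof -
    have "sl.ur j < sl.ul i"
     using sl.u_less[of "real i + 5/4" "real j + 3/4"] \<open>i < j\<close> XF(1)[OF ij(2)] by (simp add: sl.ul_def sl.ur_def)
    then show ?thesis using XF[OF ij(1)] XF[OF ij(2)] by linarith
   qed
   note F1 = XF[OF ij(1)] and f = slotF[OF XF(1)[OF ij(1)]]
   have "(X j, 0) \<in> cyc i" using X ij by (auto simp: cyc_def)
   moreover have "H (A (X i)) < H y" if "X i < y" "y < A (X i)" for y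
   proof (cases "y <= c")
    case True
    then have "H (X i) < H y" using that F1 f xe by (intro H_left) auto
    then show ?thesis using F1 by simp
   next
    case False
    then show ?thesis using that F1 f ij(1) by (intro descend[OF F1(1)]) auto
   qed
   ultimately have "(X j, 0) = (X i, 0) \<or> (X j, 0) = (A (X i), 0)"
    using upper_axis[of "X i" "(X j, 0)"] lower_axis[of "X i" "A (X i)" "(X j, 0)"] F1 xe h by (auto simp: cyc_def)
   then show False using \<open>X j < X i\<close> F1 XF[OF ij(2)] by auto
  qed
  fix i j assume "i \<in> {l..<l + M}" "j \<in> {l..<l + M}" "cyc i = cyc j"
  then show "i = j" using *[of i j] *[of j i] by (cases i j rule: linorder_cases) auto
 qed
 then have card: "card (cyc ` {l..<l + M}) = M" by (simp add: card_image)
 have "cyc ` {l..<l + M} \<subseteq> {C. crossing_limit_cycle U Xp Xm C & C \<subseteq> N}"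
 proof (rule image_subsetI)
  fix j assume j: "j \<in> {l..<l + M}"
  with X have "crossing_limit_cycle U Xp Xm (cyc j)" by (simp add: cyc_def)
  with sub[OF j] show "cyc j \<in> {C. crossing_limit_cycle U Xp Xm C & C \<subseteq> N}" by simp
 qed
 from number_of_mono[OF this] card show "enat M <= beta_c U Xp Xm N"
  by (simp add: beta_c_def number_of_def)
qed

end

section \<open>Existence of the perturbations\<close>

lemma (in grazing_orbit) L_ne: "L ~= {}" and O_in_L: "(0, 0) \<in> L"
 using range_orb orb_0 by (metis UNIV_I empty_iff image_eqI, metis rangeI)

text \<open>By compactness the part of \<open>L\<close> away from the origin has heights above some
  \<open>\<mu> > 0\<close>, so a thin tube around \<open>L\<close> has low points only near the
  origin. This locates \<open>N0\<close> and the landing points.\<close>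

lemma (in grazing_orbit) near_axis:
 assumes "d > 0"
 obtains r where "r > 0" "\<And>p. infdist p L < r ==> snd p < r ==> \<bar>fst p\<bar> < d & \<bar>snd p\<bar> < d"
proof -
 let ?B = "{p :: plane. \<bar>fst p\<bar> < d & \<bar>snd p\<bar> < d}"
 have oB: "open ?B" by (intro open_Collect_conj open_Collect_less continuous_intros)
 obtain \<mu> where \<mu>: "\<mu> > 0" "\<And>p. p \<in> L - ?B ==> \<mu> < snd p"
 proof (cases "L - ?B = {}")
  case True
  show ?thesis by (rule that[of 1]) (use True in auto)
 next
  case False
  have "compact (L - ?B)" using compact_L oB by (rule compact_diff)
  then obtain q where q: "q \<in> L - ?B" "\<And>p. p \<in> L - ?B ==> snd q <= snd p"
   using continuous_attains_inf[OF _ False, of snd] continuous_on_snd[OF continuous_on_id] by blast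
  have "q ~= (0, 0)" using q(1) assms by auto
  then have "snd q > 0" using L_upper[of q] q(1) by auto
  then show ?thesis using q by (intro that[of "snd q / 2"]) force+
 qed
 have oW: "open (?B \<union> {p. \<mu> < snd p})" by (intro open_Un oB open_Collect_less continuous_intros)
 have "L \<subseteq> ?B \<union> {p. \<mu> < snd p}" using \<mu>(2) by blast
 then obtain e where e: "e > 0" "{p. infdist p L <= e} \<subseteq> ?B \<union> {p. \<mu> < snd p}"
  by (rule compact_in_open_separated[OF L_ne compact_L oW]) (rule that)
 show ?thesis
 proof (rule that[of "min e \<mu>"])
  fix p assume "infdist p L < min e \<mu>" "snd p < min e \<mu>"
  then have "p \<in> {p. infdist p L <= e}" "\<not> \<mu> < snd p" by auto
  with e(2) have "p \<in> ?B" by blast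
  then show "\<bar>fst p\<bar> < d & \<bar>snd p\<bar> < d" by blast
 qed (use e \<mu> in auto)
qed

lemma slots_exist:
 assumes order: "- h < xe" "xe < c" and J: "J >= 1" and l: "l < J"
  and A: "\<And>x. xe <= x ==> x <= c ==> c < A x" "\<And>x x'. xe <= x ==> x < x' ==> x' <= c ==> A x' < A x"
   "\<And>x x'. xe <= x ==> x <= c ==> xe <= x' ==> x' <= c ==> \<bar>A x - A x'\<bar> <= BA * \<bar>x - x'\<bar>"
  and BA: "BA > 0" and A_h: "A xe < h"
 obtains q0 bl BL b Bm v where "slots c xe h q0 BA A bl BL J l lb rb b Bm v"
proof -
 define q0 where "q0 = (xe + c) / 2"
 have q0: "xe < q0" "q0 < c" using order by (auto simp: q0_def)
 obtain bl BL where bl: "bump_of_mass q0 c (real J + 1) bl BL" using bump_of_mass_exists[OF q0(2), of "real J + 1"] by auto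
 interpret s0: slots0 c xe h q0 BA A bl BL J
  by (unfold_locales; (rule order q0 J A BA A_h bl; assumption?)?)
 have "\<exists>z. bump_of_mass (s0.pt j 2) (s0.pt j 3) (if j = J then 2 else 1) (fst z) (snd z)" if "j <= J" for j
  using bump_of_mass_exists[of "s0.pt j 2" "s0.pt j 3" "if j = J then 2 else 1"] s0.pt[OF that] by auto
 then have "\<exists>z. \<forall>j\<le>J. bump_of_mass (s0.pt j 2) (s0.pt j 3) (if j = J then 2 else 1) (fst (z j)) (snd (z j))"
  by (intro choice) blast
 then obtain z where b: "\<And>j. j <= J ==> bump_of_mass (s0.pt j 2) (s0.pt j 3) (if j = J then 2 else 1) (fst (z j)) (snd (z j))"
  by blast
 define v where "v x = (c - x) * (\<Prod>j<l. (x - s0.e j) * (x - s0.e' j)) * (if rb then s0.pt J 1 - x else 1) * (if lb then x - q0 else 1)" for x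
 have "slots c xe h q0 BA A bl BL J l lb rb (%j. fst (z j)) (%j. snd (z j)) v"
 proof (intro slots.intro s0.slots0_axioms slots_axioms.intro)
  show "v x = (c - x) * (\<Prod>j<l. (x - s0.e j) * (x - s0.e' j)) * (if rb then s0.pt J 1 - x else 1) * (if lb then x - q0 else 1)" for x
   by (simp add: v_def)
 qed (use b l in blast)+
 then show ?thesis by (rule that)
qed

text \<open>Where the cutoff is \<open>1\<close>, \<open>z\<close> decides the sign of the defect;
  elsewhere it is mixed with \<open>- F\<close>, and both have the sign of \<open>v\<close>, so no
  further zeros arise.\<close>

lemma sgn_mix:
 fixes \<eta> \<theta> z F v :: real
 assumes "\<eta> > 0" "0 <= \<theta>" "\<theta> <= 1" "sgn z = sgn v" "\<theta> = 1 \<or> F * v < 0"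
 shows "sgn (\<eta> * \<theta> * z - (1 - \<theta>) * F) = sgn v"
proof (cases "\<theta> = 1")
 case True
 then show ?thesis using assms by (simp add: sgn_mult)
next
 case False
 then have F: "F * v < 0" and t: "1 - \<theta> > 0" using assms by auto
 show ?thesis
 proof (cases "v > 0")
  case True
  then have "F < 0" "z > 0" using F assms(4) by (auto simp: mult_less_0_iff sgn_if split: if_splits)
  then have "(1 - \<theta>) * F < 0" "\<eta> * \<theta> * z >= 0" using t assms by (auto simp: mult_pos_neg)
  then have "\<eta> * \<theta> * z - (1 - \<theta>) * F > 0" by linarith
  then show ?thesis using True by simp
 next
  case 2: False
  then have "v < 0" "F > 0" "z < 0" using F assms(4) by (auto simp: mult_less_0_iff sgn_if split: if_splits)
  then have "(1 - \<theta>) * F > 0" "\<eta> * \<theta> * z <= 0" using t assms by (auto simp: mult_nonneg_nonpos)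
  then have "\<eta> * \<theta> * z - (1 - \<theta>) * F < 0" by linarith
  then show ?thesis using \<open>v < 0\<close> by simp
 qed
qed

text \<open>The sign of \<open>\<phi> x\<^sup>m / f\<close> on either side of the tangent point decides whether the unperturbed
 system slides there.\<close>

lemma slope_sign:
 assumes "flow_box f (%p. \<phi> p * fst p ^ m) \<rho> R L K" "\<bar>x\<bar> <= R"
  and \<phi>: "\<And>x y. \<bar>x\<bar> <= \<rho> ==> \<bar>y\<bar> <= \<rho> ==> \<phi> (x, y) * \<phi>0 > 0"
 shows "x > 0 ==> slope f (%p. \<phi> p * fst p ^ m) \<rho> x y * \<phi>0 < 0"
  "x < 0 ==> slope f (%p. \<phi> p * fst p ^ m) \<rho> x y * (\<phi>0 * (- 1) ^ m) < 0"
proof -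
 interpret flow_box f "%p. \<phi> p * fst p ^ m" \<rho> R L K by (rule assms(1))
 let ?p = "(x, clamp_to \<rho> y)"
 have b: "\<bar>x\<bar> <= \<rho>" "\<bar>clamp_to \<rho> y\<bar> <= \<rho>"
  using assms(2) R_le R_pos clamp_to(1)[of \<rho> y] by (auto simp: abs_le_iff)
 have fn: "f ?p < 0" using f_neg[OF b] .
 have eq: "slope f (%p. \<phi> p * fst p ^ m) \<rho> x y * s = (\<phi> ?p * \<phi>0) * (s * \<phi>0) * x ^ m / (f ?p * (\<phi>0 * \<phi>0))"
  if "\<phi>0 ~= 0" for s using that fn by (simp add: slope_def field_simps)
 have nz: "\<phi>0 ~= 0" using \<phi>[OF b] by auto
 have den: "f ?p * (\<phi>0 * \<phi>0) < 0" using fn nz by (intro mult_neg_pos) (auto simp: zero_less_mult_iff)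
 have sq: "\<phi>0 * \<phi>0 > 0" using nz by (auto simp: zero_less_mult_iff)
 show "slope f (%p. \<phi> p * fst p ^ m) \<rho> x y * \<phi>0 < 0" if "x > 0"
  unfolding eq[OF nz] by (rule divide_pos_neg[OF mult_pos_pos[OF mult_pos_pos[OF \<phi>[OF b] sq]] den]) (use that in simp)
 show "slope f (%p. \<phi> p * fst p ^ m) \<rho> x y * (\<phi>0 * (- 1) ^ m) < 0" if "x < 0"
 proof -
  have "(- 1) ^ m * x ^ m = (- x) ^ m" by (simp add: power_mult_distrib[symmetric])
  then have "(\<phi> ?p * \<phi>0) * ((\<phi>0 * (- 1) ^ m) * \<phi>0) * x ^ m = (\<phi> ?p * \<phi>0) * (\<phi>0 * \<phi>0) * (- x) ^ m"
   by (metis (no_types, opaque_lifting) mult.assoc mult.commute)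
  moreover have "(\<phi> ?p * \<phi>0) * (\<phi>0 * \<phi>0) * (- x) ^ m > 0"
   by (rule mult_pos_pos[OF mult_pos_pos[OF \<phi>[OF b] sq]]) (use that in simp)
  ultimately have "(\<phi> ?p * \<phi>0) * ((\<phi>0 * (- 1) ^ m) * \<phi>0) * x ^ m > 0" by (simp only:)
  then show ?thesis unfolding eq[OF nz] by (rule divide_pos_neg[OF _ den])
 qed
qed

lemma positive_near:
 assumes "isCont (h :: plane => real) (0, 0)" "h (0, 0) > 0"
 obtains d where "d > 0" "\<And>x y. \<bar>x\<bar> <= d ==> \<bar>y\<bar> <= d ==> h (x, y) > 0"
proof -
 have "\<forall>\<^sub>F p in at (0, 0). h p > 0" using assms unfolding isCont_def by (rule order_tendstoD)
 then obtain e where e: "e > 0" "\<And>p. p ~= (0, 0) ==> dist p (0, 0) < e ==> h p > 0"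
  unfolding eventually_at by auto
 show ?thesis
 proof (rule that[of "e / 3"])
  fix x y :: real assume b: "\<bar>x\<bar> <= e / 3" "\<bar>y\<bar> <= e / 3"
  have "dist (x, y) (0, 0) <= \<bar>x\<bar> + \<bar>y\<bar>" using sqrt_sum_squares_le_sum_abs[of x y] by (simp add: dist_Pair_Pair dist_real_def)
  then have "dist (x, y) (0, 0) < e" using b e(1) by linarith
  then show "h (x, y) > 0" using e(2)[of "(x, y)"] assms(2) by (cases "(x, y) = (0, 0)") auto
 qed (use e in auto)
qed

lemma landing_end:
 assumes "landing f g L x0 \<alpha> C c A" "- x0 <= x" "x <= c"
 shows "infdist (A x, \<alpha>) L <= C * (\<bar>x\<bar> + \<alpha>)"
proof -
 from assms obtain \<eta> T where "landing_arc f g L \<alpha> C x (A x) \<eta> T" unfolding landing_def by blast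
 then have e: "0 < T" "\<eta> T = (A x, \<alpha>)" "\<forall>t. 0 <= t & t <= T --> infdist (\<eta> t) L <= C * (\<bar>x\<bar> + \<alpha>)"
  unfolding landing_arc_def by auto
 from e(3)[rule_format, of T] e(1,2) show ?thesis by simp
qed

text \<open>One choice of parameters has to serve all \<open>N\<close> between the tube of radius
  \<epsilon> and \<open>N0\<close>, because only countably many profiles are going to be put into
  \<psi>.\<close>

definition realizes :: "plane set => (plane => real) => (plane => real) => (plane => real) => (plane => real) => nat =>
  plane set => nat => nat => plane set => real => real => (real => real) => bool" where
 "realizes U f g fm \<phi> m L M l N0 \<epsilon> \<alpha> w \<longleftrightarrow> \<bar>\<alpha>\<bar> < \<epsilon> & (\<forall>k. ck_on k UNIV w) \<and>
  (let Xp = perturbed_upper f g \<alpha>; Xm = perturbed_lower fm \<phi> (replicate m 0) w in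
   system_dist U Xp Xm (upper_field f g) (lower_field fm \<phi> m) < \<epsilon> \<and>
   (\<forall>N. {p. infdist p L < \<epsilon>} \<subseteq> N --> N \<subseteq> N0 --> beta_s U Xp Xm N = enat l & enat M <= beta_c U Xp Xm N))"

lemma (in grazing_orbit) perturbation_exists:
 fixes fm \<phi> :: "plane => real" and m M l :: nat
 assumes sm: "smooth fm" "smooth \<phi>" and fm0: "fm (0, 0) < 0" and \<phi>0: "\<phi> (0, 0) ~= 0" and m: "m >= 2"
 obtains N0 where "L \<subseteq> interior N0"
  "\<And>\<epsilon>. \<epsilon> > 0 ==> \<exists>\<alpha> w. realizes U f g fm \<phi> m L M l N0 \<epsilon> \<alpha> w"
proof -
 let ?g = "%p. \<phi> p * fst p ^ m"
 \<comment> \<open>One slot more than is to be filled, so that \<open>l < J\<close> and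
   \<open>J \<ge> 1\<close> also for \<open>M = 0\<close>.\<close>
 define J where "J = M + l + 1"
 have J: "J >= 1" "l < J" "l + M <= J" by (auto simp: J_def)
 have sg: "smooth ?g" by (rule smooth_mult_power_fst[OF sm(2)])
 obtain \<rho>0 where \<rho>0: "\<rho>0 > 0"
  "\<And>\<rho>. 0 < \<rho> ==> \<rho> <= \<rho>0 ==>
   \<exists>L K. L > 0 & K > 0 & (\<forall>R. 0 < R --> R <= \<rho> --> 16 * R * L <= 1 --> flow_box fm ?g \<rho> R L K)"
  by (rule flow_box_exists[OF sm(1) sg fm0]) (rule that)
 obtain d1 where d1: "d1 > 0" "\<And>x y. \<bar>x\<bar> <= d1 ==> \<bar>y\<bar> <= d1 ==> \<phi> (x, y) * \<phi> (0, 0) > 0"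
 proof (rule positive_near[of "%p. \<phi> p * \<phi> (0, 0)"])
  show "isCont (%p. \<phi> p * \<phi> (0, 0)) (0, 0)" by (intro continuous_intros smooth_isCont sm)
  show "\<phi> (0, 0) * \<phi> (0, 0) > 0" using \<phi>0 by (auto simp: zero_less_mult_iff)
 qed (rule that)
 obtain d2 where d2: "d2 > 0" "\<And>x y. \<bar>x\<bar> <= d2 ==> \<bar>y\<bar> <= d2 ==> - f (x, y) > 0"
  by (rule positive_near[of "%p. - f p"])
   (use smooth_isCont[OF smooth_f] f_O_neg that in \<open>auto intro!: continuous_intros\<close>)
 have "(0, 0) \<in> U" using O_in_L L_U by blast
 then obtain d3 where d3: "d3 > 0" "ball (0, 0) d3 \<subseteq> U" using open_U openE by blast
 define \<rho> where "\<rho> = min (min \<rho>0 d1) (min d2 (d3 / 3))"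
 have \<rho>: "\<rho> > 0" "\<rho> <= \<rho>0" "\<rho> <= d1" "\<rho> <= d2" "\<rho> <= d3 / 3" using \<rho>0(1) d1(1) d2(1) d3(1) by (auto simp: \<rho>_def)
 have box_U: "(x, y) \<in> U" if "\<bar>x\<bar> <= \<rho>" "\<bar>y\<bar> <= \<rho>" for x y
 proof -
  have "dist (x, y) (0, 0) <= \<bar>x\<bar> + \<bar>y\<bar>" using sqrt_sum_squares_le_sum_abs[of x y] by (simp add: dist_Pair_Pair dist_real_def)
  then have "dist (0, 0) (x, y) < d3" using that \<rho> d3(1) by (simp add: dist_commute)
  then show ?thesis using d3(2) by (meson mem_ball subsetD)
 qed
 obtain Lc K where LK: "Lc > 0" "K > 0" "\<And>R. 0 < R ==> R <= \<rho> ==> 16 * R * Lc <= 1 ==> flow_box fm ?g \<rho> R Lc K"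
  using \<rho>0(2)[OF \<rho>(1,2)] by blast
 \<comment> \<open>With \<open>400\<close> the relative error \<open>3 * (4 * R * Lc)\<close> times
   the total variation \<open>2 * real J + 4\<close> is at most
   \<open>12 / 400 < 1 / 32\<close>.\<close>
 define R where "R = min \<rho> (1 / (400 * Lc * (2 * real J + 4)))"
 have R: "0 < R" "R <= \<rho>" using \<rho> LK by (auto simp: R_def)
 have RL: "R * Lc * (2 * real J + 4) <= 1 / 400"
 proof -
  have p: "400 * Lc * (2 * real J + 4) > 0" using LK(1) by (intro mult_pos_pos) auto
  have "R <= 1 / (400 * Lc * (2 * real J + 4))" by (simp add: R_def)
  then have "R * (400 * Lc * (2 * real J + 4)) <= 1" using p by (simp add: field_simps)
  then show ?thesis by (simp add: algebra_simps)
 qed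
 have kappa: "3 * (4 * R * Lc) * (2 * real J + 4) <= 1 / 32" using RL by simp
 have "R * Lc * 4 <= R * Lc * (2 * real J + 4)" using R LK by (intro mult_left_mono) auto
 then have "16 * R * Lc <= 1" using RL by simp
 then have fb: "flow_box fm ?g \<rho> R Lc K" using LK(3) R by blast
 interpret fb: flow_box fm ?g \<rho> R Lc K by (rule fb)
 obtain \<rho>' R' Lc' K' \<tau>' x2 y1 C' \<delta>' E where rs: "return_setup U L f g orb T \<rho>' R' Lc' K' \<tau>' x2 y1 C' \<delta>' E"
  by (rule return_setup_exists) (rule that)
 obtain xb where xb: "xb > 0" "\<And>x0. 0 < x0 ==> x0 <= xb ==>
   \<exists>ab>0. \<exists>C>0. \<forall>\<alpha>. 0 < \<alpha> & \<alpha> < ab --> (\<exists>c A. landing f g L x0 \<alpha> C c A)"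
  by (rule return_setup.landing_exists[OF rs]) (rule that)
 \<comment> \<open>The last entry limits the rise \<open>K * (2 * x0)\<close> of a lower orbit over
   the whole range to \<open>\<rho> / 8\<close>.\<close>
 define x0 where "x0 = min (min R xb) (\<rho> / (16 * K))"
 have x0: "0 < x0" "x0 <= R" "x0 <= xb" "x0 <= \<rho> / (16 * K)" using R xb \<rho> LK by (auto simp: x0_def)
 have x0K: "2 * K * x0 <= \<rho> / 8" using x0(4) LK by (simp add: field_simps)
 obtain ab C where ab: "ab > 0" "C > 0" "\<And>\<alpha>. 0 < \<alpha> ==> \<alpha> < ab ==> \<exists>c A. landing f g L x0 \<alpha> C c A"
  using xb(2)[OF x0(1,3)] by blast
 obtain r0 where r0: "r0 > 0" "\<And>p. infdist p L < r0 ==> snd p < r0 ==> \<bar>fst p\<bar> < min x0 (\<rho> / 8) & \<bar>snd p\<bar> < min x0 (\<rho> / 8)"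
  by (rule near_axis[of "min x0 (\<rho> / 8)"]) (use x0 \<rho> that in auto)
 \<comment> \<open>Fixed before \<epsilon>. Its points at or below the axis have abscissae within
   \<open>x0\<close> and small heights, so every lower arc and every axis point in it is covered by
   the flow box.\<close>
 define N0 where "N0 = {p. infdist p L < r0}"
 have open_tube: "open {p. infdist p L < r}" for r by (intro open_Collect_less continuous_intros)
 have L_tube: "L \<subseteq> {p. infdist p L < r}" if "r > 0" for r using that by auto
 obtain rU where rU: "rU > 0" "{p. infdist p L <= rU} \<subseteq> U"
  by (rule compact_in_open_separated[OF L_ne compact_L open_U L_U]) (rule that)
 show ?thesis
 proof (rule that[of N0])
  show "L \<subseteq> interior N0"
   unfolding N0_def using interior_open[OF open_tube[of r0]] L_tube[OF r0(1)] by simp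
  fix \<epsilon> :: real assume \<epsilon>: "\<epsilon> > 0"
  have Une: "U ~= {}" using \<open>(0, 0) \<in> U\<close> by auto
  obtain \<delta> where \<delta>: "\<delta> > 0"
   "\<And>\<alpha> w w1 w2. \<bar>\<alpha>\<bar> < \<delta> ==> \<forall>x. (w has_real_derivative w1 x) (at x) ==> \<forall>x. (w1 has_real_derivative w2 x) (at x) ==>
   \<forall>x. \<bar>w x\<bar> < \<delta> & \<bar>w1 x\<bar> < \<delta> & \<bar>w2 x\<bar> < \<delta> ==>
   system_dist U (perturbed_upper f g \<alpha>) (perturbed_lower fm \<phi> (replicate m 0) w) (upper_field f g) (lower_field fm \<phi> m) < \<epsilon>"
   by (rule perturbation_small[OF bounded_U Une smooth_f smooth_g sm \<epsilon>]) (rule that)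
  define \<epsilon>' where "\<epsilon>' = min \<delta> (min (\<rho> / 8) (\<epsilon> / 8))"
  have \<epsilon>': "\<epsilon>' > 0" "\<epsilon>' <= \<delta>" "\<epsilon>' <= \<rho> / 8" "\<epsilon>' <= \<epsilon> / 8" using \<delta> \<rho> \<epsilon> by (auto simp: \<epsilon>'_def)
  obtain s0 where s0: "s0 > 0" "s0 <= R"
   "\<And>s z. 0 < s ==> s < s0 ==> (\<forall>k. ck_on k UNIV z) ==> \<exists>\<eta>>0. \<exists>w w1 w2 \<theta>. fb.profile \<epsilon>' (s / 2) z \<eta> w w1 w2 \<theta>"
   by (rule fb.profile_exists[OF refl sm(2) m \<epsilon>'(1)]) (rule that)
  \<comment> \<open>\<open>2 * h\<close> will be the width of the cutoff, so the prescribed rate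
    holds for \<open>\<bar>x\<bar> \<le> h\<close>; the last entry keeps lower arcs with ends in
    this range inside the \<epsilon>-tube.\<close>
  define h where "h = min (s0 / 4) (min (x0 / 2) (\<epsilon> / (4 * (1 + 2 * K))))"
  have h: "h > 0" "2 * h < s0" "h < x0" "h <= \<epsilon> / (4 * (1 + 2 * K))"
   using s0(1) x0(1) \<epsilon> LK(2) by (auto simp: h_def intro!: divide_pos_pos add_pos_pos)
  have h\<epsilon>: "h + 2 * K * h <= \<epsilon> / 4"
  proof -
   have p: "4 * (1 + 2 * K) > 0" using LK(2) by simp
   have "h * (4 * (1 + 2 * K)) <= \<epsilon>" using h(4) p by (simp add: pos_le_divide_eq)
   then show ?thesis by (simp add: algebra_simps)
  qed
  obtain r1 where r1: "r1 > 0" "\<And>p. infdist p L < r1 ==> snd p < r1 ==> \<bar>fst p\<bar> < h & \<bar>snd p\<bar> < h"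
   by (rule near_axis[OF h(1)]) (rule that)
  define B where "B = min (min r1 rU) (min \<epsilon> \<delta>)"
  have B: "B > 0" "B <= r1" "B <= rU" "B <= \<epsilon>" "B <= \<delta>" using r1 rU \<epsilon> \<delta> by (auto simp: B_def)
  define \<sigma> where "\<sigma> = min (h / 2) (B / (4 * C))"
  have \<sigma>: "\<sigma> > 0" "\<sigma> < h" "C * \<sigma> <= B / 4" using h B ab(2) by (auto simp: \<sigma>_def min_def field_simps)
  \<comment> \<open>\<open>C * \<alpha> < \<sigma>\<close> places the tangency \<open>c\<close>
    between \<open>- \<sigma>\<close> and \<sigma>; the fractions of \<open>B\<close> keep the upper
    arcs from \<open>- \<sigma>\<close> on in the tube of radius \<open>B\<close>.\<close>
  define \<alpha> where "\<alpha> = min (min (ab / 2) (\<rho> / 2)) (min (\<sigma> / (2 * C)) (min (B / 4) (B / (4 * C))))"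
  have \<alpha>: "\<alpha> > 0" "\<alpha> < ab" "\<alpha> <= \<rho>" "C * \<alpha> < \<sigma>" "\<alpha> <= B / 4" "C * \<alpha> <= B / 4"
  proof -
   show "\<alpha> > 0" "\<alpha> < ab" "\<alpha> <= \<rho>" "\<alpha> <= B / 4" using ab \<rho> \<sigma> B by (auto simp: \<alpha>_def)
   have "\<alpha> <= \<sigma> / (2 * C)" "\<alpha> <= B / (4 * C)" by (auto simp: \<alpha>_def)
   then have "C * \<alpha> <= \<sigma> / 2" "C * \<alpha> <= B / 4" using ab(2) by (auto simp: field_simps)
   then show "C * \<alpha> < \<sigma>" "C * \<alpha> <= B / 4" using \<sigma>(1) by auto
  qed
  obtain c A where land: "landing f g L x0 \<alpha> C c A" using ab(3)[OF \<alpha>(1,2)] by blast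
  have cb: "\<bar>c\<bar> < \<sigma>" using land \<alpha>(4) by (auto simp: landing_def)
  have tube_small: "C * (\<bar>x\<bar> + \<alpha>) + \<alpha> < B" if "\<bar>x\<bar> <= \<sigma>" for x
  proof -
   have "C * \<bar>x\<bar> <= C * \<sigma>" using that ab(2) by (intro mult_left_mono) auto
   then show ?thesis using \<sigma>(3) \<alpha>(5,6) B(1) by (simp add: distrib_left)
  qed
  have A_small: "A (- \<sigma>) < h"
  proof -
   have "- x0 <= - \<sigma>" "- \<sigma> <= c" using \<sigma> h cb by auto
   from landing_end[OF land this] have "infdist (A (- \<sigma>), \<alpha>) L < r1"
    using tube_small[of "- \<sigma>"] \<sigma> \<alpha> B by auto
   from r1(2)[OF this] show ?thesis using \<alpha>(1,5) B by auto
  qed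
  obtain BA where BA: "BA > 0" "\<And>x x'. - x0 <= x ==> x <= c ==> - x0 <= x' ==> x' <= c ==> \<bar>A x - A x'\<bar> <= BA * \<bar>x - x'\<bar>"
   using land unfolding landing_def by blast
  \<comment> \<open>\<open>rb\<close> and \<open>lb\<close> tell on which side, right or left, the
    unperturbed system slides: there \<open>- F\<close> has the sign opposite to that of a crossing
    side, and \<open>v\<close> gets an extra zero to match it.\<close>
  define rb where "rb \<longleftrightarrow> \<phi> (0, 0) > 0"
  define lb where "lb \<longleftrightarrow> \<phi> (0, 0) * (- 1) ^ m < 0"
  obtain q0 bl BL b Bm v where slots: "slots c (- \<sigma>) h q0 BA A bl BL J l lb rb b Bm v"
  proof (rule slots_exist[of h "- \<sigma>" c J l A BA])
   show "c < A x" if "- \<sigma> <= x" "x <= c" for x using land that \<sigma> h by (auto simp: landing_def)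
   show "A x' < A x" if "- \<sigma> <= x" "x < x'" "x' <= c" for x x' using land that \<sigma> h by (auto simp: landing_def)
   show "\<bar>A x - A x'\<bar> <= BA * \<bar>x - x'\<bar>" if "- \<sigma> <= x" "x <= c" "- \<sigma> <= x'" "x' <= c" for x x'
    using that \<sigma> h by (intro BA(2)) auto
  qed (use \<sigma> cb J BA A_small that in auto)
  interpret sl: slots c "- \<sigma>" h q0 BA A bl BL J l lb rb b Bm v by (rule slots)
  have "continuous_on {-h..h} v" using sl.ck_v[of 0] by simp
  then have "bounded (v ` {-h..h})" by (intro compact_imp_bounded compact_continuous_image) auto
  then obtain Bv where Bv: "Bv > 0" "\<forall>y\<in>v ` {-h..h}. norm y <= Bv" unfolding bounded_pos by blast
  obtain k where k: "k > 0" "\<And>x. sl.ul (J - 1) <= x ==> x <= sl.ur 0 ==> k <= bl x"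
  proof -
   let ?I = "{sl.ul (J - 1)..sl.ur 0}"
   have J1: "J - 1 < J" "0 < J" using J by auto
   have in_c: "q0 < x & x < c" if "x \<in> ?I" for x using sl.slot(1)[OF J1(1)] sl.slot(3)[OF J1(2)] that by auto
   show ?thesis
   proof (cases "?I = {}")
    case True
    then show ?thesis using that[of 1] by auto
   next
    case False
    have "continuous_on ?I bl" using sl.bl(1)[of 0] by simp
    then obtain x where x: "x \<in> ?I" "\<forall>y\<in>?I. bl x <= bl y"
     using continuous_attains_inf[OF compact_Icc False] by blast
    then show ?thesis using that[of "bl x"] sl.bl(4)[of x] in_c[OF x(1)] by auto
   qed
  qed
  \<comment> \<open>The first bound makes the sign term negligible in \<open>H_step\<close>, the
    second one gives the contraction.\<close>
  define \<tau> where "\<tau> = min (1 / (64 * Bv * h)) (k / (16 * Bv * BA))"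
  have \<tau>: "\<tau> > 0" "\<tau> * Bv * h <= 1 / 64" "8 * (\<tau> * Bv * BA) < k"
  proof -
   show "\<tau> > 0" using Bv(1) h(1) k(1) BA(1) by (simp add: \<tau>_def)
   have "\<tau> <= 1 / (64 * Bv * h)" "\<tau> <= k / (16 * Bv * BA)" by (auto simp: \<tau>_def)
   then have "\<tau> * (64 * Bv * h) <= 1" "\<tau> * (16 * Bv * BA) <= k"
    using Bv(1) h(1) BA(1) by (auto simp: pos_le_divide_eq)
   then show "\<tau> * Bv * h <= 1 / 64" "8 * (\<tau> * Bv * BA) < k" using k(1) by (auto simp: algebra_simps)
  qed
  have ckz: "\<forall>k. ck_on k UNIV (sl.z \<tau>)" using sl.ck_z by blast
  have s: "0 < 2 * h" using h by simp
  obtain \<eta> w w1 w2 \<theta> where \<eta>: "\<eta> > 0" and "fb.profile \<epsilon>' (2 * h / 2) (sl.z \<tau>) \<eta> w w1 w2 \<theta>"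
   using s0(3)[OF s h(2) ckz] by blast
  then have w: "\<forall>k. ck_on k UNIV w" "\<forall>x. (w has_real_derivative w1 x) (at x)"
    "\<forall>x. (w1 has_real_derivative w2 x) (at x)" "\<forall>x. \<bar>w x\<bar> < \<epsilon>' & \<bar>w1 x\<bar> < \<epsilon>' & \<bar>w2 x\<bar> < \<epsilon>'"
    "\<forall>x. 0 <= \<theta> x & \<theta> x <= 1" "\<forall>x. \<bar>x\<bar> <= 2 * h / 2 --> \<theta> x = 1"
    "\<forall>x\<in>{-R..R}. w1 x - slope fm ?g \<rho> x (w x) = \<eta> * \<theta> x * sl.z \<tau> x - (1 - \<theta> x) * slope fm ?g \<rho> x (w x)"
   unfolding fb.profile_def by blast+
  \<comment> \<open>For \<open>\<bar>x\<bar> \<le> h\<close> the cutoff is \<open>1\<close>; beyond,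
    \<open>- F\<close> has the sign of \<open>v\<close> by the choice of \<open>rb\<close> and
    \<open>lb\<close>, so mixing it in does no harm.\<close>
  have zeta_sgn: "sgn (w1 x - slope fm ?g \<rho> x (w x)) = sgn (v x)" if x: "\<bar>x\<bar> < x0" for x
  proof -
   have xR: "\<bar>x\<bar> <= R" "x \<in> {-R..R}" using x x0 by auto
   have \<phi>s: "\<phi> (x, y) * \<phi> (0, 0) > 0" if "\<bar>x\<bar> <= \<rho>" "\<bar>y\<bar> <= \<rho>" for x y using d1(2) that \<rho> by simp
   let ?F = "slope fm ?g \<rho> x (w x)"
   have "\<theta> x = 1 \<or> ?F * v x < 0"
   proof (cases "\<bar>x\<bar> <= h")
    case False
    consider "x > h" | "x < - h" using False by linarith
    then show ?thesis
    proof cases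
     case 1
     have F: "?F * \<phi> (0, 0) < 0" using slope_sign(1)[OF fb xR(1), of "\<phi> (0, 0)" "w x"] \<phi>s 1 h by auto
     show ?thesis
     proof (cases rb)
      case True
      have "v x > 0" using sl.v_far_right[OF True, of x] sl.pt_J(2) sl.hi_bound(2) 1 by simp
      moreover have "?F < 0" using F True by (auto simp: rb_def mult_less_0_iff)
      ultimately show ?thesis by (simp add: mult_neg_pos)
     next
      case 2: False
      have "v x < 0"
      proof (rule sl.v_right)
       show "x < sl.e j \<or> sl.e' j < x" if "j < l" for j using sl.e_above[OF that] sl.hi_bound(2) 1 by auto
      qed (use 1 2 cb \<sigma> in auto)
      moreover have "?F > 0" using F 2 by (auto simp: rb_def mult_less_0_iff)
      ultimately show ?thesis by (simp add: mult_pos_neg)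
     qed
    next
     case 2
     have F: "?F * (\<phi> (0, 0) * (- 1) ^ m) < 0" using slope_sign(2)[OF fb xR(1), of "\<phi> (0, 0)" "w x"] \<phi>s 2 h by auto
     show ?thesis
     proof (cases lb)
      case True
      have "v x < 0" using sl.v_far_left[OF True, of x] sl.order 2 by simp
      moreover have "?F > 0" using F True unfolding lb_def by (simp add: mult_less_0_iff)
      ultimately show ?thesis by (simp add: mult_pos_neg)
     next
      case 3: False
      have "v x > 0" using 2 3 cb \<sigma> by (intro sl.v_left) auto
      moreover have "?F < 0" using F 3 unfolding lb_def by (auto simp: mult_less_0_iff not_less)
      ultimately show ?thesis by (simp add: mult_neg_pos)
     qed
    qed
   qed (use w(6) in auto)
   from sgn_mix[OF \<eta> _ _ sl.sgn_z[OF \<tau>(1)] this] w(5,7) xR show ?thesis by simp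
  qed
  have pp: "perturbed_pair fm \<phi> m \<rho> R Lc K U L N0 f g x0 \<alpha> C c (- \<sigma>) A w w1 v"
  proof (intro perturbed_pair.intro fb perturbed_pair_axioms.intro)
   show "continuous_on UNIV w1" by (rule DERIV_at_continuous_on[of UNIV w1 w2]) (use w(3) in auto)
   show "\<bar>w x\<bar> <= \<rho> / 8" for x using w(4) \<epsilon>'(3) by (meson less_imp_le less_le_trans)
   show "(x, y) \<in> U" if "\<bar>x\<bar> < x0" "\<bar>y\<bar> <= \<rho>" for x y using box_U[of x y] that x0 R by simp
   show "\<bar>fst p\<bar> < x0 & \<bar>snd p\<bar> <= \<rho> / 8" if "p \<in> N0" "snd p <= 0" for p
    using r0(2)[of p] that r0(1) by (auto simp: N0_def)
   show "f (x, \<alpha>) < 0" if "\<bar>x\<bar> < x0" for x using d2(2)[of x \<alpha>] that x0 R \<rho> \<alpha> by auto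
   show "p \<in> U" if "infdist p L <= C * (\<alpha> - - \<sigma>) + \<alpha>" for p
   proof -
    have "infdist p L <= rU" using that tube_small[of "- \<sigma>"] \<sigma>(1) B(3) by (simp add: add.commute)
    with rU(2) show ?thesis by blast
   qed
  qed (use smooth_f smooth_g land \<alpha> ab w(2) x0K LK x0 \<sigma> h cb zeta_sgn in auto)
  interpret pp: perturbed_pair fm \<phi> m \<rho> R Lc K U L N0 f g x0 \<alpha> C c "- \<sigma>" A w w1 v by (rule pp)
  have "design c (- \<sigma>) h q0 BA A bl BL J l lb rb b Bm v fm \<phi> m \<rho> R Lc K U L N0 f g x0 \<alpha> C w w1 M \<eta> \<tau> Bv k"
  proof (intro design.intro slots pp design_axioms.intro)
   show "w1 x - slope fm ?g \<rho> x (w x) = \<eta> * sl.z \<tau> x" if "\<bar>x\<bar> <= h" for x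
   proof -
    have "x \<in> {-R..R}" "\<theta> x = 1" using w(6) that x0(2) h(3) by auto
    with w(7)[rule_format, of x] show ?thesis by simp
   qed
   show "\<bar>v x\<bar> <= Bv" if "\<bar>x\<bar> <= h" for x using Bv(2) that by (simp add: abs_le_iff)
  qed (use J \<eta> \<tau> h kappa k in auto)
  then interpret ds: design c "- \<sigma>" h q0 BA A bl BL J l lb rb b Bm v fm \<phi> m \<rho> R Lc K U L N0 f g x0 \<alpha> C w w1 M \<eta> \<tau> Bv k .
  show "\<exists>\<alpha> w. realizes U f g fm \<phi> m L M l N0 \<epsilon> \<alpha> w"
   unfolding realizes_def Let_def
  proof (rule exI[of _ \<alpha>], rule exI[of _ w], intro conjI allI impI)
   show "\<bar>\<alpha>\<bar> < \<epsilon>" using \<alpha> B \<epsilon> by auto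
   show "ck_on k UNIV w" for k using w(1) by blast
   have wd: "\<bar>w x\<bar> < \<delta>" "\<bar>w1 x\<bar> < \<delta>" "\<bar>w2 x\<bar> < \<delta>" for x using w(4)[rule_format, of x] \<epsilon>'(2) by auto
   show "system_dist U (perturbed_upper f g \<alpha>) (perturbed_lower fm \<phi> (replicate m 0) w) (upper_field f g) (lower_field fm \<phi> m) < \<epsilon>"
    by (rule \<delta>(2)[of \<alpha> w w1 w2]) (use \<alpha> B w wd \<delta>(1) in auto)
   fix N assume N: "{p. infdist p L < \<epsilon>} \<subseteq> N" "N \<subseteq> N0"
   have sub: "{p. infdist p L < \<epsilon>} \<subseteq> interior N" by (rule interior_maximal[OF N(1) open_tube])
   have U1: "pp.UA x \<subseteq> interior N" if "- \<sigma> <= x" "x <= c" for x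
   proof
    fix p assume p: "p \<in> pp.UA x"
    have "\<bar>x\<bar> <= \<sigma>" using that cb by auto
    then have "infdist p L < \<epsilon>" using pp.UA_near[OF _ that(2) p] that \<sigma> h tube_small[of x] B(4) by auto
    with sub show "p \<in> interior N" by blast
   qed
   have U2: "pp.LA p q \<subseteq> interior N" if "- h <= q" "q < p" "p <= h" for p q
   proof
    fix y assume y: "y \<in> pp.LA p q"
    have "infdist y L <= h + 2 * K * h + 2 * \<epsilon>'"
     by (rule pp.LA_near[OF _ that(2) _ _ y O_in_L]) (use that h w(4) in \<open>auto intro: less_imp_le\<close>)
    then have "infdist y L < \<epsilon>" using h\<epsilon> \<epsilon>' \<epsilon> by linarith
    with sub show "y \<in> interior N" by blast
   qed
   have U3: "(x, 0) \<in> N" if "\<bar>x\<bar> <= h" for x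
   proof -
    have "dist (x, 0 :: real) (0, 0) = \<bar>x\<bar>" by (simp add: dist_Pair_Pair dist_real_def)
    then have "infdist (x, 0) L <= \<bar>x\<bar>" using infdist_le[OF O_in_L, of "(x, 0)"] by simp
    also have "\<dots> < \<epsilon>"
    proof -
     have "2 * K * h >= 0" using LK h by simp
     then show ?thesis using that h\<epsilon> \<epsilon> by linarith
    qed
    finally show ?thesis using N(1) by blast
   qed
   show "beta_s U (perturbed_upper f g \<alpha>) (perturbed_lower fm \<phi> (replicate m 0) w) N = enat l"
    by (rule ds.counts(1)[OF N(2) U1 U2 U3])
   show "enat M <= beta_c U (perturbed_upper f g \<alpha>) (perturbed_lower fm \<phi> (replicate m 0) w) N"
    by (rule ds.counts(2)[OF N(2) U1 U2 U3])
  qed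
 qed
qed

lemma has_perturbation_mono:
 assumes "has_perturbation U fp gp fm \<phi> m L Q" "\<And>c s. Q c s ==> Q' c s"
 shows "has_perturbation U fp gp fm \<phi> m L Q'"
proof -
 have "realized_in U fp gp fm \<phi> m n \<psi> Q \<epsilon> N ==> realized_in U fp gp fm \<phi> m n \<psi> Q' \<epsilon> N" for n \<psi> \<epsilon> N
  unfolding realized_in_def Let_def using assms(2) by blast
 with assms(1) show ?thesis unfolding has_perturbation_def by meson
qed

lemma (in grazing_orbit) has_perturbation_counts:
 fixes fm \<phi> :: "plane => real" and m M l :: nat
 assumes "smooth fm" "smooth \<phi>" "fm (0, 0) < 0" "\<phi> (0, 0) ~= 0" "m >= 2"
 shows "has_perturbation U f g fm \<phi> m L (%c s. enat M <= c & s = enat l)"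
proof -
 let ?P = "realizes U f g fm \<phi> m L M l"
 obtain N0 where N0: "L \<subseteq> interior N0" "\<And>\<epsilon>. \<epsilon> > 0 ==> \<exists>\<alpha> w. ?P N0 \<epsilon> \<alpha> w"
  by (rule perturbation_exists[OF assms, where M = M and l = l]) (rule that)
 define ep where "ep j = 1 / (real j + 1)" for j :: nat
 have ep: "ep j > 0" for j by (simp add: ep_def add_nonneg_pos)
 have ep_inj: "ep i = ep j ==> i = j" for i j by (simp add: ep_def)
 have "\<forall>j. \<exists>z. ?P N0 (ep j) (fst z) (snd z)" using N0(2)[OF ep] by simp
 from choice[OF this] obtain z where z: "\<And>j. ?P N0 (ep j) (fst (z j)) (snd (z j))" by blast
 define ix where "ix k = (SOME j. k = [ep j])" for k
 have ix: "ix [ep j] = j" for j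
  unfolding ix_def by (rule some_equality) (auto dest: ep_inj)
 \<comment> \<open>One scalar parameter: at \<open>[ep j]\<close> the function is the profile made
   for accuracy \<open>ep j\<close>, at \<open>[0]\<close> it vanishes, and any other
   \<open>k\<close> receives some profile, which is smooth as well. Parameter and accuracy tend to
   \<open>0\<close> together.\<close>
 define \<psi> where "\<psi> x k = (if k = [0] then 0 else snd (z (ix k)) x)" for x and k :: "real list"
 have \<psi>j: "(%x. \<psi> x [ep j]) = snd (z j)" for j using ep[of j] by (auto simp: \<psi>_def ix)
 have "smooth (%x. \<psi> x k)" for k
 proof (rule smooth_if_ck_on)
  show "ck_on n UNIV (%x. \<psi> x k)" for n
   using z[of "ix k"] by (cases "k = [0]") (auto simp: \<psi>_def realizes_def)
 qed
 moreover have "\<psi> x (replicate 1 0) = 0" for x by (simp add: \<psi>_def)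
 moreover have "realized_in U f g fm \<phi> m 1 \<psi> (%c s. enat M <= c & s = enat l) \<epsilon> N"
  if \<epsilon>: "\<epsilon> > 0" and N: "L \<subseteq> interior N" "N \<subseteq> N0" for \<epsilon> N
 proof -
  \<comment> \<open>Some closed tube around \<open>L\<close> lies in the interior of
    \<open>N\<close>; \<open>j\<close> is taken so large that the tube of radius \<open>ep j\<close>
    is thinner and \<open>ep j\<close> is below \<epsilon>.\<close>
  obtain e where e: "e > 0" "{p. infdist p L <= e} \<subseteq> interior N"
   by (rule compact_in_open_separated[OF L_ne compact_L open_interior N(1)]) (rule that)
  obtain j where "inverse (real (Suc j)) < min \<epsilon> e" using reals_Archimedean[of "min \<epsilon> e"] \<epsilon> e(1) by auto
  then have j: "ep j < \<epsilon>" "ep j < e" by (auto simp: ep_def field_simps)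
  have sub: "{p. infdist p L < ep j} \<subseteq> N"
  proof
   fix p assume "p \<in> {p. infdist p L < ep j}"
   then have "p \<in> {p. infdist p L <= e}" using j(2) by simp
   with e(2) interior_subset[of N] show "p \<in> N" by blast
  qed
  have n1: "vec_norm (replicate m 0) = 0" by (simp add: vec_norm_def L2_set_def)
  have n2: "vec_norm [ep j] = ep j" using ep[of j] by (simp add: vec_norm_def L2_set_def)
  have Pj: "?P N0 (ep j) (fst (z j)) (snd (z j))" by (rule z)
  show ?thesis
   unfolding realized_in_def Let_def
  proof (rule exI[of _ "fst (z j)"], rule exI[of _ "replicate m 0"], rule exI[of _ "[ep j]"], unfold \<psi>j n1 n2, intro conjI)
   show "\<bar>fst (z j)\<bar> < \<epsilon>" using Pj j(1) unfolding realizes_def Let_def by linarith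
   show "system_dist U (perturbed_upper f g (fst (z j))) (perturbed_lower fm \<phi> (replicate m 0) (snd (z j)))
     (upper_field f g) (lower_field fm \<phi> m) < \<epsilon>" using Pj j(1) unfolding realizes_def Let_def by linarith
  qed (use Pj sub N(2) \<epsilon> j(1) in \<open>auto simp: realizes_def Let_def\<close>)
 qed
 ultimately show ?thesis
  unfolding has_perturbation_def using N0(1) by (intro exI[of _ 1] exI[of _ \<psi>] conjI exI[of _ N0]) auto
qed

lemma ck_on_deriv:
 assumes "\<And>k. ck_on k UNIV a"
 shows "(a has_real_derivative deriv a x) (at x)" "ck_on k UNIV (deriv a)"
proof -
 have "ck_on (Suc k) UNIV a" by (rule assms)
 then obtain a' where a': "\<And>x. (a has_real_derivative a' x) (at x)" "ck_on k UNIV a'" by auto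
 then have "deriv a = a'" by (auto intro: DERIV_imp_deriv)
 with a' show "(a has_real_derivative deriv a x) (at x)" "ck_on k UNIV (deriv a)" by auto
qed

text \<open>Differentiation lowers the power by one and replaces \<open>a\<close> by
  \<open>?a\<close>, which vanishes at \<open>0\<close> again. Hence contact order \<open>m\<close>
  of the lower field at the origin forces \<open>\<phi> (0, 0) \<noteq> 0\<close>.\<close>

lemma deriv_mult_power_vanishes:
 "(\<And>k. ck_on k UNIV a) ==> a 0 = 0 ==> (deriv ^^ m) (%x. a x * x ^ m) 0 = (0 :: real)"
proof (induction m arbitrary: a)
 case (Suc m)
 note D = ck_on_deriv[OF Suc.prems(1)]
 let ?a = "%x. deriv a x * x + real (Suc m) * a x"
 have "((%x. a x * x ^ Suc m) has_real_derivative ?a x * x ^ m) (at x)" for x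
  using DERIV_mult[OF D(1) DERIV_pow[of "Suc m" x UNIV]] by (simp add: algebra_simps)
 then have "deriv (%x. a x * x ^ Suc m) = (%x. ?a x * x ^ m)" by (auto intro: DERIV_imp_deriv)
 moreover have "(deriv ^^ m) (%x. ?a x * x ^ m) 0 = 0"
  by (rule Suc.IH) (use Suc.prems D(2) in \<open>auto intro!: ck_on_add ck_on_mult\<close>)
 ultimately show ?case by (simp only: funpow_Suc_right o_apply)
qed simp

theorem theorem1p1:
  fixes U L :: "(real \<times> real) set"
    and fp gp fm \<phi> :: "real \<times> real \<Rightarrow> real"
    and m :: nat
  assumes "m \<ge> 2"
    and "open U" and "bounded U" and "(0, 0) \<in> U" and "L \<subseteq> U"
    and "smooth fp" and "smooth gp" and "smooth fm" and "smooth \<phi>"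
    and "grazing_loop U (upper_field fp gp) (lower_field fm \<phi> m) {(0, 0)} L"
    and "periodic_orbit (upper_field fp gp) L"
    and "(0, 0) \<in> L" and "L \<subseteq> Sigma_plus U \<union> {(0, 0)}"
    and "tangent_point_of_multiplicity U (upper_field fp gp) (lower_field fm \<phi> m) (0, 0) 1 m"
    and "limit_cycle (upper_field fp gp) L"
    and "hyperbolic_orbit (upper_field fp gp) L"
    and "clockwise_orbit (upper_field fp gp) L"
    and "fp (0, 0) * fm (0, 0) > 0"
  shows "(type_SI U (upper_field fp gp) (lower_field fm \<phi> m) L \<or>
          type_SL U (upper_field fp gp) (lower_field fm \<phi> m) L \<longrightarrow>
            has_perturbation U fp gp fm \<phi> m L (\<lambda>\<beta>c \<beta>s. \<beta>c + \<beta>s \<ge> enat (m + 1)) \<and>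
            (m \<ge> 4 \<longrightarrow> (\<forall>l \<in> {0..m div 2}.
              has_perturbation U fp gp fm \<phi> m L (\<lambda>\<beta>c \<beta>s. \<beta>c \<ge> enat (m + 1 - l) \<and> \<beta>s = enat l)))) \<and>
         (type_SV U (upper_field fp gp) (lower_field fm \<phi> m) L \<longrightarrow>
            has_perturbation U fp gp fm \<phi> m L (\<lambda>\<beta>c \<beta>s. \<beta>c + \<beta>s \<ge> enat m) \<and>
            (m \<ge> 4 \<longrightarrow> (\<forall>l \<in> {0..m div 2}.
              has_perturbation U fp gp fm \<phi> m L (\<lambda>\<beta>c \<beta>s. \<beta>c \<ge> enat (m - l) \<and> \<beta>s = enat l)))) \<and>
         (type_SR U (upper_field fp gp) (lower_field fm \<phi> m) L \<longrightarrow>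
            (m = 2 \<longrightarrow> has_perturbation U fp gp fm \<phi> m L (\<lambda>\<beta>c \<beta>s. \<beta>c + \<beta>s \<ge> enat 2)) \<and>
            (m \<ge> 4 \<longrightarrow> (\<forall>l \<in> {0..m div 2}.
              has_perturbation U fp gp fm \<phi> m L (\<lambda>\<beta>c \<beta>s. \<beta>c \<ge> enat (m + 2 - l) \<and> \<beta>s = enat l))))"
proof -
 let ?Z = "upper_field fp gp"
 have cg: "gp (0, 0) = 0" "deriv (%x. gp (x, 0)) 0 ~= 0" and cm: "(deriv ^^ m) (%x. \<phi> (x, 0) * x ^ m) 0 ~= 0"
  using assms(14) by (auto simp: tangent_point_of_multiplicity_def contact_order_def upper_field_def lower_field_def)
 have "((%x. gp (x, 0)) has_real_derivative 1 * dx gp (0, 0) + 0 * dy gp (0, 0)) (at 0)"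
  by (rule smooth_chain[OF assms(7)]) auto
 then have gx: "dx gp (0, 0) ~= 0" using cg(2) DERIV_imp_deriv by fastforce
 have \<phi>0: "\<phi> (0, 0) ~= 0"
 proof
  assume "\<phi> (0, 0) = 0"
  moreover have "ck_on k UNIV (%x. \<phi> (x, 0))" for k
   by (rule ck_on_compose_plane[OF smooth_imp_Ck[OF assms(9)] ck_on_const])
  ultimately show False using deriv_mult_power_vanishes[of "%x. \<phi> (x, 0)" m] cm by simp
 qed
 have main: "has_perturbation U fp gp fm \<phi> m L (%c s. enat M <= c & s = enat l)"
  if stable: "stable_limit_cycle ?Z L" for M l
 proof -
  obtain orb T where g: "periodic_solution ?Z orb T" "L = range orb"
   "\<And>z. z \<in> inside (path_image (orbit_path orb T)) ==> winding_number (orbit_path orb T) z = -1"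
   using assms(17) unfolding clockwise_orbit_def by blast
  obtain d where d: "orb d = (0, 0)" using assms(12) g(2) by (metis rangeE)
  \<comment> \<open>The clock is restarted at the time \<open>d\<close> at which the orbit is at the
    origin.\<close>
  have "grazing_orbit U L fp gp (%t. orb (t + d)) T"
  proof
   show "p = (0, 0) \<or> snd p > 0" if "p \<in> L" for p using assms(13) that by (auto simp: Sigma_plus_def)
   show "periodic_solution ?Z (%t. orb (t + d)) T" by (rule periodic_solution_shift[OF g(1)])
   show "range (%t. orb (t + d)) = L" using range_shift g(2) by metis
   show "winding_number (orbit_path (%t. orb (t + d)) T) z = -1" if z: "z \<in> inside (cplx ` L)" for z
   proof -
    have "z \<notin> cplx ` range orb" using z g(2) inside_no_overlap by blast
    then show ?thesis using winding_number_orbit_shift[OF g(1)] g(3) z periodic_path(3)[OF g(1)] g(2) by metis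
   qed
  qed (use assms cg gx d stable in auto)
  then interpret grazing_orbit U L fp gp "%t. orb (t + d)" T .
  have "fm (0, 0) < 0" using f_O_neg assms(18) by (auto simp: zero_less_mult_iff)
  then show ?thesis using has_perturbation_counts assms \<phi>0 by blast
 qed
 have exact: "has_perturbation U fp gp fm \<phi> m L (%\<beta>c \<beta>s. \<beta>c >= enat M & \<beta>s = enat l)"
  if "stable_limit_cycle ?Z L" for M l by (rule main[OF that])
 \<comment> \<open>\<open>l = 0\<close> is enough here: a lower bound for the crossing cycles alone
   bounds the sum.\<close>
 have total: "has_perturbation U fp gp fm \<phi> m L (%\<beta>c \<beta>s. \<beta>c + \<beta>s >= enat M)"
  if "stable_limit_cycle ?Z L" for M
  by (rule has_perturbation_mono[OF main[OF that, of M 0]]) (auto intro: add_increasing2)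
 show ?thesis
  unfolding type_SI_def type_SL_def type_SV_def type_SR_def using exact total by blast
qed

end
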